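(* Let $\kappa>0$ and let the level $\ell\neq 0$ be fixed. Then there exists a constant $K$ such that $$\lim_{x\to\infty}\frac{\mathbb{P}^x(\tau(\ell)<\infty)}{e^{-\mu_1x}\,x^{\frac{p\alpha_1\lambda}{\kappa}-1}}=K .$$ The constant $K$ is given explicitly as follows. Let $a>0$ be arbitrary and put $$I=\psi_{\setminus\{\mu_1\}}(\mu_1)\int_{\Gamma_{-a}}z^{-\frac{p\alpha_1\lambda}{\kappa}}e^{-z}\,dz .$$ If $\ell<0$, then $$K=I\left(c_1^1\,\frac{1-f_2(\ell)}{f_1(\ell)-f_2(\ell)}+c_1^2\,\frac{f_1(\ell)-1}{f_1(\ell)-f_2(\ell)}\right),$$ where $f_1,f_2$ are the two partial eigenfunctions described in the context and $c_1^1,c_1^2$ are their respective coefficients of $f^1_{\Gamma_{1}}$. If $\ell>0$, then $$K=c_1\,I,$$ where $c_1$ is the coefficient of $f_{\Gamma_1}$ in the single partial eigenfunction $f$ described in the context.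
   Context: **Process.** Let $\kappa\in\mathbb{R}\setminus\{0\}$, $\lambda>0$. The real-valued process $X$ solves $dX_t=\kappa X_t\,dt+dU_t$, where $U_t=\sum_{n=1}^{N_t}V_n$, $(N_t)$ is a Poisson process with parameter $\lambda$ and $(V_n)$ are iid with distribution $G$, independent of $(N_t)$. Here $G=pG_-+qG_+$, $0<p\le 1$, $q=1-p$, $G_-(du)=\sum_{k=1}^r\alpha_k\mu_ke^{\mu_ku}\,du$ for $u<0$, and $G_+(du)=\sum_{d=1}^s\beta_d\nu_de^{-\nu_du}\,du$ for $u>0$, with $0<\mu_1<\dots<\mu_r$, $0<\nu_1<\dots<\nu_s$, all $\alpha_k,\beta_d\neq0$, $\sum_k\alpha_k=1$, $\sum_d\beta_d=1$, $\alpha_1>0$, $\beta_1>0$ (the other $\alpha_k,\beta_d$ may be negative, provided $G_\pm$ are probability distributions). Under $\mathbb{P}^x$ we have $X_0=x$, with $x>0$ and $x>\ell$. $\tau=\tau(\ell)=\inf\{t>0: X_t\le\ell\}$. **Kernel.** $$\psi(z)=z^{-1}\prod_{k=1}^r(z-\mu_k)^{-\frac{p\lambda\alpha_k}{\kappa}}\prod_{d=1}^s(z+\nu_d)^{-\frac{q\lambda\beta_d}{\kappa}},$$ $$\psi_{\setminus\{\mu_1\}}(z)=z^{-1}\prod_{k=2}^r(z-\mu_k)^{-\frac{p\lambda\alpha_k}{\kappa}}\prod_{d=1}^s(z+\nu_d)^{-\frac{q\lambda\beta_d}{\kappa}}.$$ On each integration contour a holomorphic version (branch) of $\psi$ on a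 simply connected domain containing the contour (apart from a possible endpoint) is used. The branches of $\psi_{\setminus\{\mu_1\}}$ and of the power are chosen consistently, so that $(z-\mu_1)^{-p\lambda\alpha_1/\kappa}\psi_{\setminus\{\mu_1\}}(z)=\psi(z)$ on the contour $\Gamma_1$ below. Contours are oriented by increasing parameter. Write $\mathrm{i}$ for the imaginary unit. A point among $-\nu_s,\dots,-\nu_1,0,\mu_1,\dots,\mu_r$ is called a zero or a singularity of $\psi$ according to whether its exponent in $\psi$ is positive or negative (so, as $\kappa>0$, $\mu_k$ is a zero iff $\alpha_k<0$, $-\nu_d$ is a zero iff $\beta_d<0$, and $0$ is a singularity). **Contours.** For $a>0$: $\Gamma_{-a}=\{-a+(-1+\mathrm{i})t:-\infty<t\le0\}\cup\{-a+(1+\mathrm{i})t:0<t<\infty\}$. For $i=1,\dots,r$: if $\mu_i$ is a zero, $\Gamma_i=\{\mu_i+(1+\mathrm{i})t:0\le t<\infty\}$. If $\mu_i$ is a singularity, $\Gamma_i=\{\mu+(-1+\mathrm{i})t:-\infty<t\le0\}\cup\{\mu+(1+\mathrm{i})t:0\le t<\infty\}$ for some $\mu\in(\mu_{i-1},\mu_i)$ (with $\mu_0=0$). Let $p_1<\dots<p_{r+s+1}$ denote the points $-\nu_s,\dots,-\nu_1,0,\mu_1,\dots,\mu_r$ (and $p_{r+s+2}=\infty$). For $j=1,\dots,r+s+1$: if $p_j$ is a zero, $\Gamma_{j2}=\{p_j+(-1+\mathrm{i})t:0\le t<\infty\}$. If $p_j$ is a singularity, $\Gamma_{j2}=\{\tilde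 p+(1+\mathrm{i})t:-\infty<t\le0\}\cup\{\tilde p+(-1+\mathrm{i})t:0\le t<\infty\}$ for some $\tilde p\in(p_j,p_{j+1})$. **Case $\ell>0$: the eigenfunction $f$.** Put $f_{\Gamma_i}(y)=\int_{\Gamma_i}\psi(z)e^{-yz}\,dz$ for $y\ge\ell$, and $f_{\Gamma_i}(y)=0$ for $y<\ell$. Then $f=\sum_{i=1}^rc_if_{\Gamma_i}+1_{(-\infty,\ell)}$, where $c_1,\dots,c_r$ solve $$\sum_{i=1}^rc_i\,\mu_k\int_{\Gamma_i}\frac{\psi(z)}{z-\mu_k}e^{-\ell z}\,dz+1=0,\qquad k=1,\dots,r.$$ **Case $\ell<0$: the eigenfunctions $f_1,f_2$.** Put $f^1_{\Gamma_i}(y)=\int_{\Gamma_i}\psi(z)e^{-yz}dz$ for $y>0$ and $0$ for $y<0$; put $f^2_{\Gamma_{j2}}(y)=\int_{\Gamma_{j2}}\psi(z)e^{-yz}dz$ for $\ell\le y<0$ and $0$ otherwise. Then $f_1$ and $f_2$ are two different functions, with $f_1(\ell)\neq f_2(\ell)$, of the form $$f_h=\sum_{i=1}^rc_i^hf^1_{\Gamma_i}+\sum_{j=1}^{r+s+1}b_j^hf^2_{\Gamma_{j2}}+1_{(-\infty,\ell)},\qquad h=1,2,$$ whose coefficients satisfy, for $k=1,\dots,r$ and $d=1,\dots,s$, $$\sum_jb_j^h\int_{\Gamma_{j2}}\frac{\psi(z)}{z-\mu_k}e^{-\ell z}dz+\frac1{\mu_k}=0,$$ $$\sum_ic_i^h\int_{\Gamma_i}\frac{\psi(z)}{z-\mu_k}dz+\sum_jb_j^h\int_{\Gamma_{j2}}\frac{\psi(z)}{\mu_k-z}dz=0,$$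 $$\sum_jb_j^h\int_{\Gamma_{j2}}\frac{\psi(z)}{\nu_d+z}dz-\sum_ic_i^h\int_{\Gamma_i}\frac{\psi(z)}{\nu_d+z}dz=0.$$ The linear systems are taken to be solvable. *)

theory Defs
  imports "HOL-Probability.Probability"
begin

record params =
  kappa :: real
  lam :: real
  p_neg :: real
  r_neg :: nat
  s_pos :: nat
  alpha :: "nat \<Rightarrow> real"
  mu :: "nat \<Rightarrow> real"
  beta :: "nat \<Rightarrow> real"
  nu :: "nat \<Rightarrow> real"

abbreviation q_pos :: "params \<Rightarrow> real" where
  "q_pos Q \<equiv> 1 - p_neg Q"

definition dens_neg :: "params \<Rightarrow> real \<Rightarrow> real" where
  "dens_neg Q u = (if u < 0 then \<Sum>k=1..r_neg Q. alpha Q k * mu Q k * exp (mu Q k * u) else 0)"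

definition dens_pos :: "params \<Rightarrow> real \<Rightarrow> real" where
  "dens_pos Q u = (if u > 0 then \<Sum>d=1..s_pos Q. beta Q d * nu Q d * exp (- nu Q d * u) else 0)"

definition jump_law :: "params \<Rightarrow> real measure" where
  "jump_law Q = density lborel (\<lambda>u. ennreal (p_neg Q * dens_neg Q u + q_pos Q * dens_pos Q u))"

text \<open>
  Individual \<open>alpha\<close> and \<open>beta\<close> may be negative.  Since both families sum to 1, the two signed
  densities have total mass 1, so nonnegativity is exactly the requirement that they are
  probability densities.
\<close>
definition admissible :: "params \<Rightarrow> bool" where
  "admissible Q \<longleftrightarrow>
     kappa Q \<noteq> 0 \<and> lam Q > 0 \<and> 0 < p_neg Q \<and> p_neg Q \<le> 1 \<and> r_neg Q \<ge> 1 \<and> s_pos Q \<ge> 1 \<and>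
     0 < mu Q 1 \<and> strict_mono_on {1..r_neg Q} (mu Q) \<and>
     0 < nu Q 1 \<and> strict_mono_on {1..s_pos Q} (nu Q) \<and>
     (\<forall>k\<in>{1..r_neg Q}. alpha Q k \<noteq> 0) \<and> (\<forall>d\<in>{1..s_pos Q}. beta Q d \<noteq> 0) \<and>
     (\<Sum>k=1..r_neg Q. alpha Q k) = 1 \<and> (\<Sum>d=1..s_pos Q. beta Q d) = 1 \<and>
     alpha Q 1 > 0 \<and> beta Q 1 > 0 \<and>
     (\<forall>u. dens_neg Q u \<ge> 0) \<and> (\<forall>u. dens_pos Q u \<ge> 0)"


subsection \<open>The process\<close>

definition poisson_process :: "'a measure \<Rightarrow> real \<Rightarrow> (real \<Rightarrow> 'a \<Rightarrow> nat) \<Rightarrow> bool" where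
  "poisson_process M rate N \<longleftrightarrow>
     (\<forall>t\<ge>0. N t \<in> measurable M (count_space UNIV)) \<and>
     (\<forall>\<omega>\<in>space M. N 0 \<omega> = 0 \<and> mono_on {0..} (\<lambda>t. N t \<omega>) \<and>
        (\<forall>t\<ge>0. continuous (at_right t) (\<lambda>t. N t \<omega>))) \<and>
     (\<forall>s\<ge>0. \<forall>t>s. distr M (count_space UNIV) (\<lambda>\<omega>. N t \<omega> - N s \<omega>)
        = measure_pmf (poisson_pmf (rate * (t - s)))) \<and>
     (\<forall>(n::nat) t. 0 \<le> t 0 \<and> (\<forall>i<n. t i \<le> t (Suc i)) \<longrightarrow>
        prob_space.indep_vars M (\<lambda>_. count_space UNIV) (\<lambda>i \<omega>. N (t (Suc i)) \<omega> - N (t i) \<omega>) {..<n})"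

definition compound_sum :: "(real \<Rightarrow> 'a \<Rightarrow> nat) \<Rightarrow> (nat \<Rightarrow> 'a \<Rightarrow> real) \<Rightarrow> real \<Rightarrow> 'a \<Rightarrow> real" where
  "compound_sum N V t \<omega> = (\<Sum>n=1..N t \<omega>. V n \<omega>)"

text \<open>
  \<open>M\<close> plays the role of the law with starting point \<open>x\<close>.  The driving noise has finite variation,
  so the stochastic differential equation is a pathwise integral equation.  The independence of
  \<open>N\<close> and \<open>V\<close> is independence of the sigma-algebras generated by the two families.
\<close>
definition ou_process ::
  "params \<Rightarrow> 'a measure \<Rightarrow> (real \<Rightarrow> 'a \<Rightarrow> nat) \<Rightarrow> (nat \<Rightarrow> 'a \<Rightarrow> real) \<Rightarrow>
   (real \<Rightarrow> 'a \<Rightarrow> real) \<Rightarrow> real \<Rightarrow> bool" where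
  "ou_process Q M N V X x \<longleftrightarrow>
     prob_space M \<and>
     poisson_process M (lam Q) N \<and>
     prob_space.indep_vars M (\<lambda>_. borel) V {1..} \<and>
     (\<forall>n\<ge>1. distr M borel (V n) = jump_law Q) \<and>
     prob_space.indep_set M
       (sets (vimage_algebra (space M) (\<lambda>\<omega>. \<lambda>t\<in>{0..}. N t \<omega>)
          (Pi\<^sub>M {0..} (\<lambda>_. count_space UNIV))))
       (sets (vimage_algebra (space M) (\<lambda>\<omega>. \<lambda>n\<in>{1..}. V n \<omega>)
          (Pi\<^sub>M {1..} (\<lambda>_. borel)))) \<and>
     (\<forall>t\<ge>0. X t \<in> borel_measurable M) \<and>
     (AE \<omega> in M. X 0 \<omega> = x) \<and>
     (\<forall>\<omega>\<in>space M. \<forall>t\<ge>0. (\<lambda>s. X s \<omega>) integrable_on {0..t} \<and>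
        X t \<omega> = X 0 \<omega> + kappa Q * integral {0..t} (\<lambda>s. X s \<omega>) + compound_sum N V t \<omega>)"

definition tau :: "(real \<Rightarrow> 'a \<Rightarrow> real) \<Rightarrow> real \<Rightarrow> 'a \<Rightarrow> ereal" where
  "tau X l \<omega> = (INF t\<in>{t. t > 0 \<and> X t \<omega> \<le> l}. ereal t)"


subsection \<open>Unbounded contours\<close>

text \<open>
  A contour is a parametrisation together with its parameter set.  The integral is the one of
  \<open>contour_integral\<close>, with the parameter set in place of the unit interval; the kink at
  parameter 0 is negligible.
\<close>
type_synonym contour = "(real \<Rightarrow> complex) \<times> real set"

definition contour_image :: "contour \<Rightarrow> complex set" where
  "contour_image C = fst C ` snd C"

definition cint :: "contour \<Rightarrow> (complex \<Rightarrow> complex) \<Rightarrow> complex" where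
  "cint C g = integral (snd C) (\<lambda>t. g (fst C t) * vector_derivative (fst C) (at t))"

definition vee_right :: "real \<Rightarrow> contour" where
  "vee_right v = ((\<lambda>t. complex_of_real v +
     (if t \<le> 0 then (-1 + \<i>) * complex_of_real t else (1 + \<i>) * complex_of_real t)), UNIV)"

definition vee_left :: "real \<Rightarrow> contour" where
  "vee_left v = ((\<lambda>t. complex_of_real v +
     (if t \<le> 0 then (1 + \<i>) * complex_of_real t else (-1 + \<i>) * complex_of_real t)), UNIV)"

definition ray_right :: "real \<Rightarrow> contour" where
  "ray_right v = ((\<lambda>t. complex_of_real v + (1 + \<i>) * complex_of_real t), {0..})"

definition ray_left :: "real \<Rightarrow> contour" where
  "ray_left v = ((\<lambda>t. complex_of_real v + (-1 + \<i>) * complex_of_real t), {0..})"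


subsection \<open>Special points of the kernel and the contours attached to them\<close>

definition expo_mu :: "params \<Rightarrow> nat \<Rightarrow> real" where
  "expo_mu Q k = - (p_neg Q * lam Q * alpha Q k / kappa Q)"

definition expo_nu :: "params \<Rightarrow> nat \<Rightarrow> real" where
  "expo_nu Q d = - (q_pos Q * lam Q * beta Q d / kappa Q)"

text \<open>
  \<open>pt Q 1 < \<dots> < pt Q (r + s + 1)\<close> enumerates the points in increasing order,
  and \<open>expo_pt\<close> gives their exponents in the kernel.
\<close>
definition pt :: "params \<Rightarrow> nat \<Rightarrow> real" where
  "pt Q j = (if j \<le> s_pos Q then - nu Q (s_pos Q + 1 - j)
             else if j = s_pos Q + 1 then 0 else mu Q (j - s_pos Q - 1))"

definition expo_pt :: "params \<Rightarrow> nat \<Rightarrow> real" where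
  "expo_pt Q j = (if j \<le> s_pos Q then expo_nu Q (s_pos Q + 1 - j)
                  else if j = s_pos Q + 1 then -1 else expo_mu Q (j - s_pos Q - 1))"

text \<open>
  A point is a zero if its exponent is positive.  An exponent vanishes only at the points
  \<open>- nu Q d\<close> when \<open>p_neg Q = 1\<close>; such a point gets the contour of a singularity.
  The argument \<open>m\<close> is the arbitrarily chosen vertex, used only in the case of a singularity.
\<close>
definition Gam :: "params \<Rightarrow> (nat \<Rightarrow> real) \<Rightarrow> nat \<Rightarrow> contour" where
  "Gam Q m i = (if expo_mu Q i > 0 then ray_right (mu Q i) else vee_right (m i))"

definition Gam2 :: "params \<Rightarrow> (nat \<Rightarrow> real) \<Rightarrow> nat \<Rightarrow> contour" where
  "Gam2 Q m j = (if expo_pt Q j > 0 then ray_left (pt Q j) else vee_left (m j))"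

definition vertices :: "params \<Rightarrow> (nat \<Rightarrow> real) \<Rightarrow> bool" where
  "vertices Q m \<longleftrightarrow> (\<forall>i\<in>{1..r_neg Q}. \<not> expo_mu Q i > 0 \<longrightarrow>
     (if i = 1 then 0 else mu Q (i - 1)) < m i \<and> m i < mu Q i)"

definition vertices2 :: "params \<Rightarrow> (nat \<Rightarrow> real) \<Rightarrow> bool" where
  "vertices2 Q m \<longleftrightarrow> (\<forall>j\<in>{1..r_neg Q + s_pos Q + 1}. \<not> expo_pt Q j > 0 \<longrightarrow>
     pt Q j < m j \<and> (j < r_neg Q + s_pos Q + 1 \<longrightarrow> m j < pt Q (j + 1)))"


subsection \<open>Holomorphic branches\<close>

text \<open>\<open>h\<close> is a holomorphic branch of \<open>(z - w) powr a\<close> on \<open>D\<close>, for a real exponent \<open>a\<close>.\<close>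
definition power_branch_on :: "complex set \<Rightarrow> real \<Rightarrow> real \<Rightarrow> (complex \<Rightarrow> complex) \<Rightarrow> bool" where
  "power_branch_on D w a h \<longleftrightarrow>
     (\<exists>L. L holomorphic_on D \<and>
        (\<forall>z\<in>D. exp (L z) = z - complex_of_real w \<and> h z = exp (complex_of_real a * L z)))"

definition power_branch :: "complex set \<Rightarrow> real \<Rightarrow> (complex \<Rightarrow> complex) \<Rightarrow> bool" where
  "power_branch S a h \<longleftrightarrow>
     (\<exists>D. open D \<and> simply_connected D \<and> S \<subseteq> D \<and> power_branch_on D 0 a h)"

text \<open>
  \<open>\<Psi>\<close> is, on \<open>S\<close>, a holomorphic version of the kernel in which only the factors
  \<open>mu Q k\<close> with \<open>k \<in> K\<close> are kept; all of them for the kernel itself, all but the first one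
  for the kernel with \<open>mu Q 1\<close> removed.
\<close>
definition kernel_branch ::
  "params \<Rightarrow> nat set \<Rightarrow> complex set \<Rightarrow> (complex \<Rightarrow> complex) \<Rightarrow> bool" where
  "kernel_branch Q K S \<Psi> \<longleftrightarrow>
     (\<exists>D A B. open D \<and> simply_connected D \<and> S \<subseteq> D \<and> 0 \<notin> D \<and>
        (\<forall>k\<in>K. power_branch_on D (mu Q k) (expo_mu Q k) (A k)) \<and>
        (\<forall>d\<in>{1..s_pos Q}. power_branch_on D (- nu Q d) (expo_nu Q d) (B d)) \<and>
        (\<forall>z\<in>D. \<Psi> z = inverse z * (\<Prod>k\<in>K. A k z) * (\<Prod>d=1..s_pos Q. B d z)))"

abbreviation psi_branch where
  "psi_branch Q \<equiv> kernel_branch Q {1..r_neg Q}"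

abbreviation psi_minus_branch where
  "psi_minus_branch Q \<equiv> kernel_branch Q {2..r_neg Q}"


subsection \<open>Partial eigenfunctions\<close>

text \<open>
  \<open>\<Psi> i\<close> and \<open>\<Psi>2 j\<close> are the branches of the kernel used on \<open>Gam Q m i\<close> and \<open>Gam2 Q m2 j\<close>.
\<close>
definition partial_eigenfunction_pos ::
  "params \<Rightarrow> real \<Rightarrow> (nat \<Rightarrow> real) \<Rightarrow> (nat \<Rightarrow> complex \<Rightarrow> complex) \<Rightarrow>
   (nat \<Rightarrow> complex) \<Rightarrow> (real \<Rightarrow> complex) \<Rightarrow> bool" where
  "partial_eigenfunction_pos Q l m \<Psi> c f \<longleftrightarrow>
     (\<forall>y. f y = (\<Sum>i=1..r_neg Q. c i *
            (if y \<ge> l then cint (Gam Q m i) (\<lambda>z. \<Psi> i z * exp (- complex_of_real y * z)) else 0))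
          + (if y < l then 1 else 0)) \<and>
     (\<forall>k\<in>{1..r_neg Q}.
        (\<Sum>i=1..r_neg Q. c i * complex_of_real (mu Q k) *
           cint (Gam Q m i) (\<lambda>z. \<Psi> i z / (z - complex_of_real (mu Q k)) * exp (- complex_of_real l * z)))
        + 1 = 0)"

definition partial_eigenfunction_neg ::
  "params \<Rightarrow> real \<Rightarrow> (nat \<Rightarrow> real) \<Rightarrow> (nat \<Rightarrow> complex \<Rightarrow> complex) \<Rightarrow>
   (nat \<Rightarrow> real) \<Rightarrow> (nat \<Rightarrow> complex \<Rightarrow> complex) \<Rightarrow>
   (nat \<Rightarrow> complex) \<Rightarrow> (nat \<Rightarrow> complex) \<Rightarrow> (real \<Rightarrow> complex) \<Rightarrow> bool" where
  "partial_eigenfunction_neg Q l m \<Psi> m2 \<Psi>2 c b f \<longleftrightarrow>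
     (\<forall>y. f y = (\<Sum>i=1..r_neg Q. c i *
            (if y > 0 then cint (Gam Q m i) (\<lambda>z. \<Psi> i z * exp (- complex_of_real y * z)) else 0))
          + (\<Sum>j=1..r_neg Q + s_pos Q + 1. b j *
            (if l \<le> y \<and> y < 0 then cint (Gam2 Q m2 j) (\<lambda>z. \<Psi>2 j z * exp (- complex_of_real y * z)) else 0))
          + (if y < l then 1 else 0)) \<and>
     (\<forall>k\<in>{1..r_neg Q}.
        (\<Sum>j=1..r_neg Q + s_pos Q + 1. b j *
           cint (Gam2 Q m2 j) (\<lambda>z. \<Psi>2 j z / (z - complex_of_real (mu Q k)) * exp (- complex_of_real l * z)))
        + 1 / complex_of_real (mu Q k) = 0) \<and>
     (\<forall>k\<in>{1..r_neg Q}.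
        (\<Sum>i=1..r_neg Q. c i * cint (Gam Q m i) (\<lambda>z. \<Psi> i z / (z - complex_of_real (mu Q k))))
        + (\<Sum>j=1..r_neg Q + s_pos Q + 1. b j *
             cint (Gam2 Q m2 j) (\<lambda>z. \<Psi>2 j z / (complex_of_real (mu Q k) - z))) = 0) \<and>
     (\<forall>d\<in>{1..s_pos Q}.
        (\<Sum>j=1..r_neg Q + s_pos Q + 1. b j *
             cint (Gam2 Q m2 j) (\<lambda>z. \<Psi>2 j z / (complex_of_real (nu Q d) + z)))
        - (\<Sum>i=1..r_neg Q. c i *
             cint (Gam Q m i) (\<lambda>z. \<Psi> i z / (complex_of_real (nu Q d) + z))) = 0)"

text \<open>
  The constant \<open>I\<close> built from branches \<open>\<Phi>\<close> of the kernel without \<open>mu Q 1\<close> and \<open>h\<close> of the power.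
\<close>
definition I_const :: "params \<Rightarrow> real \<Rightarrow> (complex \<Rightarrow> complex) \<Rightarrow> (complex \<Rightarrow> complex) \<Rightarrow> complex" where
  "I_const Q a \<Phi> h = \<Phi> (complex_of_real (mu Q 1)) * cint (vee_right (- a)) (\<lambda>z. h z * exp (- z))"

text \<open>
  Consistent choice of the branches in \<open>I\<close>.  The domain of \<open>\<Phi>\<close> contains the first contour
  together with the segment from its vertex to \<open>mu Q 1\<close>: a simply connected domain containing
  only the contour and the point could reach \<open>mu Q 1\<close> by a detour around \<open>mu Q 2\<close>, which would
  change the phase of \<open>\<Phi> (mu Q 1)\<close>.  The domain of \<open>h\<close> contains the contour through \<open>- a\<close> and the
  translate by \<open>- mu Q 1\<close> of the first contour, where \<open>h\<close> is tied to \<open>\<Phi>\<close> and \<open>\<Psi>1\<close>.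
  The first contour is \<open>vee_right (m 1)\<close> since \<open>alpha Q 1 > 0\<close>.
\<close>
definition consistent_branches ::
  "params \<Rightarrow> (nat \<Rightarrow> real) \<Rightarrow> (complex \<Rightarrow> complex) \<Rightarrow> real \<Rightarrow>
   (complex \<Rightarrow> complex) \<Rightarrow> (complex \<Rightarrow> complex) \<Rightarrow> bool" where
  "consistent_branches Q m \<Psi>1 a \<Phi> h \<longleftrightarrow>
     psi_minus_branch Q (contour_image (Gam Q m 1) \<union>
        closed_segment (complex_of_real (m 1)) (complex_of_real (mu Q 1))) \<Phi> \<and>
     power_branch (contour_image (vee_right (- a)) \<union>
        (\<lambda>z. z - complex_of_real (mu Q 1)) ` contour_image (Gam Q m 1)) (expo_mu Q 1) h \<and>
     (\<forall>z\<in>contour_image (Gam Q m 1). h (z - complex_of_real (mu Q 1)) * \<Phi> z = \<Psi>1 z)"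

end

theory Submission
  imports Defs "HOL-Complex_Analysis.Complex_Analysis" "HOL-Real_Asymp.Real_Asymp"
begin

text \<open>
  A function \<open>g\<close> that is 1 below \<open>l\<close>, vanishes at infinity and is invariant under one jump of the process stopped at passage is the
  passage probability: on the event of no passage the process drifts to infinity, because
  \<open>exp (- kappa * t) * X t\<close> converges to a limit with an atomless law.  The contour integrals solve an ordinary differential
  equation equivalent to this one-step identity (integrate by parts along the contour), and the
  linear systems for the coefficients glue the pieces at \<open>l\<close> and \<open>0\<close>.  For \<open>l < 0\<close> the two
  partial eigenfunctions are combined with weights of sum 1 that give the value 1 at \<open>l\<close>.
  As \<open>x\<close> grows, the contours to the right of \<open>mu 1\<close> contribute negligibly, and the first
  contour is moved to the vertex \<open>mu 1 - a / x\<close>; the substitution \<open>z = mu 1 + w / x\<close> and dominated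
  convergence then give the constant \<open>I\<close>.
\<close>

section \<open>Interarrival times of a Poisson process\<close>

text \<open>The Poisson process is given through its increments over fixed times, so the law of the
  waiting times has to be derived before the process can be reduced to a chain. The sign of
  \<open>l\<close> matters because \<open>kappa\<close> is positive: a positive state is carried
  upwards by the flow, so a level above 0 can be passed by a jump only, whereas a negative state is
  carried downwards and can pass a negative level continuously. In that case the one-step identity
  needs a function that is continuous at \<open>l\<close>, and a second partial eigenfunction
  supplies the missing degree of freedom. The branches of the kernel enter in two ways. The
  differential equation and the estimates use only the modulus and the logarithmic derivative, which
  no choice of branch affects. The constant \<open>I\<close> does depend on the branches, but each
  is a constant multiple of one built from principal logarithms, and the same multiples appear in
  the first contour integral. The power of \<open>x\<close> comes from the substitution:
  \<open>dz\<close> gives \<open>1 / x\<close>, the singular factor at \<open>mu 1\<close> gives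
  \<open>x\<close> to the power \<open>p * alpha 1 * lam / kappa\<close>.\<close>

definition jump_time :: "(real \<Rightarrow> 'a \<Rightarrow> nat) \<Rightarrow> nat \<Rightarrow> 'a \<Rightarrow> real" where
  "jump_time N n \<omega> = Inf {t. 0 \<le> t \<and> n \<le> N t \<omega>}"

text \<open>No probability is assumed here, so that the locale can be instantiated a second time
  with the sigma-algebra generated by the counting process. Jump times are then measurable with
  respect to that smaller algebra, which is what independence of the jump sizes requires.\<close>

locale counting_paths =
  fixes M :: "'a measure" and N :: "real \<Rightarrow> 'a \<Rightarrow> nat"
  assumes N_measurable: "\<And>t. 0 \<le> t \<Longrightarrow> N t \<in> measurable M (count_space UNIV)"
    and N_0: "\<And>\<omega>. \<omega> \<in> space M \<Longrightarrow> N 0 \<omega> = 0"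
    and N_mono: "\<And>\<omega> s t. \<omega> \<in> space M \<Longrightarrow> 0 \<le> s \<Longrightarrow> s \<le> t \<Longrightarrow> N s \<omega> \<le> N t \<omega>"
    and N_right: "\<And>\<omega> t. \<omega> \<in> space M \<Longrightarrow> 0 \<le> t \<Longrightarrow> \<exists>e>0. \<forall>s. t \<le> s \<and> s < t + e \<longrightarrow> N s \<omega> = N t \<omega>"
begin

lemma N_pred:
  assumes "0 \<le> s" "0 \<le> t"
  shows "Measurable.pred M (\<lambda>\<omega>. P (N s \<omega>) (N t \<omega>))"
  by (rule measurable_compose_countable[OF _ N_measurable[OF assms(1)]])
    (rule measurable_compose[OF N_measurable[OF assms(2)]], simp)

text \<open>Right-continuity makes the infimum attained. Reaching level \<open>n\<close> is assumed
  because the infimum of the empty set is an unspecified real. The equivalence converts later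
  statements on jump times into statements on counts.\<close>

lemma jump_time_le_iff:
  assumes \<omega>: "\<omega> \<in> space M" and r: "\<exists>t\<ge>0. n \<le> N t \<omega>" and t: "0 \<le> t"
  shows "jump_time N n \<omega> \<le> t \<longleftrightarrow> n \<le> N t \<omega>"
proof
  define S where "S = {t. 0 \<le> t \<and> n \<le> N t \<omega>}"
  have ne: "S \<noteq> {}" and bb: "bdd_below S" using r by (auto simp: S_def intro: bdd_belowI[of _ 0])
  have J: "jump_time N n \<omega> = Inf S" by (simp add: jump_time_def S_def)
  show "n \<le> N t \<omega> \<Longrightarrow> jump_time N n \<omega> \<le> t"
    unfolding J by (rule cInf_lower[OF _ bb]) (simp add: S_def t)
  assume le: "jump_time N n \<omega> \<le> t"
  obtain e where e: "e > 0" "\<And>s. t \<le> s \<Longrightarrow> s < t + e \<Longrightarrow> N s \<omega> = N t \<omega>"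
    using N_right[OF \<omega> t] by auto
  have "Inf S < t + e" using le e(1) J by simp
  then obtain s where s: "s \<in> S" "s < t + e" using cInf_less_iff[OF ne bb] by auto
  show "n \<le> N t \<omega>"
  proof (cases "t \<le> s")
    case True
    then show ?thesis using s e(2)[of s] by (auto simp: S_def)
  next
    case False
    then show ?thesis using s N_mono[OF \<omega>, of s t] by (auto simp: S_def)
  qed
qed

lemma jump_time_nonneg:
  assumes "\<exists>t\<ge>0. n \<le> N t \<omega>"
  shows "0 \<le> jump_time N n \<omega>"
  unfolding jump_time_def using assms by (intro cInf_greatest) auto

lemma jump_time_0: "jump_time N 0 \<omega> = 0"
  unfolding jump_time_def by (rule cInf_eq_minimum) auto

lemma jump_time_attained:
  assumes "\<omega> \<in> space M" "\<exists>t\<ge>0. n \<le> N t \<omega>"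
  shows "n \<le> N (jump_time N n \<omega>) \<omega>"
  using jump_time_le_iff[OF assms, of "jump_time N n \<omega>"] jump_time_nonneg[OF assms(2)] by simp

lemma reach_measurable: "{\<omega>\<in>space M. \<exists>t\<ge>0. n \<le> N t \<omega>} \<in> sets M"
proof -
  have "{\<omega>\<in>space M. \<exists>t\<ge>0. n \<le> N t \<omega>} = (\<Union>k::nat. {\<omega>\<in>space M. n \<le> N (real k) \<omega>})"
  proof safe
    fix \<omega> t assume "\<omega> \<in> space M" "0 \<le> t" "n \<le> N t \<omega>"
    moreover obtain k :: nat where "t \<le> real k" using real_arch_simple by blast
    ultimately have "n \<le> N (real k) \<omega>" using N_mono[of \<omega> t "real k"] by simp
    then show "\<omega> \<in> (\<Union>k::nat. {\<omega>\<in>space M. n \<le> N (real k) \<omega>})" using \<open>\<omega> \<in> space M\<close> by blast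
  next
    fix k \<omega> assume "n \<le> N (real k) \<omega>"
    then show "\<exists>t\<ge>0. n \<le> N t \<omega>" by (intro exI[of _ "real k"]) simp
  qed
  also have "\<dots> \<in> sets M"
    using predE[OF N_pred[where s=0 and P="\<lambda>_ b. n \<le> b"]] by (intro sets.countable_UN) auto
  finally show ?thesis .
qed

lemma jump_time_measurable: "jump_time N n \<in> borel_measurable M"
proof (subst borel_measurable_iff_le, intro allI)
  fix a :: real
  define R where "R = {\<omega>\<in>space M. \<exists>t\<ge>0. n \<le> N t \<omega>}"
  have R: "R \<in> sets M" unfolding R_def by (rule reach_measurable)
  \<comment> \<open>On paths that never reach \<open>n\<close> the jump time is the constant
    \<open>Inf {}\<close>, so these paths belong to the sublevel set either all together or not at
    all.\<close>
  have "{\<omega>\<in>space M. jump_time N n \<omega> \<le> a} =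
      (if 0 \<le> a then R \<inter> {\<omega>\<in>space M. n \<le> N a \<omega>} else {}) \<union>
      (if Inf {} \<le> a then space M - R else {})"
  proof -
    have "jump_time N n \<omega> = Inf {}" if "\<omega> \<in> space M" "\<omega> \<notin> R" for \<omega>
      using that unfolding R_def jump_time_def by (intro arg_cong[where f=Inf]) auto
    moreover have "jump_time N n \<omega> \<le> a \<longleftrightarrow> 0 \<le> a \<and> n \<le> N a \<omega>" if "\<omega> \<in> R" for \<omega>
      using that jump_time_le_iff[of \<omega> n a] jump_time_nonneg[of n \<omega>] unfolding R_def by auto
    moreover have "R \<subseteq> space M" by (auto simp: R_def)
    ultimately have "\<omega> \<in> {\<omega>\<in>space M. jump_time N n \<omega> \<le> a} \<longleftrightarrow>
        \<omega> \<in> (if 0 \<le> a then R \<inter> {\<omega>\<in>space M. n \<le> N a \<omega>} else {}) \<union>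
          (if Inf {} \<le> a then space M - R else {})" for \<omega>
      by (cases "\<omega> \<in> R"; cases "\<omega> \<in> space M") auto
    then show ?thesis by (rule set_eqI)
  qed
  also have "\<dots> \<in> sets M"
  proof -
    have "{\<omega>\<in>space M. n \<le> N a \<omega>} \<in> sets M" if "0 \<le> a"
      using that by (intro predE N_pred[where s=0 and P="\<lambda>_ b. n \<le> b"]) auto
    then show ?thesis using R by auto
  qed
  finally show "{\<omega>\<in>space M. jump_time N n \<omega> \<le> a} \<in> sets M" .
qed

end

section \<open>Limits of probabilities along almost surely convergent events\<close>

lemma (in prob_space) prob_tendsto_0_AE:
  assumes [measurable]: "\<And>j. B j \<in> sets M"
    and "AE \<omega> in M. eventually (\<lambda>j. \<omega> \<notin> B j) sequentially"
  shows "(\<lambda>j. prob (B j)) \<longlonglongrightarrow> 0"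
proof -
  have "(\<lambda>j. integral\<^sup>L M (indicat_real (B j))) \<longlonglongrightarrow> integral\<^sup>L M (\<lambda>_. 0::real)"
  proof (rule integral_dominated_convergence[where w="\<lambda>_. 1"])
    show "AE x in M. (\<lambda>i. indicat_real (B i) x) \<longlonglongrightarrow> 0"
      using assms(2)
    proof eventually_elim
      case (elim \<omega>)
      then have "eventually (\<lambda>j. indicat_real (B j) \<omega> = 0) sequentially"
        by eventually_elim simp
      then show ?case by (rule tendsto_eventually)
    qed
  qed (auto simp: indicator_def)
  then show ?thesis by simp
qed

text \<open>One-sided comparison: nothing is assumed outside \<open>A\<close>. The discretised gap
  conditions converge in this sense only, since they decide neither way when a gap equals its
  threshold.\<close>

lemma (in prob_space) prob_le_limit_AE:
  assumes [measurable]: "A \<in> sets M" "\<And>j. B j \<in> sets M"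
    and "AE \<omega> in M. \<omega> \<in> A \<longrightarrow> eventually (\<lambda>j. \<omega> \<in> B j) sequentially"
    and "(\<lambda>j. prob (B j)) \<longlonglongrightarrow> b"
  shows "prob A \<le> b"
proof -
  have "(\<lambda>j. prob (A - B j)) \<longlonglongrightarrow> 0"
  proof (rule prob_tendsto_0_AE)
    show "AE \<omega> in M. eventually (\<lambda>j. \<omega> \<notin> A - B j) sequentially"
      using assms(3) by eventually_elim (auto elim: eventually_mono)
  qed auto
  from tendsto_add[OF assms(4) this]
  have "(\<lambda>j. prob (B j) + prob (A - B j)) \<longlonglongrightarrow> b" by simp
  then show ?thesis
  proof (rule tendsto_lowerbound[OF _ always_eventually], intro allI)
    fix j
    have "prob A \<le> prob (B j \<union> (A - B j))" by (intro finite_measure_mono) auto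
    also have "\<dots> \<le> prob (B j) + prob (A - B j)" by (intro measure_Un_le) auto
    finally show "prob A \<le> prob (B j) + prob (A - B j)" .
  qed simp
qed

lemma (in prob_space) limit_le_prob_AE:
  assumes [measurable]: "A \<in> sets M" "\<And>j. B j \<in> sets M"
    and "AE \<omega> in M. \<omega> \<notin> A \<longrightarrow> eventually (\<lambda>j. \<omega> \<notin> B j) sequentially"
    and "(\<lambda>j. prob (B j)) \<longlonglongrightarrow> b"
  shows "b \<le> prob A"
proof -
  have "prob (space M - A) \<le> 1 - b"
  proof (rule prob_le_limit_AE)
    show "AE \<omega> in M. \<omega> \<in> space M - A \<longrightarrow> eventually (\<lambda>j. \<omega> \<in> space M - B j) sequentially"
      using assms(3) by eventually_elim (auto elim: eventually_mono)
    show "(\<lambda>j. prob (space M - B j)) \<longlonglongrightarrow> 1 - b"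
      using tendsto_diff[OF tendsto_const[of 1] assms(4)] by (simp add: prob_compl)
  qed auto
  then show ?thesis by (simp add: prob_compl)
qed

section \<open>Almost sure path properties of a Poisson process\<close>

locale poisson_proc = prob_space M for M :: "'a measure" +
  fixes rate :: real and N :: "real \<Rightarrow> 'a \<Rightarrow> nat"
  assumes rate_pos: "0 < rate" and pp: "poisson_process M rate N"

sublocale poisson_proc \<subseteq> counting_paths M N
proof
  show "N t \<in> measurable M (count_space UNIV)" if "0 \<le> t" for t
    using pp that by (simp add: poisson_process_def)
  fix \<omega> assume \<omega>: "\<omega> \<in> space M"
  show "N 0 \<omega> = 0" using pp \<omega> by (simp add: poisson_process_def)
  show "N s \<omega> \<le> N t \<omega>" if "0 \<le> s" "s \<le> t" for s t
    using pp \<omega> that by (auto simp: poisson_process_def mono_on_def)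
  fix t :: real assume t: "0 \<le> t"
  have "continuous (at_right t) (\<lambda>t. N t \<omega>)" using pp \<omega> t by (simp add: poisson_process_def)
  \<comment> \<open>Convergence in a discrete space means being eventually constant.\<close>
  then have "eventually (\<lambda>s. N s \<omega> = N t \<omega>) (at_right t)"
    by (simp add: continuous_within tendsto_discrete)
  then obtain b where b: "b > t" "\<And>s. t < s \<Longrightarrow> s < b \<Longrightarrow> N s \<omega> = N t \<omega>"
    by (auto simp: eventually_at_right[of t "t + 1"])
  show "\<exists>e>0. \<forall>s. t \<le> s \<and> s < t + e \<longrightarrow> N s \<omega> = N t \<omega>"
  proof (intro exI[of _ "b - t"] conjI allI impI)
    fix s assume "t \<le> s \<and> s < t + (b - t)"
    then show "N s \<omega> = N t \<omega>" using b(2)[of s] by (cases "s = t") auto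
  qed (use b in simp)
qed

context poisson_proc
begin

lemma increment_distr:
  assumes "0 \<le> s" "s < t"
  shows "prob {\<omega>\<in>space M. N t \<omega> - N s \<omega> \<in> A} = measure_pmf.prob (poisson_pmf (rate * (t - s))) A"
proof -
  have [measurable]: "N t \<in> measurable M (count_space UNIV)" "N s \<in> measurable M (count_space UNIV)"
    using N_measurable assms by auto
  have m: "(\<lambda>\<omega>. N t \<omega> - N s \<omega>) \<in> measurable M (count_space UNIV)" by measurable
  have "measure (distr M (count_space UNIV) (\<lambda>\<omega>. N t \<omega> - N s \<omega>)) A
      = prob {\<omega>\<in>space M. N t \<omega> - N s \<omega> \<in> A}"
    by (subst measure_distr[OF m]) (auto intro!: arg_cong[where f=prob])
  then show ?thesis using pp assms by (simp add: poisson_process_def)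
qed

lemma prob_no_jump:
  assumes "0 \<le> s" "s \<le> t"
  shows "prob {\<omega>\<in>space M. N t \<omega> = N s \<omega>} = exp (- rate * (t - s))"
proof (cases "s = t")
  case True
  then show ?thesis by (simp add: prob_space)
next
  case False
  have "{\<omega>\<in>space M. N t \<omega> = N s \<omega>} = {\<omega>\<in>space M. N t \<omega> - N s \<omega> \<in> {0}}"
    using N_mono[of _ s t] assms by (auto intro: antisym)
  with increment_distr[of s t "{0}"] False assms rate_pos show ?thesis
    by (simp add: measure_pmf_single)
qed

text \<open>The bound is quadratic in the length of the interval, so that its sum over the
  \<open>m\<close> cells of a mesh is of order \<open>1 / m\<close>.\<close>

lemma prob_double_jump:
  assumes "0 \<le> s" "s < t"
  shows "prob {\<omega>\<in>space M. N s \<omega> + 2 \<le> N t \<omega>} \<le> (rate * (t - s))\<^sup>2"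
proof -
  define a where "a = rate * (t - s)"
  have a: "0 < a" using assms rate_pos by (simp add: a_def)
  have "{\<omega>\<in>space M. N s \<omega> + 2 \<le> N t \<omega>} = {\<omega>\<in>space M. N t \<omega> - N s \<omega> \<in> UNIV - {0, 1}}"
    using N_mono[of _ s t] assms by (auto simp: le_diff_conv2)
  then have "prob {\<omega>\<in>space M. N s \<omega> + 2 \<le> N t \<omega>} = 1 - measure_pmf.prob (poisson_pmf a) {0, 1}"
    using increment_distr[of s t "UNIV - {0, 1}"] assms measure_pmf.prob_compl[of "{0,1}" "poisson_pmf a"]
    by (simp add: a_def)
  also have "measure_pmf.prob (poisson_pmf a) {0, 1} = exp (- a) + a * exp (- a)"
    using a by (subst measure_measure_pmf_finite) auto
  also have "1 - (exp (- a) + a * exp (- a)) \<le> a\<^sup>2"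
  proof -
    \<comment> \<open>This is \<open>1 - a <= exp (- a)\<close> times a positive factor; the claim
      is the same inequality rearranged.\<close>
    have "(1 - a) * (1 + a) \<le> exp (- a) * (1 + a)"
      using exp_ge_add_one_self[of "- a"] a by (intro mult_right_mono) auto
    then show ?thesis by (simp add: algebra_simps power2_eq_square)
  qed
  finally show ?thesis by (simp add: a_def)
qed

text \<open>After any integer time, \<open>k\<close> further time units without a jump have
  probability \<open>exp (- rate * k)\<close>, so another jump follows almost surely. Induction on
  the level then shows that the count is unbounded.\<close>

lemma AE_reach: "AE \<omega> in M. \<forall>n. \<exists>t\<ge>0. n \<le> N t \<omega>"
proof -
  have *: "AE \<omega> in M. \<exists>k::nat. N (real J + real k) \<omega> \<noteq> N (real J) \<omega>" for J :: nat
  proof -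
    define B where "B k = {\<omega>\<in>space M. N (real J + real k) \<omega> = N (real J) \<omega>}" for k :: nat
    have B[measurable]: "B k \<in> sets M" for k
      unfolding B_def using N_pred[of "real J" "real J + real k" "\<lambda>a b. b = a"] by simp
    have "prob (\<Inter>k. B k) \<le> 0"
    proof (rule tendsto_lowerbound[OF _ always_eventually])
      show "(\<lambda>k::nat. exp (- rate * real k)) \<longlonglongrightarrow> 0"
        using rate_pos by real_asymp
      show "\<forall>k. prob (\<Inter>k. B k) \<le> exp (- rate * real k)"
      proof
        fix k
        have "prob (\<Inter>k. B k) \<le> prob (B k)" by (intro finite_measure_mono) auto
        then show "prob (\<Inter>k. B k) \<le> exp (- rate * real k)"
          using prob_no_jump[of "real J" "real J + real k"] by (simp add: B_def)
      qed
    qed simp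
    then have "prob (\<Inter>k. B k) = 0" by (simp add: measure_le_0_iff)
    then have "AE \<omega> in M. \<omega> \<notin> (\<Inter>k. B k)"
      by (intro AE_not_in null_setsI) (auto simp: emeasure_eq_measure)
    then show ?thesis by (rule AE_mp) (auto simp: B_def intro!: AE_I2)
  qed
  then have "AE \<omega> in M. \<forall>J::nat. \<exists>k::nat. N (real J + real k) \<omega> \<noteq> N (real J) \<omega>"
    by (simp add: AE_all_countable)
  with AE_space show ?thesis
  proof eventually_elim
    case (elim \<omega>)
    show ?case
    proof
      fix n
      show "\<exists>t\<ge>0. n \<le> N t \<omega>"
      proof (induction n)
        case 0
        then show ?case by (intro exI[of _ 0]) simp
      next
        case (Suc n)
        then obtain t where t: "0 \<le> t" "n \<le> N t \<omega>" by blast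
        obtain J :: nat where J: "t \<le> real J" using real_arch_simple by blast
        obtain k :: nat where k: "N (real J + real k) \<omega> \<noteq> N (real J) \<omega>" using elim by blast
        have "N t \<omega> \<le> N (real J) \<omega>" "N (real J) \<omega> \<le> N (real J + real k) \<omega>"
          using N_mono elim t J by auto
        with k t show ?case by (intro exI[of _ "real J + real k"]) auto
      qed
    qed
  qed
qed

text \<open>A jump of size at least 2 would show two counts in one cell of every mesh on
  \<open>[0, R]\<close>. By the union bound some such cell exists with probability at most
  \<open>(rate * R)^2 / m\<close>, for every \<open>m\<close>.\<close>

lemma AE_simple_jumps: "AE \<omega> in M. \<forall>n. N (jump_time N n \<omega>) \<omega> = n"
proof -
  define D where "D R m = {\<omega>\<in>space M. \<exists>k<m. N (real k * (real R / real m)) \<omega> + 2 \<le>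
      N (real (Suc k) * (real R / real m)) \<omega>}" for R m :: nat
  have D[measurable]: "D R m \<in> sets M" for R m
  proof -
    have *: "Measurable.pred M (\<lambda>\<omega>. N (real k * (real R / real m)) \<omega> + 2 \<le> N (real (Suc k) * (real R / real m)) \<omega>)" for k
      by (rule N_pred[where P="\<lambda>a b. a + 2 \<le> b"]) auto
    show ?thesis unfolding D_def
      by (intro predE pred_intros_countable pred_intros_conj1' *)
  qed
  have *: "AE \<omega> in M. \<exists>m>0. \<omega> \<notin> D R m" if R: "R > 0" for R :: nat
  proof -
    have "prob (\<Inter>m\<in>{0<..}. D R m) \<le> 0"
    proof (rule tendsto_lowerbound[OF _ eventually_at_top_linorderI[of 1]])
      show "(\<lambda>m::nat. (rate * real R)\<^sup>2 / real m) \<longlonglongrightarrow> 0" by real_asymp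
      fix m :: nat assume m: "1 \<le> m"
      have "prob (\<Inter>m\<in>{0<..}. D R m) \<le> prob (D R m)"
        using m by (intro finite_measure_mono) auto
      also have "D R m = (\<Union>k<m. {\<omega>\<in>space M. N (real k * (real R / real m)) \<omega> + 2 \<le>
            N (real (Suc k) * (real R / real m)) \<omega>})" by (auto simp: D_def)
      also have "prob \<dots> \<le> (\<Sum>k<m. prob {\<omega>\<in>space M. N (real k * (real R / real m)) \<omega> + 2 \<le>
            N (real (Suc k) * (real R / real m)) \<omega>})"
      proof (rule finite_measure_subadditive_finite)
        show "(\<lambda>k. {\<omega>\<in>space M. N (real k * (real R / real m)) \<omega> + 2 \<le>
            N (real (Suc k) * (real R / real m)) \<omega>}) ` {..<m} \<subseteq> sets M"
          by (intro image_subsetI predE N_pred[where P="\<lambda>a b. a + 2 \<le> b"]) auto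
      qed simp
      also have "\<dots> \<le> (\<Sum>k<m. (rate * (real R / real m))\<^sup>2)"
      proof (rule sum_mono)
        fix k assume "k \<in> {..<m}"
        have "real k * (real R / real m) < real (Suc k) * (real R / real m)"
          using m R by (intro mult_strict_right_mono) auto
        from prob_double_jump[OF _ this]
        show "prob {\<omega>\<in>space M. N (real k * (real R / real m)) \<omega> + 2 \<le>
            N (real (Suc k) * (real R / real m)) \<omega>} \<le> (rate * (real R / real m))\<^sup>2"
          by (simp only: left_diff_distrib[symmetric] of_nat_Suc) simp
      qed
      also have "\<dots> = (rate * real R)\<^sup>2 / real m"
        using m by (simp add: field_simps power2_eq_square)
      finally show "prob (\<Inter>m\<in>{0<..}. D R m) \<le> (rate * real R)\<^sup>2 / real m" .
    qed simp
    then have "prob (\<Inter>m\<in>{0<..}. D R m) = 0" by (simp add: measure_le_0_iff)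
    moreover have "(\<Inter>m\<in>{0<..}. D R m) \<in> sets M" by (rule sets.countable_INT') auto
    ultimately have "AE \<omega> in M. \<omega> \<notin> (\<Inter>m\<in>{0<..}. D R m)"
      by (intro AE_not_in null_setsI) (auto simp: emeasure_eq_measure)
    then show ?thesis by eventually_elim auto
  qed
  then have "AE \<omega> in M. \<forall>R. 0 < R \<longrightarrow> (\<exists>m>0. \<omega> \<notin> D R m)"
    by (simp add: AE_all_countable)
  with AE_reach AE_space show ?thesis
  proof eventually_elim
    case (elim \<omega>)
    show ?case
    proof
      fix n
      let ?T = "jump_time N n \<omega>"
      have r: "\<exists>t\<ge>0. n \<le> N t \<omega>" using elim by blast
      have T0: "0 \<le> ?T" by (rule jump_time_nonneg[OF r])
      have ge: "n \<le> N ?T \<omega>" by (rule jump_time_attained[OF elim(2) r])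
      show "N ?T \<omega> = n"
      proof (rule ccontr)
        assume "N ?T \<omega> \<noteq> n"
        with ge have n1: "n + 1 \<le> N ?T \<omega>" by simp
        have Tpos: "0 < ?T" using T0 n1 N_0[OF elim(2)] by (cases "?T = 0") auto
        obtain R :: nat where R: "?T \<le> real R" using real_arch_simple by blast
        with Tpos have Rpos: "0 < R" by (cases R) auto
        then obtain m where m: "m > 0" "\<omega> \<notin> D R m" using elim by blast
        define d where "d = real R / real m"
        have d: "0 < d" using Rpos m by (simp add: d_def)
        \<comment> \<open>The cell is open on the left and closed on the right, so that fewer than
          \<open>n\<close> counts occur by its left end even if the jump time is itself a mesh
          point. Hence the ceiling minus one.\<close>
        define k where "k = nat (\<lceil>?T / d\<rceil> - 1)"
        have c1: "1 \<le> \<lceil>?T / d\<rceil>" using Tpos d by (simp add: one_le_ceiling)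
        have kr: "real k = real_of_int \<lceil>?T / d\<rceil> - 1" using c1 by (simp add: k_def)
        have "real k < ?T / d" "?T / d \<le> real (Suc k)"
          using kr ceiling_correct[of "?T / d"] by linarith+
        then have k1: "real k * d < ?T" and k2: "?T \<le> real (Suc k) * d"
          using d by (simp_all only: pos_less_divide_eq pos_divide_le_eq)
        have "real k * d < real m * d" using k1 R m by (simp add: d_def)
        then have km: "k < m" using d by simp
        have "N (real k * d) \<omega> < n"
          using jump_time_le_iff[OF elim(2) r, of "real k * d"] k1 d by auto
        moreover have "N ?T \<omega> \<le> N (real (Suc k) * d) \<omega>" using N_mono[OF elim(2) T0 k2] .
        ultimately have "N (real k * d) \<omega> + 2 \<le> N (real (Suc k) * d) \<omega>" using n1 by simp
        then have "\<omega> \<in> D R m" using km elim(2) by (auto simp: D_def d_def)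
        with m show False by simp
      qed
    qed
  qed
qed

section \<open>The past sampled at fixed times and its independence of the next increment\<close>

lemma past_pred:
  fixes t :: "nat \<Rightarrow> real" and S :: "(nat \<Rightarrow> nat) set"
  assumes "t 0 = 0" and "\<And>i. t i \<le> t (Suc i)"
  shows "Measurable.pred M (\<lambda>\<omega>. (\<lambda>i. N (t (min i n)) \<omega>) \<in> S)"
proof -
  have tn: "0 \<le> t i" for i using lift_Suc_mono_le[of t 0 i] assms by auto
  \<comment> \<open>A finite list of sampled counts takes countably many values, so every property
    \<open>P\<close> of it is an event. The sequence frozen by \<open>min i n\<close> is a function
    of such a list.\<close>
  have *: "Measurable.pred M (\<lambda>\<omega>. P (map (\<lambda>i. N (t i) \<omega>) [0..<k]))" for P k
  proof (induction k arbitrary: P)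
    case (Suc k)
    have "Measurable.pred M (\<lambda>\<omega>. P (map (\<lambda>i. N (t i) \<omega>) [0..<k] @ [N (t k) \<omega>]))"
      by (rule measurable_compose_countable[OF Suc N_measurable[OF tn]])
    then show ?case by simp
  qed simp
  have "(\<lambda>i. N (t (min i n)) \<omega>) = (\<lambda>i. map (\<lambda>i. N (t i) \<omega>) [0..<Suc n] ! min i n)" for \<omega>
    by (auto simp: fun_eq_iff simp del: upt_Suc)
  then show ?thesis using *[of "\<lambda>xs. (\<lambda>i. xs ! min i n) \<in> S" "Suc n"] by (simp del: upt_Suc)
qed

lemma past_indep_no_jump:
  fixes t :: "nat \<Rightarrow> real" and S :: "(nat \<Rightarrow> nat) set"
  assumes t0: "t 0 = 0" and tmono: "\<And>i. t i \<le> t (Suc i)"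
  shows "prob {\<omega>\<in>space M. (\<lambda>i. N (t (min i n)) \<omega>) \<in> S \<and> N (t (Suc n)) \<omega> = N (t n) \<omega>} =
    prob {\<omega>\<in>space M. (\<lambda>i. N (t (min i n)) \<omega>) \<in> S} * exp (- rate * (t (Suc n) - t n))"
proof -
  define X where "X i \<omega> = N (t (Suc i)) \<omega> - N (t i) \<omega>" for i \<omega>
  have tm: "i \<le> j \<Longrightarrow> t i \<le> t j" for i j using lift_Suc_mono_le[of t i j] tmono by auto
  have tn: "0 \<le> t i" for i using tm[of 0 i] t0 by simp
  have ind: "indep_vars (\<lambda>_. count_space UNIV) X {..<Suc n}"
    using pp tn tmono unfolding poisson_process_def X_def by auto
  let ?A = "\<lambda>\<omega>. restrict (\<lambda>i. X i \<omega>) {..<n}" and ?B = "\<lambda>\<omega>. restrict (\<lambda>i. X i \<omega>) {n}"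
  let ?PA = "Pi\<^sub>M {..<n} (\<lambda>_. count_space (UNIV::nat set))"
  let ?PB = "Pi\<^sub>M {n} (\<lambda>_. count_space (UNIV::nat set))"
  have iv: "indep_var ?PA ?A ?PB ?B"
    by (rule indep_var_restrict[OF ind]) auto
  \<comment> \<open>A finite power of the natural numbers is countable and its singletons are
    measurable, so every subset is. This is why the past may be tested against an arbitrary set
    \<open>S\<close>.\<close>
  have cs: "C \<in> sets (Pi\<^sub>M J (\<lambda>_. count_space (UNIV::nat set)))"
    if "C \<subseteq> Pi\<^sub>E J (\<lambda>_. UNIV)" "finite J" for C and J :: "nat set"
  proof (rule sets.countable)
    show "countable C"
      by (rule countable_subset[OF that(1)]) (rule countable_PiE[OF that(2)], simp)
    fix a assume "a \<in> C"
    then have "a \<in> Pi\<^sub>E J (\<lambda>_. UNIV)" using that by blast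
    then have "{a} = Pi\<^sub>E J (\<lambda>i. {a i})"
      by (auto simp: PiE_def extensional_def fun_eq_iff Pi_def) metis
    also have "\<dots> \<in> sets (Pi\<^sub>M J (\<lambda>_. count_space UNIV))"
      by (rule sets_PiM_I_finite[OF that(2)]) auto
    finally show "{a} \<in> sets (Pi\<^sub>M J (\<lambda>_. count_space UNIV))" .
  qed
  define SA where "SA = {x \<in> Pi\<^sub>E {..<n} (\<lambda>_. UNIV). (\<lambda>i. \<Sum>j<min i n. x j) \<in> S}"
  define SB where "SB = {x \<in> Pi\<^sub>E {n} (\<lambda>_. UNIV::nat set). x n = 0}"
  have SA: "SA \<in> sets ?PA" unfolding SA_def by (rule cs) auto
  have SB: "SB \<in> sets ?PB" unfolding SB_def by (rule cs) auto
  have Nsum: "N (t k) \<omega> = (\<Sum>j<k. X j \<omega>)" if "\<omega> \<in> space M" for k \<omega>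
  proof (induction k)
    case 0
    then show ?case using that N_0 t0 by simp
  next
    case (Suc k)
    have "N (t k) \<omega> \<le> N (t (Suc k)) \<omega>" using N_mono[OF that tn tmono] .
    then show ?case using Suc by (simp add: X_def)
  qed
  have eqA: "?A -` SA \<inter> space M = {\<omega>\<in>space M. (\<lambda>i. N (t (min i n)) \<omega>) \<in> S}"
  proof -
    have "(\<lambda>i. \<Sum>j<min i n. ?A \<omega> j) = (\<lambda>i. N (t (min i n)) \<omega>)" if "\<omega> \<in> space M" for \<omega>
      using that by (auto simp: Nsum fun_eq_iff intro!: sum.cong)
    then show ?thesis by (auto simp: SA_def)
  qed
  have eqB: "?B -` SB \<inter> space M = {\<omega>\<in>space M. N (t (Suc n)) \<omega> = N (t n) \<omega>}"
    using N_mono[OF _ tn tmono, of _ n] by (auto simp: SB_def X_def intro: antisym)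
  have "prob {\<omega>\<in>space M. (\<lambda>i. N (t (min i n)) \<omega>) \<in> S \<and> N (t (Suc n)) \<omega> = N (t n) \<omega>}
      = prob ((\<lambda>x. (?A x, ?B x)) -` (SA \<times> SB) \<inter> space M)"
    using eqA eqB by (intro arg_cong[where f=prob]) auto
  also have "\<dots> = prob (?A -` SA \<inter> space M) * prob (?B -` SB \<inter> space M)"
    by (rule indep_varD[OF iv SA SB])
  also have "\<dots> = prob {\<omega>\<in>space M. (\<lambda>i. N (t (min i n)) \<omega>) \<in> S} * exp (- rate * (t (Suc n) - t n))"
    unfolding eqA eqB using prob_no_jump[OF tn tmono, of n] by simp
  finally show ?thesis .
qed

text \<open>
  The process sampled at the multiples of \<open>d\<close> has independent increments over fixed intervals, which makes the discretised
  interarrival times geometric and independent; then \<open>d\<close> tends to 0.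
\<close>
definition grid :: "real \<Rightarrow> nat \<Rightarrow> 'a \<Rightarrow> nat" where
  "grid d i \<omega> = (LEAST k. i \<le> N (real k * d) \<omega>)"

lemma grid_le_iff:
  assumes \<omega>: "\<omega> \<in> space M" and r: "\<exists>t\<ge>0. i \<le> N t \<omega>" and d: "0 < d"
  shows "grid d i \<omega> \<le> k \<longleftrightarrow> i \<le> N (real k * d) \<omega>"
proof -
  obtain t where t: "0 \<le> t" "i \<le> N t \<omega>" using r by blast
  obtain j :: nat where "t / d \<le> real j" using real_arch_simple by blast
  then have "t \<le> real j * d" using d by (simp add: field_simps)
  then have j: "i \<le> N (real j * d) \<omega>" using t N_mono[OF \<omega>, of t "real j * d"] by simp
  have L: "i \<le> N (real (grid d i \<omega>) * d) \<omega>"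
    unfolding grid_def by (rule LeastI[of "\<lambda>k. i \<le> N (real k * d) \<omega>", OF j])
  show ?thesis
  proof
    assume "grid d i \<omega> \<le> k"
    then have "N (real (grid d i \<omega>) * d) \<omega> \<le> N (real k * d) \<omega>"
      using d by (intro N_mono[OF \<omega>] mult_right_mono) auto
    with L show "i \<le> N (real k * d) \<omega>" by simp
  next
    assume "i \<le> N (real k * d) \<omega>"
    then show "grid d i \<omega> \<le> k" unfolding grid_def by (rule Least_le)
  qed
qed

lemma grid_jump_time:
  assumes \<omega>: "\<omega> \<in> space M" and r: "\<exists>t\<ge>0. i \<le> N t \<omega>" and d: "0 < d"
  shows "jump_time N i \<omega> \<le> real (grid d i \<omega>) * d" "real (grid d i \<omega>) * d < jump_time N i \<omega> + d"
proof -
  show "jump_time N i \<omega> \<le> real (grid d i \<omega>) * d"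
    using jump_time_le_iff[OF \<omega> r, of "real (grid d i \<omega>) * d"] grid_le_iff[OF \<omega> r d, of "grid d i \<omega>"] d
    by simp
  show "real (grid d i \<omega>) * d < jump_time N i \<omega> + d"
  proof (cases "grid d i \<omega>")
    case 0
    then show ?thesis using jump_time_nonneg[OF r] d by simp
  next
    case (Suc k)
    then have "\<not> i \<le> N (real k * d) \<omega>" using grid_le_iff[OF \<omega> r d, of k] by simp
    then have "real k * d < jump_time N i \<omega>"
      using jump_time_le_iff[OF \<omega> r, of "real k * d"] d by auto
    then show ?thesis using Suc by (simp add: algebra_simps)
  qed
qed

lemma grid_measurable: "0 < d \<Longrightarrow> grid d i \<in> measurable M (count_space UNIV)"
  unfolding grid_def using N_pred[where s=0 and P="\<lambda>_ b. i \<le> b"] by (intro measurable_Least) auto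

lemma grid_pred: "0 < d \<Longrightarrow> Measurable.pred M (\<lambda>\<omega>. P (grid d i \<omega>) (grid d j \<omega>))"
  by (rule measurable_compose_countable[OF _ grid_measurable[of d i]])
    (rule measurable_compose[OF grid_measurable[of d j]], simp_all)

lemma N_grid_pred:
  assumes "0 < d"
  shows "Measurable.pred M (\<lambda>\<omega>. P (N (real (grid d n \<omega> + r) * d) \<omega>) (N (real (grid d n \<omega>) * d) \<omega>))"
  by (rule measurable_compose_countable[OF _ grid_measurable[of d n]])
    (use assms in \<open>auto intro!: N_pred\<close>)

lemma prob_sums_partition:
  fixes g :: "'a \<Rightarrow> nat"
  assumes P: "Measurable.pred M P" and g: "g \<in> measurable M (count_space UNIV)"
  shows "(\<lambda>k. prob {\<omega>\<in>space M. P \<omega> \<and> g \<omega> = k}) sums prob {\<omega>\<in>space M. P \<omega>}"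
proof -
  note P[measurable] g[measurable]
  have "(\<lambda>k. prob {\<omega>\<in>space M. P \<omega> \<and> g \<omega> = k}) sums prob (\<Union>k. {\<omega>\<in>space M. P \<omega> \<and> g \<omega> = k})"
    by (rule finite_measure_UNION) (auto simp: disjoint_family_on_def)
  also have "(\<Union>k. {\<omega>\<in>space M. P \<omega> \<and> g \<omega> = k}) = {\<omega>\<in>space M. P \<omega>}" by auto
  finally show ?thesis .
qed

definition gaps :: "real \<Rightarrow> (nat \<Rightarrow> nat) \<Rightarrow> nat \<Rightarrow> 'a \<Rightarrow> bool" where
  "gaps d r n \<omega> \<longleftrightarrow> (\<forall>i<n. grid d i \<omega> + r i < grid d (Suc i) \<omega>)"

lemma gaps_pred: "0 < d \<Longrightarrow> Measurable.pred M (gaps d r n)"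
  unfolding gaps_def using grid_pred[of d "\<lambda>a b. a + r i < b" for i]
  by (intro pred_intros_countable pred_intros_imp') auto

text \<open>The Markov property at the random index \<open>grid d n\<close>, obtained by summing
  over its values \<open>k\<close>. For fixed \<open>k\<close> both the gap conditions and
  \<open>grid d n = k\<close> are determined by the samples at times up to
  \<open>k * d\<close>.\<close>

lemma grid_step_eq:
  assumes d: "0 < d"
  shows "prob {\<omega>\<in>space M. gaps d r n \<omega> \<and> N (real (grid d n \<omega> + q) * d) \<omega> = N (real (grid d n \<omega>) * d) \<omega>}
    = prob {\<omega>\<in>space M. gaps d r n \<omega>} * exp (- rate * (real q * d))"
proof -
  let ?P = "\<lambda>\<omega>. gaps d r n \<omega> \<and> N (real (grid d n \<omega> + q) * d) \<omega> = N (real (grid d n \<omega>) * d) \<omega>"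
  have mP: "Measurable.pred M ?P"
    using gaps_pred[OF d] N_grid_pred[OF d, where P="(=)"] by (intro pred_intros_logic)
  note gP = gaps_pred[OF d, of r n] and gm = grid_measurable[OF d, of n]
  have "prob {\<omega>\<in>space M. ?P \<omega> \<and> grid d n \<omega> = k} =
      prob {\<omega>\<in>space M. gaps d r n \<omega> \<and> grid d n \<omega> = k} * exp (- rate * (real q * d))" for k
  proof -
    \<comment> \<open>The mesh up to index \<open>k\<close>, then a leap over \<open>q\<close>
      cells: the step from \<open>k\<close> to \<open>Suc k\<close> has length \<open>q * d\<close>,
      so the independence of increments is applied once.\<close>
    define t where "t i = (if i \<le> k then real i * d else real (i - 1 + q) * d)" for i
    \<comment> \<open>Reads a grid index off a sampled sequence. Freezing the sequence after
      \<open>k\<close> does not change the indices up to \<open>n\<close> once level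
      \<open>n\<close> has been reached by \<open>k\<close>.\<close>
    define g where "g x i = (LEAST j. i \<le> x j)" for x :: "nat \<Rightarrow> nat" and i
    define S where "S = {x. n \<le> x k \<and> (\<forall>i<n. g x i + r i < g x (Suc i)) \<and> g x n = k}"
    have t0: "t 0 = 0" by (simp add: t_def)
    have tm: "t i \<le> t (Suc i)" for i
      using d by (auto simp: t_def intro!: mult_right_mono)
    let ?x = "\<lambda>\<omega> i. N (t (min i k)) \<omega>"
    have x: "?x \<omega> i = N (real (min i k) * d) \<omega>" for \<omega> i by (simp add: t_def)
    have gx: "g (?x \<omega>) i = grid d i \<omega>" if "\<omega> \<in> space M" "i \<le> n" "n \<le> N (real k * d) \<omega>" for \<omega> i
    proof -
      have r: "\<exists>t\<ge>0. i \<le> N t \<omega>" using that d by (intro exI[of _ "real k * d"]) auto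
      note le = grid_le_iff[OF that(1) r d]
      have gk: "grid d i \<omega> \<le> k" using le that by simp
      show ?thesis unfolding g_def
      proof (rule Least_equality)
        show "i \<le> ?x \<omega> (grid d i \<omega>)" unfolding x using gk le[of "grid d i \<omega>"] by simp
        fix j assume "i \<le> ?x \<omega> j"
        then have "grid d i \<omega> \<le> min j k" unfolding x le by simp
        then show "grid d i \<omega> \<le> j" by simp
      qed
    qed
    have eq: "?x \<omega> \<in> S \<longleftrightarrow> gaps d r n \<omega> \<and> grid d n \<omega> = k"
      if \<omega>: "\<omega> \<in> space M" and r: "\<forall>n. \<exists>t\<ge>0. n \<le> N t \<omega>" for \<omega>
    proof -
      have "n \<le> ?x \<omega> k \<longleftrightarrow> n \<le> N (real k * d) \<omega>" using x[of k \<omega>] by simp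
      moreover have "n \<le> N (real k * d) \<omega> \<longleftrightarrow> grid d n \<omega> \<le> k"
        using grid_le_iff[OF \<omega> _ d] r by blast
      ultimately show ?thesis using gx[OF \<omega>] by (auto simp: S_def gaps_def)
    qed
    have ts: "t (Suc k) = real (k + q) * d" "t k = real k * d" by (simp_all add: t_def)
    have Sm: "Measurable.pred M (\<lambda>\<omega>. ?x \<omega> \<in> S)"
      using t0 tm by (rule past_pred)
    have Nm: "Measurable.pred M (\<lambda>\<omega>. N (t (Suc k)) \<omega> = N (t k) \<omega>)"
      using d by (intro N_pred[where P="\<lambda>a b. a = b"]) (auto simp: ts)
    have mg: "Measurable.pred M (\<lambda>\<omega>. grid d n \<omega> = k)"
      using grid_pred[OF d, where P="\<lambda>a b. a = k"] by simp
    have "prob {\<omega>\<in>space M. ?P \<omega> \<and> grid d n \<omega> = k} =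
        prob {\<omega>\<in>space M. ?x \<omega> \<in> S \<and> N (t (Suc k)) \<omega> = N (t k) \<omega>}"
    proof (rule finite_measure_eq_AE)
      show "AE \<omega> in M. \<omega> \<in> {\<omega>\<in>space M. ?P \<omega> \<and> grid d n \<omega> = k} \<longleftrightarrow>
          \<omega> \<in> {\<omega>\<in>space M. ?x \<omega> \<in> S \<and> N (t (Suc k)) \<omega> = N (t k) \<omega>}"
        using AE_reach AE_space by eventually_elim (use eq in \<open>auto simp: ts\<close>)
      show "{\<omega>\<in>space M. ?P \<omega> \<and> grid d n \<omega> = k} \<in> events"
        by (rule predE[OF pred_intros_logic(3)[OF mP mg]])
      show "{\<omega>\<in>space M. ?x \<omega> \<in> S \<and> N (t (Suc k)) \<omega> = N (t k) \<omega>} \<in> events"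
        by (rule predE[OF pred_intros_logic(3)[OF Sm Nm]])
    qed
    also have "\<dots> = prob {\<omega>\<in>space M. ?x \<omega> \<in> S} * exp (- rate * (t (Suc k) - t k))"
      by (rule past_indep_no_jump[OF t0 tm])
    also have "prob {\<omega>\<in>space M. ?x \<omega> \<in> S} = prob {\<omega>\<in>space M. gaps d r n \<omega> \<and> grid d n \<omega> = k}"
    proof (rule finite_measure_eq_AE)
      show "AE \<omega> in M. \<omega> \<in> {\<omega>\<in>space M. ?x \<omega> \<in> S} \<longleftrightarrow>
          \<omega> \<in> {\<omega>\<in>space M. gaps d r n \<omega> \<and> grid d n \<omega> = k}"
        using AE_reach AE_space by eventually_elim (use eq in auto)
      show "{\<omega>\<in>space M. ?x \<omega> \<in> S} \<in> events" by (rule predE[OF Sm])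
      show "{\<omega>\<in>space M. gaps d r n \<omega> \<and> grid d n \<omega> = k} \<in> events"
        by (rule predE[OF pred_intros_logic(3)[OF gP mg]])
    qed
    also have "t (Suc k) - t k = real q * d" by (simp add: ts algebra_simps)
    finally show ?thesis .
  qed
  then have "(\<lambda>k. prob {\<omega>\<in>space M. gaps d r n \<omega> \<and> grid d n \<omega> = k} * exp (- rate * (real q * d)))
      sums prob {\<omega>\<in>space M. ?P \<omega>}"
    using prob_sums_partition[OF mP gm] by simp
  moreover have "(\<lambda>k. prob {\<omega>\<in>space M. gaps d r n \<omega> \<and> grid d n \<omega> = k} * exp (- rate * (real q * d)))
      sums (prob {\<omega>\<in>space M. gaps d r n \<omega>} * exp (- rate * (real q * d)))"
    by (rule sums_mult2[OF prob_sums_partition[OF gP gm]])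
  ultimately show ?thesis by (rule sums_unique2)
qed

text \<open>The error event is a further count in the cell of the \<open>n\<close>-th jump. Outside
  it the count at the grid time is exactly \<open>n\<close>, and a gap of more than
  \<open>r n\<close> cells means that no count is added over these cells.\<close>

lemma grid_step:
  assumes d: "0 < d"
  shows "\<bar>prob {\<omega>\<in>space M. gaps d r (Suc n) \<omega>} - prob {\<omega>\<in>space M. gaps d r n \<omega>} * exp (- rate * (real (r n) * d))\<bar>
    \<le> prob {\<omega>\<in>space M. N (real (grid d n \<omega>) * d) \<omega> \<noteq> n}"
proof -
  define A where "A = {\<omega>\<in>space M. gaps d r (Suc n) \<omega>}"
  define B where "B = {\<omega>\<in>space M. gaps d r n \<omega> \<and> N (real (grid d n \<omega> + r n) * d) \<omega> = N (real (grid d n \<omega>) * d) \<omega>}"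
  define D where "D = {\<omega>\<in>space M. N (real (grid d n \<omega>) * d) \<omega> \<noteq> n}"
  have A: "A \<in> events" unfolding A_def using gaps_pred[OF d] by (intro predE)
  have B: "B \<in> events" unfolding B_def using gaps_pred[OF d] N_grid_pred[OF d, where P="(=)"]
    by (intro predE pred_intros_logic)
  have D: "D \<in> events" unfolding D_def using N_grid_pred[OF d, where P="\<lambda>a b. b \<noteq> n" and r=0] by (intro predE)
  have eq: "AE \<omega> in M. \<omega> \<notin> D \<longrightarrow> \<omega> \<in> A \<longleftrightarrow> \<omega> \<in> B"
    using AE_reach AE_space
  proof eventually_elim
    case (elim \<omega>)
    show ?case
    proof
      assume "\<omega> \<notin> D"
      then have Nn: "N (real (grid d n \<omega>) * d) \<omega> = n" using elim by (simp add: D_def)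
      have le: "n \<le> N (real (grid d n \<omega> + r n) * d) \<omega>"
        using grid_le_iff[OF elim(2) _ d, of n "grid d n \<omega> + r n"] elim by simp
      have "grid d n \<omega> + r n < grid d (Suc n) \<omega> \<longleftrightarrow> \<not> Suc n \<le> N (real (grid d n \<omega> + r n) * d) \<omega>"
        using grid_le_iff[OF elim(2) _ d, of "Suc n" "grid d n \<omega> + r n"] elim by auto
      also have "\<dots> \<longleftrightarrow> N (real (grid d n \<omega> + r n) * d) \<omega> = N (real (grid d n \<omega>) * d) \<omega>"
        using Nn le by auto
      finally show "\<omega> \<in> A \<longleftrightarrow> \<omega> \<in> B" using elim by (auto simp: A_def B_def gaps_def less_Suc_eq)
    qed
  qed
  have "prob A \<le> prob (B \<union> D)"
    using eq A B D by (intro finite_measure_mono_AE) auto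
  moreover have "prob B \<le> prob (A \<union> D)"
    using eq A B D by (intro finite_measure_mono_AE) auto
  moreover have "prob (B \<union> D) \<le> prob B + prob D" "prob (A \<union> D) \<le> prob A + prob D"
    using A B D by (auto intro: measure_Un_le)
  ultimately have "\<bar>prob A - prob B\<bar> \<le> prob D" by linarith
  then show ?thesis using grid_step_eq[OF d, of r n "r n"] by (simp add: A_def B_def D_def)
qed

text \<open>The mesh is \<open>1 / (j + 1)\<close>, and a threshold \<open>s i\<close> becomes the
  floor of \<open>s i * (j + 1)\<close> cells. Each gap contributes a factor that converges to
  \<open>exp (- rate * s i)\<close>, up to an error that vanishes with the mesh.\<close>

lemma grid_limit:
  fixes s :: "nat \<Rightarrow> real"
  assumes s: "\<And>i. 0 \<le> s i"
  defines "d \<equiv> \<lambda>j::nat. 1 / real (Suc j)" and "r \<equiv> \<lambda>(j::nat) i. nat \<lfloor>s i * real (Suc j)\<rfloor>"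
  shows "(\<lambda>j. prob {\<omega>\<in>space M. gaps (d j) (r j) n \<omega>}) \<longlonglongrightarrow> (\<Prod>i<n. exp (- rate * s i))"
proof (induction n)
  case 0
  then show ?case by (simp add: gaps_def prob_space)
next
  case (Suc n)
  have d: "0 < d j" for j by (simp add: d_def)
  have d0: "d \<longlonglongrightarrow> 0" unfolding d_def by real_asymp
  have r: "(\<lambda>j. real (r j n) * d j) \<longlonglongrightarrow> s n"
  proof (rule tendsto_sandwich[OF always_eventually always_eventually])
    have rj: "real (r j n) = of_int \<lfloor>s n * real (Suc j)\<rfloor>" for j using s[of n] by (simp add: r_def)
    have "s n * real (Suc j) - 1 \<le> real (r j n)" "real (r j n) \<le> s n * real (Suc j)" for j
      unfolding rj by linarith+
    then have *: "(s n * real (Suc j) - 1) * d j \<le> real (r j n) * d j"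
      "real (r j n) * d j \<le> (s n * real (Suc j)) * d j" for j
      using d[of j] by (auto intro!: mult_right_mono simp del: of_nat_Suc)
    moreover have "(s n * real (Suc j) - 1) * d j = s n - d j" "s n * real (Suc j) * d j = s n" for j
      by (simp_all add: d_def diff_divide_distrib del: of_nat_Suc)
    ultimately show "\<forall>j. s n - d j \<le> real (r j n) * d j" "\<forall>j. real (r j n) * d j \<le> s n"
      by metis+
    show "(\<lambda>j. s n - d j) \<longlonglongrightarrow> s n" using tendsto_diff[OF tendsto_const d0, of "s n"] by simp
  qed simp
  \<comment> \<open>The count is \<open>n\<close> at the jump time and stays constant for a while
    after it. The grid time is late by less than \<open>d j\<close>, so for large \<open>j\<close>
    it falls into that interval.\<close>
  have bad: "(\<lambda>j. prob {\<omega>\<in>space M. N (real (grid (d j) n \<omega>) * d j) \<omega> \<noteq> n}) \<longlonglongrightarrow> 0"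
  proof (rule prob_tendsto_0_AE)
    show "{\<omega>\<in>space M. N (real (grid (d j) n \<omega>) * d j) \<omega> \<noteq> n} \<in> events" for j
      using N_grid_pred[OF d, where P="\<lambda>a b. b \<noteq> n" and r=0] by (intro predE)
    show "AE \<omega> in M. eventually (\<lambda>j. \<omega> \<notin> {\<omega>\<in>space M. N (real (grid (d j) n \<omega>) * d j) \<omega> \<noteq> n}) sequentially"
      using AE_reach AE_simple_jumps AE_space
    proof eventually_elim
      case (elim \<omega>)
      let ?T = "jump_time N n \<omega>"
      have re: "\<exists>t\<ge>0. n \<le> N t \<omega>" using elim by blast
      obtain e where e: "e > 0" "\<And>s. ?T \<le> s \<Longrightarrow> s < ?T + e \<Longrightarrow> N s \<omega> = N ?T \<omega>"
        using N_right[OF elim(3) jump_time_nonneg[OF re]] by auto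
      have "eventually (\<lambda>j. d j < e) sequentially" using order_tendstoD(2)[OF d0 e(1)] .
      then show ?case
      proof eventually_elim
        case (elim j)
        then have "N (real (grid (d j) n \<omega>) * d j) \<omega> = N ?T \<omega>"
          using grid_jump_time[OF \<open>\<omega> \<in> space M\<close> re d, of j] by (intro e(2)) auto
        then show ?case using \<open>\<forall>n. N (jump_time N n \<omega>) \<omega> = n\<close> by simp
      qed
    qed
  qed
  have l1: "(\<lambda>j. prob {\<omega>\<in>space M. gaps (d j) (r j) (Suc n) \<omega>} -
      prob {\<omega>\<in>space M. gaps (d j) (r j) n \<omega>} * exp (- rate * (real (r j n) * d j))) \<longlonglongrightarrow> 0"
    by (rule Lim_null_comparison[OF _ bad]) (use grid_step[OF d] in \<open>simp add: always_eventually\<close>)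
  have l2: "(\<lambda>j. prob {\<omega>\<in>space M. gaps (d j) (r j) n \<omega>} * exp (- rate * (real (r j n) * d j)))
      \<longlonglongrightarrow> (\<Prod>i<n. exp (- rate * s i)) * exp (- rate * s n)"
    by (intro tendsto_intros Suc r)
  show ?case using tendsto_add[OF l1 l2] by simp
qed

section \<open>Joint law of the interarrival times\<close>

definition gap :: "nat \<Rightarrow> 'a \<Rightarrow> real" where
  "gap i \<omega> = jump_time N (Suc i) \<omega> - jump_time N i \<omega>"

lemma gap_measurable[measurable]: "gap i \<in> borel_measurable M"
  unfolding gap_def using jump_time_measurable by (intro borel_measurable_diff)

text \<open>In the limit the discretised condition lies between the strict and the weak inequality,
  so its limiting probability is an upper bound for the strict event and a lower bound for the weak
  one. Raising the thresholds slightly turns the weak inequality into a strict one, and the formula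
  is continuous in the thresholds.\<close>

lemma prob_gaps_gt:
  fixes s :: "nat \<Rightarrow> real"
  assumes s: "\<And>i. 0 \<le> s i"
  shows "prob {\<omega>\<in>space M. \<forall>i<n. s i < gap i \<omega>} = (\<Prod>i<n. exp (- rate * s i))"
proof -
  let ?d = "\<lambda>j::nat. 1 / real (Suc j)" and ?r = "\<lambda>s (j::nat) i. nat \<lfloor>s i * real (Suc j)\<rfloor>"
  have d: "0 < ?d j" for j by simp
  have d0: "?d \<longlonglongrightarrow> 0" by real_asymp
  have ev: "{\<omega>\<in>space M. gaps (?d j) (?r s j) n \<omega>} \<in> events" for j s
    using gaps_pred[OF d] by (intro predE)
  \<comment> \<open>Against natural numbers a nonnegative real threshold may be replaced by its
    floor.\<close>
  have r1: "a * real (Suc j) < real k \<longleftrightarrow> nat \<lfloor>a * real (Suc j)\<rfloor> < k" if "0 \<le> a" for a j k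
  proof -
    have "0 \<le> a * real (Suc j)" using that by simp
    then show ?thesis by (simp add: nat_less_iff floor_less_iff del: of_nat_Suc)
  qed
  \<comment> \<open>Both grid times are late by an amount in \<open>[0, d)\<close>, hence their
    difference errs by less than \<open>d\<close>.\<close>
  have gd: "\<bar>(real (grid (?d j) (Suc i) \<omega>) - real (grid (?d j) i \<omega>)) * ?d j - gap i \<omega>\<bar> < ?d j"
    if "\<omega> \<in> space M" "\<forall>n. \<exists>t\<ge>0. n \<le> N t \<omega>" for \<omega> i j
  proof -
    have re: "\<exists>t\<ge>0. i \<le> N t \<omega>" "\<exists>t\<ge>0. Suc i \<le> N t \<omega>" using that by blast+
    show ?thesis
      using grid_jump_time[OF that(1) re(1) d, of j] grid_jump_time[OF that(1) re(2) d, of j]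
      unfolding gap_def left_diff_distrib by linarith
  qed
  have gi: "grid (?d j) i \<omega> + ?r s j i < grid (?d j) (Suc i) \<omega> \<longleftrightarrow>
      s i < (real (grid (?d j) (Suc i) \<omega>) - real (grid (?d j) i \<omega>)) * ?d j"
    if s: "\<And>i. 0 \<le> s i" for s j i \<omega>
  proof -
    have "s i < (real (grid (?d j) (Suc i) \<omega>) - real (grid (?d j) i \<omega>)) * ?d j \<longleftrightarrow>
        s i * real (Suc j) < real (grid (?d j) (Suc i) \<omega>) - real (grid (?d j) i \<omega>)"
      by (simp add: field_simps)
    also have "\<dots> \<longleftrightarrow> ?r s j i < grid (?d j) (Suc i) \<omega> - grid (?d j) i \<omega>"
    proof (cases "grid (?d j) i \<omega> \<le> grid (?d j) (Suc i) \<omega>")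
      case True
      then show ?thesis using r1[OF s, of i j "grid (?d j) (Suc i) \<omega> - grid (?d j) i \<omega>"]
        by (simp add: of_nat_diff)
    next
      case False
      moreover have "0 \<le> s i * real (Suc j)" using s by simp
      ultimately show ?thesis by (simp add: not_less del: of_nat_Suc)
    qed
    finally show ?thesis by auto
  qed
  have upper: "prob {\<omega>\<in>space M. \<forall>i<n. s i < gap i \<omega>} \<le> (\<Prod>i<n. exp (- rate * s i))"
  proof (rule prob_le_limit_AE[OF _ ev _ grid_limit[OF s]])
    show "{\<omega>\<in>space M. \<forall>i<n. s i < gap i \<omega>} \<in> events" by measurable
    show "AE \<omega> in M. \<omega> \<in> {\<omega>\<in>space M. \<forall>i<n. s i < gap i \<omega>} \<longrightarrow>
        eventually (\<lambda>j. \<omega> \<in> {\<omega>\<in>space M. gaps (?d j) (?r s j) n \<omega>}) sequentially"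
      using AE_reach
    proof eventually_elim
      case (elim \<omega>)
      show ?case
      proof
        assume \<omega>: "\<omega> \<in> {\<omega>\<in>space M. \<forall>i<n. s i < gap i \<omega>}"
        have "eventually (\<lambda>j. \<forall>i\<in>{..<n}. ?d j < gap i \<omega> - s i) sequentially"
          using \<omega> by (intro eventually_ball_finite ballI order_tendstoD(2)[OF d0]) auto
        then show "eventually (\<lambda>j. \<omega> \<in> {\<omega>\<in>space M. gaps (?d j) (?r s j) n \<omega>}) sequentially"
        proof eventually_elim
          case (elim j)
          have "s i < (real (grid (?d j) (Suc i) \<omega>) - real (grid (?d j) i \<omega>)) * ?d j" if "i < n" for i
          proof -
            have "?d j < gap i \<omega> - s i" using elim that by blast
            then show ?thesis using gd[of \<omega> j i] \<omega> \<open>\<forall>n. \<exists>t\<ge>0. n \<le> N t \<omega>\<close> by auto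
          qed
          then show ?case using \<omega> gi[of s, OF s] by (simp add: gaps_def)
        qed
      qed
    qed
  qed
  have lower: "(\<Prod>i<n. exp (- rate * s i)) \<le> prob {\<omega>\<in>space M. \<forall>i<n. s i \<le> gap i \<omega>}"
    if s: "\<And>i. 0 \<le> s i" for s
  proof (rule limit_le_prob_AE[OF _ ev _ grid_limit[OF s]])
    show "{\<omega>\<in>space M. \<forall>i<n. s i \<le> gap i \<omega>} \<in> events" by measurable
    show "AE \<omega> in M. \<omega> \<notin> {\<omega>\<in>space M. \<forall>i<n. s i \<le> gap i \<omega>} \<longrightarrow>
        eventually (\<lambda>j. \<omega> \<notin> {\<omega>\<in>space M. gaps (?d j) (?r s j) n \<omega>}) sequentially"
      using AE_reach AE_space
    proof eventually_elim
      case (elim \<omega>)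
      show ?case
      proof
        assume "\<omega> \<notin> {\<omega>\<in>space M. \<forall>i<n. s i \<le> gap i \<omega>}"
        then obtain i where i: "i < n" "gap i \<omega> < s i" using elim by auto
        have "eventually (\<lambda>j. ?d j < s i - gap i \<omega>) sequentially"
          using i by (intro order_tendstoD(2)[OF d0]) auto
        then show "eventually (\<lambda>j. \<omega> \<notin> {\<omega>\<in>space M. gaps (?d j) (?r s j) n \<omega>}) sequentially"
        proof eventually_elim
          case (elim j)
          then have "\<not> s i < (real (grid (?d j) (Suc i) \<omega>) - real (grid (?d j) i \<omega>)) * ?d j"
            using gd[of \<omega> j i] \<open>\<omega> \<in> space M\<close> \<open>\<forall>n. \<exists>t\<ge>0. n \<le> N t \<omega>\<close> by auto
          then show ?case using i gi[of s, OF s] by (auto simp: gaps_def)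
        qed
      qed
    qed
  qed
  have "(\<Prod>i<n. exp (- rate * s i)) \<le> prob {\<omega>\<in>space M. \<forall>i<n. s i < gap i \<omega>}"
  proof (rule tendsto_upperbound[OF _ always_eventually])
    show "(\<lambda>j::nat. \<Prod>i<n. exp (- rate * (s i + ?d j))) \<longlonglongrightarrow> (\<Prod>i<n. exp (- rate * s i))"
    proof (intro tendsto_prod)
      fix i
      have "(\<lambda>j. exp (- rate * (s i + ?d j))) \<longlonglongrightarrow> exp (- rate * (s i + 0))"
        by (intro tendsto_intros d0)
      then show "(\<lambda>j. exp (- rate * (s i + ?d j))) \<longlonglongrightarrow> exp (- rate * s i)" by simp
    qed
    show "\<forall>j. (\<Prod>i<n. exp (- rate * (s i + ?d j))) \<le> prob {\<omega>\<in>space M. \<forall>i<n. s i < gap i \<omega>}"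
    proof
      fix j :: nat
      have "(\<Prod>i<n. exp (- rate * (s i + ?d j))) \<le> prob {\<omega>\<in>space M. \<forall>i<n. s i + ?d j \<le> gap i \<omega>}"
        using s by (intro lower) auto
      also have "\<dots> \<le> prob {\<omega>\<in>space M. \<forall>i<n. s i < gap i \<omega>}"
      proof (rule finite_measure_mono)
        show "{\<omega>\<in>space M. \<forall>i<n. s i + ?d j \<le> gap i \<omega>} \<subseteq> {\<omega>\<in>space M. \<forall>i<n. s i < gap i \<omega>}"
        proof safe
          fix \<omega> i assume "\<forall>i<n. s i + ?d j \<le> gap i \<omega>" "i < n"
          then have "s i + ?d j \<le> gap i \<omega>" by blast
          with d[of j] show "s i < gap i \<omega>" by linarith
        qed
        show "{\<omega>\<in>space M. \<forall>i<n. s i < gap i \<omega>} \<in> events" by measurable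
      qed
      finally show "(\<Prod>i<n. exp (- rate * (s i + ?d j))) \<le> prob {\<omega>\<in>space M. \<forall>i<n. s i < gap i \<omega>}" .
    qed
  qed simp
  with upper show ?thesis by simp
qed

lemma AE_gap_pos: "AE \<omega> in M. 0 < gap i \<omega>"
proof -
  have "prob {\<omega>\<in>space M. \<forall>j<Suc i. 0 < gap j \<omega>} = 1"
    using prob_gaps_gt[of "\<lambda>_. 0" "Suc i"] by simp
  then have "AE \<omega> in M. \<forall>j<Suc i. 0 < gap j \<omega>"
    by (intro prob_Collect_eq_1[THEN iffD1]) auto
  then show ?thesis by eventually_elim auto
qed

text \<open>Gaps are almost surely positive, so a negative threshold acts like 0, and indices
  outside \<open>J\<close> can be added with threshold 0. This reduces an arbitrary finite family to
  an initial segment.\<close>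

lemma prob_gap_ball:
  assumes J: "finite J"
  shows "prob {\<omega>\<in>space M. \<forall>j\<in>J. s j < gap j \<omega>} = (\<Prod>j\<in>J. exp (- rate * max 0 (s j)))"
proof -
  obtain n where n: "J \<subseteq> {..<n}" using finite_nat_iff_bounded J by blast
  define s' where "s' j = (if j \<in> J then max 0 (s j) else 0)" for j
  have "prob {\<omega>\<in>space M. \<forall>j\<in>J. s j < gap j \<omega>} = prob {\<omega>\<in>space M. \<forall>i<n. s' i < gap i \<omega>}"
  proof (rule finite_measure_eq_AE)
    have "AE \<omega> in M. \<forall>i. 0 < gap i \<omega>" using AE_gap_pos by (simp add: AE_all_countable)
    with AE_space show "AE \<omega> in M. (\<omega> \<in> {\<omega> \<in> space M. \<forall>j\<in>J. s j < gap j \<omega>}) =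
        (\<omega> \<in> {\<omega> \<in> space M. \<forall>i<n. s' i < gap i \<omega>})"
      by eventually_elim (use n in \<open>auto simp: s'_def\<close>)
    show "{\<omega> \<in> space M. \<forall>j\<in>J. s j < gap j \<omega>} \<in> events"
      using J by measurable
    show "{\<omega> \<in> space M. \<forall>i<n. s' i < gap i \<omega>} \<in> events" by measurable
  qed
  also have "\<dots> = (\<Prod>i<n. exp (- rate * s' i))"
    by (rule prob_gaps_gt) (simp add: s'_def)
  also have "\<dots> = (\<Prod>j\<in>J. exp (- rate * s' j))"
    using n by (intro prod.mono_neutral_right) (auto simp: s'_def)
  also have "\<dots> = (\<Prod>j\<in>J. exp (- rate * max 0 (s j)))"
    by (intro prod.cong) (auto simp: s'_def)
  finally show ?thesis .
qed

lemma gap_exponential: "distributed M lborel (gap i) (exponential_density rate)"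
proof (rule exponential_distributed_iff[OF rate_pos, THEN iffD2], intro conjI allI impI)
  fix a :: real assume a: "0 \<le> a"
  have "\<P>(x in M. a < gap i x) = exp (- rate * a)"
    using prob_gap_ball[of "{i}" "\<lambda>_. a"] a by simp
  moreover have "\<P>(x in M. \<not> (a < gap i x)) = 1 - \<P>(x in M. a < gap i x)"
    by (rule prob_neg) measurable
  ultimately show "\<P>(x in M. gap i x \<le> a) = 1 - exp (- a * rate)"
    by (simp add: not_less mult.commute)
qed (use rate_pos in auto)

text \<open>The events \<open>a < gap i\<close> are closed under intersection and generate the
  sigma-algebra of \<open>gap i\<close>; on them independence is the product formula for the
  tails.\<close>

lemma gap_indep: "indep_vars (\<lambda>_. borel) gap UNIV"
proof -
  define F where "F i = {{\<omega>\<in>space M. a < gap i \<omega>} | a. True}" for i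
  have "indep_sets F UNIV"
  proof (rule indep_setsI)
    show "F i \<subseteq> events" for i by (auto simp: F_def)
    fix A and J :: "nat set" assume J: "J \<noteq> {}" "J \<subseteq> UNIV" "finite J" "\<forall>j\<in>J. A j \<in> F j"
    then obtain s where s: "\<And>j. j \<in> J \<Longrightarrow> A j = {\<omega>\<in>space M. s j < gap j \<omega>}"
      unfolding F_def by (simp add: bchoice_iff) metis
    have "(\<Inter>j\<in>J. A j) = {\<omega>\<in>space M. \<forall>j\<in>J. s j < gap j \<omega>}" using s J by auto
    then have "prob (\<Inter>j\<in>J. A j) = (\<Prod>j\<in>J. exp (- rate * max 0 (s j)))"
      using prob_gap_ball[OF J(3)] by simp
    also have "\<dots> = (\<Prod>j\<in>J. prob (A j))"
    proof (rule prod.cong[OF refl])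
      fix j assume "j \<in> J"
      then show "exp (- rate * max 0 (s j)) = prob (A j)"
        using prob_gap_ball[of "{j}" s] s by simp
    qed
    finally show "prob (\<Inter>j\<in>J. A j) = (\<Prod>j\<in>J. prob (A j))" .
  qed
  then have "indep_sets (\<lambda>i. sigma_sets (space M) (F i)) UNIV"
  proof (rule indep_sets_sigma)
    fix i show "Int_stable (F i)"
    proof (rule Int_stableI)
      fix a b assume "a \<in> F i" "b \<in> F i"
      then obtain x y where "a = {\<omega>\<in>space M. x < gap i \<omega>}" "b = {\<omega>\<in>space M. y < gap i \<omega>}"
        by (auto simp: F_def)
      then have "a \<inter> b = {\<omega>\<in>space M. max x y < gap i \<omega>}" by auto
      then show "a \<inter> b \<in> F i" unfolding F_def by blast
    qed
  qed
  moreover have "sigma_sets (space M) (F i) = {gap i -` A \<inter> space M | A. A \<in> sets borel}" for i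
  proof -
    have "{gap i -` A \<inter> space M | A. A \<in> sets borel}
        = {gap i -` A \<inter> space M | A. A \<in> sigma_sets UNIV (range (\<lambda>a::real. {a<..}))}"
      by (simp add: borel_Ioi)
    also have "\<dots> = sigma_sets (space M) {gap i -` A \<inter> space M | A. A \<in> range (\<lambda>a::real. {a<..})}"
      by (rule sigma_sets_vimage_commute) auto
    also have "{gap i -` A \<inter> space M | A. A \<in> range (\<lambda>a::real. {a<..})} = F i"
      unfolding F_def by (auto simp: vimage_def Int_def conj_commute)
    finally show ?thesis by simp
  qed
  ultimately show ?thesis by (simp add: indep_vars_def2)
qed

end

section \<open>The chain embedded at the jump times\<close>

text \<open>
  A stream element \<open>(e, v)\<close> is an interarrival time and the jump that ends it.  The comparison before
  the jump is strict: started above \<open>l\<close>, the monotone flow reaches \<open>l\<close> strictly before the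
  jump iff its left limit there is below \<open>l\<close>.
\<close>
primrec hit :: "real \<Rightarrow> real \<Rightarrow> nat \<Rightarrow> real \<Rightarrow> (real \<times> real) stream \<Rightarrow> bool" where
  "hit k l 0 x w = False"
| "hit k l (Suc n) x w = (x * exp (k * fst (shd w)) < l \<or> x * exp (k * fst (shd w)) + snd (shd w) \<le> l \<or>
     hit k l n (x * exp (k * fst (shd w)) + snd (shd w)) (stl w))"

text \<open>If \<open>g\<close> satisfies the one-step identity, this is a martingale in the horizon
  \<open>n\<close>, frozen at 1 from the passage on.\<close>

primrec stopped_value :: "real \<Rightarrow> real \<Rightarrow> (real \<Rightarrow> complex) \<Rightarrow> nat \<Rightarrow> real \<Rightarrow> (real \<times> real) stream \<Rightarrow> complex" where
  "stopped_value k l g 0 x w = g x"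
| "stopped_value k l g (Suc n) x w =
     (if x * exp (k * fst (shd w)) < l \<or> x * exp (k * fst (shd w)) + snd (shd w) \<le> l then 1
      else stopped_value k l g n (x * exp (k * fst (shd w)) + snd (shd w)) (stl w))"

primrec chain_state :: "real \<Rightarrow> nat \<Rightarrow> real \<Rightarrow> (real \<times> real) stream \<Rightarrow> real" where
  "chain_state k 0 x w = x"
| "chain_state k (Suc n) x w = chain_state k n (x * exp (k * fst (shd w)) + snd (shd w)) (stl w)"

lemma stopped_value_hit: "hit k l n x w \<Longrightarrow> n \<le> m \<Longrightarrow> stopped_value k l g m x w = 1"
proof (induction n arbitrary: m x w)
  case (Suc n)
  then obtain m' where "m = Suc m'" by (cases m) auto
  with Suc show ?case by auto
qed simp

lemma stopped_value_not_hit: "\<not> hit k l n x w \<Longrightarrow> stopped_value k l g n x w = g (chain_state k n x w)"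
  by (induction n arbitrary: x w) auto

lemma chain_state_gt: "\<not> hit k l n x w \<Longrightarrow> l < x \<Longrightarrow> l < chain_state k n x w"
  by (induction n arbitrary: x w) auto

primrec discount :: "real \<Rightarrow> (real \<times> real \<Rightarrow> real) \<Rightarrow> nat \<Rightarrow> (real \<times> real) stream \<Rightarrow> real" where
  "discount k h 0 w = exp (- k * fst (shd w)) * h (shd w)"
| "discount k h (Suc i) w = exp (- k * fst (shd w)) * discount k h i (stl w)"

text \<open>With \<open>h = 1\<close> the \<open>n\<close>-th discount factor is \<open>exp (- k * T)\<close> for the \<open>n+1\<close>-st jump time \<open>T\<close>;
  the discounted jumps sum to the limit of \<open>exp (- k * t) * X t\<close>.\<close>
lemma chain_state_discount:
  "chain_state k (Suc n) x w * discount k (\<lambda>_. 1) n w = x + (\<Sum>i\<le>n. discount k snd i w)"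
proof (induction n arbitrary: x w)
  case 0
  then show ?case by (simp add: algebra_simps flip: exp_add)
next
  case (Suc n)
  have "chain_state k (Suc (Suc n)) x w * discount k (\<lambda>_. 1) (Suc n) w =
     exp (- k * fst (shd w)) * (x * exp (k * fst (shd w)) + snd (shd w) + (\<Sum>i\<le>n. discount k snd i (stl w)))"
    by (subst Suc[symmetric]) simp
  also have "\<dots> = x + (\<Sum>i\<le>Suc n. discount k snd i w)"
    by (simp only: sum.atMost_Suc_shift discount.simps sum_distrib_left[symmetric])
      (simp add: algebra_simps flip: exp_add)
  finally show ?case .
qed

lemma discount_one_pos: "0 < discount k (\<lambda>_. 1) n w"
  by (induction n arbitrary: w) auto

text \<open>\<open>J_mean\<close> makes the discounted jumps summable. \<open>J_atomless\<close>
  keeps their sum from cancelling the starting point exactly, the case in which the growth of the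
  chain would be undetermined.\<close>

locale jump_chain = J: prob_space J for J :: "real measure" +
  fixes k rate :: real
  assumes k_pos: "0 < k" and rate_pos: "0 < rate"
    and sets_J[measurable_cong]: "sets J = sets borel"
    and J_atomless: "\<And>c. AE v in J. v \<noteq> c"
    and J_mean: "(\<integral>\<^sup>+v. ennreal \<bar>v\<bar> \<partial>J) < \<infinity>"
begin

abbreviation "E \<equiv> density lborel (\<lambda>x. ennreal (exponential_density rate x))"

definition "step = E \<Otimes>\<^sub>M J"

abbreviation "S \<equiv> stream_space step"

lemma prob_space_E: "prob_space E"
  by (rule prob_space_exponential_density[OF rate_pos])

lemma sets_step[measurable_cong]: "sets step = sets (borel \<Otimes>\<^sub>M borel)"
  unfolding step_def by (intro sets_pair_measure_cong) (auto simp: sets_J)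

lemma prob_space_step: "prob_space step"
proof -
  interpret E: prob_space E by (rule prob_space_E)
  interpret P: pair_prob_space E J ..
  show ?thesis unfolding step_def by unfold_locales
qed

sublocale step: prob_space step by (rule prob_space_step)

sublocale S: prob_space S by (rule step.prob_space_stream_space)

lemma space_S[simp]: "space S = UNIV"
proof -
  have "space step = UNIV" using sets_eq_imp_space_eq[OF sets_step] by (simp add: space_pair_measure)
  then show ?thesis by (simp add: space_stream_space)
qed

lemma space_step[simp]: "space step = UNIV"
  using sets_eq_imp_space_eq[OF sets_step] by (simp add: space_pair_measure)

lemma S_UNIV[simp]: "emeasure S UNIV = 1" "measure S UNIV = 1"
  using S.emeasure_space_1 S.prob_space by simp_all

lemma snd_shd_measurable[measurable]: "(\<lambda>w. snd (shd w)) \<in> borel_measurable S"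
proof -
  have "snd \<in> borel_measurable step" by measurable
  then show ?thesis by (auto intro: measurable_compose[OF measurable_shd])
qed

lemma hit_measurable: "Measurable.pred (borel \<Otimes>\<^sub>M S) (\<lambda>(x, w). hit k l n x w)"
proof (induction n)
  case (Suc n)
  have [measurable]: "(\<lambda>p. (fst p * exp (k * fst (shd (snd p))) + snd (shd (snd p)), stl (snd p)))
    \<in> (borel \<Otimes>\<^sub>M S) \<rightarrow>\<^sub>M (borel \<Otimes>\<^sub>M S)" by measurable
  have [measurable]: "Measurable.pred (borel \<Otimes>\<^sub>M S)
      (\<lambda>p. hit k l n (fst p * exp (k * fst (shd (snd p))) + snd (shd (snd p))) (stl (snd p)))"
    using measurable_compose[OF _ Suc, of "\<lambda>p. (fst p * exp (k * fst (shd (snd p))) + snd (shd (snd p)), stl (snd p))"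
      "borel \<Otimes>\<^sub>M S"] by simp
  show ?case by (simp add: split_beta')
qed simp

lemma hit_measurable'[measurable]: "Measurable.pred S (hit k l n x)"
  using measurable_compose[OF _ hit_measurable, of "\<lambda>w. (x, w)" S] by simp

lemma stopped_value_measurable:
  assumes [measurable]: "g \<in> borel_measurable borel"
  shows "(\<lambda>(x, w). stopped_value k l g n x w) \<in> borel_measurable (borel \<Otimes>\<^sub>M S)"
proof (induction n)
  case (Suc n)
  have [measurable]: "(\<lambda>p. (fst p * exp (k * fst (shd (snd p))) + snd (shd (snd p)), stl (snd p)))
    \<in> (borel \<Otimes>\<^sub>M S) \<rightarrow>\<^sub>M (borel \<Otimes>\<^sub>M S)" by measurable
  have [measurable]: "(\<lambda>p. stopped_value k l g n (fst p * exp (k * fst (shd (snd p))) + snd (shd (snd p))) (stl (snd p)))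
      \<in> borel_measurable (borel \<Otimes>\<^sub>M S)"
    using measurable_compose[OF _ Suc, of "\<lambda>p. (fst p * exp (k * fst (shd (snd p))) + snd (shd (snd p)), stl (snd p))"
      "borel \<Otimes>\<^sub>M S"] by simp
  show ?case by (simp add: split_beta')
qed simp

lemma stopped_value_measurable':
  assumes "g \<in> borel_measurable borel"
  shows "stopped_value k l g n x \<in> borel_measurable S"
  using measurable_compose[OF _ stopped_value_measurable[OF assms], of "\<lambda>w. (x, w)" S] by simp

lemma stopped_value_bounded:
  assumes "\<And>y. norm (g y) \<le> B" "1 \<le> B"
  shows "norm (stopped_value k l g n x w) \<le> B"
  using assms by (induction n arbitrary: x w) auto

text \<open>The first step is independent of the remaining stream, which has the same law again. In
  this product form Fubini's theorem applies to complex integrands.\<close>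

lemma stream_distr: "S = distr (step \<Otimes>\<^sub>M S) S (\<lambda>(p, w). p ## w)"
proof (rule measure_eqI)
  fix A assume A: "A \<in> sets S"
  have m: "(\<lambda>(p, w). p ## w) \<in> (step \<Otimes>\<^sub>M S) \<rightarrow>\<^sub>M S" by measurable
  have "emeasure (distr (step \<Otimes>\<^sub>M S) S (\<lambda>(p, w). p ## w)) A
      = emeasure (step \<Otimes>\<^sub>M S) ((\<lambda>(p, w). p ## w) -` A \<inter> space (step \<Otimes>\<^sub>M S))"
    using A by (subst emeasure_distr[OF m]) auto
  also have "\<dots> = (\<integral>\<^sup>+p. emeasure S (Pair p -` ((\<lambda>(p, w). p ## w) -` A \<inter> space (step \<Otimes>\<^sub>M S))) \<partial>step)"
    by (rule S.emeasure_pair_measure_alt[OF measurable_sets[OF m A]])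
  also have "\<dots> = emeasure S A"
    by (subst step.emeasure_stream_space[OF A])
      (auto intro!: nn_integral_cong arg_cong[where f="emeasure S"] simp: space_pair_measure)
  finally show "emeasure S A = emeasure (distr (step \<Otimes>\<^sub>M S) S (\<lambda>(p, w). p ## w)) A" by simp
qed simp

lemma integral_stream_step:
  fixes f :: "(real \<times> real) stream \<Rightarrow> complex"
  assumes f[measurable]: "f \<in> borel_measurable S" and b: "\<And>w. norm (f w) \<le> B"
  shows "(\<integral>w. f w \<partial>S) = (\<integral>p. (\<integral>w. f (p ## w) \<partial>S) \<partial>step)"
proof -
  interpret P: pair_prob_space step S ..
  have m: "(\<lambda>(p, w). p ## w) \<in> (step \<Otimes>\<^sub>M S) \<rightarrow>\<^sub>M S" by measurable
  have "(\<integral>w. f w \<partial>S) = (\<integral>q. f (case q of (p, w) \<Rightarrow> p ## w) \<partial>(step \<Otimes>\<^sub>M S))"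
    by (subst stream_distr) (rule integral_distr[OF m f])
  also have "\<dots> = (\<integral>q. (case q of (p, w) \<Rightarrow> f (p ## w)) \<partial>(step \<Otimes>\<^sub>M S))"
    by (simp add: split_beta')
  also have "\<dots> = (\<integral>p. (\<integral>w. f (p ## w) \<partial>S) \<partial>step)"
  proof -
    have "integrable (step \<Otimes>\<^sub>M S) (\<lambda>(p, w). f (p ## w))"
      by (rule P.integrable_const_bound[of _ B]) (use b in \<open>auto simp: split_beta'\<close>)
    from P.integral_fst'[OF this] show ?thesis by simp
  qed
  finally show ?thesis .
qed

text \<open>Conditioning on the first step: by induction the remaining horizon contributes
  \<open>g\<close> at the new state, and the one-step identity closes the recursion.\<close>

lemma integral_stopped_value:
  assumes g[measurable]: "g \<in> borel_measurable borel" and b: "\<And>y. norm (g y) \<le> B" "1 \<le> B"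
    and eq: "\<And>x. l < x \<Longrightarrow> g x = (\<integral>p. (if x * exp (k * fst p) < l \<or> x * exp (k * fst p) + snd p \<le> l
       then 1 else g (x * exp (k * fst p) + snd p)) \<partial>step)"
  shows "l < x \<Longrightarrow> (\<integral>w. stopped_value k l g n x w \<partial>S) = g x"
proof (induction n arbitrary: x)
  case 0
  then show ?case by (simp add: S.prob_space)
next
  case (Suc n)
  have "(\<integral>w. stopped_value k l g (Suc n) x w \<partial>S)
      = (\<integral>p. (\<integral>w. stopped_value k l g (Suc n) x (p ## w) \<partial>S) \<partial>step)"
    by (rule integral_stream_step[OF stopped_value_measurable'[OF g] stopped_value_bounded[OF b]])
  also have "\<dots> = (\<integral>p. (if x * exp (k * fst p) < l \<or> x * exp (k * fst p) + snd p \<le> l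
       then 1 else g (x * exp (k * fst p) + snd p)) \<partial>step)"
    using Suc.IH by (intro Bochner_Integration.integral_cong) (auto simp: S.prob_space)
  also have "\<dots> = g x" using eq[OF Suc.prems] by simp
  finally show ?case .
qed

section \<open>Discounted sums and the chain at infinity\<close>

lemma discount_measurable[measurable]:
  assumes [measurable]: "h \<in> borel_measurable step"
  shows "discount k h i \<in> borel_measurable S"
proof (induction i)
  case 0
  have [measurable]: "(\<lambda>w. h (shd w)) \<in> borel_measurable S"
    by (rule measurable_compose[OF measurable_shd]) measurable
  then show ?case by simp
next
  case (Suc i)
  have [measurable]: "(\<lambda>w. discount k h i (stl w)) \<in> borel_measurable S"
    by (rule measurable_compose[OF measurable_stl Suc])
  then show ?case by simp
qed

definition "rho = (\<integral>\<^sup>+p. ennreal (exp (- k * fst p)) \<partial>step)"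

lemma nn_integral_E_fst:
  assumes [measurable]: "f \<in> borel_measurable borel" "h \<in> borel_measurable borel"
  shows "(\<integral>\<^sup>+p. f (fst p) * h (snd p) \<partial>step) = (\<integral>\<^sup>+e. f e \<partial>E) * (\<integral>\<^sup>+v. h v \<partial>J)"
proof -
  interpret E: prob_space E by (rule prob_space_E)
  interpret P: pair_prob_space E J ..
  have "(\<integral>\<^sup>+p. f (fst p) * h (snd p) \<partial>step) = (\<integral>\<^sup>+e. \<integral>\<^sup>+v. f e * h v \<partial>J \<partial>E)"
    unfolding step_def by (subst J.nn_integral_fst[symmetric]) (auto simp: split_beta')
  also have "\<dots> = (\<integral>\<^sup>+e. f e * (\<integral>\<^sup>+v. h v \<partial>J) \<partial>E)"
    by (intro nn_integral_cong nn_integral_cmult) measurable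
  also have "\<dots> = (\<integral>\<^sup>+e. f e \<partial>E) * (\<integral>\<^sup>+v. h v \<partial>J)"
    by (rule nn_integral_multc) measurable
  finally show ?thesis .
qed

lemma AE_E_pos: "AE e in E. 0 < e"
proof -
  have "AE x::real in lborel. x \<noteq> 0" by (rule AE_lborel_singleton)
  then show ?thesis
    by (subst AE_density) (auto simp: exponential_density_def elim!: eventually_mono split: if_splits)
qed

text \<open>\<open>rho\<close> is the mean discount over one waiting time, in closed form
  \<open>rate / (rate + k)\<close>. Only the strict bound matters, and it holds because waiting
  times are positive almost surely.\<close>

lemma rho_less_1: "rho < 1"
proof -
  interpret E: prob_space E by (rule prob_space_E)
  have "rho = (\<integral>\<^sup>+e. ennreal (exp (- k * e)) \<partial>E) * (\<integral>\<^sup>+v. 1 \<partial>J)"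
    unfolding rho_def using nn_integral_E_fst[of "\<lambda>e. ennreal (exp (- k * e))" "\<lambda>_. 1"] by simp
  also have "\<dots> = (\<integral>\<^sup>+e. ennreal (exp (- k * e)) \<partial>E)" by (simp add: J.emeasure_space_1)
  also have "\<dots> < (\<integral>\<^sup>+e. 1 \<partial>E)"
  proof (rule nn_integral_less)
    show "(\<integral>\<^sup>+e. ennreal (exp (- k * e)) \<partial>E) \<noteq> \<infinity>"
    proof -
      have "(\<integral>\<^sup>+e. ennreal (exp (- k * e)) \<partial>E) \<le> (\<integral>\<^sup>+e. 1 \<partial>E)"
        using AE_E_pos k_pos by (intro nn_integral_mono_AE) (auto elim!: eventually_mono)
      also have "\<dots> = 1" using E.emeasure_space_1 by simp
      finally show ?thesis by (auto simp: top_unique)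
    qed
    show "AE x in E. ennreal (exp (- k * x)) \<le> 1"
      using AE_E_pos k_pos by (auto elim!: eventually_mono)
    show "\<not> (AE x in E. 1 \<le> ennreal (exp (- k * x)))"
    proof
      assume "AE x in E. 1 \<le> ennreal (exp (- k * x))"
      with AE_E_pos have "AE x in E. False"
        by eventually_elim (use k_pos in \<open>auto simp: mult_le_0_iff\<close>)
      then show False using E.AE_False by simp
    qed
  qed auto
  also have "\<dots> = 1" using E.emeasure_space_1 by simp
  finally show ?thesis .
qed

text \<open>Steps are independent, so each earlier waiting time contributes a factor
  \<open>rho\<close>: the terms decay geometrically in mean.\<close>

lemma nn_integral_discount:
  assumes [measurable]: "h \<in> borel_measurable step"
  shows "(\<integral>\<^sup>+w. ennreal \<bar>discount k h i w\<bar> \<partial>S) = rho ^ i * (\<integral>\<^sup>+p. ennreal (exp (- k * fst p) * \<bar>h p\<bar>) \<partial>step)"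
proof (induction i)
  case 0
  show ?case
    by (subst step.nn_integral_stream_space) (auto simp: S.emeasure_space_1 abs_mult)
next
  case (Suc i)
  have "(\<integral>\<^sup>+w. ennreal \<bar>discount k h (Suc i) w\<bar> \<partial>S)
     = (\<integral>\<^sup>+p. (\<integral>\<^sup>+w. ennreal (exp (- k * fst p)) * ennreal \<bar>discount k h i w\<bar> \<partial>S) \<partial>step)"
    by (subst step.nn_integral_stream_space)
      (auto simp: abs_mult ennreal_mult simp del: discount.simps(1))
  also have "\<dots> = (\<integral>\<^sup>+p. ennreal (exp (- k * fst p)) * (\<integral>\<^sup>+w. ennreal \<bar>discount k h i w\<bar> \<partial>S) \<partial>step)"
    by (intro nn_integral_cong nn_integral_cmult) auto
  also have "\<dots> = rho * (\<integral>\<^sup>+w. ennreal \<bar>discount k h i w\<bar> \<partial>S)"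
    unfolding rho_def by (rule nn_integral_multc) auto
  finally show ?case using Suc by (simp add: mult.assoc)
qed

lemma AE_discount_summable:
  assumes [measurable]: "h \<in> borel_measurable step"
    and fin: "(\<integral>\<^sup>+p. ennreal (exp (- k * fst p) * \<bar>h p\<bar>) \<partial>step) < \<infinity>"
  shows "AE w in S. summable (\<lambda>i. discount k h i w)"
proof -
  let ?m = "\<integral>\<^sup>+p. ennreal (exp (- k * fst p) * \<bar>h p\<bar>) \<partial>step"
  obtain r where r: "rho = ennreal r" "0 \<le> r" "r < 1"
    using rho_less_1 by (cases rho) (auto simp: ennreal_less_one_iff)
  obtain m where m: "?m = ennreal m" "0 \<le> m" using fin by (cases ?m) auto
  have "(\<integral>\<^sup>+w. (\<Sum>i. ennreal \<bar>discount k h i w\<bar>) \<partial>S) = (\<Sum>i. rho ^ i * ?m)"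
    by (subst nn_integral_suminf) (auto simp: nn_integral_discount)
  also have "\<dots> = (\<Sum>i. ennreal (r ^ i * m))"
    using r m by (simp add: ennreal_mult ennreal_power)
  also have "\<dots> = ennreal (\<Sum>i. r ^ i * m)"
    using r m by (intro suminf_ennreal2 summable_mult2 summable_geometric) auto
  also have "\<dots> < \<infinity>" by simp
  finally have "AE w in S. (\<Sum>i. ennreal \<bar>discount k h i w\<bar>) \<noteq> \<infinity>"
    by (intro nn_integral_PInf_AE) auto
  then show ?thesis
  proof eventually_elim
    case (elim w)
    then have "summable (\<lambda>i. \<bar>discount k h i w\<bar>)" by (intro summable_suminf_not_top) auto
    then show ?case by (rule summable_rabs_cancel)
  qed
qed

lemma snd_discount_finite: "(\<integral>\<^sup>+p. ennreal (exp (- k * fst p) * \<bar>snd p\<bar>) \<partial>step) < \<infinity>"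
proof -
  have "(\<integral>\<^sup>+p. ennreal (exp (- k * fst p) * \<bar>snd p\<bar>) \<partial>step) =
      (\<integral>\<^sup>+e. ennreal (exp (- k * e)) \<partial>E) * (\<integral>\<^sup>+v. ennreal \<bar>v\<bar> \<partial>J)"
    by (subst nn_integral_E_fst[symmetric]) (auto simp: ennreal_mult)
  also have "(\<integral>\<^sup>+e. ennreal (exp (- k * e)) \<partial>E) = rho"
    unfolding rho_def using nn_integral_E_fst[of "\<lambda>e. ennreal (exp (- k * e))" "\<lambda>_. 1"]
    by (simp add: J.emeasure_space_1)
  finally show ?thesis using rho_less_1 J_mean by (auto simp: ennreal_mult_less_top less_top)
      (metis ennreal_one_less_top order.strict_trans)
qed

lemma one_discount_finite: "(\<integral>\<^sup>+p. ennreal (exp (- k * fst p) * \<bar>1\<bar>) \<partial>step) < \<infinity>"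
  using rho_less_1 unfolding rho_def by (auto simp: less_top) (metis ennreal_one_less_top order.strict_trans)

text \<open>Conditionally on everything but the first jump, the sum is an affine function of an atomless variable.\<close>
lemma AE_discount_sum_neq: "AE w in S. (\<Sum>i. discount k snd i w) \<noteq> c"
proof -
  interpret E: prob_space E by (rule prob_space_E)
  interpret P: pair_prob_space step S ..
  interpret PEJ: pair_prob_space E J ..
  have [measurable]: "snd \<in> borel_measurable step" "fst \<in> borel_measurable step" by measurable
  have sm[measurable]: "(\<lambda>w. \<Sum>i. discount k snd i w) \<in> borel_measurable S" by measurable
  have *: "AE p in step. exp (- k * fst p) * (snd p + b) \<noteq> c" for b
  proof -
    have "AE e in E. AE v in J. exp (- k * e) * (v + b) \<noteq> c"
    proof (rule AE_I2)
      fix e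
      show "AE v in J. exp (- k * e) * (v + b) \<noteq> c"
        using J_atomless[of "c * exp (k * e) - b"]
        by eventually_elim (auto simp: exp_minus field_simps)
    qed
    moreover have "Measurable.pred (E \<Otimes>\<^sub>M J) (\<lambda>p. exp (- k * fst p) * (snd p + b) \<noteq> c)" by measurable
    ultimately show ?thesis unfolding step_def
      by (intro PEJ.AE_pair_measure) (auto simp: pred_def)
  qed
  have "AE p in step. AE w in S. exp (- k * fst p) * (snd p + (\<Sum>i. discount k snd i w)) \<noteq> c"
    by (subst P.AE_commute) (use * in auto)
  then have "AE p in step. AE w in S. (\<Sum>i. discount k snd i (p ## w)) \<noteq> c"
  proof eventually_elim
    case (elim p)
    have "AE w in S. summable (\<lambda>i. discount k snd i w)"
      by (rule AE_discount_summable[OF _ snd_discount_finite]) measurable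
    with elim show ?case
    proof eventually_elim
      case (elim w)
      have eq: "discount k snd (Suc i) (p ## w) = exp (- k * fst p) * discount k snd i w" for i by simp
      have "summable (\<lambda>i. discount k snd i (p ## w))"
        using elim(2) unfolding summable_Suc_iff[of "\<lambda>i. discount k snd i (p ## w)", symmetric] eq
        by (rule summable_mult)
      then have "(\<Sum>i. discount k snd i (p ## w)) = discount k snd 0 (p ## w) + (\<Sum>i. discount k snd (Suc i) (p ## w))"
        by (subst suminf_split_head) auto
      also have "\<dots> = exp (- k * fst p) * (snd p + (\<Sum>i. discount k snd i w))"
        unfolding eq using suminf_mult[OF elim(2), of "exp (- k * fst p)"] by (simp add: algebra_simps)
      finally show ?case using elim(1) by simp
    qed
  qed
  then show ?thesis by (subst step.AE_stream_space) auto
qed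

text \<open>By \<open>chain_state_discount\<close> the state is a sum with an almost surely nonzero
  limit \<open>z\<close>, divided by a discount that tends to 0. The sign of \<open>z\<close>
  decides between plus and minus infinity, and a chain that stays above \<open>l\<close> cannot tend
  to minus infinity.\<close>

lemma AE_chain_state_at_top:
  assumes "l < x"
  shows "AE w in S. (\<forall>n. \<not> hit k l n x w) \<longrightarrow> filterlim (\<lambda>n. chain_state k n x w) at_top sequentially"
proof -
  have [measurable]: "snd \<in> borel_measurable step" by measurable
  have "AE w in S. summable (\<lambda>i. discount k (\<lambda>_. 1) i w)"
    using one_discount_finite by (intro AE_discount_summable) auto
  moreover have "AE w in S. summable (\<lambda>i. discount k snd i w)"
    by (rule AE_discount_summable[OF _ snd_discount_finite]) measurable
  ultimately show ?thesis using AE_discount_sum_neq[of "- x"]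
  proof eventually_elim
    case (elim w)
    let ?d = "\<lambda>n. discount k (\<lambda>_. 1) n w" and ?Z = "\<lambda>n. x + (\<Sum>i\<le>n. discount k snd i w)"
    have d0: "?d \<longlonglongrightarrow> 0" by (rule summable_LIMSEQ_zero[OF elim(1)])
    then have di: "filterlim (\<lambda>n. inverse (?d n)) at_top sequentially"
      using discount_one_pos by (intro filterlim_inverse_at_top) auto
    define z where "z = x + (\<Sum>i. discount k snd i w)"
    have Z: "?Z \<longlonglongrightarrow> z" unfolding z_def
      using summable_LIMSEQ'[OF elim(2)] by (intro tendsto_intros)
    have z0: "z \<noteq> 0" using elim(3) by (auto simp: z_def)
    have st: "chain_state k (Suc n) x w = ?Z n * inverse (?d n)" for n
      using chain_state_discount[of k n x w] discount_one_pos[of k n w] by (simp add: field_simps)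
    show ?case
    proof
      assume nh: "\<forall>n. \<not> hit k l n x w"
      show "filterlim (\<lambda>n. chain_state k n x w) at_top sequentially"
      proof (cases "0 < z")
        case True
        have "filterlim (\<lambda>n. ?Z n * inverse (?d n)) at_top sequentially"
          by (rule filterlim_tendsto_pos_mult_at_top[OF Z True di])
        then show ?thesis unfolding st[symmetric] by (rule filterlim_sequentially_Suc[THEN iffD1])
      next
        case False
        then have "z < 0" using z0 by simp
        have "filterlim (\<lambda>n. ?Z n * inverse (?d n)) at_bot sequentially"
          by (rule filterlim_tendsto_neg_mult_at_bot[OF Z \<open>z < 0\<close> di])
        then have "eventually (\<lambda>n. chain_state k (Suc n) x w \<le> l) sequentially"
          unfolding st[symmetric] by (simp add: filterlim_at_bot)
        then obtain n where "chain_state k (Suc n) x w \<le> l" by (auto simp: eventually_sequentially)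
        moreover have "l < chain_state k (Suc n) x w"
          using chain_state_gt[of k l "Suc n" x w] nh assms by blast
        ultimately show ?thesis by simp
      qed
    qed
  qed
qed

text \<open>The stopped value has constant mean \<open>g x\<close> and converges to the indicator of
  passage: after a hit it is frozen at 1, otherwise it is \<open>g\<close> at a state tending to
  infinity. Dominated convergence identifies the limit of the means.\<close>

theorem hit_prob:
  assumes g[measurable]: "g \<in> borel_measurable borel" and b: "\<And>y. norm (g y) \<le> B"
    and g0: "(g \<longlongrightarrow> 0) at_top"
    and eq: "\<And>x. l < x \<Longrightarrow> g x = (\<integral>p. (if x * exp (k * fst p) < l \<or> x * exp (k * fst p) + snd p \<le> l
       then 1 else g (x * exp (k * fst p) + snd p)) \<partial>step)"
    and x: "l < x"
  shows "complex_of_real (measure S {w. \<exists>n. hit k l n x w}) = g x"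
proof -
  let ?B = "max 1 B"
  have b': "norm (g y) \<le> ?B" for y using b[of y] by simp
  let ?H = "{w. \<exists>n. hit k l n x w}"
  have H: "?H \<in> sets S" using predE[where M=S and P="\<lambda>w. \<exists>n. hit k l n x w"] by simp
  have "(\<lambda>n. \<integral>w. stopped_value k l g n x w \<partial>S) \<longlonglongrightarrow> (\<integral>w. indicator ?H w \<partial>S)"
  proof (rule integral_dominated_convergence[where w="\<lambda>_. ?B"])
    show "AE w in S. (\<lambda>n. stopped_value k l g n x w) \<longlonglongrightarrow> indicator ?H w"
      using AE_chain_state_at_top[OF x]
    proof eventually_elim
      case (elim w)
      show ?case
      proof (cases "\<exists>n. hit k l n x w")
        case True
        then obtain n where n: "hit k l n x w" by blast
        have "eventually (\<lambda>m. stopped_value k l g m x w = 1) sequentially"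
          using stopped_value_hit[OF n] by (auto simp: eventually_sequentially)
        then show ?thesis using True by (simp add: tendsto_eventually)
      next
        case False
        then have "(\<lambda>n. g (chain_state k n x w)) \<longlonglongrightarrow> 0"
          using elim by (intro filterlim_compose[OF g0]) auto
        then show ?thesis using False by (simp add: stopped_value_not_hit)
      qed
    qed
    show "stopped_value k l g n x \<in> borel_measurable S" for n
      by (rule stopped_value_measurable'[OF g])
    show "AE w in S. norm (stopped_value k l g n x w) \<le> ?B" for n
      using stopped_value_bounded[OF b'] by auto
  qed (use H in auto)
  moreover have "(\<integral>w. stopped_value k l g n x w \<partial>S) = g x" for n
    by (rule integral_stopped_value[OF g b' _ eq x]) auto
  moreover have "(\<integral>w. indicator ?H w \<partial>S) = complex_of_real (measure S ?H)"
  proof -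
    have "(\<lambda>w. indicator ?H w) = (\<lambda>w. complex_of_real (indicator ?H w))"
      by (auto simp: indicator_def fun_eq_iff)
    then show ?thesis using H by simp
  qed
  ultimately show ?thesis by (simp add: LIMSEQ_const_iff)
qed

end

section \<open>From the process to the chain\<close>

text \<open>For rectangles three product formulas combine: within \<open>E\<close>, within
  \<open>V\<close>, and across the two algebras. Rectangles form an intersection-stable generator of
  the sigma-algebra of each pair.\<close>

lemma (in prob_space) indep_pairs:
  fixes E V :: "nat \<Rightarrow> 'a \<Rightarrow> real"
  assumes ind: "indep_set (sets A) (sets B)" and sp: "space A = space M" "space B = space M"
    and EA: "\<And>i. E i \<in> borel_measurable A" and VB: "\<And>i. V i \<in> borel_measurable B"
    and E: "indep_vars (\<lambda>_. borel) E UNIV" and V: "indep_vars (\<lambda>_. borel) V UNIV"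
  shows "indep_vars (\<lambda>_. borel \<Otimes>\<^sub>M borel) (\<lambda>i \<omega>. (E i \<omega>, V i \<omega>)) UNIV"
    and "distr M (borel \<Otimes>\<^sub>M borel) (\<lambda>\<omega>. (E i \<omega>, V i \<omega>)) = distr M borel (E i) \<Otimes>\<^sub>M distr M borel (V i)"
proof -
  have [measurable]: "E i \<in> borel_measurable M" "V i \<in> borel_measurable M" for i
    using E V by (auto simp: indep_vars_def2)
  have prod: "prob (a \<inter> b) = prob a * prob b" if "a \<in> sets A" "b \<in> sets B" for a b
    using indep_setD[OF ind that] .
  have Es: "E i -` C \<inter> space M \<in> sets A" if "C \<in> sets borel" for i C
    using measurable_sets[OF EA that] sp by simp
  have Vs: "V i -` C \<inter> space M \<in> sets B" if "C \<in> sets borel" for i C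
    using measurable_sets[OF VB that] sp by simp
  define F where "F i = {E i -` C \<inter> V i -` D \<inter> space M | C D. C \<in> sets borel \<and> D \<in> sets borel}" for i
  have "indep_sets F UNIV"
  proof (rule indep_setsI)
    fix i
    have "(\<lambda>\<omega>. (E i \<omega>, V i \<omega>)) -` (C \<times> D) \<inter> space M \<in> events" if "C \<in> sets borel" "D \<in> sets borel" for C D
      using that by (intro measurable_sets[of _ M "borel \<Otimes>\<^sub>M borel"] pair_measureI) auto
    moreover have "(\<lambda>\<omega>. (E i \<omega>, V i \<omega>)) -` (C \<times> D) = E i -` C \<inter> V i -` D" for C D by auto
    ultimately show "F i \<subseteq> events" by (auto simp: F_def)
  next
    fix G and J :: "nat set" assume J: "J \<noteq> {}" "J \<subseteq> UNIV" "finite J" "\<forall>j\<in>J. G j \<in> F j"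
    then obtain C D where CD: "\<And>j. j \<in> J \<Longrightarrow> C j \<in> sets borel" "\<And>j. j \<in> J \<Longrightarrow> D j \<in> sets borel"
      "\<And>j. j \<in> J \<Longrightarrow> G j = E j -` C j \<inter> V j -` D j \<inter> space M"
      unfolding F_def by (simp add: bchoice_iff) metis
    have GJ: "prob (G j) = prob (E j -` C j \<inter> space M) * prob (V j -` D j \<inter> space M)" if "j \<in> J" for j
    proof -
      have "G j = (E j -` C j \<inter> space M) \<inter> (V j -` D j \<inter> space M)" using CD(3)[OF that] by auto
      then show ?thesis using prod[OF Es Vs] CD that by metis
    qed
    have "(\<Inter>j\<in>J. G j) = (\<Inter>j\<in>J. E j -` C j \<inter> space M) \<inter> (\<Inter>j\<in>J. V j -` D j \<inter> space M)"
      using CD(3) J(1) by auto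
    also have "prob \<dots> = prob (\<Inter>j\<in>J. E j -` C j \<inter> space M) * prob (\<Inter>j\<in>J. V j -` D j \<inter> space M)"
      using J CD Es Vs by (intro prod sets.finite_INT) auto
    also have "prob (\<Inter>j\<in>J. E j -` C j \<inter> space M) = (\<Prod>j\<in>J. prob (E j -` C j \<inter> space M))"
      by (rule indep_varsD[OF E J(1,3,2) CD(1)])
    also have "prob (\<Inter>j\<in>J. V j -` D j \<inter> space M) = (\<Prod>j\<in>J. prob (V j -` D j \<inter> space M))"
      by (rule indep_varsD[OF V J(1,3,2) CD(2)])
    finally show "prob (\<Inter>j\<in>J. G j) = (\<Prod>j\<in>J. prob (G j))"
      by (simp add: GJ prod.distrib)
  qed
  then have "indep_sets (\<lambda>i. sigma_sets (space M) (F i)) UNIV"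
  proof (rule indep_sets_sigma)
    fix i show "Int_stable (F i)"
    proof (rule Int_stableI)
      fix a b assume "a \<in> F i" "b \<in> F i"
      then obtain C D C' D' where *: "C \<in> sets borel" "D \<in> sets borel" "C' \<in> sets borel" "D' \<in> sets borel"
        "a = E i -` C \<inter> V i -` D \<inter> space M" "b = E i -` C' \<inter> V i -` D' \<inter> space M"
        unfolding F_def by blast
      then have "a \<inter> b = E i -` (C \<inter> C') \<inter> V i -` (D \<inter> D') \<inter> space M" by auto
      with * show "a \<inter> b \<in> F i" unfolding F_def by blast
    qed
  qed
  moreover have "sigma_sets (space M) (F i) =
      {(\<lambda>\<omega>. (E i \<omega>, V i \<omega>)) -` C \<inter> space M | C. C \<in> sets (borel \<Otimes>\<^sub>M borel)}" for i
  proof -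
    have "F i = {(\<lambda>\<omega>. (E i \<omega>, V i \<omega>)) -` C \<inter> space M | C. C \<in> {a \<times> b | a b. a \<in> sets borel \<and> b \<in> sets borel}}"
    proof -
      have "(\<lambda>\<omega>. (E i \<omega>, V i \<omega>)) -` (C \<times> D) = E i -` C \<inter> V i -` D" for C D by auto
      then show ?thesis unfolding F_def by (smt (verit) Collect_cong mem_Collect_eq)
    qed
    then show ?thesis
      unfolding sets_pair_measure by (subst sigma_sets_vimage_commute) auto
  qed
  ultimately show "indep_vars (\<lambda>_. borel \<Otimes>\<^sub>M borel) (\<lambda>i \<omega>. (E i \<omega>, V i \<omega>)) UNIV"
    by (simp add: indep_vars_def2)
  interpret DE: prob_space "distr M borel (E i)" by (rule prob_space_distr) simp
  interpret DV: prob_space "distr M borel (V i)" by (rule prob_space_distr) simp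
  show "distr M (borel \<Otimes>\<^sub>M borel) (\<lambda>\<omega>. (E i \<omega>, V i \<omega>)) = distr M borel (E i) \<Otimes>\<^sub>M distr M borel (V i)"
  proof (rule pair_measure_eqI[symmetric])
    fix C D assume "C \<in> sets (distr M borel (E i))" "D \<in> sets (distr M borel (V i))"
    then have CD: "C \<in> sets borel" "D \<in> sets borel" by auto
    have "emeasure (distr M (borel \<Otimes>\<^sub>M borel) (\<lambda>\<omega>. (E i \<omega>, V i \<omega>))) (C \<times> D)
        = emeasure M ((E i -` C \<inter> space M) \<inter> (V i -` D \<inter> space M))"
      using CD by (subst emeasure_distr) (auto intro!: arg_cong[where f="emeasure M"])
    then show "emeasure (distr M borel (E i)) C * emeasure (distr M borel (V i)) D =
        emeasure (distr M (borel \<Otimes>\<^sub>M borel) (\<lambda>\<omega>. (E i \<omega>, V i \<omega>))) (C \<times> D)"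
      using CD prod[OF Es Vs, OF CD]
      by (simp add: emeasure_distr emeasure_eq_measure ennreal_mult[symmetric])
  qed (auto intro!: sets_pair_measure_cong DE.sigma_finite_measure_axioms DV.sigma_finite_measure_axioms)
qed

section \<open>Tails and mean of the jump law\<close>

lemma nn_integral_exp_abs_finite:
  assumes "0 < c"
  shows "(\<integral>\<^sup>+u. ennreal (exp (- c * \<bar>u\<bar>)) \<partial>lborel) < \<infinity>"
proof -
  let ?d = "exponential_density c"
  have one: "(\<integral>\<^sup>+u. ennreal (?d u) \<partial>lborel) = 1"
    using prob_space.emeasure_space_1[OF prob_space_exponential_density[OF assms]]
    by (simp add: emeasure_density)
  have "(\<integral>\<^sup>+u. ennreal (?d (- u)) \<partial>lborel) = 1"
    using nn_integral_real_affine[of "\<lambda>u. ennreal (?d u)" "- 1" 0] one by simp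
  have "(\<integral>\<^sup>+u. ennreal (exp (- c * \<bar>u\<bar>)) \<partial>lborel) \<le>
      (\<integral>\<^sup>+u. ennreal (1 / c) * (ennreal (?d u) + ennreal (?d (- u))) \<partial>lborel)"
  proof (rule nn_integral_mono)
    fix u :: real
    have "exp (- c * \<bar>u\<bar>) \<le> 1 / c * (?d u + ?d (- u))"
      using assms by (auto simp: exponential_density_def field_simps)
    also have "ennreal \<dots> = ennreal (1 / c) * (ennreal (?d u) + ennreal (?d (- u)))"
      using assms exponential_density_nonneg[OF assms]
      by (subst ennreal_plus[symmetric], simp, simp, subst ennreal_mult[symmetric]) auto
    finally show "ennreal (exp (- c * \<bar>u\<bar>)) \<le> ennreal (1 / c) * (ennreal (?d u) + ennreal (?d (- u)))"
      by (simp add: ennreal_leI)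
  qed
  also have "\<dots> = ennreal (1 / c) * (1 + 1)"
    using one \<open>(\<integral>\<^sup>+u. ennreal (?d (- u)) \<partial>lborel) = 1\<close>
    by (subst nn_integral_cmult, measurable, subst nn_integral_add) auto
  also have "\<dots> < \<infinity>" by (simp add: ennreal_mult_less_top)
  finally show ?thesis .
qed

lemma mu_pos: "admissible Q \<Longrightarrow> i \<in> {1..r_neg Q} \<Longrightarrow> mu Q 1 \<le> mu Q i \<and> 0 < mu Q i"
  using strict_mono_on_leD[of "{1..r_neg Q}" "mu Q" 1 i] by (auto simp: admissible_def)

lemma nu_pos: "admissible Q \<Longrightarrow> i \<in> {1..s_pos Q} \<Longrightarrow> nu Q 1 \<le> nu Q i \<and> 0 < nu Q i"
  using strict_mono_on_leD[of "{1..s_pos Q}" "nu Q" 1 i] by (auto simp: admissible_def)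

definition dens :: "params \<Rightarrow> real \<Rightarrow> real" where
  "dens Q u = p_neg Q * dens_neg Q u + q_pos Q * dens_pos Q u"

lemma dens_nonneg: "admissible Q \<Longrightarrow> 0 \<le> dens Q u"
  by (auto simp: dens_def admissible_def)

lemma dens_measurable[measurable]: "dens Q \<in> borel_measurable borel"
  unfolding dens_def[abs_def] dens_neg_def dens_pos_def by measurable

lemma jump_law_dens: "jump_law Q = density lborel (\<lambda>u. ennreal (dens Q u))"
  by (simp add: jump_law_def dens_def)

text \<open>Single weights may be negative, so the constant uses their absolute values. The rate is
  the slower decay of the two sides, the minimum of \<open>mu 1\<close> and
  \<open>nu 1\<close>.\<close>

lemma dens_bound:
  assumes Q: "admissible Q"
  obtains c C where "0 < c" "0 \<le> C" "\<And>u. dens Q u \<le> C * exp (- c * \<bar>u\<bar>)"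
proof -
  define c where "c = min (mu Q 1) (nu Q 1)"
  have c: "0 < c" using Q by (auto simp: c_def admissible_def)
  define A where "A = (\<Sum>k=1..r_neg Q. \<bar>alpha Q k\<bar> * mu Q k)"
  define B where "B = (\<Sum>d=1..s_pos Q. \<bar>beta Q d\<bar> * nu Q d)"
  have A: "0 \<le> A" unfolding A_def using mu_pos[OF Q] by (intro sum_nonneg mult_nonneg_nonneg) (auto intro: less_imp_le)
  have B: "0 \<le> B" unfolding B_def using nu_pos[OF Q] by (intro sum_nonneg mult_nonneg_nonneg) (auto intro: less_imp_le)
  have neg: "dens_neg Q u \<le> A * exp (- c * \<bar>u\<bar>)" for u
  proof (cases "u < 0")
    case True
    have "dens_neg Q u = (\<Sum>k=1..r_neg Q. alpha Q k * mu Q k * exp (mu Q k * u))" using True by (simp add: dens_neg_def)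
    also have "\<dots> \<le> (\<Sum>k=1..r_neg Q. \<bar>alpha Q k\<bar> * mu Q k * exp (- c * \<bar>u\<bar>))"
    proof (rule sum_mono)
      fix i assume i: "i \<in> {1..r_neg Q}"
      have "c \<le> mu Q i" using mu_pos[OF Q i] by (auto simp: c_def)
      then have "mu Q i * u \<le> - c * \<bar>u\<bar>" using True mult_right_mono_neg[of c "mu Q i" u] by simp
      then show "alpha Q i * mu Q i * exp (mu Q i * u) \<le> \<bar>alpha Q i\<bar> * mu Q i * exp (- c * \<bar>u\<bar>)"
        using mu_pos[OF Q i] by (intro mult_mono mult_right_mono) auto
    qed
    finally show ?thesis by (simp add: A_def sum_distrib_right)
  qed (use A in \<open>simp add: dens_neg_def\<close>)
  have pos: "dens_pos Q u \<le> B * exp (- c * \<bar>u\<bar>)" for u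
  proof (cases "u > 0")
    case True
    have "dens_pos Q u = (\<Sum>k=1..s_pos Q. beta Q k * nu Q k * exp (- nu Q k * u))" using True by (simp add: dens_pos_def)
    also have "\<dots> \<le> (\<Sum>k=1..s_pos Q. \<bar>beta Q k\<bar> * nu Q k * exp (- c * \<bar>u\<bar>))"
    proof (rule sum_mono)
      fix i assume i: "i \<in> {1..s_pos Q}"
      have "c \<le> nu Q i" using nu_pos[OF Q i] by (auto simp: c_def)
      then have "- nu Q i * u \<le> - c * \<bar>u\<bar>" using True mult_right_mono[of c "nu Q i" u] by simp
      then show "beta Q i * nu Q i * exp (- nu Q i * u) \<le> \<bar>beta Q i\<bar> * nu Q i * exp (- c * \<bar>u\<bar>)"
        using nu_pos[OF Q i] by (intro mult_mono mult_right_mono) auto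
    qed
    finally show ?thesis by (simp add: B_def sum_distrib_right)
  qed (use B in \<open>simp add: dens_pos_def\<close>)
  have "dens Q u \<le> (p_neg Q * A + q_pos Q * B) * exp (- c * \<bar>u\<bar>)" for u
  proof -
    have "p_neg Q * dens_neg Q u + q_pos Q * dens_pos Q u \<le>
        p_neg Q * (A * exp (- c * \<bar>u\<bar>)) + q_pos Q * (B * exp (- c * \<bar>u\<bar>))"
      using Q neg pos by (intro add_mono mult_left_mono) (auto simp: admissible_def)
    then show ?thesis by (simp add: dens_def algebra_simps)
  qed
  moreover have "0 \<le> p_neg Q * A + q_pos Q * B" using A B Q by (auto simp: admissible_def)
  ultimately show ?thesis using c that by blast
qed

lemma jump_law_mean_finite:
  assumes Q: "admissible Q"
  shows "(\<integral>\<^sup>+v. ennreal \<bar>v\<bar> \<partial>jump_law Q) < \<infinity>"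
proof -
  obtain c C where c: "0 < c" "0 \<le> C" "\<And>u. dens Q u \<le> C * exp (- c * \<bar>u\<bar>)"
    using dens_bound[OF Q] by metis
  have "(\<integral>\<^sup>+v. ennreal \<bar>v\<bar> \<partial>jump_law Q) = (\<integral>\<^sup>+v. ennreal (dens Q v) * ennreal \<bar>v\<bar> \<partial>lborel)"
    unfolding jump_law_dens by (subst nn_integral_density) auto
  also have "\<dots> \<le> (\<integral>\<^sup>+v. ennreal (2 * C / c) * ennreal (exp (- (c / 2) * \<bar>v\<bar>)) \<partial>lborel)"
  proof (rule nn_integral_mono)
    fix v :: real
    \<comment> \<open>Half of the exponential decay is spent on the factor
      \<open>|v|\<close>.\<close>
    have "c / 2 * \<bar>v\<bar> \<le> exp (c / 2 * \<bar>v\<bar>)" using exp_ge_add_one_self[of "c / 2 * \<bar>v\<bar>"] by linarith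
    then have "\<bar>v\<bar> \<le> 2 / c * exp (c / 2 * \<bar>v\<bar>)" using c by (simp add: field_simps)
    then have "dens Q v * \<bar>v\<bar> \<le> (C * exp (- c * \<bar>v\<bar>)) * (2 / c * exp (c / 2 * \<bar>v\<bar>))"
      using c dens_nonneg[OF Q] by (intro mult_mono) auto
    also have "\<dots> = 2 * C / c * exp (- (c / 2) * \<bar>v\<bar>)"
      by (simp flip: exp_add)
    finally show "ennreal (dens Q v) * ennreal \<bar>v\<bar> \<le> ennreal (2 * C / c) * ennreal (exp (- (c / 2) * \<bar>v\<bar>))"
      using c dens_nonneg[OF Q, of v] by (simp add: ennreal_mult[symmetric] ennreal_leI)
  qed
  also have "\<dots> = ennreal (2 * C / c) * (\<integral>\<^sup>+v. ennreal (exp (- (c / 2) * \<bar>v\<bar>)) \<partial>lborel)"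
    by (rule nn_integral_cmult) measurable
  also have "\<dots> < \<infinity>"
    using nn_integral_exp_abs_finite[of "c / 2"] c by (simp add: ennreal_mult_less_top)
  finally show ?thesis .
qed

lemma jump_chain_jump_law:
  assumes "admissible Q" "kappa Q > 0" "prob_space (jump_law Q)"
  shows "jump_chain (jump_law Q) (kappa Q) (lam Q)"
proof -
  interpret prob_space "jump_law Q" by fact
  show ?thesis
  proof
    show "AE v in jump_law Q. v \<noteq> c" for c
      unfolding jump_law_dens using AE_lborel_singleton[of c]
      by (subst AE_density) (auto elim: eventually_mono)
  qed (use assms jump_law_mean_finite[OF assms(1)] in \<open>auto simp: jump_law_def admissible_def\<close>)
qed

section \<open>Paths of the process between its jumps and at them\<close>

lemma chain_state_Suc:
  "chain_state k (Suc n) x w = chain_state k n x w * exp (k * fst (w !! n)) + snd (w !! n)"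
  by (induction n arbitrary: x w) auto

lemma hit_iff:
  "hit k l n x w \<longleftrightarrow> (\<exists>i<n. chain_state k i x w * exp (k * fst (w !! i)) < l \<or> chain_state k (Suc i) x w \<le> l)"
proof (induction n arbitrary: x w)
  case (Suc n)
  show ?case
    unfolding hit.simps Suc by (auto simp: less_Suc_eq_0_disj)
qed simp

locale ou = prob_space M for M :: "'a measure" +
  fixes Q :: params and N :: "real \<Rightarrow> 'a \<Rightarrow> nat" and V :: "nat \<Rightarrow> 'a \<Rightarrow> real"
    and X :: "real \<Rightarrow> 'a \<Rightarrow> real" and x l :: real
  assumes ou: "ou_process Q M N V X x" and Q: "admissible Q" and kappa: "0 < kappa Q"

sublocale ou \<subseteq> poisson_proc M "lam Q" N
proof
  show "0 < lam Q" using Q by (simp add: admissible_def)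
  show "poisson_process M (lam Q) N" using ou by (simp add: ou_process_def)
qed

context ou
begin

abbreviation "U \<equiv> compound_sum N V"

lemma X_measurable: "0 \<le> t \<Longrightarrow> X t \<in> borel_measurable M"
  using ou by (simp add: ou_process_def)

lemma V_indep: "indep_vars (\<lambda>_. borel) V {1..}"
  using ou by (simp add: ou_process_def)

lemma X_eq:
  assumes "\<omega> \<in> space M" "0 \<le> t"
  shows "(\<lambda>s. X s \<omega>) integrable_on {0..t}" "X t \<omega> = X 0 \<omega> + kappa Q * integral {0..t} (\<lambda>s. X s \<omega>) + U t \<omega>"
proof -
  have "\<forall>\<omega>\<in>space M. \<forall>t\<ge>0. (\<lambda>s. X s \<omega>) integrable_on {0..t} \<and>
        X t \<omega> = X 0 \<omega> + kappa Q * integral {0..t} (\<lambda>s. X s \<omega>) + U t \<omega>"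
    using ou unfolding ou_process_def by (elim conjE)
  then show "(\<lambda>s. X s \<omega>) integrable_on {0..t}"
    "X t \<omega> = X 0 \<omega> + kappa Q * integral {0..t} (\<lambda>s. X s \<omega>) + U t \<omega>"
    using assms by blast+
qed

text \<open>The count is constant on \<open>[a, b)\<close> but may change at \<open>b\<close>, so
  the formula covers one holding interval together with the jump that ends it.\<close>

lemma X_flow:
  assumes \<omega>: "\<omega> \<in> space M" and ab: "0 \<le> a" "a \<le> b" and const: "\<And>s. a \<le> s \<Longrightarrow> s < b \<Longrightarrow> N s \<omega> = N a \<omega>"
  shows "X b \<omega> = exp (kappa Q * (b - a)) * X a \<omega> + (U b \<omega> - U a \<omega>)"
proof -
  let ?X = "\<lambda>s. X s \<omega>" and ?k = "kappa Q"
  \<comment> \<open>The path without its jump at \<open>b\<close>. It agrees with \<open>X\<close>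
    on \<open>[a, b)\<close>, so it satisfies the integral equation with itself under the integral;
    being continuous, it can then be differentiated.\<close>
  define \<phi> where "\<phi> s = X a \<omega> + ?k * integral {a..s} ?X" for s
  have int: "?X integrable_on {a..b}"
    using X_eq(1)[OF \<omega>, of b] ab by (auto intro: integrable_on_subinterval)
  have split: "integral {0..s} ?X = integral {0..a} ?X + integral {a..s} ?X" if "a \<le> s" "s \<le> b" for s
    using that ab X_eq(1)[OF \<omega>, of s] by (intro Henstock_Kurzweil_Integration.integral_combine[symmetric]) auto
  have Xs: "X s \<omega> = \<phi> s + (U s \<omega> - U a \<omega>)" if "a \<le> s" "s \<le> b" for s
    using X_eq(2)[OF \<omega>, of s] X_eq(2)[OF \<omega>, of a] split[OF that] that ab
    by (simp add: \<phi>_def algebra_simps)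
  have Xphi: "X s \<omega> = \<phi> s" if "a \<le> s" "s < b" for s
  proof -
    have "U s \<omega> = U a \<omega>" using const[OF that] by (simp add: compound_sum_def)
    then show ?thesis using Xs[of s] that by simp
  qed
  have cont: "continuous_on {a..b} \<phi>"
    unfolding \<phi>_def by (intro continuous_intros indefinite_integral_continuous_1 int)
  have "integral {a..s} ?X = integral {a..s} \<phi>" if "s \<in> {a..b}" for s
    using Xphi that by (intro integral_spike[of "{b}"]) auto
  then have phi: "\<phi> s = X a \<omega> + ?k * integral {a..s} \<phi>" if "s \<in> {a..b}" for s
    using that by (simp add: \<phi>_def)
  have der: "(\<phi> has_real_derivative ?k * \<phi> s) (at s within {a..b})" if s: "s \<in> {a..b}" for s
  proof (rule has_field_derivative_transform_within[OF _ zero_less_one s])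
    show "((\<lambda>s. X a \<omega> + ?k * integral {a..s} \<phi>) has_real_derivative ?k * \<phi> s) (at s within {a..b})"
      by (rule derivative_eq_intros integral_has_real_derivative[OF cont s] refl)+ simp
  qed (use phi in auto)
  \<comment> \<open>Integrating factor: the product of \<open>exp (- k * s)\<close> with the
    solution has derivative 0.\<close>
  have "exp (- ?k * b) * \<phi> b = exp (- ?k * a) * \<phi> a"
  proof -
    have "((\<lambda>s. exp (- ?k * s) * \<phi> s) has_real_derivative 0) (at s within {a..b})" if "s \<in> {a..b}" for s
      by (rule derivative_eq_intros der[OF that] refl)+ (simp add: algebra_simps)
    then obtain c where "\<And>s. s \<in> {a..b} \<Longrightarrow> exp (- ?k * s) * \<phi> s = c"
      using has_field_derivative_zero_constant[of "{a..b}" "\<lambda>s. exp (- ?k * s) * \<phi> s"] by auto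
    then show ?thesis using ab by simp
  qed
  then have "\<phi> b = exp (?k * b) * (exp (- ?k * a) * \<phi> a)"
    by (metis exp_minus_inverse mult.assoc mult.commute mult.right_neutral mult_minus_left)
  also have "\<dots> = exp (?k * (b - a)) * \<phi> a"
    by (simp only: mult.assoc[symmetric] exp_add[symmetric]) (simp add: algebra_simps)
  finally have "\<phi> b = exp (?k * (b - a)) * X a \<omega>" by (simp add: \<phi>_def)
  then show ?thesis using Xs[of b] ab by simp
qed

lemma X_flow_const:
  assumes \<omega>: "\<omega> \<in> space M" and ab: "0 \<le> a" "a \<le> b" and const: "N b \<omega> = N a \<omega>"
  shows "X b \<omega> = exp (kappa Q * (b - a)) * X a \<omega>"
proof -
  have c: "N s \<omega> = N a \<omega>" if "a \<le> s" "s < b" for s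
    using N_mono[OF \<omega>, of a s] N_mono[OF \<omega>, of s b] that ab const by simp
  have "U b \<omega> = U a \<omega>" using const by (simp add: compound_sum_def)
  with X_flow[OF \<omega> ab c] show ?thesis by simp
qed

lemma X_right_limit:
  assumes \<omega>: "\<omega> \<in> space M" and t: "0 \<le> t" and u: "u \<longlonglongrightarrow> t" "\<And>j. t \<le> u j"
  shows "(\<lambda>j. X (u j) \<omega>) \<longlonglongrightarrow> X t \<omega>"
proof -
  obtain e where e: "e > 0" "\<And>s. t \<le> s \<Longrightarrow> s < t + e \<Longrightarrow> N s \<omega> = N t \<omega>"
    using N_right[OF \<omega> t] by auto
  have "eventually (\<lambda>j. u j < t + e) sequentially"
    using order_tendstoD(2)[OF u(1), of "t + e"] e by simp
  then have ev: "eventually (\<lambda>j. exp (kappa Q * (u j - t)) * X t \<omega> = X (u j) \<omega>) sequentially"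
  proof eventually_elim
    case (elim j)
    show ?case using X_flow_const[OF \<omega> t u(2) e(2)[OF u(2) elim]] by simp
  qed
  have "(\<lambda>j. exp (kappa Q * (u j - t)) * X t \<omega>) \<longlonglongrightarrow> exp (kappa Q * (t - t)) * X t \<omega>"
    by (intro tendsto_intros u)
  then show ?thesis using Lim_transform_eventually[OF _ ev] by simp
qed

text \<open>The random time is approximated from the right by times with countably many values;
  right-continuity of the path gives the limit.\<close>

lemma X_at_measurable:
  assumes T[measurable]: "T \<in> borel_measurable M" and nn: "\<And>\<omega>. 0 \<le> T \<omega>"
  shows "(\<lambda>\<omega>. X (T \<omega>) \<omega>) \<in> borel_measurable M"
proof (rule borel_measurable_LIMSEQ_real)
  define m where "m j \<omega> = nat \<lfloor>T \<omega> * real (Suc j)\<rfloor>" for j \<omega>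
  define u where "u j \<omega> = (real (m j \<omega>) + 1) / real (Suc j)" for j \<omega>
  have mr: "real (m j \<omega>) = of_int \<lfloor>T \<omega> * real (Suc j)\<rfloor>" for j \<omega>
  proof -
    have "0 \<le> T \<omega> * real (Suc j)" using nn by (intro mult_nonneg_nonneg) auto
    then have "0 \<le> \<lfloor>T \<omega> * real (Suc j)\<rfloor>" by simp
    then show ?thesis unfolding m_def by (simp only: of_nat_nat)
  qed
  have b: "T \<omega> \<le> u j \<omega>" "u j \<omega> \<le> T \<omega> + 1 / real (Suc j)" for j \<omega>
  proof -
    have "T \<omega> * real (Suc j) \<le> real (m j \<omega>) + 1" "real (m j \<omega>) \<le> T \<omega> * real (Suc j)"
      unfolding mr by linarith+
    then show "T \<omega> \<le> u j \<omega>" "u j \<omega> \<le> T \<omega> + 1 / real (Suc j)"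
      unfolding u_def by (simp_all add: field_simps del: of_nat_Suc)
  qed
  show "(\<lambda>j. X (u j \<omega>) \<omega>) \<longlonglongrightarrow> X (T \<omega>) \<omega>" if "\<omega> \<in> space M" for \<omega>
  proof (rule X_right_limit[OF that nn _ b(1)])
    have "(\<lambda>j. 1 / real (Suc j)) \<longlonglongrightarrow> 0" by real_asymp
    from tendsto_add[OF tendsto_const this, of "T \<omega>"]
    have "(\<lambda>j. T \<omega> + 1 / real (Suc j)) \<longlonglongrightarrow> T \<omega>" by simp
    then show "(\<lambda>j. u j \<omega>) \<longlonglongrightarrow> T \<omega>"
      using tendsto_sandwich[of "\<lambda>_. T \<omega>" "\<lambda>j. u j \<omega>" sequentially "\<lambda>j. T \<omega> + 1 / real (Suc j)" "T \<omega>"]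
        b by (simp del: of_nat_Suc)
  qed
  show "(\<lambda>\<omega>. X (u j \<omega>) \<omega>) \<in> borel_measurable M" for j
  proof -
    have "m j \<in> measurable M (count_space UNIV)" unfolding m_def by measurable
    then show ?thesis unfolding u_def
      by (rule measurable_compose_countable[where g="m j", rotated]) (auto intro!: X_measurable)
  qed
qed

text \<open>Passage is an uncountable union over times. Between jumps the flow is monotone, so
  passage inside a holding interval forces passage at a nearby rational time; only the jump times
  are left. The \<open>max 0\<close> keeps the random time nonnegative on paths that never reach the
  level, where \<open>jump_time\<close> is unspecified.\<close>

lemma passage_iff:
  assumes \<omega>: "\<omega> \<in> space M"
  shows "(\<exists>t>0. X t \<omega> \<le> l) \<longleftrightarrow> (\<exists>q\<in>\<rat>. q > 0 \<and> X q \<omega> \<le> l) \<or>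
    (\<exists>n. (\<exists>t\<ge>0. Suc n \<le> N t \<omega>) \<and> X (max 0 (jump_time N (Suc n) \<omega>)) \<omega> \<le> l)"
proof (intro iffI; elim disjE exE conjE bexE)
  fix n t assume r: "0 \<le> t" "Suc n \<le> N t \<omega>" "X (max 0 (jump_time N (Suc n) \<omega>)) \<omega> \<le> l"
  then have re: "\<exists>t\<ge>0. Suc n \<le> N t \<omega>" by blast
  have "0 < jump_time N (Suc n) \<omega>"
    using jump_time_le_iff[OF \<omega> re, of 0] N_0[OF \<omega>] by simp
  then show "\<exists>t>0. X t \<omega> \<le> l" using r by (intro exI[of _ "jump_time N (Suc n) \<omega>"]) auto
next
  fix t assume t: "0 < t" "X t \<omega> \<le> l"
  define n where "n = N t \<omega>"
  have re: "\<exists>t\<ge>0. n \<le> N t \<omega>" using t by (auto simp: n_def intro!: exI[of _ t])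
  let ?T = "jump_time N n \<omega>"
  have T0: "0 \<le> ?T" by (rule jump_time_nonneg[OF re])
  have Tt: "?T \<le> t" using jump_time_le_iff[OF \<omega> re, of t] t by (simp add: n_def)
  show "(\<exists>q\<in>\<rat>. q > 0 \<and> X q \<omega> \<le> l) \<or>
    (\<exists>n. (\<exists>t\<ge>0. Suc n \<le> N t \<omega>) \<and> X (max 0 (jump_time N (Suc n) \<omega>)) \<omega> \<le> l)"
  proof (cases "?T = t")
    case True
    then obtain m where m: "n = Suc m" using t jump_time_0[of \<omega>] by (cases n) auto
    have "X (max 0 (jump_time N (Suc m) \<omega>)) \<omega> \<le> l" using True T0 t m by simp
    then show ?thesis using re m by blast
  next
    case False
    with Tt have Tt: "?T < t" by simp
    have NT: "N s \<omega> = n" if "?T \<le> s" "s \<le> t" for s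
      using jump_time_attained[OF \<omega> re] N_mono[OF \<omega> T0 that(1)] N_mono[OF \<omega> _ that(2)] T0 that
      by (simp add: n_def)
    obtain e where e: "e > 0" "\<And>s. t \<le> s \<Longrightarrow> s < t + e \<Longrightarrow> N s \<omega> = N t \<omega>"
      using N_right[OF \<omega>, of t] t by auto
    \<comment> \<open>A positive value has grown, so the path was already below \<open>l\<close>
      just before \<open>t\<close>; a nonpositive value does not increase, so the path is still at
      or below \<open>l\<close> just after \<open>t\<close>.\<close>
    show ?thesis
    proof (cases "0 < X t \<omega>")
      case True
      obtain q where q: "q \<in> \<rat>" "?T < q" "q < t" using Rats_dense_in_real[OF Tt] by blast
      have "X t \<omega> = exp (kappa Q * (t - q)) * X q \<omega>"
        using q NT T0 by (intro X_flow_const[OF \<omega>]) auto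
      moreover have "1 \<le> exp (kappa Q * (t - q))" using q kappa by simp
      moreover have "0 < X q \<omega>" using True calculation(1) by (simp add: zero_less_mult_iff)
      ultimately have "X q \<omega> \<le> X t \<omega>" by simp
      then show ?thesis using q t T0 by (intro disjI1 bexI[of _ q]) auto
    next
      case False
      obtain q where q: "q \<in> \<rat>" "t < q" "q < t + e" using Rats_dense_in_real[of t "t + e"] e by auto
      have "X q \<omega> = exp (kappa Q * (q - t)) * X t \<omega>"
        using q e(2)[of q] t by (intro X_flow_const[OF \<omega>]) auto
      also have "\<dots> \<le> 1 * X t \<omega>"
        using q kappa False by (intro mult_right_mono_neg) auto
      finally show ?thesis using q t by (intro disjI1 bexI[of _ q]) auto
    qed
  qed
qed auto

lemma tau_finite_iff: "tau X l \<omega> < \<infinity> \<longleftrightarrow> (\<exists>t>0. X t \<omega> \<le> l)"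
  unfolding tau_def INF_less_iff by auto

lemma passage_measurable: "{\<omega>\<in>space M. tau X l \<omega> < \<infinity>} \<in> sets M"
proof -
  let ?A = "\<Union>q\<in>\<rat> \<inter> {0<..}. {\<omega>\<in>space M. X q \<omega> \<le> l}"
  let ?B = "\<Union>n. {\<omega>\<in>space M. \<exists>t\<ge>0. Suc n \<le> N t \<omega>} \<inter> {\<omega>\<in>space M. X (max 0 (jump_time N (Suc n) \<omega>)) \<omega> \<le> l}"
  have "{\<omega>\<in>space M. X q \<omega> \<le> l} \<in> sets M" if "q > 0" for q
    using X_measurable[of q] that by simp
  then have "?A \<in> sets M"
    by (intro sets.countable_UN' countable_Int1 countable_rat) auto
  moreover have "?B \<in> sets M"
  proof (intro sets.countable_UN image_subsetI sets.Int reach_measurable)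
    fix n
    have "(\<lambda>\<omega>. X (max 0 (jump_time N (Suc n) \<omega>)) \<omega>) \<in> borel_measurable M"
      using jump_time_measurable by (intro X_at_measurable) auto
    then show "{\<omega>\<in>space M. X (max 0 (jump_time N (Suc n) \<omega>)) \<omega> \<le> l} \<in> sets M" by simp
  qed
  moreover have "{\<omega>\<in>space M. tau X l \<omega> < \<infinity>} = ?A \<union> ?B"
  proof (rule set_eqI)
    fix \<omega>
    show "\<omega> \<in> {\<omega>\<in>space M. tau X l \<omega> < \<infinity>} \<longleftrightarrow> \<omega> \<in> ?A \<union> ?B"
    proof (cases "\<omega> \<in> space M")
      case True
      show ?thesis
        unfolding mem_Collect_eq Un_iff tau_finite_iff passage_iff[OF True] using True by auto
    qed auto
  qed
  ultimately show ?thesis by simp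
qed

definition W :: "'a \<Rightarrow> (real \<times> real) stream" where
  "W \<omega> = to_stream (\<lambda>n. (gap n \<omega>, V (Suc n) \<omega>))"

lemma W_nth: "W \<omega> !! n = (gap n \<omega>, V (Suc n) \<omega>)"
  by (simp add: W_def to_stream_def)

text \<open>At the \<open>n\<close>-th jump time the process is in the \<open>n\<close>-th state of
  the chain, and until the next jump it moves along one flow line. From a state above
  \<open>l\<close> only a negative one can be carried below \<open>l\<close>, and the infimum along
  its flow line is the left limit at the next jump.\<close>

lemma passage_chain:
  assumes \<omega>: "\<omega> \<in> space M" and re: "\<forall>n. \<exists>t\<ge>0. n \<le> N t \<omega>" and simple: "\<forall>n. N (jump_time N n \<omega>) \<omega> = n"
    and X0: "X 0 \<omega> = x" and xl: "l < x"
  shows "(\<exists>t>0. X t \<omega> \<le> l) \<longleftrightarrow> (\<exists>n. hit (kappa Q) l n x (W \<omega>))"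
proof -
  let ?k = "kappa Q" and ?T = "\<lambda>n. jump_time N n \<omega>" and ?Y = "\<lambda>n. chain_state (kappa Q) n x (W \<omega>)"
  note le = jump_time_le_iff[OF \<omega> re[rule_format]] and nn = jump_time_nonneg[OF re[rule_format]]
  have Tlt: "?T n < ?T (Suc n)" for n
  proof -
    have "\<not> ?T (Suc n) \<le> ?T n" using le[of "?T n" "Suc n"] nn simple by simp
    then show ?thesis by simp
  qed
  have Nc: "N s \<omega> = n" if "?T n \<le> s" "s < ?T (Suc n)" for n s
  proof -
    have s0: "0 \<le> s" using that nn[of n] by simp
    have "n \<le> N s \<omega>" using le[OF s0, of n] that by simp
    moreover have "\<not> Suc n \<le> N s \<omega>" using le[OF s0, of "Suc n"] that by simp
    ultimately show ?thesis by simp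
  qed
  have flow: "X s \<omega> = exp (?k * (s - ?T n)) * X (?T n) \<omega>" if "?T n \<le> s" "s < ?T (Suc n)" for n s
    using that Nc simple nn by (intro X_flow_const[OF \<omega>]) auto
  have XY: "X (?T n) \<omega> = ?Y n" for n
  proof (induction n)
    case 0
    then show ?case using X0 by (simp add: jump_time_0)
  next
    case (Suc n)
    have "X (?T (Suc n)) \<omega> = exp (?k * (?T (Suc n) - ?T n)) * X (?T n) \<omega> + (U (?T (Suc n)) \<omega> - U (?T n) \<omega>)"
      using Nc simple Tlt[of n] nn by (intro X_flow[OF \<omega>]) auto
    also have "U (?T (Suc n)) \<omega> - U (?T n) \<omega> = V (Suc n) \<omega>"
      using simple by (simp add: compound_sum_def)
    finally show ?case
      unfolding chain_state_Suc W_nth using Suc by (simp add: gap_def mult.commute)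
  qed
  have hits: "(\<exists>n. hit ?k l n x (W \<omega>)) \<longleftrightarrow>
      (\<exists>i. ?Y i * exp (?k * gap i \<omega>) < l \<or> ?Y (Suc i) \<le> l)"
    unfolding hit_iff W_nth by auto
  show ?thesis unfolding hits
  proof
    assume "\<exists>t>0. X t \<omega> \<le> l"
    then obtain t where t: "0 < t" "X t \<omega> \<le> l" by blast
    show "\<exists>i. ?Y i * exp (?k * gap i \<omega>) < l \<or> ?Y (Suc i) \<le> l"
    proof (rule ccontr)
      assume "\<not> (\<exists>i. ?Y i * exp (?k * gap i \<omega>) < l \<or> ?Y (Suc i) \<le> l)"
      then have nz: "\<And>i. l \<le> ?Y i * exp (?k * gap i \<omega>)" and ns: "\<And>i. l < ?Y (Suc i)" by (auto simp: not_less not_le)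
      have Yl: "l < ?Y i" for i using ns xl by (cases i) auto
      define n where "n = N t \<omega>"
      have t0: "0 \<le> t" using t by simp
      have n: "?T n \<le> t" "t < ?T (Suc n)"
        using le[OF t0, of n] le[OF t0, of "Suc n"] by (auto simp: n_def)
      have Xt: "X t \<omega> = exp (?k * (t - ?T n)) * ?Y n" using flow[OF n] XY by simp
      show False
      proof (cases "0 \<le> ?Y n")
        case True
        then have "1 * ?Y n \<le> X t \<omega>" unfolding Xt using n kappa by (intro mult_right_mono) auto
        then show False using Yl[of n] t by simp
      next
        case False
        \<comment> \<open>The state is negative and falls, so at a time before the next jump it is
          strictly above the left limit there, which is at least \<open>l\<close>.\<close>
        have "?k * (t - ?T n) < ?k * gap n \<omega>" using n kappa by (simp add: gap_def)
        then have "exp (?k * gap n \<omega>) * ?Y n < X t \<omega>"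
          unfolding Xt using False by (intro mult_strict_right_mono_neg) auto
        then show False using nz[of n] t by (simp add: mult.commute)
      qed
    qed
  next
    assume "\<exists>i. ?Y i * exp (?k * gap i \<omega>) < l \<or> ?Y (Suc i) \<le> l"
    then obtain i where "?Y i * exp (?k * gap i \<omega>) < l \<or> ?Y (Suc i) \<le> l" by blast
    then show "\<exists>t>0. X t \<omega> \<le> l"
    proof
      assume "?Y (Suc i) \<le> l"
      then show ?thesis using XY[of "Suc i"] Tlt[of i] nn[of i] by (intro exI[of _ "?T (Suc i)"]) auto
    next
      assume z: "?Y i * exp (?k * gap i \<omega>) < l"
      \<comment> \<open>The left limit at the jump is strictly below \<open>l\<close>, so by
        continuity of the flow the path is below \<open>l\<close> at some time before the
        jump.\<close>
      have "((\<lambda>s. ?Y i * exp (?k * (s - ?T i))) \<longlongrightarrow> ?Y i * exp (?k * (?T (Suc i) - ?T i))) (at_left (?T (Suc i)))"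
        by (intro tendsto_intros)
      then have "eventually (\<lambda>s. ?Y i * exp (?k * (s - ?T i)) < l) (at_left (?T (Suc i)))"
        using z by (intro order_tendstoD(2)) (auto simp: gap_def)
      moreover have "eventually (\<lambda>s. s \<in> {?T i<..<?T (Suc i)}) (at_left (?T (Suc i)))"
        by (rule eventually_at_left_real[OF Tlt])
      ultimately have "eventually (\<lambda>s. ?T i < s \<and> s < ?T (Suc i) \<and> ?Y i * exp (?k * (s - ?T i)) < l) (at_left (?T (Suc i)))"
        by eventually_elim auto
      then obtain s where s: "?T i < s" "s < ?T (Suc i)" "?Y i * exp (?k * (s - ?T i)) < l"
        using eventually_happens[of _ "at_left (?T (Suc i))"] by auto
      then have "X s \<omega> \<le> l" using flow[of i s] XY by (simp add: mult.commute)
      then show ?thesis using s nn[of i] by (intro exI[of _ s]) auto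
    qed
  qed
qed

lemma prob_space_jump_law: "prob_space (jump_law Q)"
proof -
  have "V 1 \<in> borel_measurable M" using V_indep by (simp add: indep_vars_def2)
  then have "prob_space (distr M borel (V 1))" by (rule prob_space_distr)
  then show ?thesis using ou by (simp add: ou_process_def)
qed

interpretation chain: jump_chain "jump_law Q" "kappa Q" "lam Q"
  by (rule jump_chain_jump_law[OF Q kappa prob_space_jump_law])

lemma W_distr: "W \<in> measurable M chain.S" "distr M chain.S W = chain.S"
proof -
  let ?VA = "vimage_algebra (space M) (\<lambda>\<omega>. \<lambda>t\<in>{0..}. N t \<omega>) (Pi\<^sub>M {0..} (\<lambda>_. count_space UNIV))"
  let ?VB = "vimage_algebra (space M) (\<lambda>\<omega>. \<lambda>n\<in>{1..}. V n \<omega>) (Pi\<^sub>M {1..} (\<lambda>_. borel))"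
  have ind: "indep_set (sets ?VA) (sets ?VB)" using ou by (simp add: ou_process_def)
  \<comment> \<open>The same paths over the sigma-algebra generated by \<open>N\<close> alone: the
    gaps are measurable there, whence their independence of \<open>V\<close>.\<close>
  interpret A: counting_paths ?VA N
  proof
    fix t :: real assume t: "0 \<le> t"
    have "(\<lambda>\<omega>. \<lambda>t\<in>{0..}. N t \<omega>) \<in> measurable ?VA (Pi\<^sub>M {0..} (\<lambda>_. count_space UNIV))"
      by (rule measurable_vimage_algebra1) (auto simp: space_PiM)
    then have "(\<lambda>\<omega>. (\<lambda>t\<in>{0..}. N t \<omega>) t) \<in> measurable ?VA (count_space UNIV)"
      by (rule measurable_compose[OF _ measurable_component_singleton]) (use t in auto)
    then show "N t \<in> measurable ?VA (count_space UNIV)" using t by simp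
  qed (use N_0 N_mono N_right in auto)
  have EA: "gap i \<in> borel_measurable ?VA" for i
    unfolding gap_def[abs_def] using A.jump_time_measurable by (intro borel_measurable_diff)
  have VB: "V (Suc i) \<in> borel_measurable ?VB" for i
  proof -
    have "(\<lambda>\<omega>. \<lambda>n\<in>{1..}. V n \<omega>) \<in> measurable ?VB (Pi\<^sub>M {1..} (\<lambda>_. borel))"
      by (rule measurable_vimage_algebra1) (auto simp: space_PiM)
    then have "(\<lambda>\<omega>. (\<lambda>n\<in>{1..}. V n \<omega>) (Suc i)) \<in> borel_measurable ?VB"
      by (rule measurable_compose[OF _ measurable_component_singleton]) auto
    then show ?thesis by simp
  qed
  \<comment> \<open>Jumps are numbered from 1, positions in the stream from 0.\<close>
  have Vind: "indep_vars (\<lambda>_. borel) (\<lambda>i. V (Suc i)) UNIV"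
    unfolding indep_vars_def2
  proof (intro conjI ballI indep_setsI)
    show "V (Suc i) \<in> borel_measurable M" for i using V_indep by (simp add: indep_vars_def2)
    then show "{V (Suc i) -` A \<inter> space M |A. A \<in> sets borel} \<subseteq> events" for i
      by (auto intro: measurable_sets)
    fix A and J :: "nat set" assume J: "J \<noteq> {}" "J \<subseteq> UNIV" "finite J"
      "\<forall>j\<in>J. A j \<in> {V (Suc j) -` A \<inter> space M |A. A \<in> sets borel}"
    then obtain C where C: "\<And>j. j \<in> J \<Longrightarrow> C j \<in> sets borel" "\<And>j. j \<in> J \<Longrightarrow> A j = V (Suc j) -` C j \<inter> space M"
      by (simp add: bchoice_iff) metis
    have "prob (\<Inter>i\<in>Suc ` J. V i -` C (i - 1) \<inter> space M) = (\<Prod>i\<in>Suc ` J. prob (V i -` C (i - 1) \<inter> space M))"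
      using J C by (intro indep_varsD[OF V_indep]) auto
    also have "(\<Inter>i\<in>Suc ` J. V i -` C (i - 1) \<inter> space M) = (\<Inter>j\<in>J. A j)"
      using C(2) by auto
    also have "(\<Prod>i\<in>Suc ` J. prob (V i -` C (i - 1) \<inter> space M)) = (\<Prod>j\<in>J. prob (A j))"
      using C(2) by (subst prod.reindex) auto
    finally show "prob (\<Inter>j\<in>J. A j) = (\<Prod>j\<in>J. prob (A j))" .
  qed
  have sp: "space ?VA = space M" "space ?VB = space M" by simp_all
  note P = indep_pairs[OF ind sp EA VB gap_indep Vind]
  have D: "distr M (borel \<Otimes>\<^sub>M borel) (\<lambda>\<omega>. (gap i \<omega>, V (Suc i) \<omega>)) = chain.step" for i
  proof -
    have "distr M borel (gap i) = chain.E"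
      using gap_exponential[of i] by (auto simp: distributed_def cong: distr_cong)
    moreover have "distr M borel (V (Suc i)) = jump_law Q" using ou by (simp add: ou_process_def)
    ultimately show ?thesis using P(2)[of i] by (simp add: chain.step_def)
  qed
  let ?P = "Pi\<^sub>M UNIV (\<lambda>_::nat. borel \<Otimes>\<^sub>M borel :: (real \<times> real) measure)"
  let ?w = "\<lambda>\<omega> n. (gap n \<omega>, V (Suc n) \<omega>)"
  have rv: "(\<lambda>\<omega>. (gap i \<omega>, V (Suc i) \<omega>)) \<in> measurable M (borel \<Otimes>\<^sub>M borel)" for i
    using P(1) by (simp add: indep_vars_def2)
  have "distr M ?P (\<lambda>\<omega>. \<lambda>i\<in>UNIV. ?w \<omega> i) = Pi\<^sub>M UNIV (\<lambda>i. distr M (borel \<Otimes>\<^sub>M borel) (\<lambda>\<omega>. (gap i \<omega>, V (Suc i) \<omega>)))"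
    using P(1) by (subst indep_vars_iff_distr_eq_PiM[symmetric]) (use rv in auto)
  then have dP: "distr M ?P ?w = Pi\<^sub>M UNIV (\<lambda>_. chain.step)"
    by (simp add: D restrict_def)
  have sP: "sets ?P = sets (Pi\<^sub>M UNIV (\<lambda>_. chain.step))"
    by (intro sets_PiM_cong) (auto simp: chain.sets_step)
  have wm: "?w \<in> measurable M ?P" using rv by (intro measurable_PiM_single') (auto simp: space_pair_measure)
  then have wm': "?w \<in> measurable M (Pi\<^sub>M UNIV (\<lambda>_. chain.step))" by (simp cong: measurable_cong_sets add: sP)
  have Wc: "W = to_stream \<circ> ?w" by (auto simp: W_def)
  show "W \<in> measurable M chain.S"
    unfolding Wc by (rule measurable_comp[OF wm' measurable_to_stream])
  have "distr M chain.S W = distr (distr M (Pi\<^sub>M UNIV (\<lambda>_. chain.step)) ?w) chain.S to_stream"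
    unfolding Wc by (rule distr_distr[OF measurable_to_stream wm', symmetric])
  also have "distr M (Pi\<^sub>M UNIV (\<lambda>_. chain.step)) ?w = Pi\<^sub>M UNIV (\<lambda>_. chain.step)"
    using dP distr_cong[OF refl sP, of M ?w ?w] by simp
  finally show "distr M chain.S W = chain.S" by (simp flip: stream_space_eq_distr)
qed

theorem passage_prob:
  assumes xl: "l < x"
  shows "measure M {\<omega>\<in>space M. tau X l \<omega> < \<infinity>} =
    measure (stream_space (jump_chain.step (jump_law Q) (lam Q))) {w. \<exists>n. hit (kappa Q) l n x w}"
proof -
  let ?H = "{w. \<exists>n. hit (kappa Q) l n x w}"
  have H: "?H \<in> sets chain.S"
    using predE[where M=chain.S and P="\<lambda>w. \<exists>n. hit (kappa Q) l n x w"] by simp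
  have "AE \<omega> in M. X 0 \<omega> = x" using ou unfolding ou_process_def by (elim conjE)
  then have "AE \<omega> in M. \<omega> \<in> {\<omega>\<in>space M. tau X l \<omega> < \<infinity>} \<longleftrightarrow> \<omega> \<in> W -` ?H \<inter> space M"
    using AE_reach AE_simple_jumps AE_space
  proof eventually_elim
    case (elim \<omega>)
    show ?case using passage_chain[OF elim(4,2,3,1) xl] elim(4) unfolding mem_Collect_eq tau_finite_iff by simp
  qed
  then have "measure M {\<omega>\<in>space M. tau X l \<omega> < \<infinity>} = measure M (W -` ?H \<inter> space M)"
    using passage_measurable measurable_sets[OF W_distr(1) H] by (rule finite_measure_eq_AE)
  also have "\<dots> = measure (distr M chain.S W) ?H"
    by (rule measure_distr[OF W_distr(1) H, symmetric])
  finally show ?thesis by (simp add: W_distr(2))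
qed

end

section \<open>The one-step identity\<close>

lemma halfline_FTC:
  fixes F f :: "real \<Rightarrow> complex"
  assumes "finite S" and cont: "continuous_on {a..} F"
    and der: "\<And>x. a < x \<Longrightarrow> x \<notin> S \<Longrightarrow> (F has_vector_derivative f x) (at x)"
    and int: "set_integrable lborel {a..} f" and lim: "(F \<longlongrightarrow> L) at_top"
  shows "(LINT x:{a..}|lborel. f x) = L - F a"
proof -
  have "((\<lambda>b. LINT x:{a..b}|lborel. f x) \<longlongrightarrow> (LINT x:{a..}|lborel. f x)) at_top"
    by (rule tendsto_set_lebesgue_integral_at_top[OF _ int]) auto
  moreover have "eventually (\<lambda>b. (LINT x:{a..b}|lborel. f x) = F b - F a) at_top"
    using eventually_ge_at_top[of a]
  proof eventually_elim
    case (elim b)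
    have "set_integrable lborel {a..b} f" by (rule set_integrable_subset[OF int]) auto
    then have "(LINT x:{a..b}|lborel. f x) = integral {a..b} f" by (rule set_borel_integral_eq_integral)
    also have "(f has_integral (F b - F a)) {a..b}"
      using continuous_on_subset[OF cont, of "{a..b}"] der elim
      by (intro fundamental_theorem_of_calculus_interior_strong[OF \<open>finite S\<close>]) auto
    then have "integral {a..b} f = F b - F a" by (rule integral_unique)
    finally show ?case .
  qed
  ultimately have "((\<lambda>b. F b - F a) \<longlongrightarrow> (LINT x:{a..}|lborel. f x)) at_top"
    by (rule Lim_transform_eventually)
  moreover have "((\<lambda>b. F b - F a) \<longlongrightarrow> L - F a) at_top" by (intro tendsto_intros lim)
  ultimately show ?thesis using tendsto_unique by (metis trivial_limit_at_top_linorder)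
qed

lemma integral_sum_plus_sum:
  fixes m n :: "'i \<Rightarrow> 'b \<Rightarrow> complex"
  assumes "\<And>k. k \<in> A \<Longrightarrow> integrable M (m k)" "\<And>k. k \<in> B \<Longrightarrow> integrable M (n k)"
  shows "(\<integral>x. (\<Sum>k\<in>A. a k * m k x) + (\<Sum>k\<in>B. b k * n k x) \<partial>M)
    = (\<Sum>k\<in>A. a k * (\<integral>x. m k x \<partial>M)) + (\<Sum>k\<in>B. b k * (\<integral>x. n k x \<partial>M))"
  using assms by (subst Bochner_Integration.integral_add)
    (auto intro!: Bochner_Integration.integrable_sum simp: Bochner_Integration.integral_sum)

lemma integrable_exp_abs: "0 < (c::real) \<Longrightarrow> integrable lborel (\<lambda>u. exp (- c * \<bar>u\<bar>))"
  using nn_integral_exp_abs_finite[of c] by (intro integrableI_nonneg) auto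

lemma integrable_bounded_exp:
  fixes h :: "real \<Rightarrow> complex"
  assumes "0 < (c::real)" "h \<in> borel_measurable borel" "\<And>t. norm (h t) \<le> B * exp (- c * \<bar>t\<bar>)"
  shows "integrable lborel h"
proof (rule Bochner_Integration.integrable_bound)
  show "integrable lborel (\<lambda>t. B * exp (- c * \<bar>t\<bar>))"
    using integrable_exp_abs[OF assms(1)] by simp
  show "AE t in lborel. norm (h t) \<le> norm (B * exp (- c * \<bar>t\<bar>))"
    using assms(3) by (intro AE_I2) (metis abs_ge_self order_trans real_norm_def)
qed (use assms(2) in simp)

lemma integrable_exp_halfline:
  fixes h :: "real \<Rightarrow> complex" and \<rho> :: real
  assumes "0 < \<rho>" "h \<in> borel_measurable borel" "\<And>t. norm (h t) \<le> B"
  shows "set_integrable lborel {0..} (\<lambda>t. complex_of_real (exp (- \<rho> * t)) * h t)"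
  unfolding set_integrable_def
proof (rule integrable_bounded_exp[OF assms(1)])
  have "0 \<le> B" using assms(3)[of 0] norm_ge_zero order_trans by blast
  then show "norm (indicat_real {0..} t *\<^sub>R (complex_of_real (exp (- \<rho> * t)) * h t)) \<le> B * exp (- \<rho> * \<bar>t\<bar>)" for t
    using assms(3)[of t] by (auto simp: norm_mult indicator_def mult.commute intro!: mult_right_mono)
qed (use assms in measurable)

text \<open>Solutions of \<open>H' = rho * H - h\<close> differ by multiples of
  \<open>exp (rho * t)\<close>, so at most one is bounded. Boundedness removes the boundary term at
  infinity, and finitely many kinks of \<open>H\<close> do no harm.\<close>

lemma laplace_tail:
  fixes h H :: "real \<Rightarrow> complex" and \<rho> :: real
  assumes \<rho>: "0 < \<rho>" and h[measurable]: "h \<in> borel_measurable borel" and hB: "\<And>t. norm (h t) \<le> B"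
    and cont: "continuous_on {0..} H" and HB: "\<And>t. 0 \<le> t \<Longrightarrow> norm (H t) \<le> C"
    and "finite S" and der: "\<And>t. 0 < t \<Longrightarrow> t \<notin> S \<Longrightarrow> (H has_vector_derivative \<rho> * H t - h t) (at t)"
  shows "(LINT t:{0..}|lborel. complex_of_real (exp (- \<rho> * t)) * h t) = H 0"
proof -
  let ?F = "\<lambda>t. - (complex_of_real (exp (- \<rho> * t)) * H t)"
  have "(LINT t:{0..}|lborel. complex_of_real (exp (- \<rho> * t)) * h t) = 0 - ?F 0"
  proof (rule halfline_FTC[OF \<open>finite S\<close>])
    show "continuous_on {0..} ?F" by (intro continuous_intros cont)
    show "(?F has_vector_derivative complex_of_real (exp (- \<rho> * t)) * h t) (at t)" if "0 < t" "t \<notin> S" for t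
    proof -
      have e: "((\<lambda>t. complex_of_real (exp (- \<rho> * t))) has_vector_derivative complex_of_real (- \<rho> * exp (- \<rho> * t))) (at t)"
        by (rule has_vector_derivative_of_real) (auto intro!: derivative_eq_intros)
      show ?thesis
        by (rule has_vector_derivative_eq_rhs[OF has_vector_derivative_minus[OF has_vector_derivative_mult[OF e der[OF that]]]])
          (simp add: algebra_simps)
    qed
    show "set_integrable lborel {0..} (\<lambda>t. complex_of_real (exp (- \<rho> * t)) * h t)"
      by (rule integrable_exp_halfline[OF \<rho> h hB])
    show "(?F \<longlongrightarrow> 0) at_top"
    proof (rule Lim_null_comparison)
      show "eventually (\<lambda>t. norm (?F t) \<le> exp (- \<rho> * t) * C) at_top"
        using eventually_ge_at_top[of 0]
        by eventually_elim (use HB in \<open>auto simp: norm_mult intro!: mult_left_mono\<close>)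
      show "((\<lambda>t. exp (- \<rho> * t) * C) \<longlongrightarrow> 0) at_top" using \<rho> by real_asymp
    qed
  qed
  then show ?thesis by simp
qed

text \<open>
  \<open>D k\<close> and \<open>E d\<close> are antiderivatives of \<open>exp (mu k * w) * f w\<close> and \<open>exp (- nu d * w) * f w\<close> up to
  the factors \<open>- exp (mu k * w)\<close> and \<open>- exp (- nu d * w)\<close>.  The linear systems for the coefficients of a partial
  eigenfunction say precisely that \<open>D k\<close> and \<open>E d\<close> are continuous across \<open>l\<close> and \<open>0\<close>.
\<close>
locale eigen_data =
  fixes Q :: params and l :: real and f :: "real \<Rightarrow> complex" and D E :: "nat \<Rightarrow> real \<Rightarrow> complex" and B :: real
  assumes Q: "admissible Q" and kappa: "0 < kappa Q" and law: "prob_space (jump_law Q)" and l0: "l \<noteq> 0"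
    and f_below: "\<And>y. y < l \<Longrightarrow> f y = 1"
    and f_meas[measurable]: "f \<in> borel_measurable borel" and f_bound: "\<And>y. norm (f y) \<le> B"
    and D_cont: "\<And>k. k \<in> {1..r_neg Q} \<Longrightarrow> continuous_on UNIV (D k)"
    and D_bound: "\<And>k y. k \<in> {1..r_neg Q} \<Longrightarrow> y \<le> l \<Longrightarrow> norm (D k y) \<le> B"
    and D_der: "\<And>k y. k \<in> {1..r_neg Q} \<Longrightarrow> y \<notin> {l, 0} \<Longrightarrow> (D k has_vector_derivative - mu Q k * D k y - f y) (at y)"
    and E_cont: "\<And>d. d \<in> {1..s_pos Q} \<Longrightarrow> continuous_on {l..} (E d)"
    and E_bound: "\<And>d y. d \<in> {1..s_pos Q} \<Longrightarrow> l \<le> y \<Longrightarrow> norm (E d y) \<le> B"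
    and E_der: "\<And>d y. d \<in> {1..s_pos Q} \<Longrightarrow> l < y \<Longrightarrow> y \<noteq> 0 \<Longrightarrow> (E d has_vector_derivative nu Q d * E d y - f y) (at y)"
    and ode: "\<And>y. l < y \<Longrightarrow> y \<noteq> 0 \<Longrightarrow> \<exists>f'::complex. (f has_vector_derivative f') (at y) \<and>
        kappa Q * y * f' = lam Q * (f y + (\<Sum>k=1..r_neg Q. p_neg Q * alpha Q k * mu Q k * D k y)
          - (\<Sum>d=1..s_pos Q. q_pos Q * beta Q d * nu Q d * E d y))"
    and f_cont_neg: "l < 0 \<Longrightarrow> continuous_on {..<0} f"
begin

text \<open>The mean of \<open>f\<close> after one jump from \<open>y\<close>, in closed form;
  \<open>Pf_eq\<close> identifies it with the integral against the jump density.\<close>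

definition Pf :: "real \<Rightarrow> complex" where
  "Pf y = (\<Sum>d=1..s_pos Q. q_pos Q * beta Q d * nu Q d * E d y)
     - (\<Sum>k=1..r_neg Q. p_neg Q * alpha Q k * mu Q k * D k y)"

text \<open>\<open>laplace_tail\<close> on the half-line run backwards from \<open>y\<close>, with
  the exceptional parameters at which it passes \<open>l\<close> and 0. Below \<open>l\<close> the
  bound on \<open>D k\<close> is given; on the compact interval \<open>[l, y]\<close> it comes from
  continuity.\<close>

lemma D_tail:
  assumes k: "k \<in> {1..r_neg Q}" and y: "l \<le> y"
  shows "(LINT t:{0..}|lborel. complex_of_real (exp (- mu Q k * t)) * f (y - t)) = - D k y"
proof -
  have mu: "0 < mu Q k" using mu_pos[OF Q k] by simp
  have "compact {l..y}" "continuous_on {l..y} (D k)" using D_cont[OF k] continuous_on_subset by auto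
  then have "bounded (D k ` {l..y})" by (intro compact_imp_bounded compact_continuous_image)
  then obtain C where "\<forall>x\<in>D k ` {l..y}. norm x \<le> C" unfolding bounded_iff by blast
  then have C: "norm (D k u) \<le> C" if "u \<in> {l..y}" for u using that by blast
  have "(LINT t:{0..}|lborel. complex_of_real (exp (- mu Q k * t)) * f (y - t)) = - D k (y - 0)"
  proof (rule laplace_tail[where h="\<lambda>t. f (y - t)" and H="\<lambda>t. - D k (y - t)" and S="{y - l, y}" and B=B and C="max B C", OF mu])
    show "continuous_on {0..} (\<lambda>t. - D k (y - t))"
      by (rule continuous_on_minus[OF continuous_on_compose2[OF D_cont[OF k]]]) (auto intro!: continuous_intros)
    show "norm (- D k (y - t)) \<le> max B C" if "0 \<le> t" for t
      using C[of "y - t"] D_bound[OF k, of "y - t"] that by (cases "y - t \<le> l") auto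
    show "((\<lambda>t. - D k (y - t)) has_vector_derivative mu Q k * - D k (y - t) - f (y - t)) (at t)"
      if "0 < t" "t \<notin> {y - l, y}" for t
    proof -
      have "y - t \<notin> {l, 0}" using that by auto
      from D_der[OF k this]
      have d: "(D k has_vector_derivative - mu Q k * D k (y - t) - f (y - t)) (at (y - t) within UNIV)" by simp
      have "((\<lambda>t. y - t) has_vector_derivative - 1) (at t)"
        by (auto intro!: derivative_eq_intros simp flip: has_real_derivative_iff_has_vector_derivative)
      from vector_diff_chain_at[OF this d]
      show ?thesis
        by (intro has_vector_derivative_eq_rhs[OF has_vector_derivative_minus]) (auto simp: o_def)
    qed
  qed (use f_bound in auto)
  then show ?thesis by simp
qed

lemma E_tail:
  assumes d: "d \<in> {1..s_pos Q}" and y: "l \<le> y"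
  shows "(LINT t:{0..}|lborel. complex_of_real (exp (- nu Q d * t)) * f (y + t)) = E d y"
proof -
  have nu: "0 < nu Q d" using nu_pos[OF Q d] by simp
  have "(LINT t:{0..}|lborel. complex_of_real (exp (- nu Q d * t)) * f (y + t)) = E d (y + 0)"
  proof (rule laplace_tail[where h="\<lambda>t. f (y + t)" and H="\<lambda>t. E d (y + t)" and S="{- y}" and B=B and C=B, OF nu])
    show "continuous_on {0..} (\<lambda>t. E d (y + t))"
      by (rule continuous_on_compose2[OF E_cont[OF d]]) (use y in \<open>auto intro!: continuous_intros\<close>)
    show "norm (E d (y + t)) \<le> B" if "0 \<le> t" for t
      using E_bound[OF d, of "y + t"] that y by simp
    show "((\<lambda>t. E d (y + t)) has_vector_derivative nu Q d * E d (y + t) - f (y + t)) (at t)"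
      if "0 < t" "t \<notin> {- y}" for t
    proof -
      have e: "(E d has_vector_derivative nu Q d * E d (y + t) - f (y + t)) (at (y + t))"
        using that y by (intro E_der[OF d]) auto
      have "((\<lambda>t. y + t) has_vector_derivative 1) (at t)"
        by (auto intro!: derivative_eq_intros simp flip: has_real_derivative_iff_has_vector_derivative)
      from vector_diff_chain_at[OF this e] show ?thesis by (simp add: o_def)
    qed
  qed (use f_bound in auto)
  then show ?thesis by simp
qed

lemma integrable_f_dens: "integrable lborel (\<lambda>u. dens Q u * f (y + u))"
proof -
  obtain c C where c: "0 < c" "0 \<le> C" "\<And>u. dens Q u \<le> C * exp (- c * \<bar>u\<bar>)"
    using dens_bound[OF Q] by metis
  show ?thesis
  proof (rule integrable_bounded_exp[OF c(1), where B="B * C"])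
    show "norm (complex_of_real (dens Q u) * f (y + u)) \<le> B * C * exp (- c * \<bar>u\<bar>)" for u
      using mult_mono[OF c(3)[of u] f_bound[of "y + u"]] dens_nonneg[OF Q, of u] c
      by (auto simp: norm_mult algebra_simps)
  qed measurable
qed

text \<open>On each side of 0 the jump density is a sum of exponentials, so its convolution with
  \<open>f\<close> splits into the Laplace tails computed by \<open>D_tail\<close> and
  \<open>E_tail\<close>.\<close>

lemma Pf_eq:
  assumes y: "l \<le> y"
  shows "(LINT u|lborel. dens Q u * f (y + u)) = Pf y"
proof -
  let ?m = "\<lambda>k t. indicator {0..} t *\<^sub>R (complex_of_real (exp (- mu Q k * t)) * f (y - t))"
  let ?n = "\<lambda>d t. indicator {0..} t *\<^sub>R (complex_of_real (exp (- nu Q d * t)) * f (y + t))"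
  have im: "integrable lborel (?m k)" if "k \<in> {1..r_neg Q}" for k
    using mu_pos[OF Q that] f_bound integrable_exp_halfline[of "mu Q k" "\<lambda>t. f (y - t)" B]
    by (simp add: set_integrable_def)
  have imr: "integrable lborel (\<lambda>u. ?m k (- u))" if "k \<in> {1..r_neg Q}" for k
    using lborel_integrable_real_affine[OF im[OF that], of "- 1" 0] by simp
  have inn: "integrable lborel (?n d)" if "d \<in> {1..s_pos Q}" for d
    using nu_pos[OF Q that] f_bound integrable_exp_halfline[of "nu Q d" "\<lambda>t. f (y + t)" B]
    by (simp add: set_integrable_def)
  have "(LINT u|lborel. dens Q u * f (y + u)) =
      (LINT u|lborel. (\<Sum>k=1..r_neg Q. complex_of_real (p_neg Q * alpha Q k * mu Q k) * ?m k (- u)) +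
        (\<Sum>d=1..s_pos Q. complex_of_real (q_pos Q * beta Q d * nu Q d) * ?n d u))"
  proof (rule integral_cong_AE)
    show "AE u in lborel. dens Q u * f (y + u) =
      (\<Sum>k=1..r_neg Q. complex_of_real (p_neg Q * alpha Q k * mu Q k) * ?m k (- u)) +
        (\<Sum>d=1..s_pos Q. complex_of_real (q_pos Q * beta Q d * nu Q d) * ?n d u)"
      using AE_lborel_singleton[of 0]
    proof eventually_elim
      case (elim u)
      then consider "u < 0" | "0 < u" by linarith
      then show ?case
      proof cases
        case 1
        then show ?thesis
          by (simp add: dens_def dens_neg_def dens_pos_def sum_distrib_left sum_distrib_right mult_ac)
      next
        case 2
        then show ?thesis
          by (simp add: dens_def dens_neg_def dens_pos_def sum_distrib_left sum_distrib_right mult_ac)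
      qed
    qed
  qed (use borel_measurable_integrable[OF im] in measurable)
  also have "\<dots> = (\<Sum>k=1..r_neg Q. complex_of_real (p_neg Q * alpha Q k * mu Q k) * (LINT u|lborel. ?m k (- u))) +
        (\<Sum>d=1..s_pos Q. complex_of_real (q_pos Q * beta Q d * nu Q d) * (LINT u|lborel. ?n d u))"
    by (rule integral_sum_plus_sum[OF imr inn])
  also have "(\<Sum>k=1..r_neg Q. complex_of_real (p_neg Q * alpha Q k * mu Q k) * (LINT u|lborel. ?m k (- u)))
      = (\<Sum>k=1..r_neg Q. complex_of_real (p_neg Q * alpha Q k * mu Q k) * - D k y)"
  proof (rule sum.cong[OF refl])
    fix k assume k: "k \<in> {1..r_neg Q}"
    have "(LINT u|lborel. ?m k (- u)) = (LINT u|lborel. ?m k u)"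
      using lborel_integral_real_affine[of "- 1" "?m k" 0] by simp
    then show "complex_of_real (p_neg Q * alpha Q k * mu Q k) * (LINT u|lborel. ?m k (- u))
        = complex_of_real (p_neg Q * alpha Q k * mu Q k) * - D k y"
      using D_tail[OF k y] by (simp add: set_lebesgue_integral_def)
  qed
  also have "(\<Sum>d=1..s_pos Q. complex_of_real (q_pos Q * beta Q d * nu Q d) * (LINT u|lborel. ?n d u))
     = (\<Sum>d=1..s_pos Q. complex_of_real (q_pos Q * beta Q d * nu Q d) * E d y)"
    using E_tail y by (intro sum.cong) (auto simp: set_lebesgue_integral_def)
  finally show ?thesis by (simp add: Pf_def sum_negf)
qed

text \<open>An average of \<open>f\<close> under a probability law inherits the bound of
  \<open>f\<close> with the same constant, so \<open>B\<close> bounds \<open>g\<close> as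
  well.\<close>

lemma Pf_bound: "l \<le> y \<Longrightarrow> norm (Pf y) \<le> B"
proof -
  assume y: "l \<le> y"
  interpret J: prob_space "jump_law Q" by (rule law)
  have one: "(\<integral>\<^sup>+u. ennreal (dens Q u) \<partial>lborel) = 1"
    using J.emeasure_space_1 by (simp add: jump_law_dens emeasure_density)
  then have id: "integrable lborel (dens Q)"
    using dens_nonneg[OF Q] by (intro integrableI_nonneg) auto
  have "(LINT u|lborel. dens Q u) = 1"
    using one dens_nonneg[OF Q] by (subst integral_eq_nn_integral) auto
  moreover have "norm (LINT u|lborel. dens Q u * f (y + u)) \<le> (LINT u|lborel. norm (dens Q u * f (y + u)))"
    by (rule integral_norm_bound)
  moreover have "(LINT u|lborel. norm (dens Q u * f (y + u))) \<le> (LINT u|lborel. B * dens Q u)"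
    using id integrable_norm[OF integrable_f_dens[of y]] dens_nonneg[OF Q] f_bound
    by (intro integral_mono) (auto simp: norm_mult mult.commute[of B] intro!: mult_left_mono)
  ultimately show ?thesis using Pf_eq[OF y] by simp
qed

lemma f_cont_pos: "continuous_on ({l<..} - {0}) f"
proof (rule continuous_at_imp_continuous_on, rule ballI)
  fix y assume "y \<in> {l<..} - {0}"
  then obtain f' where "(f has_vector_derivative f') (at y)" using ode by auto
  then show "isCont f y" by (rule has_vector_derivative_continuous)
qed

text \<open>A partial eigenfunction takes the junk value 0 at 0 when \<open>l < 0\<close>; the one-step identity forces the value \<open>Pf 0\<close>.\<close>
definition g :: "real \<Rightarrow> complex" where "g y = (if y = 0 \<and> l < 0 then Pf 0 else f y)"

lemma g_meas[measurable]: "g \<in> borel_measurable borel"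
  unfolding g_def[abs_def] by measurable

lemma integral_law:
  assumes y: "l \<le> y"
  shows "(LINT v|jump_law Q. (if y + v \<le> l then 1 else g (y + v))) = Pf y"
proof -
  have "(LINT v|jump_law Q. (if y + v \<le> l then 1 else g (y + v))) =
      (LINT v|lborel. dens Q v *\<^sub>R (if y + v \<le> l then 1 else g (y + v)))"
    unfolding jump_law_dens using dens_nonneg[OF Q] by (subst integral_density) auto
  also have "\<dots> = (LINT v|lborel. dens Q v * f (y + v))"
  proof (rule integral_cong_AE)
    \<comment> \<open>The integrands can differ only for jumps that land exactly on \<open>l\<close>
      or on 0, and these have probability 0.\<close>
    show "AE v in lborel. dens Q v *\<^sub>R (if y + v \<le> l then 1 else g (y + v)) = dens Q v * f (y + v)"
      using AE_lborel_singleton[of "l - y"] AE_lborel_singleton[of "- y"]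
      by eventually_elim (use f_below in \<open>auto simp: g_def scaleR_conv_of_real\<close>)
  qed measurable
  finally show ?thesis using Pf_eq[OF y] by simp
qed

lemma killed_Pf_measurable: "(\<lambda>u. if u < l then 1 else Pf u) \<in> borel_measurable borel"
proof -
  have "continuous_on {l..} Pf" unfolding Pf_def
    by (intro continuous_intros E_cont continuous_on_subset[OF D_cont]) auto
  then have "Pf \<in> borel_measurable (restrict_space borel {l..})"
    by (rule borel_measurable_continuous_on_restrict)
  then have "(\<lambda>u. if u \<in> {l..} then Pf u else 1) \<in> borel_measurable borel"
    by (subst (asm) measurable_restrict_space_iff) auto
  then show ?thesis by (rule back_subst[of "\<lambda>h. h \<in> borel_measurable borel"]) (auto simp: fun_eq_iff)
qed

text \<open>Along a flow line the function \<open>H s = f (y * exp (kappa * s))\<close> satisfies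
  \<open>H' = lam * H - lam * P\<close>, with \<open>P\<close> the mean after a jump, and
  \<open>laplace_tail\<close> with rate \<open>lam\<close> averages this over the waiting time. At
  \<open>y = 0\<close> the flow rests and the integrand is constant up to the exponential.\<close>

lemma flow_identity:
  assumes y: "l < y"
  shows "(LINT s:{0..}|lborel. complex_of_real (exp (- lam Q * s)) * (complex_of_real (lam Q) * (if y * exp (kappa Q * s) < l then 1 else Pf (y * exp (kappa Q * s))))) = g y"
proof -
  let ?P = "\<lambda>s. if y * exp (kappa Q * s) < l then 1 else Pf (y * exp (kappa Q * s))"
  have lam: "0 < lam Q" using Q by (simp add: admissible_def)
  have Pm: "?P \<in> borel_measurable borel"
    by (rule measurable_compose[OF _ killed_Pf_measurable]) measurable
  have Pb: "norm (?P s) \<le> max 1 B" for s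
    using Pf_bound[of "y * exp (kappa Q * s)"] by (auto simp: not_less le_max_iff_disj)
  show ?thesis
  proof (cases "y = 0")
    case True
    then have l: "l < 0" using y by simp
    have "(LINT s:{0..}|lborel. complex_of_real (exp (- lam Q * s)) * (complex_of_real (lam Q) * Pf 0)) = Pf 0"
      using lam by (intro laplace_tail[where B="norm (lam Q * Pf 0)" and C="norm (Pf 0)" and S="{}" and H="\<lambda>_. Pf 0"]) auto
    then show ?thesis using True l by (simp add: g_def)
  next
    case False
    \<comment> \<open>Times at which the flow line is at \<open>l\<close>, where \<open>f\<close>
      may fail to be differentiable. There is at most one, as the flow is strictly monotone off
      0.\<close>
    define S where "S = {s. y * exp (kappa Q * s) = l}"
    have inj: "s = s'" if "y * exp (kappa Q * s) = y * exp (kappa Q * s')" for s s'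
      using that False kappa by simp
    have finS: "finite S"
    proof (cases "S = {}")
      case False
      then obtain s where s: "s \<in> S" by blast
      have "S \<subseteq> {s}"
      proof
        fix s' assume "s' \<in> S"
        with s have "y * exp (kappa Q * s') = y * exp (kappa Q * s)" by (simp add: S_def)
        then have "s' = s" by (rule inj)
        then show "s' \<in> {s}" by simp
      qed
      then show ?thesis by (rule finite_subset) simp
    qed simp
    have "(LINT s:{0..}|lborel. complex_of_real (exp (- lam Q * s)) * (complex_of_real (lam Q) * ?P s)) = f (y * exp (kappa Q * 0))"
    proof (rule laplace_tail[OF lam _ _ _ _ finS, where C=B and B="lam Q * max 1 B"])
      show "(\<lambda>s. complex_of_real (lam Q) * ?P s) \<in> borel_measurable borel" using Pm by measurable
      show "norm (complex_of_real (lam Q) * ?P s) \<le> lam Q * max 1 B" for s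
        using Pb[of s] lam by (simp add: norm_mult)
      show "norm (f (y * exp (kappa Q * s))) \<le> B" for s by (rule f_bound)
      \<comment> \<open>From \<open>y > 0\<close> the flow line rises and meets neither
        \<open>l\<close> nor 0. From \<open>y < 0\<close> it falls and crosses \<open>l\<close>,
        where continuity of \<open>f\<close> is the assumption \<open>f_cont_neg\<close>.\<close>
      show "continuous_on {0..} (\<lambda>s. f (y * exp (kappa Q * s)))"
      proof (cases "0 < y")
        case True
        show ?thesis
        proof (rule continuous_on_compose2[OF f_cont_pos])
          show "(\<lambda>s. y * exp (kappa Q * s)) ` {0..} \<subseteq> {l<..} - {0}"
          proof (rule image_subsetI)
            fix s :: real assume "s \<in> {0..}"
            then have "y * 1 \<le> y * exp (kappa Q * s)" using True kappa by (intro mult_left_mono) auto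
            then have "l < y * exp (kappa Q * s)" using y by linarith
            then show "y * exp (kappa Q * s) \<in> {l<..} - {0}" using True by simp
          qed
        qed (intro continuous_intros)
      next
        case False
        with \<open>y \<noteq> 0\<close> have "y < 0" by simp
        then show ?thesis using y
          by (intro continuous_on_compose2[OF f_cont_neg] continuous_intros) (auto simp: mult_neg_pos)
      qed
      show "((\<lambda>s. f (y * exp (kappa Q * s))) has_vector_derivative
          lam Q * f (y * exp (kappa Q * s)) - lam Q * ?P s) (at s)" if s: "0 < s" "s \<notin> S" for s
      proof -
        let ?z = "y * exp (kappa Q * s)"
        have zl: "?z \<noteq> l" using s by (simp add: S_def)
        have z0: "?z \<noteq> 0" using False by simp
        have fl: "((\<lambda>s. y * exp (kappa Q * s)) has_vector_derivative kappa Q * ?z) (at s)"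
          by (auto intro!: derivative_eq_intros simp flip: has_real_derivative_iff_has_vector_derivative)
        show ?thesis
        proof (cases "?z < l")
          case True
          have "(f has_vector_derivative 0) (at ?z)"
            by (rule has_vector_derivative_transform_within_open[of "\<lambda>_. 1" _ _ "{..<l}"])
              (use True f_below in auto)
          from vector_diff_chain_at[OF fl this] show ?thesis
            using True f_below[of ?z] by (simp add: o_def)
        next
          case False
          then have zl: "l < ?z" using zl by simp
          have fP: "f ?z - Pf ?z = f ?z + (\<Sum>k=1..r_neg Q. p_neg Q * alpha Q k * mu Q k * D k ?z)
              - (\<Sum>d=1..s_pos Q. q_pos Q * beta Q d * nu Q d * E d ?z)"
            unfolding Pf_def by (rule diff_diff_eq2)
          obtain f' :: complex where f': "(f has_vector_derivative f') (at ?z)" "kappa Q * ?z * f' = lam Q * (f ?z - Pf ?z)"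
            using ode[OF zl z0] unfolding fP by blast
          from vector_diff_chain_at[OF fl f'(1)] show ?thesis
            using False f'(2) by (simp add: o_def scaleR_conv_of_real right_diff_distrib)
        qed
      qed
    qed
    then show ?thesis using False by (simp add: g_def)
  qed
qed

lemma g_bound: "norm (g y) \<le> B"
  using Pf_bound[of 0] f_bound[of y] by (auto simp: g_def)

text \<open>The jump is integrated out first, which gives \<open>Pf\<close> at the state before it;
  the exponential waiting time is then handled by \<open>flow_identity\<close>.\<close>

lemma one_step:
  assumes y: "l < y"
  shows "g y = (\<integral>p. (if y * exp (kappa Q * fst p) < l \<or> y * exp (kappa Q * fst p) + snd p \<le> l
       then 1 else g (y * exp (kappa Q * fst p) + snd p)) \<partial>jump_chain.step (jump_law Q) (lam Q))"
proof -
  interpret C: jump_chain "jump_law Q" "kappa Q" "lam Q" by (rule jump_chain_jump_law[OF Q kappa law])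
  interpret E: prob_space C.E by (rule C.prob_space_E)
  interpret P: pair_prob_space C.E "jump_law Q" ..
  let ?z = "\<lambda>e. y * exp (kappa Q * e)"
  let ?G = "\<lambda>p. (if ?z (fst p) < l \<or> ?z (fst p) + snd p \<le> l then 1 else g (?z (fst p) + snd p))"
  have int: "integrable (C.E \<Otimes>\<^sub>M jump_law Q) ?G"
    by (rule P.integrable_const_bound[of _ "max 1 B"]) (use g_bound in \<open>auto simp: le_max_iff_disj\<close>)
  have "(\<integral>p. ?G p \<partial>C.step) = (\<integral>e. (\<integral>v. ?G (e, v) \<partial>jump_law Q) \<partial>C.E)"
    unfolding C.step_def by (rule P.integral_fst'[OF int, symmetric])
  also have "\<dots> = (\<integral>e. (if ?z e < l then 1 else Pf (?z e)) \<partial>C.E)"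
  proof (rule Bochner_Integration.integral_cong[OF refl])
    fix e
    show "(\<integral>v. ?G (e, v) \<partial>jump_law Q) = (if ?z e < l then 1 else Pf (?z e))"
      using integral_law[of "?z e"] C.J.prob_space by (cases "?z e < l") (simp_all only: fst_conv snd_conv, auto)
  qed
  also have "\<dots> = (\<integral>e. exponential_density (lam Q) e *\<^sub>R (if ?z e < l then 1 else Pf (?z e)) \<partial>lborel)"
  proof (rule integral_density)
    show "(\<lambda>e. if ?z e < l then 1 else Pf (?z e)) \<in> borel_measurable lborel"
      by (rule measurable_compose[OF _ killed_Pf_measurable]) measurable
  qed (use exponential_density_nonneg[OF C.rate_pos] in auto)
  also have "\<dots> = (LINT s:{0..}|lborel. complex_of_real (exp (- lam Q * s)) * (complex_of_real (lam Q) * (if ?z s < l then 1 else Pf (?z s))))"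
    unfolding set_lebesgue_integral_def
    by (intro Bochner_Integration.integral_cong) (auto simp: exponential_density_def scaleR_conv_of_real mult_ac)
  also have "\<dots> = g y" by (rule flow_identity[OF y])
  finally show ?thesis by simp
qed

end

section \<open>Kernel integrals along the contours\<close>

text \<open>
  With \<open>\<sigma> = 1\<close> all contours to the right, and with \<open>\<sigma> = - 1\<close> all contours to the left, are the
  path \<open>gam \<sigma> v\<close> over the line or over the half-line.
\<close>
definition gam :: "real \<Rightarrow> real \<Rightarrow> real \<Rightarrow> complex" where
  "gam \<sigma> v t = complex_of_real (v + \<sigma> * \<bar>t\<bar>) + \<i> * complex_of_real t"

lemma gam_simps[simp]: "Re (gam \<sigma> v t) = v + \<sigma> * \<bar>t\<bar>" "Im (gam \<sigma> v t) = t"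
  by (simp_all add: gam_def)

lemma gam_cont: "continuous_on S (gam \<sigma> v)"
  unfolding gam_def by (intro continuous_intros)

lemma gam_meas[measurable]: "gam \<sigma> v \<in> borel_measurable borel"
  by (rule borel_measurable_continuous_onI[OF gam_cont])

section \<open>Laplace integrals along a bent path\<close>

locale laplace_path =
  fixes \<sigma> v :: real and k :: "real \<Rightarrow> complex"
  assumes sig: "\<sigma> = 1 \<or> \<sigma> = - 1" and k_int: "integrable lborel k"
begin

abbreviation "\<gamma> \<equiv> gam \<sigma> v"

lemma k_meas[measurable]: "k \<in> borel_measurable borel"
  using borel_measurable_integrable[OF k_int] by simp

definition lp :: "real \<Rightarrow> complex" where
  "lp s = (\<integral>t. k t * exp (- (complex_of_real s * \<gamma> t)) \<partial>lborel)"

lemma norm_exp: "0 \<le> \<sigma> * s \<Longrightarrow> norm (exp (- (complex_of_real s * \<gamma> t))) = exp (- s * v - \<bar>s\<bar> * \<bar>t\<bar>)"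
  using sig by (auto simp: algebra_simps abs_if)

lemma norm_exp_le: "0 \<le> \<sigma> * s \<Longrightarrow> norm (exp (- (complex_of_real s * \<gamma> t))) \<le> exp (- s * v)"
  unfolding norm_exp by simp

lemma norm_gam: "norm (\<gamma> t) \<le> \<bar>v\<bar> + 2 * \<bar>t\<bar>"
proof -
  have "norm (\<gamma> t) \<le> \<bar>Re (\<gamma> t)\<bar> + \<bar>Im (\<gamma> t)\<bar>" by (rule cmod_le)
  also have "\<dots> \<le> \<bar>v\<bar> + \<bar>\<sigma> * \<bar>t\<bar>\<bar> + \<bar>t\<bar>" unfolding gam_simps by linarith
  also have "\<bar>\<sigma> * \<bar>t\<bar>\<bar> = \<bar>t\<bar>" using sig by auto
  finally show ?thesis by simp
qed

lemma gam_exp_bound: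
  assumes "0 < c"
  shows "norm (\<gamma> t) * exp (- c * \<bar>t\<bar>) \<le> \<bar>v\<bar> + 2 / c"
proof -
  have "c * \<bar>t\<bar> \<le> exp (c * \<bar>t\<bar>)" using exp_ge_add_one_self[of "c * \<bar>t\<bar>"] by linarith
  then have "\<bar>t\<bar> * exp (- c * \<bar>t\<bar>) \<le> 1 / c"
    using assms by (simp add: exp_minus field_simps)
  moreover have "\<bar>v\<bar> * exp (- c * \<bar>t\<bar>) \<le> \<bar>v\<bar> * 1"
    using assms by (intro mult_left_mono) auto
  moreover have "norm (\<gamma> t) * exp (- c * \<bar>t\<bar>) \<le> (\<bar>v\<bar> + 2 * \<bar>t\<bar>) * exp (- c * \<bar>t\<bar>)"
    by (intro mult_right_mono norm_gam) auto
  ultimately show ?thesis by (simp add: algebra_simps)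
qed

lemma lp_integrable:
  assumes "0 \<le> \<sigma> * s"
  shows "integrable lborel (\<lambda>t. k t * exp (- (complex_of_real s * \<gamma> t)))"
proof (rule Bochner_Integration.integrable_bound)
  show "integrable lborel (\<lambda>t. exp (- s * v) * norm (k t))" using k_int by simp
  show "AE t in lborel. norm (k t * exp (- (complex_of_real s * \<gamma> t))) \<le> norm (exp (- s * v) * norm (k t))"
    using mult_left_mono[OF norm_exp_le[OF assms] norm_ge_zero]
    by (intro AE_I2) (simp add: norm_mult mult.commute)
qed measurable

lemma lp_norm:
  assumes "0 \<le> \<sigma> * s"
  shows "norm (lp s) \<le> exp (- s * v) * (\<integral>t. norm (k t) \<partial>lborel)"
proof -
  have "norm (lp s) \<le> (\<integral>t. norm (k t * exp (- (complex_of_real s * \<gamma> t))) \<partial>lborel)"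
    unfolding lp_def by (rule integral_norm_bound)
  also have "\<dots> \<le> (\<integral>t. exp (- s * v) * norm (k t) \<partial>lborel)"
    using lp_integrable[OF assms] k_int mult_left_mono[OF norm_exp_le[OF assms] norm_ge_zero]
    by (intro integral_mono integrable_norm) (auto simp: norm_mult mult.commute)
  finally show ?thesis by simp
qed

text \<open>The end point \<open>s = 0\<close> is included: the exponential gives no decay there,
  and integrability of \<open>k\<close> alone supplies the dominating function. For
  \<open>l < 0\<close> the pieces are matched at this end point.\<close>

lemma lp_cont: "continuous_on {s. 0 \<le> \<sigma> * s} lp"
  unfolding continuous_on_sequentially
proof (intro allI ballI impI, elim conjE)
  fix x :: "nat \<Rightarrow> real" and a assume a: "\<forall>n. x n \<in> {s. 0 \<le> \<sigma> * s}" and lim: "x \<longlonglongrightarrow> a"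
  obtain M where M: "\<And>n. \<bar>x n\<bar> \<le> M"
    using convergent_imp_Bseq[OF convergentI[OF lim]] by (auto simp: Bseq_def)
  show "(lp \<circ> x) \<longlonglongrightarrow> lp a"
    unfolding lp_def comp_def
  proof (rule integral_dominated_convergence[where w="\<lambda>t. exp (M * \<bar>v\<bar>) * norm (k t)"])
    show "AE t in lborel. (\<lambda>n. k t * exp (- (complex_of_real (x n) * \<gamma> t))) \<longlonglongrightarrow> k t * exp (- (complex_of_real a * \<gamma> t))"
      by (intro AE_I2 tendsto_intros lim)
    show "AE t in lborel. norm (k t * exp (- (complex_of_real (x n) * \<gamma> t))) \<le> exp (M * \<bar>v\<bar>) * norm (k t)" for n
    proof (rule AE_I2)
      fix t
      have "- x n * v \<le> M * \<bar>v\<bar>"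
      proof -
        have "- x n * v \<le> \<bar>x n\<bar> * \<bar>v\<bar>" by (metis abs_ge_self abs_minus_cancel abs_mult)
        also have "\<dots> \<le> M * \<bar>v\<bar>" using M by (intro mult_right_mono) auto
        finally show ?thesis .
      qed
      then have b: "norm (exp (- (complex_of_real (x n) * \<gamma> t))) \<le> exp (M * \<bar>v\<bar>)"
        using norm_exp_le[of "x n" t] a by (smt (verit) exp_le_cancel_iff mem_Collect_eq)
      then show "norm (k t * exp (- (complex_of_real (x n) * \<gamma> t))) \<le> exp (M * \<bar>v\<bar>) * norm (k t)"
        unfolding norm_mult using mult_left_mono[OF b norm_ge_zero[of "k t"]]
        by (simp only: mult.commute[of _ "norm (k t)"])
    qed
  qed (auto simp: k_int)
qed

lemma lpg_integrable:
  assumes s: "0 < \<sigma> * s"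
  shows "integrable lborel (\<lambda>t. k t * \<gamma> t * exp (- (complex_of_real s * \<gamma> t)))"
proof (rule Bochner_Integration.integrable_bound)
  have s0: "0 < \<bar>s\<bar>" using s by auto
  let ?B = "exp (- s * v) * (\<bar>v\<bar> + 2 / \<bar>s\<bar>)"
  show "integrable lborel (\<lambda>t. ?B * norm (k t))" using k_int by simp
  show "AE t in lborel. norm (k t * \<gamma> t * exp (- (complex_of_real s * \<gamma> t))) \<le> norm (?B * norm (k t))"
  proof (rule AE_I2)
    fix t
    have "norm (\<gamma> t) * norm (exp (- (complex_of_real s * \<gamma> t))) = exp (- s * v) * (norm (\<gamma> t) * exp (- \<bar>s\<bar> * \<bar>t\<bar>))"
      using norm_exp[of s t] s by (simp add: exp_diff exp_minus field_simps)
    also have "\<dots> \<le> ?B" using gam_exp_bound[OF s0] by (intro mult_left_mono) auto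
    finally have "norm (k t) * (norm (\<gamma> t) * norm (exp (- (complex_of_real s * \<gamma> t)))) \<le> norm (k t) * ?B"
      by (intro mult_left_mono) auto
    then show "norm (k t * \<gamma> t * exp (- (complex_of_real s * \<gamma> t))) \<le> norm (?B * norm (k t))"
      by (simp add: norm_mult abs_mult mult_ac)
  qed
qed measurable

text \<open>Mean value inequality on the segment from \<open>s\<close> to \<open>x\<close>, along
  which the parameter keeps the sign of \<open>s\<close> and its modulus stays between
  \<open>|s| / 2\<close> and \<open>2 * |s|\<close>. The bound is uniform in \<open>t\<close>, as
  differentiation under the integral requires.\<close>

lemma exp_quotient_bound:
  assumes s: "0 < \<sigma> * s" and h: "\<bar>x - s\<bar> \<le> \<bar>s\<bar> / 2"
  shows "norm (exp (- (complex_of_real x * \<gamma> t)) - exp (- (complex_of_real s * \<gamma> t)))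
    \<le> exp (2 * \<bar>s\<bar> * \<bar>v\<bar>) * (\<bar>v\<bar> + 4 / \<bar>s\<bar>) * norm (complex_of_real x - complex_of_real s)"
proof (rule field_differentiable_bound[where f="\<lambda>z. exp (- (z * \<gamma> t))" and
      f'="\<lambda>z. - \<gamma> t * exp (- (z * \<gamma> t))" and S="closed_segment (complex_of_real s) (complex_of_real x)"])
  have s0: "0 < \<bar>s\<bar> / 2" using s by auto
  fix z assume "z \<in> closed_segment (complex_of_real s) (complex_of_real x)"
  then obtain r where r: "z = complex_of_real r" "r \<in> closed_segment s x"
    unfolding closed_segment_of_real by auto
  then have rs: "\<bar>r - s\<bar> \<le> \<bar>s\<bar> / 2"
    using h by (auto simp: closed_segment_eq_real_ivl split: if_splits)
  have sr: "0 \<le> \<sigma> * r" using sig s rs by (auto simp: abs_if split: if_splits)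
  have r2: "\<bar>s\<bar> / 2 \<le> \<bar>r\<bar>" "\<bar>r\<bar> \<le> 2 * \<bar>s\<bar>" using rs by linarith+
  show "((\<lambda>z. exp (- (z * \<gamma> t))) has_field_derivative - \<gamma> t * exp (- (z * \<gamma> t)))
      (at z within closed_segment (complex_of_real s) (complex_of_real x))"
    by (auto intro!: derivative_eq_intros)
  have "- r * v \<le> 2 * \<bar>s\<bar> * \<bar>v\<bar>"
  proof -
    have "- r * v \<le> \<bar>r\<bar> * \<bar>v\<bar>" by (metis abs_ge_self abs_minus_cancel abs_mult)
    also have "\<dots> \<le> 2 * \<bar>s\<bar> * \<bar>v\<bar>" using r2 by (intro mult_right_mono) auto
    finally show ?thesis .
  qed
  moreover have "\<bar>s\<bar> / 2 * \<bar>t\<bar> \<le> \<bar>r\<bar> * \<bar>t\<bar>" using r2 by (intro mult_right_mono) auto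
  ultimately have "exp (- r * v - \<bar>r\<bar> * \<bar>t\<bar>) \<le> exp (2 * \<bar>s\<bar> * \<bar>v\<bar> + - (\<bar>s\<bar> / 2) * \<bar>t\<bar>)" by simp
  then have "norm (\<gamma> t) * norm (exp (- (z * \<gamma> t))) \<le> norm (\<gamma> t) * (exp (2 * \<bar>s\<bar> * \<bar>v\<bar>) * exp (- (\<bar>s\<bar> / 2) * \<bar>t\<bar>))"
    unfolding r(1) norm_exp[OF sr] exp_add[symmetric] by (intro mult_left_mono) auto
  also have "\<dots> = exp (2 * \<bar>s\<bar> * \<bar>v\<bar>) * (norm (\<gamma> t) * exp (- (\<bar>s\<bar> / 2) * \<bar>t\<bar>))" by simp
  also have "\<dots> \<le> exp (2 * \<bar>s\<bar> * \<bar>v\<bar>) * (\<bar>v\<bar> + 2 / (\<bar>s\<bar> / 2))"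
    using gam_exp_bound[OF s0, of t] by (intro mult_left_mono) auto
  finally show "norm (- \<gamma> t * exp (- (z * \<gamma> t))) \<le> exp (2 * \<bar>s\<bar> * \<bar>v\<bar>) * (\<bar>v\<bar> + 4 / \<bar>s\<bar>)"
    by (simp add: norm_mult)
qed auto

lemma lp_der:
  assumes s: "0 < \<sigma> * s"
  shows "(lp has_vector_derivative - (\<integral>t. k t * \<gamma> t * exp (- (complex_of_real s * \<gamma> t)) \<partial>lborel)) (at s)"
proof -
  let ?D = "- (\<integral>t. k t * \<gamma> t * exp (- (complex_of_real s * \<gamma> t)) \<partial>lborel)"
  have lim: "((\<lambda>x. (lp x - lp s) / complex_of_real (x - s)) \<longlongrightarrow> ?D) (at s)"
    unfolding tendsto_at_iff_sequentially
  proof (intro allI impI)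
    fix X :: "nat \<Rightarrow> real" assume X: "\<forall>i. X i \<in> UNIV - {s}" "X \<longlonglongrightarrow> s"
    have s2: "0 < \<bar>s\<bar> / 2" using s by auto
    obtain n0 where n0: "\<And>n. n0 \<le> n \<Longrightarrow> \<bar>X n - s\<bar> < \<bar>s\<bar> / 2"
      using X(2) s2 unfolding LIMSEQ_iff by (metis real_norm_def)
    \<comment> \<open>Dropping the first \<open>n0\<close> terms keeps every difference quotient
      within the range of the uniform bound.\<close>
    define Y where "Y n = X (n + n0)" for n
    have Y: "Y n \<noteq> s" "\<bar>Y n - s\<bar> \<le> \<bar>s\<bar> / 2" for n
      using X(1) n0[of "n + n0"] by (auto simp: Y_def)
    have Ylim: "Y \<longlonglongrightarrow> s" unfolding Y_def by (rule LIMSEQ_ignore_initial_segment[OF X(2)])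
    have Ys: "0 \<le> \<sigma> * Y n" for n using sig s Y(2)[of n] by (auto simp: abs_if split: if_splits)
    let ?B = "exp (2 * \<bar>s\<bar> * \<bar>v\<bar>) * (\<bar>v\<bar> + 4 / \<bar>s\<bar>)"
    let ?q = "\<lambda>n t. k t * ((exp (- (complex_of_real (Y n) * \<gamma> t)) - exp (- (complex_of_real s * \<gamma> t))) / complex_of_real (Y n - s))"
    have "(\<lambda>n. \<integral>t. ?q n t \<partial>lborel) \<longlonglongrightarrow> (\<integral>t. - (k t * \<gamma> t * exp (- (complex_of_real s * \<gamma> t))) \<partial>lborel)"
    proof (rule integral_dominated_convergence[where w="\<lambda>t. ?B * norm (k t)"])
      show "AE t in lborel. (\<lambda>n. ?q n t) \<longlonglongrightarrow> - (k t * \<gamma> t * exp (- (complex_of_real s * \<gamma> t)))"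
      proof (rule AE_I2)
        fix t
        have "((\<lambda>z. exp (- (z * \<gamma> t))) has_field_derivative - \<gamma> t * exp (- (complex_of_real s * \<gamma> t))) (at (complex_of_real s))"
          by (auto intro!: derivative_eq_intros)
        then have "((\<lambda>z. (exp (- (z * \<gamma> t)) - exp (- (complex_of_real s * \<gamma> t))) / (z - complex_of_real s))
            \<longlongrightarrow> - \<gamma> t * exp (- (complex_of_real s * \<gamma> t))) (at (complex_of_real s))"
          by (simp add: has_field_derivative_iff)
        moreover have "filterlim (\<lambda>n. complex_of_real (Y n)) (at (complex_of_real s)) sequentially"
          using Y(1) Ylim by (auto simp: filterlim_at intro: tendsto_of_real)
        ultimately have "(\<lambda>n. (exp (- (complex_of_real (Y n) * \<gamma> t)) - exp (- (complex_of_real s * \<gamma> t))) / (complex_of_real (Y n) - complex_of_real s))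
            \<longlonglongrightarrow> - \<gamma> t * exp (- (complex_of_real s * \<gamma> t))"
          by (rule filterlim_compose)
        from tendsto_mult[OF tendsto_const[of "k t"] this]
        show "(\<lambda>n. ?q n t) \<longlonglongrightarrow> - (k t * \<gamma> t * exp (- (complex_of_real s * \<gamma> t)))"
          by (simp add: mult.assoc)
      qed
      show "AE t in lborel. norm (?q n t) \<le> ?B * norm (k t)" for n
      proof (rule AE_I2)
        fix t
        have "norm ((exp (- (complex_of_real (Y n) * \<gamma> t)) - exp (- (complex_of_real s * \<gamma> t))) / complex_of_real (Y n - s)) \<le> ?B"
          using exp_quotient_bound[OF s Y(2)[of n], of t] Y(1)[of n]
          by (simp add: norm_divide divide_le_eq del: of_real_diff flip: of_real_diff)
        from mult_left_mono[OF this norm_ge_zero[of "k t"]]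
        show "norm (?q n t) \<le> ?B * norm (k t)"
          unfolding norm_mult[of "k t"] by (simp only: mult.commute[of _ "norm (k t)"])
      qed
    qed (auto simp: k_int)
    also have "(\<lambda>n. \<integral>t. ?q n t \<partial>lborel) = (\<lambda>n. (lp (Y n) - lp s) / complex_of_real (Y n - s))"
    proof
      fix n
      have "(\<integral>t. ?q n t \<partial>lborel) = (\<integral>t. (k t * exp (- (complex_of_real (Y n) * \<gamma> t)) - k t * exp (- (complex_of_real s * \<gamma> t))) / complex_of_real (Y n - s) \<partial>lborel)"
        by (simp add: right_diff_distrib)
      also have "\<dots> = (lp (Y n) - lp s) / complex_of_real (Y n - s)"
        unfolding lp_def using lp_integrable[OF Ys] lp_integrable[of s] s
        by (subst integral_divide_zero) (simp add: Bochner_Integration.integral_diff)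
      finally show "(\<integral>t. ?q n t \<partial>lborel) = (lp (Y n) - lp s) / complex_of_real (Y n - s)" .
    qed
    finally have "(\<lambda>n. (lp (Y n) - lp s) / complex_of_real (Y n - s)) \<longlonglongrightarrow> ?D"
      by simp
    then have "(\<lambda>n. ((\<lambda>x. (lp x - lp s) / complex_of_real (x - s)) \<circ> X) (n + n0)) \<longlonglongrightarrow> ?D"
      by (simp add: Y_def comp_def)
    then show "((\<lambda>x. (lp x - lp s) / complex_of_real (x - s)) \<circ> X) \<longlonglongrightarrow> ?D"
      by (rule LIMSEQ_offset)
  qed
  show ?thesis
    unfolding has_vector_derivative_def has_derivative_iff_norm
  proof (intro conjI bounded_linear_scaleR_left)
    have "((\<lambda>x. norm ((lp x - lp s) / complex_of_real (x - s) - ?D)) \<longlongrightarrow> 0) (at s)"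
      using tendsto_norm_zero[OF LIM_zero[OF lim]] .
    then show "((\<lambda>y. norm (lp y - lp s - (y - s) *\<^sub>R ?D) / norm (y - s)) \<longlongrightarrow> 0) (at s)"
    proof (rule Lim_transform_eventually)
      show "eventually (\<lambda>x. norm ((lp x - lp s) / complex_of_real (x - s) - ?D) = norm (lp x - lp s - (x - s) *\<^sub>R ?D) / norm (x - s)) (at s)"
        unfolding eventually_at_filter
      proof (intro always_eventually allI impI)
        fix x assume "x \<noteq> s"
        then have "(lp x - lp s) / complex_of_real (x - s) - ?D = (lp x - lp s - (x - s) *\<^sub>R ?D) / complex_of_real (x - s)"
          by (simp add: scaleR_conv_of_real diff_divide_distrib add_divide_distrib del: of_real_diff)
        then show "norm ((lp x - lp s) / complex_of_real (x - s) - ?D) = norm (lp x - lp s - (x - s) *\<^sub>R ?D) / norm (x - s)"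
          by (simp only: norm_divide norm_of_real real_norm_def)
      qed
    qed
  qed
qed

end

section \<open>Branches of powers and of the kernel\<close>

lemma power_branch_on_props:
  assumes "power_branch_on D w a h" and "open D" and z: "z \<in> D"
  shows "z \<noteq> complex_of_real w" "norm (h z) = norm (z - complex_of_real w) powr a"
    "(h has_field_derivative h z * (complex_of_real a / (z - complex_of_real w))) (at z)"
proof -
  obtain L where L: "L holomorphic_on D" "\<And>z. z \<in> D \<Longrightarrow> exp (L z) = z - complex_of_real w"
      "\<And>z. z \<in> D \<Longrightarrow> h z = exp (complex_of_real a * L z)"
    using assms(1) by (auto simp: power_branch_on_def)
  show ne: "z \<noteq> complex_of_real w" using L(2)[OF z] exp_not_eq_zero[of "L z"] by auto
  have "norm (z - complex_of_real w) = exp (Re (L z))" using L(2)[OF z] by (metis norm_exp_eq_Re)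
  then show "norm (h z) = norm (z - complex_of_real w) powr a"
    using L(3)[OF z] by (simp add: powr_def)
  have dL: "(L has_field_derivative deriv L z) (at z)"
    using L(1) \<open>open D\<close> z by (rule holomorphic_derivI)
  have "((\<lambda>z. exp (L z)) has_field_derivative exp (L z) * deriv L z) (at z)"
    by (auto intro!: derivative_eq_intros dL)
  moreover have "((\<lambda>z. exp (L z)) has_field_derivative 1) (at z)"
    by (rule has_field_derivative_transform_within_open[OF _ \<open>open D\<close> z, where f="\<lambda>z. z - complex_of_real w"])
      (auto intro!: derivative_eq_intros simp: L(2))
  ultimately have "exp (L z) * deriv L z = 1" by (rule DERIV_unique)
  then have dl: "deriv L z = 1 / (z - complex_of_real w)"
    using ne L(2)[OF z] by (simp add: field_simps)
  have "((\<lambda>z. exp (complex_of_real a * L z)) has_field_derivative exp (complex_of_real a * L z) * (complex_of_real a * deriv L z)) (at z)"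
    by (auto intro!: derivative_eq_intros dL)
  then have "((\<lambda>z. exp (complex_of_real a * L z)) has_field_derivative h z * (complex_of_real a / (z - complex_of_real w))) (at z)"
    by (simp add: L(3)[OF z] dl)
  then show "(h has_field_derivative h z * (complex_of_real a / (z - complex_of_real w))) (at z)"
    by (rule has_field_derivative_transform_within_open[OF _ \<open>open D\<close> z]) (simp add: L(3))
qed

lemma has_field_derivative_prod_log:
  assumes "finite K" "\<And>k. k \<in> K \<Longrightarrow> (A k has_field_derivative A k z * a k) (at z)"
  shows "((\<lambda>z. \<Prod>k\<in>K. A k z) has_field_derivative (\<Prod>k\<in>K. A k z) * (\<Sum>k\<in>K. a k)) (at (z::complex))"
  using assms
proof (induction K rule: finite_induct)
  case (insert k K)
  have "((\<lambda>z. A k z * (\<Prod>k\<in>K. A k z)) has_field_derivative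
      A k z * a k * (\<Prod>k\<in>K. A k z) + (\<Prod>k\<in>K. A k z) * (\<Sum>k\<in>K. a k) * A k z) (at z)"
    using insert by (intro DERIV_mult) auto
  then show ?case using insert(1,2) by (simp add: algebra_simps)
qed simp

definition ksize :: "params \<Rightarrow> nat set \<Rightarrow> complex \<Rightarrow> real" where
  "ksize Q K z = norm z powr (- 1) * (\<Prod>k\<in>K. norm (z - complex_of_real (mu Q k)) powr expo_mu Q k) *
     (\<Prod>d=1..s_pos Q. norm (z - complex_of_real (- nu Q d)) powr expo_nu Q d)"

text \<open>Logarithmic derivative of \<open>z\<close> times the kernel. The factor
  \<open>1 / z\<close> is left out because integration by parts is applied to that product.\<close>

definition klog :: "params \<Rightarrow> nat set \<Rightarrow> complex \<Rightarrow> complex" where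
  "klog Q K z = (\<Sum>k\<in>K. complex_of_real (expo_mu Q k) / (z - complex_of_real (mu Q k))) +
     (\<Sum>d=1..s_pos Q. complex_of_real (expo_nu Q d) / (z - complex_of_real (- nu Q d)))"

text \<open>Modulus and logarithmic derivative do not depend on the branch. Integrability and the
  differential equation are derived from these two alone.\<close>

lemma kernel_branch_props:
  assumes "kernel_branch Q K S \<Psi>" and K: "finite K"
  obtains D where "open D" "S \<subseteq> D"
    "\<And>z. z \<in> D \<Longrightarrow> z \<noteq> 0" "\<And>z k. z \<in> D \<Longrightarrow> k \<in> K \<Longrightarrow> z \<noteq> complex_of_real (mu Q k)"
    "\<And>z d. z \<in> D \<Longrightarrow> d \<in> {1..s_pos Q} \<Longrightarrow> z \<noteq> complex_of_real (- nu Q d)"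
    "\<And>z. z \<in> D \<Longrightarrow> norm (\<Psi> z) = ksize Q K z"
    "\<And>z. z \<in> D \<Longrightarrow> (\<Psi> has_field_derivative \<Psi> z * (- 1 / z + klog Q K z)) (at z)"
proof -
  obtain D A B where D: "open D" "S \<subseteq> D" "0 \<notin> D"
    and A: "\<And>k. k \<in> K \<Longrightarrow> power_branch_on D (mu Q k) (expo_mu Q k) (A k)"
    and B: "\<And>d. d \<in> {1..s_pos Q} \<Longrightarrow> power_branch_on D (- nu Q d) (expo_nu Q d) (B d)"
    and Psi: "\<And>z. z \<in> D \<Longrightarrow> \<Psi> z = inverse z * (\<Prod>k\<in>K. A k z) * (\<Prod>d=1..s_pos Q. B d z)"
    using assms(1) unfolding kernel_branch_def by blast
  note Ap = power_branch_on_props[OF A D(1)] and Bp = power_branch_on_props[OF B D(1)]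
  show ?thesis
  proof (rule that[OF D(1,2)])
    show "z \<noteq> 0" if "z \<in> D" for z using D(3) that by auto
    show "z \<noteq> complex_of_real (mu Q k)" if "z \<in> D" "k \<in> K" for z k using Ap(1)[OF that(2,1)] .
    show "z \<noteq> complex_of_real (- nu Q d)" if "z \<in> D" "d \<in> {1..s_pos Q}" for z d using Bp(1)[OF that(2,1)] .
    show "norm (\<Psi> z) = ksize Q K z" if z: "z \<in> D" for z
    proof -
      have "norm z powr (- 1) = inverse (norm z)" using D(3) z by (auto simp: powr_minus)
      moreover have "(\<Prod>k\<in>K. norm (A k z)) = (\<Prod>k\<in>K. norm (z - complex_of_real (mu Q k)) powr expo_mu Q k)"
        using Ap(2) z by (intro prod.cong) auto
      moreover have "(\<Prod>d=1..s_pos Q. norm (B d z)) = (\<Prod>d=1..s_pos Q. norm (z - complex_of_real (- nu Q d)) powr expo_nu Q d)"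
        using Bp(2) z by (intro prod.cong) auto
      ultimately show ?thesis
        unfolding ksize_def Psi[OF z] by (simp add: norm_mult norm_inverse prod_norm[symmetric])
    qed
    show "(\<Psi> has_field_derivative \<Psi> z * (- 1 / z + klog Q K z)) (at z)" if z: "z \<in> D" for z
    proof (rule has_field_derivative_transform_within_open[OF _ D(1) z])
      have z0: "z \<noteq> 0" using D(3) z by auto
      let ?a = "\<Sum>k\<in>K. complex_of_real (expo_mu Q k) / (z - complex_of_real (mu Q k))"
      let ?b = "\<Sum>d=1..s_pos Q. complex_of_real (expo_nu Q d) / (z - complex_of_real (- nu Q d))"
      have i: "(inverse has_field_derivative inverse z * (- 1 / z)) (at z)"
        using DERIV_inverse[OF z0] by (simp add: divide_inverse power2_eq_square inverse_mult_distrib)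
      have a: "((\<lambda>z. \<Prod>k\<in>K. A k z) has_field_derivative (\<Prod>k\<in>K. A k z) * ?a) (at z)"
        by (rule has_field_derivative_prod_log[OF K]) (use Ap(3) z in auto)
      have b: "((\<lambda>z. \<Prod>d=1..s_pos Q. B d z) has_field_derivative (\<Prod>d=1..s_pos Q. B d z) * ?b) (at z)"
        by (rule has_field_derivative_prod_log) (use Bp(3) z in auto)
      show "((\<lambda>z. inverse z * (\<Prod>k\<in>K. A k z) * (\<Prod>d=1..s_pos Q. B d z)) has_field_derivative
          \<Psi> z * (- 1 / z + klog Q K z)) (at z)"
        by (rule DERIV_cong[OF DERIV_mult[OF DERIV_mult[OF i a] b]])
          (simp add: Psi[OF z] klog_def algebra_simps)
    qed (simp add: Psi)
  qed
qed

section \<open>Size of the kernel along a contour\<close>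

lemma gam_lower:
  assumes sig: "\<sigma> = 1 \<or> \<sigma> = - 1" and w: "w \<noteq> v"
  shows "1 + \<bar>t\<bar> \<le> (2 / \<bar>v - w\<bar> + 1) * norm (gam \<sigma> v t - complex_of_real w)"
proof -
  let ?n = "norm (gam \<sigma> v t - complex_of_real w)"
  have a: "0 < \<bar>v - w\<bar>" using w by simp
  have im: "\<bar>t\<bar> \<le> ?n" using abs_Im_le_cmod[of "gam \<sigma> v t - complex_of_real w"] by simp
  have re: "\<bar>v - w + \<sigma> * \<bar>t\<bar>\<bar> \<le> ?n"
    using abs_Re_le_cmod[of "gam \<sigma> v t - complex_of_real w"] by (simp add: algebra_simps)
  \<comment> \<open>The distance to \<open>w\<close> dominates both the real offset and
    \<open>|t|\<close>, and these two add up to at least \<open>|v - w|\<close>.\<close>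
  have "\<bar>v - w\<bar> \<le> \<bar>v - w + \<sigma> * \<bar>t\<bar>\<bar> + \<bar>\<sigma> * \<bar>t\<bar>\<bar>"
    using abs_triangle_ineq4[of "v - w + \<sigma> * \<bar>t\<bar>" "\<sigma> * \<bar>t\<bar>"] by simp
  moreover have "\<bar>\<sigma> * \<bar>t\<bar>\<bar> = \<bar>t\<bar>" using sig by auto
  ultimately have "\<bar>v - w\<bar> / 2 \<le> ?n" using im re by simp
  then have "1 \<le> 2 / \<bar>v - w\<bar> * ?n" using a by (simp add: field_simps)
  then show ?thesis using im by (simp add: distrib_right)
qed

lemma gam_upper:
  assumes sig: "\<sigma> = 1 \<or> \<sigma> = - 1"
  shows "norm (gam \<sigma> v t - complex_of_real w) \<le> (\<bar>v - w\<bar> + 2) * (1 + \<bar>t\<bar>)"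
proof -
  have "norm (gam \<sigma> v t - complex_of_real w) \<le> \<bar>v + \<sigma> * \<bar>t\<bar> - w\<bar> + \<bar>t\<bar>"
    using cmod_le[of "gam \<sigma> v t - complex_of_real w"] by simp
  moreover have "\<bar>v + \<sigma> * \<bar>t\<bar> - w\<bar> \<le> \<bar>v - w\<bar> + \<bar>t\<bar>" using sig by auto
  moreover have "0 \<le> \<bar>v - w\<bar> * \<bar>t\<bar>" by simp
  moreover have "(\<bar>v - w\<bar> + 2) * (1 + \<bar>t\<bar>) = \<bar>v - w\<bar> + \<bar>v - w\<bar> * \<bar>t\<bar> + 2 + 2 * \<bar>t\<bar>"
    by (simp add: algebra_simps)
  ultimately show ?thesis by linarith
qed

text \<open>The sign of the exponent decides which of the two linear estimates of the distance is
  used. A negative exponent at the vertex itself has to be excluded, since the power is unbounded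
  there.\<close>

lemma gam_powr_bound:
  assumes sig: "\<sigma> = 1 \<or> \<sigma> = - 1" and e: "0 \<le> e \<or> w \<noteq> v"
  shows "\<exists>C\<ge>0. \<forall>t. norm (gam \<sigma> v t - complex_of_real w) powr e \<le> C * (1 + \<bar>t\<bar>) powr e"
proof (cases "0 \<le> e")
  case True
  show ?thesis
  proof (intro exI[of _ "(\<bar>v - w\<bar> + 2) powr e"] conjI allI)
    fix t
    have "norm (gam \<sigma> v t - complex_of_real w) powr e \<le> ((\<bar>v - w\<bar> + 2) * (1 + \<bar>t\<bar>)) powr e"
      using True gam_upper[OF sig] by (intro powr_mono2) auto
    then show "norm (gam \<sigma> v t - complex_of_real w) powr e \<le> (\<bar>v - w\<bar> + 2) powr e * (1 + \<bar>t\<bar>) powr e"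
      by (simp add: powr_mult)
  qed simp
next
  case False
  then have w: "w \<noteq> v" and e: "e < 0" using e by auto
  let ?c = "2 / \<bar>v - w\<bar> + 1"
  have c: "0 < ?c" using w by (simp add: add_pos_pos)
  show ?thesis
  proof (intro exI[of _ "(1 / ?c) powr e"] conjI allI)
    fix t
    have "1 / ?c * (1 + \<bar>t\<bar>) \<le> norm (gam \<sigma> v t - complex_of_real w)"
      using gam_lower[OF sig w, of t] c by (simp add: field_simps del: mult_le_cancel_left)
    then have "norm (gam \<sigma> v t - complex_of_real w) powr e \<le> (1 / ?c * (1 + \<bar>t\<bar>)) powr e"
      using e c by (intro powr_mono2') (auto intro!: mult_pos_pos add_pos_nonneg)
    also have "\<dots> = (1 / ?c) powr e * (1 + \<bar>t\<bar>) powr e"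
      by (rule powr_mult)
    finally show "norm (gam \<sigma> v t - complex_of_real w) powr e \<le> (1 / ?c) powr e * (1 + \<bar>t\<bar>) powr e" .
  qed simp
qed

text \<open>Near parameter 0 a factor contributes a power of \<open>|t|\<close> only if its point is
  the vertex; the other factors stay bounded.\<close>

lemma gam_powr_bound_near:
  assumes sig: "\<sigma> = 1 \<or> \<sigma> = - 1" and e: "0 \<le> e \<or> w \<noteq> v"
  shows "\<exists>C\<ge>0. \<forall>t. t \<noteq> 0 \<and> \<bar>t\<bar> \<le> 1 \<longrightarrow>
    norm (gam \<sigma> v t - complex_of_real w) powr e \<le> C * \<bar>t\<bar> powr (if w = v then e else 0)"
proof (cases "w = v")
  case True
  then have e: "0 \<le> e" using e by simp
  show ?thesis
  proof (intro exI[of _ "2 powr e"] conjI allI impI)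
    fix t
    have "norm (gam \<sigma> v t - complex_of_real w) \<le> 2 * \<bar>t\<bar>"
      using cmod_le[of "gam \<sigma> v t - complex_of_real w"] sig True by auto
    then have "norm (gam \<sigma> v t - complex_of_real w) powr e \<le> (2 * \<bar>t\<bar>) powr e"
      using e by (intro powr_mono2) auto
    then show "norm (gam \<sigma> v t - complex_of_real w) powr e \<le> 2 powr e * \<bar>t\<bar> powr (if w = v then e else 0)"
      using True by (simp add: powr_mult)
  qed simp
next
  case False
  obtain C where C: "0 \<le> C" "\<And>t. norm (gam \<sigma> v t - complex_of_real w) powr e \<le> C * (1 + \<bar>t\<bar>) powr e"
    using gam_powr_bound[OF sig e] by auto
  show ?thesis
  proof (intro exI[of _ "C * max 1 (2 powr e)"] conjI allI impI)
    fix t :: real assume t: "t \<noteq> 0 \<and> \<bar>t\<bar> \<le> 1"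
    have "(1 + \<bar>t\<bar>) powr e \<le> max 1 (2 powr e)"
    proof (cases "0 \<le> e")
      case True
      then have "(1 + \<bar>t\<bar>) powr e \<le> 2 powr e" using t by (intro powr_mono2) auto
      then show ?thesis by simp
    next
      case False
      then have "(1 + \<bar>t\<bar>) powr e \<le> (1 + \<bar>t\<bar>) powr 0" by (intro powr_mono) auto
      also have "\<dots> = 1" by simp
      finally show ?thesis by simp
    qed
    then have "C * (1 + \<bar>t\<bar>) powr e \<le> C * max 1 (2 powr e)" using C by (intro mult_left_mono) auto
    then show "norm (gam \<sigma> v t - complex_of_real w) powr e \<le> C * max 1 (2 powr e) * \<bar>t\<bar> powr (if w = v then e else 0)"
      using C(2)[of t] t False by simp
  qed (use C in simp)
qed

lemma prod_powr_bound:
  fixes f :: "'i \<Rightarrow> 'a \<Rightarrow> real"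
  assumes "finite K" "\<And>k. k \<in> K \<Longrightarrow> \<exists>C\<ge>0. \<forall>t\<in>T. f k t \<le> C * b t powr x k" "\<And>k t. 0 \<le> f k t"
    "\<And>t. t \<in> T \<Longrightarrow> 0 < b t"
  shows "\<exists>C\<ge>0. \<forall>t\<in>T. (\<Prod>k\<in>K. f k t) \<le> C * b t powr (\<Sum>k\<in>K. x k)"
  using assms(1,2)
proof (induction K rule: finite_induct)
  case empty
  have "b t \<noteq> 0" if "t \<in> T" for t using assms(4)[OF that] by simp
  then show ?case by (intro exI[of _ 1]) auto
next
  case (insert k K)
  obtain C1 where C1: "0 \<le> C1" "\<And>t. t \<in> T \<Longrightarrow> f k t \<le> C1 * b t powr x k" using insert(4)[of k] by auto
  obtain C2 where C2: "0 \<le> C2" "\<And>t. t \<in> T \<Longrightarrow> (\<Prod>k\<in>K. f k t) \<le> C2 * b t powr (\<Sum>k\<in>K. x k)"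
    using insert by auto
  show ?case
  proof (intro exI[of _ "C1 * C2"] conjI ballI)
    fix t assume t: "t \<in> T"
    have "f k t * (\<Prod>k\<in>K. f k t) \<le> (C1 * b t powr x k) * (C2 * b t powr (\<Sum>k\<in>K. x k))"
      using C1 C2 t assms(3) by (intro mult_mono) (auto intro!: prod_nonneg)
    then show "(\<Prod>k\<in>insert k K. f k t) \<le> C1 * C2 * b t powr (\<Sum>k\<in>insert k K. x k)"
      using insert(1,2) by (simp add: powr_add mult_ac)
  qed (use C1 C2 in simp)
qed

lemma integrable_even_bound:
  fixes f :: "real \<Rightarrow> real"
  assumes h: "integrable lborel (\<lambda>t. indicator {0..} t * f t)" and even: "\<And>t. f (- t) = f t"
    and m: "f \<in> borel_measurable borel" and nn: "\<And>t. 0 \<le> f t"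
  shows "integrable lborel f"
proof (rule Bochner_Integration.integrable_bound)
  show "integrable lborel (\<lambda>t. indicator {0..} t * f t + indicator {0..} (- t) * f (- t))"
    using h lborel_integrable_real_affine[OF h, of "- 1" 0] by simp
qed (use m nn even in \<open>auto intro!: AE_I2 simp: indicator_def\<close>)

lemma integrable_has_integral_nonneg:
  fixes f :: "real \<Rightarrow> real"
  assumes "(f has_integral I) S" "S \<in> sets borel" "f \<in> borel_measurable borel" "\<And>x. 0 \<le> f x"
  shows "integrable lborel (\<lambda>x. indicator S x * f x)"
proof (rule integrableI_nonneg)
  have "((\<lambda>x. indicator S x * f x) has_integral I) UNIV"
  proof -
    have "(\<lambda>x. indicator S x * f x) = (\<lambda>x. if x \<in> S then f x else 0)" by (auto simp: indicator_def)
    then show ?thesis using assms(1) by (simp only: has_integral_restrict_UNIV)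
  qed
  then have "(\<integral>\<^sup>+x. ennreal (indicator S x * f x) \<partial>lborel) = ennreal I"
    using assms by (intro nn_integral_has_integral_lborel) auto
  then show "(\<integral>\<^sup>+x. ennreal (indicator S x * f x) \<partial>lborel) < \<infinity>" by simp
qed (use assms in auto)

lemma integrable_powr_tail:
  assumes "0 < \<delta>"
  shows "integrable lborel (\<lambda>t::real. (1 + \<bar>t\<bar>) powr (- 1 - \<delta>))"
proof (rule integrable_even_bound)
  have "integrable lborel (\<lambda>x. indicator {1..} x * x powr (- 1 - \<delta>))"
    by (rule integrable_has_integral_nonneg[OF has_integral_powr_to_inf[of "- 1 - \<delta>" 1]]) (use assms in auto)
  from lborel_integrable_real_affine[OF this, of 1 1]
  have "integrable lborel (\<lambda>t. indicator {1..} (1 + t) * (1 + t) powr (- 1 - \<delta>))" by simp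
  also have "(\<lambda>t. indicator {1..} (1 + t) * (1 + t) powr (- 1 - \<delta>)) = (\<lambda>t. indicator {0..} t * (1 + \<bar>t\<bar>) powr (- 1 - \<delta>))"
    by (auto simp: indicator_def fun_eq_iff)
  finally show "integrable lborel (\<lambda>t. indicator {0..} t * (1 + \<bar>t\<bar>) powr (- 1 - \<delta>))" .
qed auto

lemma integrable_powr_origin:
  assumes "0 < e"
  shows "integrable lborel (\<lambda>t::real. indicator {- 1..1} t * \<bar>t\<bar> powr (e - 1))"
proof (rule integrable_even_bound)
  have "integrable lborel (\<lambda>x. indicator {0..1} x * x powr (e - 1))"
    by (rule integrable_has_integral_nonneg[OF has_integral_powr_from_0[of "e - 1" 1]]) (use assms in auto)
  also have "(\<lambda>x. indicator {0..1} x * x powr (e - 1)) = (\<lambda>t. indicator {0..} t * (indicator {- 1..1} t * \<bar>t\<bar> powr (e - 1)))"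
    by (auto simp: indicator_def fun_eq_iff)
  finally show "integrable lborel (\<lambda>t. indicator {0..} t * (indicator {- 1..1} t * \<bar>t\<bar> powr (e - 1)))" .
qed (auto simp: indicator_def)

lemma ksize_nonneg: "0 \<le> ksize Q K z"
  unfolding ksize_def by (intro mult_nonneg_nonneg prod_nonneg) auto

text \<open>The paths have a kink at parameter 0, so the line is split there into two half-lines;
  the boundary values at 0 cancel.\<close>

lemma line_FTC:
  fixes F f :: "real \<Rightarrow> complex"
  assumes cont: "continuous_on UNIV F" and der: "\<And>x. x \<noteq> 0 \<Longrightarrow> (F has_vector_derivative f x) (at x)"
    and int: "integrable lborel f" and lim: "(F \<longlongrightarrow> 0) at_top" "(F \<longlongrightarrow> 0) at_bot"
  shows "(LINT x|lborel. f x) = 0"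
proof -
  have i1: "set_integrable lborel {0..} f"
    unfolding set_integrable_def using int by (intro integrable_mult_indicator) auto
  have int': "integrable lborel (\<lambda>x. - f (- x))"
    using lborel_integrable_real_affine[OF int, of "- 1" 0] by simp
  then have i2: "set_integrable lborel {0..} (\<lambda>x. - f (- x))"
    unfolding set_integrable_def by (intro integrable_mult_indicator) auto
  have h1: "(LINT x:{0..}|lborel. f x) = 0 - F 0"
    by (rule halfline_FTC[where S="{}", OF _ continuous_on_subset[OF cont] _ i1 lim(1)]) (use der in auto)
  have h2: "(LINT x:{0..}|lborel. - f (- x)) = 0 - F (- 0)"
  proof (rule halfline_FTC[where S="{}" and F="\<lambda>x. F (- x)", OF _ _ _ i2])
    show "continuous_on {0..} (\<lambda>x. F (- x))"
      by (rule continuous_on_compose2[OF cont]) (auto intro!: continuous_intros)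
    show "((\<lambda>x. F (- x)) has_vector_derivative - f (- x)) (at x)" if "0 < x" for x
    proof -
      have d: "(F has_vector_derivative f (- x)) (at (- x))" using der that by simp
      have "(uminus has_vector_derivative - 1) (at x)"
        by (auto intro!: derivative_eq_intros simp flip: has_real_derivative_iff_has_vector_derivative)
      from vector_diff_chain_at[OF this d] show ?thesis by (simp add: o_def)
    qed
    show "((\<lambda>x. F (- x)) \<longlongrightarrow> 0) at_top"
      using lim(2) by (simp add: at_bot_mirror filterlim_filtermap)
  qed auto
  have "(LINT x|lborel. f x) = (LINT x|lborel. f (- x))"
    using lborel_integral_real_affine[of "- 1" f 0] by simp
  have "(LINT x|lborel. f x) = (LINT x|lborel. indicator {0..} x *\<^sub>R f x + indicator {0..} (- x) *\<^sub>R f x)"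
  proof (rule integral_cong_AE)
    show "AE x in lborel. f x = indicator {0..} x *\<^sub>R f x + indicator {0..} (- x) *\<^sub>R f x"
      using AE_lborel_singleton[of 0] by eventually_elim (auto simp: indicator_def)
  qed (use borel_measurable_integrable[OF int] in auto)
  also have "\<dots> = (LINT x|lborel. indicator {0..} x *\<^sub>R f x) + (LINT x|lborel. indicator {0..} (- x) *\<^sub>R f x)"
  proof (rule Bochner_Integration.integral_add)
    show "integrable lborel (\<lambda>x. indicator {0..} x *\<^sub>R f x)" using i1 by (simp add: set_integrable_def)
    have "integrable lborel (\<lambda>x. - (indicator {0..} (- x) *\<^sub>R - f (- (- x))))"
      using lborel_integrable_real_affine[OF i2[unfolded set_integrable_def], of "- 1" 0] by simp
    then show "integrable lborel (\<lambda>x. indicator {0..} (- x) *\<^sub>R f x)" by simp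
  qed
  also have "(LINT x|lborel. indicator {0..} (- x) *\<^sub>R f x) = (LINT x|lborel. indicator {0..} x *\<^sub>R f (- x))"
    using lborel_integral_real_affine[of "- 1" "\<lambda>x. indicator {0..} (- x) *\<^sub>R f x" 0] by simp
  also have "\<dots> = - (LINT x:{0..}|lborel. - f (- x))"
    by (simp add: set_lebesgue_integral_def)
  finally show ?thesis using h1 h2 by (simp add: set_lebesgue_integral_def)
qed

definition dgam :: "real \<Rightarrow> real \<Rightarrow> complex" where
  "dgam \<sigma> t = complex_of_real (\<sigma> * sgn t) + \<i>"

lemma gam_der:
  assumes "t \<noteq> 0"
  shows "(gam \<sigma> v has_vector_derivative dgam \<sigma> t) (at t)"
proof -
  have lin: "((\<lambda>t. complex_of_real (v + \<sigma> * (s * t)) + \<i> * complex_of_real t) has_vector_derivative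
      complex_of_real (\<sigma> * s) + \<i>) (at t)" for s
  proof -
    have "((\<lambda>t. v + \<sigma> * (s * t)) has_real_derivative \<sigma> * s) (at t)"
      by (auto intro!: derivative_eq_intros)
    then have "((\<lambda>t. complex_of_real (v + \<sigma> * (s * t))) has_vector_derivative complex_of_real (\<sigma> * s)) (at t)"
      by (rule has_vector_derivative_of_real)
    moreover have "((\<lambda>t. \<i> * complex_of_real t) has_vector_derivative \<i> * complex_of_real 1) (at t)"
      by (intro has_vector_derivative_mult_right has_vector_derivative_of_real DERIV_ident)
    ultimately show ?thesis by (intro has_vector_derivative_add) auto
  qed
  show ?thesis
  proof (cases "0 < t")
    case True
    show ?thesis
      by (rule has_vector_derivative_transform_within_open[OF _ open_greaterThan[of 0], where f="\<lambda>t. complex_of_real (v + \<sigma> * (1 * t)) + \<i> * complex_of_real t"])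
        (use True lin[of 1] in \<open>auto simp: gam_def dgam_def\<close>)
  next
    case False
    show ?thesis
      by (rule has_vector_derivative_transform_within_open[OF _ open_lessThan[of 0], where f="\<lambda>t. complex_of_real (v + \<sigma> * (- 1 * t)) + \<i> * complex_of_real t"])
        (use False assms lin[of "- 1"] in \<open>auto simp: gam_def dgam_def\<close>)
  qed
qed

abbreviation "LP \<equiv> laplace_path.lp"

text \<open>The half-line is \<open>y >= 0\<close> for \<open>\<sigma> = 1\<close> and
  \<open>y <= 0\<close> for \<open>\<sigma> = - 1\<close>. The companions \<open>D\<close> and
  \<open>E\<close> take the place of the exponential tails of \<open>F\<close>, which turns the
  integro-differential equation into a closed linear system. Continuity up to 0 is required for
  gluing when \<open>l < 0\<close>.\<close>

definition side_solution :: "params \<Rightarrow> real \<Rightarrow> (real \<Rightarrow> complex) \<Rightarrow> (nat \<Rightarrow> real \<Rightarrow> complex) \<Rightarrow> (nat \<Rightarrow> real \<Rightarrow> complex) \<Rightarrow> bool" where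
  "side_solution Q \<sigma> F D E \<longleftrightarrow>
     continuous_on {y. 0 \<le> \<sigma> * y} F \<and>
     (\<forall>k\<in>{1..r_neg Q}. continuous_on {y. 0 \<le> \<sigma> * y} (D k)) \<and>
     (\<forall>d\<in>{1..s_pos Q}. continuous_on {y. 0 \<le> \<sigma> * y} (E d)) \<and>
     (\<forall>y. 0 < \<sigma> * y \<longrightarrow>
       (F has_vector_derivative complex_of_real (lam Q / (kappa Q * y)) *
          (F y + (\<Sum>k=1..r_neg Q. complex_of_real (p_neg Q * alpha Q k * mu Q k) * D k y)
            - (\<Sum>d=1..s_pos Q. complex_of_real (q_pos Q * beta Q d * nu Q d) * E d y))) (at y) \<and>
       (\<forall>k\<in>{1..r_neg Q}. (D k has_vector_derivative - complex_of_real (mu Q k) * D k y - F y) (at y)) \<and>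
       (\<forall>d\<in>{1..s_pos Q}. (E d has_vector_derivative complex_of_real (nu Q d) * E d y - F y) (at y)))"

text \<open>\<open>S\<close> is the line for a contour around a singularity and the half-line for
  one starting at a zero. The branch is known only through its modulus and its logarithmic
  derivative, on a domain that excludes the start of a ray.\<close>

locale kernel_contour =
  fixes Q :: params and \<sigma> v :: real and S :: "real set" and \<Psi> :: "complex \<Rightarrow> complex" and dom :: "complex set"
  assumes Q: "admissible Q" and kappa: "0 < kappa Q" and sig: "\<sigma> = 1 \<or> \<sigma> = - 1"
    and v0: "v \<noteq> 0" and S: "S = UNIV \<or> S = {0..}"
    and vee: "S = UNIV \<Longrightarrow> (\<forall>k\<in>{1..r_neg Q}. mu Q k \<noteq> v) \<and> (\<forall>d\<in>{1..s_pos Q}. - nu Q d \<noteq> v)"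
    and ray: "S = {0..} \<Longrightarrow> (\<exists>k\<in>{1..r_neg Q}. mu Q k = v) \<or> (\<exists>d\<in>{1..s_pos Q}. - nu Q d = v)"
    and good: "\<And>k. k \<in> {1..r_neg Q} \<Longrightarrow> mu Q k = v \<Longrightarrow> 0 < expo_mu Q k"
      "\<And>d. d \<in> {1..s_pos Q} \<Longrightarrow> - nu Q d = v \<Longrightarrow> 0 < expo_nu Q d"
    and dom: "open dom" "\<And>t. t \<in> S \<Longrightarrow> t \<noteq> 0 \<or> S = UNIV \<Longrightarrow> gam \<sigma> v t \<in> dom"
    and dom0: "\<And>z. z \<in> dom \<Longrightarrow> z \<noteq> 0"
    and dom_mu: "\<And>z k. z \<in> dom \<Longrightarrow> k \<in> {1..r_neg Q} \<Longrightarrow> z \<noteq> complex_of_real (mu Q k)"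
    and dom_nu: "\<And>z d. z \<in> dom \<Longrightarrow> d \<in> {1..s_pos Q} \<Longrightarrow> z \<noteq> complex_of_real (- nu Q d)"
    and Psi_norm: "\<And>z. z \<in> dom \<Longrightarrow> norm (\<Psi> z) = ksize Q {1..r_neg Q} z"
    and Psi_der: "\<And>z. z \<in> dom \<Longrightarrow> (\<Psi> has_field_derivative \<Psi> z * (- 1 / z + klog Q {1..r_neg Q} z)) (at z)"
begin

abbreviation "\<gamma> \<equiv> gam \<sigma> v"
abbreviation "\<delta> \<equiv> lam Q / kappa Q"

text \<open>Kernel times derivative of the path, extended by 0 so that all integrals run over the
  whole line. Parameter 0 is removed: it is the start of a ray or the kink of a bent
  contour.\<close>

definition kk :: "real \<Rightarrow> complex" where
  "kk t = (if t \<in> S - {0} then \<Psi> (\<gamma> t) * dgam \<sigma> t else 0)"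

lemma delta_pos: "0 < \<delta>"
  using Q kappa by (simp add: admissible_def)

lemma kk_meas[measurable]: "kk \<in> borel_measurable borel"
proof -
  have "continuous_on dom \<Psi>"
    using Psi_der by (intro continuous_at_imp_continuous_on ballI) (auto dest: DERIV_isCont)
  then have "continuous_on (S - {0}) (\<lambda>t. \<Psi> (\<gamma> t))"
    by (rule continuous_on_compose2[OF _ gam_cont]) (use dom in auto)
  then have "(\<lambda>t. \<Psi> (\<gamma> t)) \<in> borel_measurable (restrict_space borel (S - {0}))"
    by (rule borel_measurable_continuous_on_restrict)
  moreover have "S - {0} \<in> sets borel" using S by auto
  ultimately have "(\<lambda>t. if t \<in> S - {0} then \<Psi> (\<gamma> t) else 0) \<in> borel_measurable borel"
    by (subst (asm) measurable_restrict_space_iff) auto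
  then have "(\<lambda>t. (if t \<in> S - {0} then \<Psi> (\<gamma> t) else 0) * dgam \<sigma> t) \<in> borel_measurable borel"
    unfolding dgam_def by measurable
  then show ?thesis unfolding kk_def[abs_def] by (simp add: if_distrib[of "\<lambda>x. x * _"] cong: if_cong)
qed

text \<open>The weights \<open>alpha\<close> and \<open>beta\<close> each sum to 1, and so do
  \<open>p\<close> and \<open>q\<close>. The resulting total exponent is below \<open>- 1\<close>,
  which gives absolute integrability at infinity even without the exponential, that is, for
  \<open>y = 0\<close>.\<close>

lemma expo_sum: "- 1 + (\<Sum>k=1..r_neg Q. expo_mu Q k) + (\<Sum>d=1..s_pos Q. expo_nu Q d) = - 1 - \<delta>"
proof -
  have "(\<Sum>k=1..r_neg Q. expo_mu Q k) = - (p_neg Q * lam Q / kappa Q) * (\<Sum>k=1..r_neg Q. alpha Q k)"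
    unfolding sum_distrib_left expo_mu_def by (intro sum.cong) auto
  moreover have "(\<Sum>d=1..s_pos Q. expo_nu Q d) = - (q_pos Q * lam Q / kappa Q) * (\<Sum>d=1..s_pos Q. beta Q d)"
    unfolding sum_distrib_left expo_nu_def by (intro sum.cong) auto
  moreover have "(\<Sum>k=1..r_neg Q. alpha Q k) = 1" "(\<Sum>d=1..s_pos Q. beta Q d) = 1"
    using Q by (auto simp: admissible_def)
  ultimately show ?thesis by (simp add: algebra_simps diff_divide_distrib)
qed

lemma e_mu: "k \<in> {1..r_neg Q} \<Longrightarrow> 0 \<le> expo_mu Q k \<or> mu Q k \<noteq> v"
  and e_nu: "d \<in> {1..s_pos Q} \<Longrightarrow> 0 \<le> expo_nu Q d \<or> - nu Q d \<noteq> v"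
  using good by force+

lemma ksize_bound: "\<exists>C\<ge>0. \<forall>t. ksize Q {1..r_neg Q} (\<gamma> t) \<le> C * (1 + \<bar>t\<bar>) powr (- 1 - \<delta>)"
proof -
  let ?b = "\<lambda>t::real. 1 + \<bar>t\<bar>"
  have "\<exists>C\<ge>0. \<forall>t\<in>UNIV. (\<Prod>k=1..r_neg Q. norm (\<gamma> t - complex_of_real (mu Q k)) powr expo_mu Q k) \<le> C * ?b t powr (\<Sum>k=1..r_neg Q. expo_mu Q k)"
    by (rule prod_powr_bound) (use gam_powr_bound[OF sig e_mu] in auto)
  then obtain C1 where C1: "0 \<le> C1" "\<And>t. (\<Prod>k=1..r_neg Q. norm (\<gamma> t - complex_of_real (mu Q k)) powr expo_mu Q k) \<le> C1 * ?b t powr (\<Sum>k=1..r_neg Q. expo_mu Q k)" by auto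
  have "\<exists>C\<ge>0. \<forall>t\<in>UNIV. (\<Prod>d=1..s_pos Q. norm (\<gamma> t - complex_of_real (- nu Q d)) powr expo_nu Q d) \<le> C * ?b t powr (\<Sum>d=1..s_pos Q. expo_nu Q d)"
    by (rule prod_powr_bound) (use gam_powr_bound[OF sig e_nu] in auto)
  then obtain C2 where C2: "0 \<le> C2" "\<And>t. (\<Prod>d=1..s_pos Q. norm (\<gamma> t - complex_of_real (- nu Q d)) powr expo_nu Q d) \<le> C2 * ?b t powr (\<Sum>d=1..s_pos Q. expo_nu Q d)" by auto
  obtain C0 where C0: "0 \<le> C0" "\<And>t. norm (\<gamma> t - complex_of_real 0) powr (- 1) \<le> C0 * ?b t powr (- 1)"
    using gam_powr_bound[OF sig, of "- 1" 0 v] v0 by auto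
  show ?thesis
  proof (intro exI[of _ "C0 * C1 * C2"] conjI allI)
    fix t
    have "ksize Q {1..r_neg Q} (\<gamma> t) \<le> (C0 * ?b t powr (- 1)) * (C1 * ?b t powr (\<Sum>k=1..r_neg Q. expo_mu Q k)) * (C2 * ?b t powr (\<Sum>d=1..s_pos Q. expo_nu Q d))"
      unfolding ksize_def using C0(1) C0(2)[of t] C1 C2 by (intro mult_mono) (auto intro!: prod_nonneg)
    also have "\<dots> = C0 * C1 * C2 * ?b t powr (- 1 + (\<Sum>k=1..r_neg Q. expo_mu Q k) + (\<Sum>d=1..s_pos Q. expo_nu Q d))"
      by (simp only: powr_add mult_ac)
    finally show "ksize Q {1..r_neg Q} (\<gamma> t) \<le> C0 * C1 * C2 * (1 + \<bar>t\<bar>) powr (- 1 - \<delta>)"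
      unfolding expo_sum .
  qed (use C0 C1 C2 in simp)
qed

text \<open>A ray starts at a zero, where the kernel vanishes like a positive power \<open>e\<close>
  of the distance. This compensates the pole of the companion that belongs to the same
  point.\<close>

lemma ksize_bound_near:
  assumes "S = {0..}"
  shows "\<exists>e>0. \<exists>C\<ge>0. \<forall>t. t \<noteq> 0 \<and> \<bar>t\<bar> \<le> 1 \<longrightarrow> ksize Q {1..r_neg Q} (\<gamma> t) \<le> C * \<bar>t\<bar> powr e"
proof -
  let ?T = "{t::real. t \<noteq> 0 \<and> \<bar>t\<bar> \<le> 1}"
  let ?em = "\<lambda>k. if mu Q k = v then expo_mu Q k else 0" and ?en = "\<lambda>d. if - nu Q d = v then expo_nu Q d else 0"
  have "\<exists>C\<ge>0. \<forall>t\<in>?T. (\<Prod>k=1..r_neg Q. norm (\<gamma> t - complex_of_real (mu Q k)) powr expo_mu Q k) \<le> C * \<bar>t\<bar> powr (\<Sum>k=1..r_neg Q. ?em k)"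
    by (rule prod_powr_bound) (use gam_powr_bound_near[OF sig e_mu] in auto)
  then obtain C1 where C1: "0 \<le> C1" "\<And>t. t \<in> ?T \<Longrightarrow> (\<Prod>k=1..r_neg Q. norm (\<gamma> t - complex_of_real (mu Q k)) powr expo_mu Q k) \<le> C1 * \<bar>t\<bar> powr (\<Sum>k=1..r_neg Q. ?em k)" by auto
  have "\<exists>C\<ge>0. \<forall>t\<in>?T. (\<Prod>d=1..s_pos Q. norm (\<gamma> t - complex_of_real (- nu Q d)) powr expo_nu Q d) \<le> C * \<bar>t\<bar> powr (\<Sum>d=1..s_pos Q. ?en d)"
    by (rule prod_powr_bound) (use gam_powr_bound_near[OF sig e_nu] in auto)
  then obtain C2 where C2: "0 \<le> C2" "\<And>t. t \<in> ?T \<Longrightarrow> (\<Prod>d=1..s_pos Q. norm (\<gamma> t - complex_of_real (- nu Q d)) powr expo_nu Q d) \<le> C2 * \<bar>t\<bar> powr (\<Sum>d=1..s_pos Q. ?en d)" by auto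
  obtain C0 where C0: "0 \<le> C0" "\<And>t. t \<in> ?T \<Longrightarrow> norm (\<gamma> t - complex_of_real 0) powr (- 1) \<le> C0 * \<bar>t\<bar> powr 0"
    using gam_powr_bound_near[OF sig, of "- 1" 0 v] v0 by auto
  let ?e = "(\<Sum>k=1..r_neg Q. ?em k) + (\<Sum>d=1..s_pos Q. ?en d)"
  have em: "0 \<le> ?em k" if "k \<in> {1..r_neg Q}" for k using good(1)[OF that] by auto
  have en: "0 \<le> ?en d" if "d \<in> {1..s_pos Q}" for d using good(2)[OF that] by auto
  have e: "0 < ?e"
    using ray[OF assms]
  proof
    assume "\<exists>k\<in>{1..r_neg Q}. mu Q k = v"
    then obtain i where i: "i \<in> {1..r_neg Q}" "mu Q i = v" by blast
    then have "0 < (\<Sum>k=1..r_neg Q. ?em k)"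
      using em good(1)[OF i] by (intro sum_pos2[of _ i]) auto
    then show ?thesis using en by (intro add_pos_nonneg sum_nonneg) auto
  next
    assume "\<exists>d\<in>{1..s_pos Q}. - nu Q d = v"
    then obtain i where i: "i \<in> {1..s_pos Q}" "- nu Q i = v" by blast
    then have "0 < (\<Sum>d=1..s_pos Q. ?en d)"
      using en good(2)[OF i] by (intro sum_pos2[of _ i]) auto
    then show ?thesis using em by (intro add_nonneg_pos sum_nonneg) auto
  qed
  show ?thesis
  proof (rule exI[of _ ?e], intro conjI e, rule exI[of _ "C0 * C1 * C2"], intro conjI allI impI)
    fix t :: real assume "t \<noteq> 0 \<and> \<bar>t\<bar> \<le> 1"
    then have t: "t \<in> ?T" by simp
    have "ksize Q {1..r_neg Q} (\<gamma> t) \<le> (C0 * \<bar>t\<bar> powr 0) * (C1 * \<bar>t\<bar> powr (\<Sum>k=1..r_neg Q. ?em k)) * (C2 * \<bar>t\<bar> powr (\<Sum>d=1..s_pos Q. ?en d))"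
      unfolding ksize_def using C0(1) C0(2)[OF t] C1(1) C1(2)[OF t] C2(1) C2(2)[OF t]
      by (intro mult_mono) (auto intro!: prod_nonneg)
    also have "\<dots> = C0 * C1 * C2 * \<bar>t\<bar> powr ?e"
    proof -
      have "\<bar>t\<bar> powr 0 = 1" using t by simp
      then show ?thesis by (simp only: powr_add mult_ac mult_1_left mult_1_right)
    qed
    finally show "ksize Q {1..r_neg Q} (\<gamma> t) \<le> C0 * C1 * C2 * \<bar>t\<bar> powr ?e" .
  qed (use C0 C1 C2 in simp)
qed

lemma norm_dgam: "norm (dgam \<sigma> t) \<le> 2"
proof -
  have "norm (dgam \<sigma> t) \<le> \<bar>\<sigma> * sgn t\<bar> + 1" using cmod_le[of "dgam \<sigma> t"] by (simp add: dgam_def)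
  also have "\<dots> \<le> 2" using sig by (auto simp: sgn_real_def)
  finally show ?thesis .
qed

lemma norm_kk: "norm (kk t) \<le> 2 * ksize Q {1..r_neg Q} (\<gamma> t)"
proof (cases "t \<in> S - {0}")
  case True
  then have "norm (\<Psi> (\<gamma> t)) = ksize Q {1..r_neg Q} (\<gamma> t)" using dom(2) by (intro Psi_norm) auto
  then show ?thesis
    using mult_left_mono[OF norm_dgam norm_ge_zero[of "\<Psi> (\<gamma> t)"], of t] True
    by (auto simp: kk_def norm_mult)
next
  case False
  moreover have "0 \<le> ksize Q {1..r_neg Q} (\<gamma> t)" by (rule ksize_nonneg)
  ultimately show ?thesis by (auto simp: kk_def)
qed

lemma kk_bound: "\<exists>C\<ge>0. \<forall>t. norm (kk t) \<le> C * (1 + \<bar>t\<bar>) powr (- 1 - \<delta>)"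
proof -
  obtain C where C: "0 \<le> C" "\<And>t. ksize Q {1..r_neg Q} (\<gamma> t) \<le> C * (1 + \<bar>t\<bar>) powr (- 1 - \<delta>)"
    using ksize_bound by auto
  show ?thesis
  proof (intro exI[of _ "2 * C"] conjI allI)
    show "norm (kk t) \<le> 2 * C * (1 + \<bar>t\<bar>) powr (- 1 - \<delta>)" for t
      using norm_kk[of t] C(2)[of t] by simp
  qed (use C in simp)
qed

lemma kk_int: "integrable lborel kk"
proof -
  obtain C where C: "0 \<le> C" "\<And>t. norm (kk t) \<le> C * (1 + \<bar>t\<bar>) powr (- 1 - \<delta>)"
    using kk_bound by auto
  show ?thesis
  proof (rule Bochner_Integration.integrable_bound)
    show "integrable lborel (\<lambda>t. C * (1 + \<bar>t\<bar>) powr (- 1 - \<delta>))"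
      using integrable_powr_tail[OF delta_pos] by simp
    show "AE t in lborel. norm (kk t) \<le> norm (C * (1 + \<bar>t\<bar>) powr (- 1 - \<delta>))"
      using C by (intro AE_I2) (simp add: abs_mult)
  qed simp
qed

text \<open>Away from the vertex the new factor is bounded. At the start of a ray the quotient is of
  order \<open>|t| powr (e - 1)\<close> for small \<open>t\<close>, integrable because
  \<open>e > 0\<close>; for \<open>|t| > 1\<close> the divisor has modulus at least 1.\<close>

lemma kk_div_int: "integrable lborel (\<lambda>t. kk t / (\<gamma> t - complex_of_real w))"
  if w: "w \<noteq> v \<or> S = {0..}"
proof (cases "w = v")
  case False
  let ?c = "2 / \<bar>v - w\<bar> + 1"
  show ?thesis
  proof (rule Bochner_Integration.integrable_bound)
    show "integrable lborel (\<lambda>t. ?c * norm (kk t))" using kk_int by simp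
    show "AE t in lborel. norm (kk t / (\<gamma> t - complex_of_real w)) \<le> norm (?c * norm (kk t))"
    proof (rule AE_I2)
      fix t
      have lo: "1 \<le> ?c * norm (\<gamma> t - complex_of_real w)"
        using gam_lower[OF sig False, of t] by linarith
      then have n: "0 < norm (\<gamma> t - complex_of_real w)" by (cases "\<gamma> t = complex_of_real w") auto
      have "norm (kk t) * 1 \<le> norm (kk t) * (?c * norm (\<gamma> t - complex_of_real w))"
        using lo by (rule mult_left_mono) simp
      then have "norm (kk t) / norm (\<gamma> t - complex_of_real w) \<le> ?c * norm (kk t)"
        by (subst pos_divide_le_eq[OF n]) (simp only: mult_ac mult_1_right)
      then show "norm (kk t / (\<gamma> t - complex_of_real w)) \<le> norm (?c * norm (kk t))"
        by (simp add: norm_divide abs_mult)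
    qed
  qed measurable
next
  case True
  then have "S = {0..}" using w by simp
  then obtain e C where e: "0 < e" "0 \<le> C" "\<And>t. t \<noteq> 0 \<and> \<bar>t\<bar> \<le> 1 \<Longrightarrow> ksize Q {1..r_neg Q} (\<gamma> t) \<le> C * \<bar>t\<bar> powr e"
    using ksize_bound_near by meson
  show ?thesis
  proof (rule Bochner_Integration.integrable_bound)
    show "integrable lborel (\<lambda>t. 2 * C * (indicator {- 1..1} t * \<bar>t\<bar> powr (e - 1)) + norm (kk t))"
      using integrable_powr_origin[OF e(1)] kk_int by simp
    show "AE t in lborel. norm (kk t / (\<gamma> t - complex_of_real w)) \<le> norm (2 * C * (indicator {- 1..1} t * \<bar>t\<bar> powr (e - 1)) + norm (kk t))"
    proof (rule AE_I2)
      fix t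
      have im: "\<bar>t\<bar> \<le> norm (\<gamma> t - complex_of_real w)"
        using abs_Im_le_cmod[of "\<gamma> t - complex_of_real w"] by simp
      have nn: "0 \<le> 2 * C * (indicator {- 1..1} t * \<bar>t\<bar> powr (e - 1))" using e by simp
      have "norm (kk t) / norm (\<gamma> t - complex_of_real w) \<le> 2 * C * (indicator {- 1..1} t * \<bar>t\<bar> powr (e - 1)) + norm (kk t)"
      proof (cases "t = 0 \<or> 1 < \<bar>t\<bar>")
        case True
        then show ?thesis
        proof
          assume "t = 0"
          then have "kk t = 0" by (simp add: kk_def)
          then show ?thesis using nn by simp
        next
          assume "1 < \<bar>t\<bar>"
          then have "norm (kk t) / norm (\<gamma> t - complex_of_real w) \<le> norm (kk t) / 1"
            using im by (intro divide_left_mono) auto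
          then show ?thesis using nn by simp
        qed
      next
        case False
        then have t: "t \<noteq> 0 \<and> \<bar>t\<bar> \<le> 1" by simp
        have "norm (kk t) / norm (\<gamma> t - complex_of_real w) \<le> (2 * C * \<bar>t\<bar> powr e) / \<bar>t\<bar>"
          using norm_kk[of t] e(3)[OF t] im t e(2) by (intro frac_le) auto
        also have "\<dots> = 2 * C * \<bar>t\<bar> powr (e - 1)" using t by (simp add: powr_diff)
        also have "\<dots> \<le> 2 * C * (indicator {- 1..1} t * \<bar>t\<bar> powr (e - 1)) + norm (kk t)"
          using t by (simp add: indicator_def abs_le_iff)
        finally show ?thesis .
      qed
      then show "norm (kk t / (\<gamma> t - complex_of_real w)) \<le> norm (2 * C * (indicator {- 1..1} t * \<bar>t\<bar> powr (e - 1)) + norm (kk t))"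
        by (simp add: norm_divide)
    qed
  qed measurable
qed

lemma w_mu: "k \<in> {1..r_neg Q} \<Longrightarrow> mu Q k \<noteq> v \<or> S = {0..}"
  and w_nu: "d \<in> {1..s_pos Q} \<Longrightarrow> - nu Q d \<noteq> v \<or> S = {0..}"
  using S vee by blast+

definition kmu :: "nat \<Rightarrow> real \<Rightarrow> complex" where "kmu k t = kk t / (\<gamma> t - complex_of_real (mu Q k))"
definition knu :: "nat \<Rightarrow> real \<Rightarrow> complex" where "knu d t = kk t / (\<gamma> t - complex_of_real (- nu Q d))"

lemma kmu_int: "k \<in> {1..r_neg Q} \<Longrightarrow> integrable lborel (kmu k)"
  unfolding kmu_def[abs_def] by (rule kk_div_int[OF w_mu])

lemma knu_int: "d \<in> {1..s_pos Q} \<Longrightarrow> integrable lborel (knu d)"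
  unfolding knu_def[abs_def] by (rule kk_div_int[OF w_nu])

text \<open>This is \<open>z / (z - w) = 1 + w / (z - w)\<close> for \<open>w\<close> equal to
  \<open>mu k\<close> or \<open>- nu d\<close>. Multiplication by \<open>z\<close> under the Laplace
  integral is minus the derivative in \<open>y\<close>, hence the equations for the
  companions.\<close>

lemma kmu_gam: "k \<in> {1..r_neg Q} \<Longrightarrow> kmu k t * \<gamma> t = kk t + mu Q k * kmu k t"
  and knu_gam: "d \<in> {1..s_pos Q} \<Longrightarrow> knu d t * \<gamma> t = kk t - nu Q d * knu d t"
proof -
  have g: "kk t = 0 \<or> \<gamma> t \<in> dom" using dom(2)[of t] by (auto simp: kk_def)
  show "kmu k t * \<gamma> t = kk t + mu Q k * kmu k t" if k: "k \<in> {1..r_neg Q}" for k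
  proof (cases "kk t = 0")
    case False
    then have "\<gamma> t - complex_of_real (mu Q k) \<noteq> 0" using g dom_mu[OF _ k] by simp
    then show ?thesis by (simp add: kmu_def field_simps)
  qed (simp add: kmu_def)
  show "knu d t * \<gamma> t = kk t - nu Q d * knu d t" if d: "d \<in> {1..s_pos Q}" for d
  proof (cases "kk t = 0")
    case False
    then have "\<gamma> t - complex_of_real (- nu Q d) \<noteq> 0"
      using g dom_nu[OF _ d, of "\<gamma> t"] unfolding right_minus_eq by blast
    then show ?thesis by (simp add: knu_def field_simps)
  qed (simp add: knu_def)
qed

sublocale L: laplace_path \<sigma> v kk by unfold_locales (rule sig, rule kk_int)

lemma LP_kmu_der:
  assumes k: "k \<in> {1..r_neg Q}" and y: "0 < \<sigma> * y"
  shows "(LP \<sigma> v (kmu k) has_vector_derivative - complex_of_real (mu Q k) * LP \<sigma> v (kmu k) y - L.lp y) (at y)"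
proof -
  interpret K: laplace_path \<sigma> v "kmu k" by unfold_locales (rule sig, rule kmu_int[OF k])
  have i: "integrable lborel (\<lambda>t. kk t * exp (- (complex_of_real y * \<gamma> t)))"
    "integrable lborel (\<lambda>t. kmu k t * exp (- (complex_of_real y * \<gamma> t)))"
    using L.lp_integrable K.lp_integrable y by simp_all
  have I: "(\<integral>t. kmu k t * \<gamma> t * exp (- (complex_of_real y * \<gamma> t)) \<partial>lborel) = L.lp y + complex_of_real (mu Q k) * K.lp y"
    unfolding kmu_gam[OF k] L.lp_def K.lp_def distrib_right mult.assoc
    using i by (subst Bochner_Integration.integral_add) auto
  show ?thesis by (rule has_vector_derivative_eq_rhs[OF K.lp_der[OF y]]) (simp only: I, simp)
qed

lemma LP_knu_der:
  assumes d: "d \<in> {1..s_pos Q}" and y: "0 < \<sigma> * y"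
  shows "(LP \<sigma> v (knu d) has_vector_derivative complex_of_real (nu Q d) * LP \<sigma> v (knu d) y - L.lp y) (at y)"
proof -
  interpret K: laplace_path \<sigma> v "knu d" by unfold_locales (rule sig, rule knu_int[OF d])
  have i: "integrable lborel (\<lambda>t. kk t * exp (- (complex_of_real y * \<gamma> t)))"
    "integrable lborel (\<lambda>t. knu d t * exp (- (complex_of_real y * \<gamma> t)))"
    using L.lp_integrable K.lp_integrable y by simp_all
  have I: "(\<integral>t. knu d t * \<gamma> t * exp (- (complex_of_real y * \<gamma> t)) \<partial>lborel) = L.lp y - complex_of_real (nu Q d) * K.lp y"
    unfolding knu_gam[OF d] L.lp_def K.lp_def left_diff_distrib mult.assoc
    using i by (subst Bochner_Integration.integral_diff) auto
  show ?thesis by (rule has_vector_derivative_eq_rhs[OF K.lp_der[OF y]]) (simp only: I, simp)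
qed

lemma exp_gam_bound: "0 < \<sigma> * y \<Longrightarrow> norm (exp (- (complex_of_real y * \<gamma> t))) \<le> exp (- y * v)"
  by (rule L.norm_exp_le) simp

text \<open>The function \<open>z * \<Psi> z * exp (- y * z)\<close> along the contour. On a ray it
  is continued by 0 through the start, where the positive exponent makes it vanish, so that no
  boundary term arises there.\<close>

definition antider :: "real \<Rightarrow> real \<Rightarrow> complex" where
  "antider y t = (if t \<in> S \<and> (t \<noteq> 0 \<or> S = UNIV) then \<gamma> t * \<Psi> (\<gamma> t) * exp (- (complex_of_real y * \<gamma> t)) else 0)"

lemma norm_antider:
  assumes y: "0 < \<sigma> * y"
  shows "norm (antider y t) \<le> (\<bar>v\<bar> + 2) * (1 + \<bar>t\<bar>) * ksize Q {1..r_neg Q} (\<gamma> t) * exp (- y * v)"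
proof (cases "t \<in> S \<and> (t \<noteq> 0 \<or> S = UNIV)")
  case True
  then have "norm (\<Psi> (\<gamma> t)) = ksize Q {1..r_neg Q} (\<gamma> t)" using dom(2) by (intro Psi_norm) auto
  moreover have "norm (\<gamma> t) \<le> (\<bar>v\<bar> + 2) * (1 + \<bar>t\<bar>)" using gam_upper[OF sig, of v t 0] by simp
  ultimately show ?thesis
    using True exp_gam_bound[OF y, of t] by (auto simp: antider_def norm_mult ksize_nonneg intro!: mult_mono mult_nonneg_nonneg)
next
  case False
  moreover have "0 \<le> ksize Q {1..r_neg Q} (\<gamma> t)" by (rule ksize_nonneg)
  ultimately show ?thesis by (auto simp: antider_def)
qed

lemma antider_der:
  assumes t: "t \<noteq> 0"
  shows "(antider y has_vector_derivative
    kk t * (klog Q {1..r_neg Q} (\<gamma> t) - complex_of_real y) * \<gamma> t * exp (- (complex_of_real y * \<gamma> t))) (at t)"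
proof (cases "t \<in> S")
  case True
  let ?g = "\<lambda>z. z * \<Psi> z * exp (- (complex_of_real y * z))"
  have z: "\<gamma> t \<in> dom" using dom(2)[OF True] t by simp
  have "(?g has_field_derivative \<Psi> (\<gamma> t) * \<gamma> t * (klog Q {1..r_neg Q} (\<gamma> t) - complex_of_real y) * exp (- (complex_of_real y * \<gamma> t))) (at (\<gamma> t))"
    by (rule derivative_eq_intros Psi_der[OF z] refl)+ (use dom0[OF z] in \<open>simp add: field_simps\<close>)
  from field_vector_diff_chain_at[OF gam_der[OF t] this]
  have d: "((\<lambda>t. ?g (\<gamma> t)) has_vector_derivative
    kk t * (klog Q {1..r_neg Q} (\<gamma> t) - complex_of_real y) * \<gamma> t * exp (- (complex_of_real y * \<gamma> t))) (at t)"
    using True t by (simp add: o_def kk_def mult_ac)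
  show ?thesis
  proof (rule has_vector_derivative_transform_within_open[OF d, of "if S = UNIV then UNIV else {0<..}"])
    show "t \<in> (if S = UNIV then UNIV else {0<..})" using True t S by auto
    show "?g (\<gamma> x) = antider y x" if "x \<in> (if S = UNIV then UNIV else {0<..})" for x
      using that S by (auto simp: antider_def split: if_splits)
  qed auto
next
  case False
  then have S0: "S = {0..}" "t < 0" using S by auto
  have z: "antider y x = 0" if "x < 0" for x
    unfolding antider_def using that S0(1) by auto
  have "(antider y has_vector_derivative 0) (at t)"
    by (rule has_vector_derivative_transform_within_open[of "\<lambda>_. 0" _ _ "{..<0}"]) (use S0(2) z in auto)
  then show ?thesis using False by (simp add: kk_def)
qed

lemma antider_cont:
  assumes y: "0 < \<sigma> * y"
  shows "continuous_on UNIV (antider y)"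
proof (cases "S = UNIV")
  case True
  have "continuous_on dom \<Psi>"
    using Psi_der by (intro continuous_at_imp_continuous_on ballI) (auto dest: DERIV_isCont)
  then have "continuous_on UNIV (\<lambda>t. \<Psi> (\<gamma> t))"
    by (rule continuous_on_compose2[OF _ gam_cont]) (use dom True in auto)
  then have "continuous_on UNIV (\<lambda>t. \<gamma> t * \<Psi> (\<gamma> t) * exp (- (complex_of_real y * \<gamma> t)))"
    by (intro continuous_intros gam_cont)
  then show ?thesis unfolding antider_def[abs_def] using True by simp
next
  case False
  then have S0: "S = {0..}" using S by auto
  obtain e C where e: "0 < e" "0 \<le> C" "\<And>t. t \<noteq> 0 \<and> \<bar>t\<bar> \<le> 1 \<Longrightarrow> ksize Q {1..r_neg Q} (\<gamma> t) \<le> C * \<bar>t\<bar> powr e"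
    using ksize_bound_near[OF S0] by meson
  have "isCont (antider y) t" for t
  proof (cases "t = 0")
    case False
    then show ?thesis using antider_der by (intro has_vector_derivative_continuous)
  next
    case True
    let ?B = "(\<bar>v\<bar> + 2) * 2 * C * exp (- y * v)"
    have "(antider y \<longlongrightarrow> 0) (at 0)"
    proof (rule Lim_null_comparison)
      show "eventually (\<lambda>t. norm (antider y t) \<le> ?B * \<bar>t\<bar> powr e) (at 0)"
        unfolding eventually_at
      proof (intro exI[of _ 1] conjI ballI impI)
        fix t :: real assume t: "t \<noteq> 0 \<and> dist t 0 < 1"
        then have t': "t \<noteq> 0 \<and> \<bar>t\<bar> \<le> 1" by (simp add: dist_real_def)
        have "(\<bar>v\<bar> + 2) * (1 + \<bar>t\<bar>) * ksize Q {1..r_neg Q} (\<gamma> t) * exp (- y * v)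
            \<le> (\<bar>v\<bar> + 2) * 2 * (C * \<bar>t\<bar> powr e) * exp (- y * v)"
          using t' e(2) e(3)[OF t'] by (intro mult_mono mult_nonneg_nonneg) (auto simp: ksize_nonneg)
        also have "\<dots> = ?B * \<bar>t\<bar> powr e" by (simp only: mult_ac)
        finally show "norm (antider y t) \<le> ?B * \<bar>t\<bar> powr e"
          using norm_antider[OF y, of t] by (rule order_trans[rotated])
      qed simp
      have "((\<lambda>t. \<bar>t\<bar> powr e) \<longlongrightarrow> 0) (at (0::real))"
      proof (rule tendsto_zero_powrI)
        show "((\<lambda>t::real. \<bar>t\<bar>) \<longlongrightarrow> 0) (at 0)" using tendsto_rabs[OF tendsto_ident_at[of 0 UNIV]] by simp
      qed (use e in \<open>auto intro!: always_eventually\<close>)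
      from tendsto_mult_left[OF this, of ?B]
      show "((\<lambda>t. ?B * \<bar>t\<bar> powr e) \<longlongrightarrow> 0) (at 0)" by simp
    qed
    moreover have "antider y 0 = 0" unfolding antider_def using \<open>S \<noteq> UNIV\<close> by simp
    ultimately show ?thesis using True by (simp add: isCont_def)
  qed
  then show ?thesis by (intro continuous_at_imp_continuous_on ballI)
qed

text \<open>The factor \<open>z\<close> costs one power, and the remaining
  \<open>(1 + |t|) powr (- lam / kappa)\<close> still tends to 0; of the exponential only
  boundedness is used.\<close>

lemma antider_tendsto:
  assumes y: "0 < \<sigma> * y" and F: "filterlim (\<lambda>t::real. 1 + \<bar>t\<bar>) at_top F"
  shows "(antider y \<longlongrightarrow> 0) F"
proof -
  obtain C where C: "0 \<le> C" "\<And>t. ksize Q {1..r_neg Q} (\<gamma> t) \<le> C * (1 + \<bar>t\<bar>) powr (- 1 - \<delta>)"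
    using ksize_bound by auto
  let ?B = "(\<bar>v\<bar> + 2) * C * exp (- y * v)"
  show ?thesis
  proof (rule Lim_null_comparison[OF always_eventually], intro allI)
    fix t
    have "norm (antider y t) \<le> (\<bar>v\<bar> + 2) * (1 + \<bar>t\<bar>) * (C * (1 + \<bar>t\<bar>) powr (- 1 - \<delta>)) * exp (- y * v)"
      using C(2)[of t] by (intro order_trans[OF norm_antider[OF y, of t]] mult_right_mono mult_left_mono) auto
    also have "\<dots> = ?B * ((1 + \<bar>t\<bar>) powr 1 * (1 + \<bar>t\<bar>) powr (- 1 - \<delta>))" by simp
    also have "(1 + \<bar>t\<bar>) powr 1 * (1 + \<bar>t\<bar>) powr (- 1 - \<delta>) = (1 + \<bar>t\<bar>) powr (- \<delta>)"
      by (subst powr_add[symmetric]) simp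
    finally show "norm (antider y t) \<le> ?B * (1 + \<bar>t\<bar>) powr (- \<delta>)" .
  next
    have "((\<lambda>t. (1 + \<bar>t\<bar>) powr (- \<delta>)) \<longlongrightarrow> 0) F"
      using delta_pos by (intro tendsto_neg_powr F) simp
    from tendsto_mult_left[OF this, of ?B]
    show "((\<lambda>t. ?B * (1 + \<bar>t\<bar>) powr (- \<delta>)) \<longlongrightarrow> 0) F" by simp
  qed
qed

lemma klog_kk: "kk t * klog Q {1..r_neg Q} (\<gamma> t) =
    (\<Sum>k=1..r_neg Q. complex_of_real (expo_mu Q k) * kmu k t) + (\<Sum>d=1..s_pos Q. complex_of_real (expo_nu Q d) * knu d t)"
  unfolding klog_def kmu_def knu_def distrib_left sum_distrib_left by (simp add: mult_ac)

text \<open>Integration by parts of \<open>z * \<Psi> z * exp (- y * z)\<close>, whose logarithmic derivative has simple poles only.\<close>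
lemma by_parts:
  assumes y: "0 < \<sigma> * y"
  shows "complex_of_real y * (\<integral>t. kk t * \<gamma> t * exp (- (complex_of_real y * \<gamma> t)) \<partial>lborel) =
    (\<Sum>k=1..r_neg Q. complex_of_real (expo_mu Q k) * (L.lp y + mu Q k * LP \<sigma> v (kmu k) y)) +
    (\<Sum>d=1..s_pos Q. complex_of_real (expo_nu Q d) * (L.lp y - nu Q d * LP \<sigma> v (knu d) y))"
proof -
  let ?e = "\<lambda>t. exp (- (complex_of_real y * \<gamma> t))"
  have im: "integrable lborel (\<lambda>t. kmu k t * \<gamma> t * ?e t)"
    and vm: "(\<integral>t. kmu k t * \<gamma> t * ?e t \<partial>lborel) = L.lp y + mu Q k * LP \<sigma> v (kmu k) y"
    if k: "k \<in> {1..r_neg Q}" for k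
  proof -
    interpret K: laplace_path \<sigma> v "kmu k" by unfold_locales (rule sig, rule kmu_int[OF k])
    show "integrable lborel (\<lambda>t. kmu k t * \<gamma> t * ?e t)" by (rule K.lpg_integrable[OF y])
    have "integrable lborel (\<lambda>t. kk t * ?e t)" "integrable lborel (\<lambda>t. kmu k t * ?e t)"
      using L.lp_integrable K.lp_integrable y by simp_all
    then show "(\<integral>t. kmu k t * \<gamma> t * ?e t \<partial>lborel) = L.lp y + mu Q k * LP \<sigma> v (kmu k) y"
      unfolding kmu_gam[OF k] L.lp_def K.lp_def distrib_right mult.assoc
      by (subst Bochner_Integration.integral_add) auto
  qed
  have inn: "integrable lborel (\<lambda>t. knu d t * \<gamma> t * ?e t)"
    and vn: "(\<integral>t. knu d t * \<gamma> t * ?e t \<partial>lborel) = L.lp y - nu Q d * LP \<sigma> v (knu d) y"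
    if d: "d \<in> {1..s_pos Q}" for d
  proof -
    interpret K: laplace_path \<sigma> v "knu d" by unfold_locales (rule sig, rule knu_int[OF d])
    show "integrable lborel (\<lambda>t. knu d t * \<gamma> t * ?e t)" by (rule K.lpg_integrable[OF y])
    have "integrable lborel (\<lambda>t. kk t * ?e t)" "integrable lborel (\<lambda>t. knu d t * ?e t)"
      using L.lp_integrable K.lp_integrable y by simp_all
    then show "(\<integral>t. knu d t * \<gamma> t * ?e t \<partial>lborel) = L.lp y - nu Q d * LP \<sigma> v (knu d) y"
      unfolding knu_gam[OF d] L.lp_def K.lp_def left_diff_distrib mult.assoc
      by (subst Bochner_Integration.integral_diff) auto
  qed
  let ?s = "\<lambda>t. (\<Sum>k=1..r_neg Q. complex_of_real (expo_mu Q k) * (kmu k t * \<gamma> t * ?e t)) +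
      (\<Sum>d=1..s_pos Q. complex_of_real (expo_nu Q d) * (knu d t * \<gamma> t * ?e t))"
  have expand: "kk t * (klog Q {1..r_neg Q} (\<gamma> t) - complex_of_real y) * \<gamma> t * ?e t
      = ?s t - complex_of_real y * (kk t * \<gamma> t * ?e t)" for t
    unfolding right_diff_distrib klog_kk left_diff_distrib distrib_right sum_distrib_right by (simp add: mult_ac)
  have int_s: "integrable lborel ?s"
    using im inn by (intro Bochner_Integration.integrable_add Bochner_Integration.integrable_sum integrable_mult_right) auto
  have ik: "integrable lborel (\<lambda>t. complex_of_real y * (kk t * \<gamma> t * ?e t))"
    using L.lpg_integrable[OF y] by (intro integrable_mult_right)
  have "(\<integral>t. ?s t - complex_of_real y * (kk t * \<gamma> t * ?e t) \<partial>lborel) = 0"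
  proof (rule line_FTC[OF antider_cont[OF y]])
    show "(antider y has_vector_derivative ?s t - complex_of_real y * (kk t * \<gamma> t * ?e t)) (at t)" if "t \<noteq> 0" for t
      using antider_der[OF that, of y] unfolding expand .
    show "integrable lborel (\<lambda>t. ?s t - complex_of_real y * (kk t * \<gamma> t * ?e t))"
      by (rule Bochner_Integration.integrable_diff[OF int_s ik])
    show "(antider y \<longlongrightarrow> 0) at_top"
      by (rule antider_tendsto[OF y filterlim_at_top_mono[OF filterlim_ident always_eventually]]) auto
    show "(antider y \<longlongrightarrow> 0) at_bot"
      by (rule antider_tendsto[OF y filterlim_at_top_mono[OF filterlim_uminus_at_top_at_bot always_eventually]]) auto
  qed
  then have "(\<integral>t. ?s t \<partial>lborel) = (\<integral>t. complex_of_real y * (kk t * \<gamma> t * ?e t) \<partial>lborel)"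
    unfolding Bochner_Integration.integral_diff[OF int_s ik] by (simp only: right_minus_eq)
  then have "complex_of_real y * (\<integral>t. kk t * \<gamma> t * ?e t \<partial>lborel) = (\<integral>t. ?s t \<partial>lborel)"
    by (simp only: integral_mult_right_zero)
  also have "\<dots> = (\<Sum>k=1..r_neg Q. complex_of_real (expo_mu Q k) * (\<integral>t. kmu k t * \<gamma> t * ?e t \<partial>lborel)) +
      (\<Sum>d=1..s_pos Q. complex_of_real (expo_nu Q d) * (\<integral>t. knu d t * \<gamma> t * ?e t \<partial>lborel))"
    by (rule integral_sum_plus_sum[OF im inn])
  finally show ?thesis by (simp add: vm vn)
qed

lemma lp_ode:
  assumes y: "0 < \<sigma> * y"
  shows "(L.lp has_vector_derivative complex_of_real (lam Q / (kappa Q * y)) *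
          (L.lp y + (\<Sum>k=1..r_neg Q. complex_of_real (p_neg Q * alpha Q k * mu Q k) * LP \<sigma> v (kmu k) y)
            - (\<Sum>d=1..s_pos Q. complex_of_real (q_pos Q * beta Q d * nu Q d) * LP \<sigma> v (knu d) y))) (at y)"
proof (rule has_vector_derivative_eq_rhs[OF L.lp_der[OF y]])
  let ?I = "\<integral>t. kk t * \<gamma> t * exp (- (complex_of_real y * \<gamma> t)) \<partial>lborel"
  let ?l = "L.lp y" and ?D = "\<lambda>k. LP \<sigma> v (kmu k) y" and ?E = "\<lambda>d. LP \<sigma> v (knu d) y"
  let ?c = "complex_of_real (lam Q / kappa Q)"
  have y0: "y \<noteq> 0" using y by auto
  have gen: "a = c / z * b" if "z \<noteq> 0" "z * a = c * b" for a b c z :: complex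
    using that by (simp add: field_simps)
  \<comment> \<open>With these sums the terms in \<open>?l\<close> collect to \<open>p\<close> from
    the points \<open>mu\<close> and \<open>q\<close> from the points \<open>- nu\<close>, together
    1: the coefficient of \<open>F\<close> in the system.\<close>
  have sa: "(\<Sum>k=1..r_neg Q. complex_of_real (alpha Q k)) = 1" and sb: "(\<Sum>d=1..s_pos Q. complex_of_real (beta Q d)) = 1"
    using Q unfolding of_real_sum[symmetric] by (auto simp: admissible_def)
  have 1: "(\<Sum>k=1..r_neg Q. complex_of_real (expo_mu Q k) * (?l + mu Q k * ?D k)) =
      - ?c * (complex_of_real (p_neg Q) * ?l + (\<Sum>k=1..r_neg Q. complex_of_real (p_neg Q * alpha Q k * mu Q k) * ?D k))"
  proof -
    have "(\<Sum>k=1..r_neg Q. complex_of_real (expo_mu Q k) * (?l + mu Q k * ?D k)) =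
      (\<Sum>k=1..r_neg Q. - ?c * (complex_of_real (p_neg Q) * ?l * complex_of_real (alpha Q k) + complex_of_real (p_neg Q * alpha Q k * mu Q k) * ?D k))"
      by (intro sum.cong) (auto simp: expo_mu_def algebra_simps)
    also have "\<dots> = - ?c * (complex_of_real (p_neg Q) * ?l * (\<Sum>k=1..r_neg Q. complex_of_real (alpha Q k)) + (\<Sum>k=1..r_neg Q. complex_of_real (p_neg Q * alpha Q k * mu Q k) * ?D k))"
      by (simp only: sum_distrib_left[symmetric] sum.distrib)
    finally show ?thesis by (simp only: sa mult_1_right)
  qed
  have 2: "(\<Sum>d=1..s_pos Q. complex_of_real (expo_nu Q d) * (?l - nu Q d * ?E d)) =
      - ?c * (complex_of_real (q_pos Q) * ?l - (\<Sum>d=1..s_pos Q. complex_of_real (q_pos Q * beta Q d * nu Q d) * ?E d))"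
  proof -
    have "(\<Sum>d=1..s_pos Q. complex_of_real (expo_nu Q d) * (?l - nu Q d * ?E d)) =
      (\<Sum>d=1..s_pos Q. - ?c * (complex_of_real (q_pos Q) * ?l * complex_of_real (beta Q d) - complex_of_real (q_pos Q * beta Q d * nu Q d) * ?E d))"
    proof (rule sum.cong[OF refl])
      fix d
      define q where "q = q_pos Q"
      show "complex_of_real (expo_nu Q d) * (?l - nu Q d * ?E d) =
        - ?c * (complex_of_real (q_pos Q) * ?l * complex_of_real (beta Q d) - complex_of_real (q_pos Q * beta Q d * nu Q d) * ?E d)"
        unfolding expo_nu_def q_def[symmetric] by (simp add: algebra_simps)
    qed
    also have "\<dots> = - ?c * (complex_of_real (q_pos Q) * ?l * (\<Sum>d=1..s_pos Q. complex_of_real (beta Q d)) - (\<Sum>d=1..s_pos Q. complex_of_real (q_pos Q * beta Q d * nu Q d) * ?E d))"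
      by (simp only: sum_distrib_left[symmetric] sum_subtractf)
    finally show ?thesis by (simp only: sb mult_1_right)
  qed
  have "complex_of_real y * ?I = - ?c * (?l + (\<Sum>k=1..r_neg Q. complex_of_real (p_neg Q * alpha Q k * mu Q k) * ?D k)
            - (\<Sum>d=1..s_pos Q. complex_of_real (q_pos Q * beta Q d * nu Q d) * ?E d))"
    unfolding by_parts[OF y] 1 2 by (simp add: algebra_simps)
  then have "complex_of_real y * - ?I = ?c * (?l + (\<Sum>k=1..r_neg Q. complex_of_real (p_neg Q * alpha Q k * mu Q k) * ?D k)
            - (\<Sum>d=1..s_pos Q. complex_of_real (q_pos Q * beta Q d * nu Q d) * ?E d))"
    by simp
  then have "- ?I = (?c / complex_of_real y) * (?l + (\<Sum>k=1..r_neg Q. complex_of_real (p_neg Q * alpha Q k * mu Q k) * ?D k)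
            - (\<Sum>d=1..s_pos Q. complex_of_real (q_pos Q * beta Q d * nu Q d) * ?E d))"
  proof (rule gen[rotated])
    show "complex_of_real y \<noteq> 0" using y0 by simp
  qed
  then show "- ?I = complex_of_real (lam Q / (kappa Q * y)) * (?l + (\<Sum>k=1..r_neg Q. complex_of_real (p_neg Q * alpha Q k * mu Q k) * ?D k)
            - (\<Sum>d=1..s_pos Q. complex_of_real (q_pos Q * beta Q d * nu Q d) * ?E d))"
    by simp
qed

theorem side_solution: "side_solution Q \<sigma> L.lp (\<lambda>k. LP \<sigma> v (kmu k)) (\<lambda>d. LP \<sigma> v (knu d))"
  unfolding side_solution_def
proof (intro conjI ballI allI impI)
  show "continuous_on {y. 0 \<le> \<sigma> * y} L.lp" by (rule L.lp_cont)
  show "continuous_on {y. 0 \<le> \<sigma> * y} (LP \<sigma> v (kmu k))" if "k \<in> {1..r_neg Q}" for k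
    by (rule laplace_path.lp_cont) (unfold_locales, rule sig, rule kmu_int[OF that])
  show "continuous_on {y. 0 \<le> \<sigma> * y} (LP \<sigma> v (knu d))" if "d \<in> {1..s_pos Q}" for d
    by (rule laplace_path.lp_cont) (unfold_locales, rule sig, rule knu_int[OF that])
qed (use lp_ode LP_kmu_der LP_knu_der in auto)

lemma lp_exp_bound: "\<exists>C\<ge>0. \<forall>y. 0 \<le> \<sigma> * y \<longrightarrow> norm (L.lp y) \<le> C * exp (- y * v)"
  using L.lp_norm by (intro exI[of _ "\<integral>t. norm (kk t) \<partial>lborel"]) (auto simp: mult.commute)

lemma knu_exp_bound: "d \<in> {1..s_pos Q} \<Longrightarrow> \<exists>C\<ge>0. \<forall>y. 0 \<le> \<sigma> * y \<longrightarrow> norm (LP \<sigma> v (knu d) y) \<le> C * exp (- y * v)"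
proof -
  assume d: "d \<in> {1..s_pos Q}"
  interpret K: laplace_path \<sigma> v "knu d" by unfold_locales (rule sig, rule knu_int[OF d])
  show ?thesis
    using K.lp_norm by (intro exI[of _ "\<integral>t. norm (knu d t) \<partial>lborel"]) (auto simp: mult.commute)
qed

text \<open>Passage from the integral over the parameter set to the Lebesgue integral over the line.
  The parameter 0 is a null set, so the value of the derivative at a kink is immaterial.\<close>

lemma cint_LP:
  assumes C: "snd C = S" "\<And>t. t \<in> S \<Longrightarrow> fst C t = \<gamma> t"
    "\<And>t. t \<in> S \<Longrightarrow> t \<noteq> 0 \<Longrightarrow> vector_derivative (fst C) (at t) = dgam \<sigma> t"
    and g: "\<And>t. t \<in> S \<Longrightarrow> t \<noteq> 0 \<Longrightarrow> g (\<gamma> t) * dgam \<sigma> t = f t" "\<And>t. t \<notin> S - {0} \<Longrightarrow> f t = 0"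
    and int: "integrable lborel f"
  shows "cint C g = (\<integral>t. f t \<partial>lborel)"
proof -
  have "cint C g = integral S f"
    unfolding cint_def C(1) by (rule integral_spike[of "{0}"]) (use C g in auto)
  also have "\<dots> = integral UNIV (\<lambda>t. if t \<in> S then f t else 0)" by (rule integral_restrict_UNIV[symmetric])
  also have "(\<lambda>t. if t \<in> S then f t else 0) = f" using g(2) by auto
  also have "integral UNIV f = (\<integral>t. f t \<partial>lborel)"
    by (rule integral_unique[OF has_integral_integral_lborel[OF int]])
  finally show ?thesis .
qed

lemma cint_values:
  assumes C: "snd C = S" "\<And>t. t \<in> S \<Longrightarrow> fst C t = \<gamma> t"
    "\<And>t. t \<in> S \<Longrightarrow> t \<noteq> 0 \<Longrightarrow> vector_derivative (fst C) (at t) = dgam \<sigma> t" and y: "0 \<le> \<sigma> * y"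
  shows "cint C (\<lambda>z. \<Psi> z * exp (- complex_of_real y * z)) = L.lp y"
    and "k \<in> {1..r_neg Q} \<Longrightarrow> cint C (\<lambda>z. \<Psi> z / (z - complex_of_real (mu Q k)) * exp (- complex_of_real y * z)) = LP \<sigma> v (kmu k) y"
    and "k \<in> {1..r_neg Q} \<Longrightarrow> cint C (\<lambda>z. \<Psi> z / (z - complex_of_real (mu Q k))) = LP \<sigma> v (kmu k) 0"
    and "k \<in> {1..r_neg Q} \<Longrightarrow> cint C (\<lambda>z. \<Psi> z / (complex_of_real (mu Q k) - z)) = - LP \<sigma> v (kmu k) 0"
    and "d \<in> {1..s_pos Q} \<Longrightarrow> cint C (\<lambda>z. \<Psi> z / (complex_of_real (nu Q d) + z)) = LP \<sigma> v (knu d) 0"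
proof -
  show "cint C (\<lambda>z. \<Psi> z * exp (- complex_of_real y * z)) = L.lp y"
    unfolding L.lp_def by (rule cint_LP[OF C _ _ L.lp_integrable[OF y]]) (auto simp: kk_def)
  show "cint C (\<lambda>z. \<Psi> z / (z - complex_of_real (mu Q k)) * exp (- complex_of_real y * z)) = LP \<sigma> v (kmu k) y"
    "cint C (\<lambda>z. \<Psi> z / (z - complex_of_real (mu Q k))) = LP \<sigma> v (kmu k) 0"
    "cint C (\<lambda>z. \<Psi> z / (complex_of_real (mu Q k) - z)) = - LP \<sigma> v (kmu k) 0"
    if k: "k \<in> {1..r_neg Q}"
  proof -
    interpret K: laplace_path \<sigma> v "kmu k" by unfold_locales (rule sig, rule kmu_int[OF k])
    show "cint C (\<lambda>z. \<Psi> z / (z - complex_of_real (mu Q k)) * exp (- complex_of_real y * z)) = K.lp y"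
      unfolding K.lp_def by (rule cint_LP[OF C _ _ K.lp_integrable[OF y]]) (auto simp: kk_def kmu_def)
    have lp0: "K.lp 0 = (\<integral>t. kmu k t \<partial>lborel)" by (simp add: K.lp_def)
    show "cint C (\<lambda>z. \<Psi> z / (z - complex_of_real (mu Q k))) = K.lp 0"
      unfolding lp0 by (rule cint_LP[OF C _ _ kmu_int[OF k]]) (auto simp: kk_def kmu_def)
    have "cint C (\<lambda>z. \<Psi> z / (complex_of_real (mu Q k) - z)) = (\<integral>t. - kmu k t \<partial>lborel)"
    proof (rule cint_LP[OF C])
      show "\<Psi> (\<gamma> t) / (complex_of_real (mu Q k) - \<gamma> t) * dgam \<sigma> t = - kmu k t" if "t \<in> S" "t \<noteq> 0" for t
        using that minus_divide_right[of "\<Psi> (\<gamma> t) * dgam \<sigma> t" "\<gamma> t - complex_of_real (mu Q k)"] by (simp add: kk_def kmu_def)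
      show "integrable lborel (\<lambda>t. - kmu k t)" using kmu_int[OF k] by simp
    next
      fix t assume "t \<notin> S - {0}"
      then show "- kmu k t = 0" by (auto simp: kk_def kmu_def)
    qed
    then show "cint C (\<lambda>z. \<Psi> z / (complex_of_real (mu Q k) - z)) = - K.lp 0" by (simp add: lp0)
  qed
  show "cint C (\<lambda>z. \<Psi> z / (complex_of_real (nu Q d) + z)) = LP \<sigma> v (knu d) 0" if d: "d \<in> {1..s_pos Q}"
  proof -
    interpret K: laplace_path \<sigma> v "knu d" by unfold_locales (rule sig, rule knu_int[OF d])
    have lp0: "K.lp 0 = (\<integral>t. knu d t \<partial>lborel)" by (simp add: K.lp_def)
    show ?thesis
      unfolding lp0 by (rule cint_LP[OF C _ _ knu_int[OF d]]) (auto simp: kk_def knu_def add.commute)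
  qed
qed

end

section \<open>Solutions attached to the contours\<close>

definition std_contour :: "contour \<Rightarrow> real \<Rightarrow> real \<Rightarrow> real set \<Rightarrow> bool" where
  "std_contour C \<sigma> v S \<longleftrightarrow> snd C = S \<and> (\<forall>t\<in>S. fst C t = gam \<sigma> v t) \<and>
     (\<forall>t\<in>S. t \<noteq> 0 \<longrightarrow> vector_derivative (fst C) (at t) = dgam \<sigma> t)"

lemma vee_right_eq: "vee_right v = (gam 1 v, UNIV)"
  unfolding vee_right_def by (auto simp: gam_def fun_eq_iff algebra_simps)

lemma vee_left_eq: "vee_left v = (gam (- 1) v, UNIV)"
  unfolding vee_left_def by (auto simp: gam_def fun_eq_iff algebra_simps)

lemma std_vee_right: "std_contour (vee_right v) 1 v UNIV"
  unfolding std_contour_def vee_right_eq by (auto intro!: vector_derivative_at gam_der)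

lemma std_vee_left: "std_contour (vee_left v) (- 1) v UNIV"
  unfolding std_contour_def vee_left_eq by (auto intro!: vector_derivative_at gam_der)

lemma std_ray:
  assumes C: "C = ((\<lambda>t. complex_of_real v + (complex_of_real \<sigma> + \<i>) * complex_of_real t), {0..})"
  shows "std_contour C \<sigma> v {0..}"
proof -
  have eq: "complex_of_real v + (complex_of_real \<sigma> + \<i>) * complex_of_real t = gam \<sigma> v t" if "0 \<le> t" for t
    using that by (simp add: gam_def algebra_simps)
  have "vector_derivative (fst C) (at t) = dgam \<sigma> t" if "0 < t" for t
  proof (rule vector_derivative_at)
    show "(fst C has_vector_derivative dgam \<sigma> t) (at t)"
      by (rule has_vector_derivative_transform_within_open[OF gam_der[of t \<sigma> v] open_greaterThan[of 0]])
        (use that eq C in auto)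
  qed
  then show ?thesis using eq C by (auto simp: std_contour_def)
qed

lemma std_ray_right: "std_contour (ray_right v) 1 v {0..}"
  by (rule std_ray) (simp add: ray_right_def)

lemma std_ray_left: "std_contour (ray_left v) (- 1) v {0..}"
  by (rule std_ray) (simp add: ray_left_def)

text \<open>Interface to the contour integrals: the values of all integrals that occur in the
  partial eigenfunctions and their linear systems, and an exponential bound whose rate is the
  vertex. The gluing of the pieces uses nothing else about contours.\<close>

definition solves :: "params \<Rightarrow> real \<Rightarrow> real \<Rightarrow> contour \<Rightarrow> (complex \<Rightarrow> complex) \<Rightarrow> (real \<Rightarrow> complex) \<Rightarrow>
    (nat \<Rightarrow> real \<Rightarrow> complex) \<Rightarrow> (nat \<Rightarrow> real \<Rightarrow> complex) \<Rightarrow> real \<Rightarrow> bool" where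
  "solves Q \<sigma> v C \<Psi> F D E B \<longleftrightarrow> side_solution Q \<sigma> F D E \<and>
    (\<forall>y. 0 \<le> \<sigma> * y \<longrightarrow> cint C (\<lambda>z. \<Psi> z * exp (- complex_of_real y * z)) = F y) \<and>
    (\<forall>y. \<forall>k\<in>{1..r_neg Q}. 0 \<le> \<sigma> * y \<longrightarrow>
      cint C (\<lambda>z. \<Psi> z / (z - complex_of_real (mu Q k)) * exp (- complex_of_real y * z)) = D k y) \<and>
    (\<forall>k\<in>{1..r_neg Q}. cint C (\<lambda>z. \<Psi> z / (z - complex_of_real (mu Q k))) = D k 0 \<and>
      cint C (\<lambda>z. \<Psi> z / (complex_of_real (mu Q k) - z)) = - D k 0) \<and>
    (\<forall>d\<in>{1..s_pos Q}. cint C (\<lambda>z. \<Psi> z / (complex_of_real (nu Q d) + z)) = E d 0) \<and>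
    0 \<le> B \<and> (\<forall>y. 0 \<le> \<sigma> * y \<longrightarrow> norm (F y) \<le> B * exp (- y * v) \<and>
      (\<forall>d\<in>{1..s_pos Q}. norm (E d y) \<le> B * exp (- y * v)))"

lemma (in kernel_contour) solves_ex:
  assumes "std_contour C \<sigma> v S"
  shows "\<exists>F D E B. solves Q \<sigma> v C \<Psi> F D E B"
proof -
  have C: "snd C = S" "\<And>t. t \<in> S \<Longrightarrow> fst C t = gam \<sigma> v t"
    "\<And>t. t \<in> S \<Longrightarrow> t \<noteq> 0 \<Longrightarrow> vector_derivative (fst C) (at t) = dgam \<sigma> t"
    using assms by (auto simp: std_contour_def)
  obtain B0 where B0: "0 \<le> B0" "\<And>y. 0 \<le> \<sigma> * y \<Longrightarrow> norm (L.lp y) \<le> B0 * exp (- y * v)"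
    using lp_exp_bound by auto
  have "\<forall>d\<in>{1..s_pos Q}. \<exists>B\<ge>0. \<forall>y. 0 \<le> \<sigma> * y \<longrightarrow> norm (LP \<sigma> v (knu d) y) \<le> B * exp (- y * v)"
    using knu_exp_bound by blast
  then obtain B1 where B1: "\<And>d. d \<in> {1..s_pos Q} \<Longrightarrow> 0 \<le> B1 d"
    "\<And>d y. d \<in> {1..s_pos Q} \<Longrightarrow> 0 \<le> \<sigma> * y \<Longrightarrow> norm (LP \<sigma> v (knu d) y) \<le> B1 d * exp (- y * v)"
    by metis
  let ?B = "B0 + (\<Sum>d=1..s_pos Q. B1 d)"
  have s0: "0 \<le> (\<Sum>d=1..s_pos Q. B1 d)" using B1(1) by (rule sum_nonneg)
  have "B1 d \<le> ?B" if "d \<in> {1..s_pos Q}" for d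
    using member_le_sum[of d "{1..s_pos Q}" B1] B1(1) that B0(1) by auto
  then have b1: "norm (LP \<sigma> v (knu d) y) \<le> ?B * exp (- y * v)" if "d \<in> {1..s_pos Q}" "0 \<le> \<sigma> * y" for d y
    using B1(2)[OF that] that(1) by (meson exp_ge_zero mult_right_mono order_trans)
  have b0: "norm (L.lp y) \<le> ?B * exp (- y * v)" if "0 \<le> \<sigma> * y" for y
    using B0(2)[OF that] s0 by (simp add: distrib_right add_increasing2)
  note cv = cint_values[OF C]
  have "solves Q \<sigma> v C \<Psi> L.lp (\<lambda>k. LP \<sigma> v (kmu k)) (\<lambda>d. LP \<sigma> v (knu d)) ?B"
    unfolding solves_def
  proof (intro conjI ballI allI impI)
    show "side_solution Q \<sigma> L.lp (\<lambda>k. LP \<sigma> v (kmu k)) (\<lambda>d. LP \<sigma> v (knu d))" by (rule side_solution)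
    show "0 \<le> ?B" using B0 s0 by simp
  qed (use cv(1) cv(2) cv(3,4,5)[of 0] b0 b1 in auto)
  then show ?thesis by blast
qed

lemma mu_strict: "admissible Q \<Longrightarrow> i \<in> {1..r_neg Q} \<Longrightarrow> j \<in> {1..r_neg Q} \<Longrightarrow> i < j \<Longrightarrow> mu Q i < mu Q j"
  by (auto simp: admissible_def strict_mono_on_def)

lemma nu_strict: "admissible Q \<Longrightarrow> i \<in> {1..s_pos Q} \<Longrightarrow> j \<in> {1..s_pos Q} \<Longrightarrow> i < j \<Longrightarrow> nu Q i < nu Q j"
  by (auto simp: admissible_def strict_mono_on_def)

definition vtx :: "params \<Rightarrow> (nat \<Rightarrow> real) \<Rightarrow> nat \<Rightarrow> real" where
  "vtx Q m i = (if expo_mu Q i > 0 then mu Q i else m i)"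

lemma vtx_pos: "admissible Q \<Longrightarrow> vertices Q m \<Longrightarrow> i \<in> {1..r_neg Q} \<Longrightarrow> 0 < vtx Q m i"
proof -
  assume a: "admissible Q" "vertices Q m" "i \<in> {1..r_neg Q}"
  show ?thesis
  proof (cases "expo_mu Q i > 0")
    case True
    then show ?thesis using mu_pos[OF a(1,3)] by (simp add: vtx_def)
  next
    case False
    then have "(if i = 1 then 0 else mu Q (i - 1)) < m i" using a by (auto simp: vertices_def)
    moreover have "0 < mu Q (i - 1)" if "i \<noteq> 1"
    proof -
      have "i - 1 \<in> {1..r_neg Q}" using a(3) that by auto
      then show ?thesis using mu_pos[OF a(1)] by blast
    qed
    ultimately show ?thesis using False by (auto simp: vtx_def split: if_splits)
  qed
qed

text \<open>By the bound in \<open>solves\<close>, contours to the right of \<open>mu 1\<close> give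
  integrals that are exponentially smaller than \<open>exp (- mu 1 * x)\<close>.\<close>

lemma vtx_gt: "admissible Q \<Longrightarrow> vertices Q m \<Longrightarrow> i \<in> {2..r_neg Q} \<Longrightarrow> mu Q 1 < vtx Q m i"
proof -
  assume a: "admissible Q" "vertices Q m" "i \<in> {2..r_neg Q}"
  show ?thesis
  proof (cases "expo_mu Q i > 0")
    case True
    then show ?thesis using mu_strict[OF a(1), of 1 i] a(3) by (simp add: vtx_def)
  next
    case False
    then have "mu Q (i - 1) < m i" using a by (auto simp: vertices_def)
    moreover have "mu Q 1 \<le> mu Q (i - 1)"
    proof -
      have "i - 1 \<in> {1..r_neg Q}" using a(3) by auto
      then show ?thesis using mu_pos[OF a(1)] by blast
    qed
    ultimately show ?thesis using False by (auto simp: vtx_def)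
  qed
qed

lemma gam_image: "std_contour C \<sigma> v S \<Longrightarrow> t \<in> S \<Longrightarrow> gam \<sigma> v t \<in> contour_image C"
  unfolding std_contour_def contour_image_def by force

lemma Gam_solves:
  assumes Q: "admissible Q" "0 < kappa Q" and m: "vertices Q m" and i: "i \<in> {1..r_neg Q}"
    and b: "psi_branch Q (contour_image (Gam Q m i) - {complex_of_real (mu Q i)}) \<Psi>"
  shows "\<exists>F D E B. solves Q 1 (vtx Q m i) (Gam Q m i) \<Psi> F D E B"
proof -
  obtain dom where dom: "open dom" "contour_image (Gam Q m i) - {complex_of_real (mu Q i)} \<subseteq> dom"
    and dp: "\<And>z. z \<in> dom \<Longrightarrow> z \<noteq> 0" "\<And>z k. z \<in> dom \<Longrightarrow> k \<in> {1..r_neg Q} \<Longrightarrow> z \<noteq> complex_of_real (mu Q k)"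
    "\<And>z d. z \<in> dom \<Longrightarrow> d \<in> {1..s_pos Q} \<Longrightarrow> z \<noteq> complex_of_real (- nu Q d)"
    "\<And>z. z \<in> dom \<Longrightarrow> norm (\<Psi> z) = ksize Q {1..r_neg Q} z"
    "\<And>z. z \<in> dom \<Longrightarrow> (\<Psi> has_field_derivative \<Psi> z * (- 1 / z + klog Q {1..r_neg Q} z)) (at z)"
    by (rule kernel_branch_props[OF b finite_atLeastAtMost]) (rule that)
  define v where "v = vtx Q m i"
  have v: "0 < v" unfolding v_def by (rule vtx_pos[OF Q(1) m i])
  define S where "S = (if expo_mu Q i > 0 then {0..} else (UNIV :: real set))"
  have std: "std_contour (Gam Q m i) 1 v S"
    using std_ray_right std_vee_right by (auto simp: Gam_def S_def v_def vtx_def)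
  have nn: "- nu Q d \<noteq> v" if "d \<in> {1..s_pos Q}" for d using nu_pos[OF Q(1) that] v by auto
  \<comment> \<open>The vertex lies strictly between two neighbouring points \<open>mu\<close>, or
    between 0 and \<open>mu 1\<close>, hence it avoids all of them.\<close>
  have vee: "mu Q k \<noteq> v" if "\<not> expo_mu Q i > 0" "k \<in> {1..r_neg Q}" for k
  proof -
    have mi: "(if i = 1 then 0 else mu Q (i - 1)) < m i" "m i < mu Q i" using m i that(1) by (auto simp: vertices_def)
    show ?thesis
    proof (cases "i \<le> k")
      case True
      then have "mu Q i \<le> mu Q k" using mu_strict[OF Q(1) i that(2)] by (cases "i = k") auto
      then show ?thesis using mi that(1) by (simp add: v_def vtx_def)
    next
      case False
      then have i1: "i - 1 \<in> {1..r_neg Q}" "i \<noteq> 1" "k \<le> i - 1" using i that by auto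
      then have "mu Q k \<le> mu Q (i - 1)" using mu_strict[OF Q(1) that(2) i1(1)] by (cases "k = i - 1") auto
      then show ?thesis using mi i1 that(1) by (simp add: v_def vtx_def)
    qed
  qed
  interpret kernel_contour Q 1 v S \<Psi> dom
  proof
    show "0 < expo_mu Q k" if "k \<in> {1..r_neg Q}" "mu Q k = v" for k
    proof -
      have e: "expo_mu Q i > 0" using vee that by blast
      then have "mu Q k = mu Q i" using that by (simp add: v_def vtx_def)
      then have "k = i" using mu_strict[OF Q(1) that(1) i] mu_strict[OF Q(1) i that(1)] by (cases k i rule: linorder_cases) auto
      then show ?thesis using e by simp
    qed
    show "gam 1 v t \<in> dom" if "t \<in> S" "t \<noteq> 0 \<or> S = UNIV" for t
    proof -
      have "gam 1 v t \<noteq> complex_of_real (mu Q i)"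
      proof (cases "t = 0")
        case True
        then have "\<not> expo_mu Q i > 0" using that by (auto simp: S_def split: if_splits)
        then show ?thesis using vee[OF _ i] True by (auto simp: gam_def)
      qed (auto simp: complex_eq_iff)
      then show ?thesis using gam_image[OF std that(1)] dom by blast
    qed
    show "(\<exists>k\<in>{1..r_neg Q}. mu Q k = v) \<or> (\<exists>d\<in>{1..s_pos Q}. - nu Q d = v)" if "S = {0..}"
    proof -
      have "expo_mu Q i > 0" using that by (auto simp: S_def split: if_splits)
      then show ?thesis using i by (auto simp: v_def vtx_def)
    qed
    show "(\<forall>k\<in>{1..r_neg Q}. mu Q k \<noteq> v) \<and> (\<forall>d\<in>{1..s_pos Q}. - nu Q d \<noteq> v)" if "S = UNIV"
    proof -
      have "\<not> expo_mu Q i > 0" using that by (auto simp: S_def split: if_splits)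
      then show ?thesis using vee nn by blast
    qed
  qed (use Q v nn dom dp in \<open>auto simp: S_def\<close>)
  show ?thesis using solves_ex[OF std] by (simp add: v_def)
qed

lemma pt_mu: "k \<in> {1..r_neg Q} \<Longrightarrow> pt Q (s_pos Q + 1 + k) = mu Q k \<and> expo_pt Q (s_pos Q + 1 + k) = expo_mu Q k"
  by (auto simp: pt_def expo_pt_def)

lemma pt_nu: "d \<in> {1..s_pos Q} \<Longrightarrow> pt Q (s_pos Q + 1 - d) = - nu Q d \<and> expo_pt Q (s_pos Q + 1 - d) = expo_nu Q d"
  by (auto simp: pt_def expo_pt_def)

lemma pt_0: "pt Q (s_pos Q + 1) = 0 \<and> expo_pt Q (s_pos Q + 1) = - 1"
  by (auto simp: pt_def expo_pt_def)

lemma pt_strict: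
  assumes Q: "admissible Q" and ij: "1 \<le> i" "i < j" "j \<le> r_neg Q + s_pos Q + 1"
  shows "pt Q i < pt Q j"
proof -
  have neg: "pt Q i < 0" if "1 \<le> i" "i \<le> s_pos Q" for i
  proof -
    have "s_pos Q + 1 - i \<in> {1..s_pos Q}" using that by auto
    then show ?thesis using nu_pos[OF Q, of "s_pos Q + 1 - i"] that(2) by (simp add: pt_def)
  qed
  have pos: "0 < pt Q j" if "s_pos Q + 1 < j" "j \<le> r_neg Q + s_pos Q + 1" for j
  proof -
    have "j - s_pos Q - 1 \<in> {1..r_neg Q}" using that by auto
    then show ?thesis using mu_pos[OF Q, of "j - s_pos Q - 1"] that(1) by (simp add: pt_def)
  qed
  consider "j \<le> s_pos Q" | "i \<le> s_pos Q" "s_pos Q + 1 \<le> j" | "s_pos Q + 1 \<le> i" "s_pos Q + 1 < j" using ij by linarith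
  then show ?thesis
  proof cases
    case 1
    then show ?thesis
      using nu_strict[OF Q, of "s_pos Q + 1 - j" "s_pos Q + 1 - i"] ij by (auto simp: pt_def)
  next
    case 2
    then show ?thesis using neg[of i] pos[of j] ij pt_0[of Q] by (cases "j = s_pos Q + 1") auto
  next
    case 3
    show ?thesis
    proof (cases "i = s_pos Q + 1")
      case True
      then show ?thesis using pos[of j] pt_0[of Q] 3 ij by auto
    next
      case False
      then show ?thesis using mu_strict[OF Q, of "i - s_pos Q - 1" "j - s_pos Q - 1"] 3 ij by (auto simp: pt_def)
    qed
  qed
qed

lemma pt_inj:
  assumes "admissible Q" "i \<in> {1..r_neg Q + s_pos Q + 1}" "j \<in> {1..r_neg Q + s_pos Q + 1}" "pt Q i = pt Q j"
  shows "i = j"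
  using pt_strict[OF assms(1), of i j] pt_strict[OF assms(1), of j i] assms by (cases i j rule: linorder_cases) auto

definition vtx2 :: "params \<Rightarrow> (nat \<Rightarrow> real) \<Rightarrow> nat \<Rightarrow> real" where
  "vtx2 Q m j = (if expo_pt Q j > 0 then pt Q j else m j)"

lemma Gam2_solves:
  assumes Q: "admissible Q" "0 < kappa Q" and m: "vertices2 Q m" and j: "j \<in> {1..r_neg Q + s_pos Q + 1}"
    and b: "psi_branch Q (contour_image (Gam2 Q m j) - {complex_of_real (pt Q j)}) \<Psi>"
  shows "\<exists>F D E B. solves Q (- 1) (vtx2 Q m j) (Gam2 Q m j) \<Psi> F D E B"
proof -
  obtain dom where dom: "open dom" "contour_image (Gam2 Q m j) - {complex_of_real (pt Q j)} \<subseteq> dom"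
    and dp: "\<And>z. z \<in> dom \<Longrightarrow> z \<noteq> 0" "\<And>z k. z \<in> dom \<Longrightarrow> k \<in> {1..r_neg Q} \<Longrightarrow> z \<noteq> complex_of_real (mu Q k)"
    "\<And>z d. z \<in> dom \<Longrightarrow> d \<in> {1..s_pos Q} \<Longrightarrow> z \<noteq> complex_of_real (- nu Q d)"
    "\<And>z. z \<in> dom \<Longrightarrow> norm (\<Psi> z) = ksize Q {1..r_neg Q} z"
    "\<And>z. z \<in> dom \<Longrightarrow> (\<Psi> has_field_derivative \<Psi> z * (- 1 / z + klog Q {1..r_neg Q} z)) (at z)"
    by (rule kernel_branch_props[OF b finite_atLeastAtMost]) (rule that)
  let ?J = "{1..r_neg Q + s_pos Q + 1}"
  define v where "v = vtx2 Q m j"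
  define S where "S = (if expo_pt Q j > 0 then {0..} else (UNIV :: real set))"
  have std: "std_contour (Gam2 Q m j) (- 1) v S"
    using std_ray_left std_vee_left by (auto simp: Gam2_def S_def v_def vtx2_def)
  have vee: "pt Q i \<noteq> v" if ne: "\<not> expo_pt Q j > 0" and i: "i \<in> ?J" for i
  proof -
    have mj: "pt Q j < m j" "j < r_neg Q + s_pos Q + 1 \<Longrightarrow> m j < pt Q (j + 1)" using m j ne by (auto simp: vertices2_def)
    show ?thesis
    proof (cases "i \<le> j")
      case True
      then have "pt Q i \<le> pt Q j" using pt_strict[OF Q(1), of i j] i j by (cases "i = j") auto
      then show ?thesis using mj ne by (simp add: v_def vtx2_def)
    next
      case False
      then have "pt Q (j + 1) \<le> pt Q i" using pt_strict[OF Q(1), of "j + 1" i] i j by (cases "j + 1 = i") auto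
      then show ?thesis using mj(2) ne False i by (auto simp: v_def vtx2_def)
    qed
  qed
  have e: "0 < expo_pt Q i" if "i \<in> ?J" "pt Q i = v" for i
  proof -
    have ej: "expo_pt Q j > 0" using vee that by blast
    then have "pt Q i = pt Q j" using that by (simp add: v_def vtx2_def)
    then have "i = j" by (rule pt_inj[OF Q(1) that(1) j])
    then show ?thesis using ej by simp
  qed
  have muJ: "s_pos Q + 1 + k \<in> ?J" if "k \<in> {1..r_neg Q}" for k using that by auto
  have nuJ: "s_pos Q + 1 - d \<in> ?J" if "d \<in> {1..s_pos Q}" for d using that by auto
  have zJ: "s_pos Q + 1 \<in> ?J" by auto
  interpret kernel_contour Q "- 1" v S \<Psi> dom
  proof
    \<comment> \<open>A special point can equal \<open>v\<close> only if its exponent is positive,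
      and the exponent of 0 is \<open>- 1\<close>.\<close>
    show "v \<noteq> 0" using e[OF zJ] pt_0[of Q] by auto
    show "0 < expo_mu Q k" if "k \<in> {1..r_neg Q}" "mu Q k = v" for k
      using e[OF muJ[OF that(1)]] pt_mu[OF that(1)] that(2) by auto
    show "0 < expo_nu Q d" if "d \<in> {1..s_pos Q}" "- nu Q d = v" for d
      using e[OF nuJ[OF that(1)]] pt_nu[OF that(1)] that(2) by auto
    show "gam (- 1) v t \<in> dom" if "t \<in> S" "t \<noteq> 0 \<or> S = UNIV" for t
    proof -
      have "gam (- 1) v t \<noteq> complex_of_real (pt Q j)"
      proof (cases "t = 0")
        case True
        then have "\<not> expo_pt Q j > 0" using that by (auto simp: S_def split: if_splits)
        then show ?thesis using vee[OF _ j] True by (auto simp: gam_def)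
      qed (auto simp: complex_eq_iff)
      then show ?thesis using gam_image[OF std that(1)] dom by blast
    qed
    show "(\<exists>k\<in>{1..r_neg Q}. mu Q k = v) \<or> (\<exists>d\<in>{1..s_pos Q}. - nu Q d = v)" if "S = {0..}"
    proof -
      have ej: "expo_pt Q j > 0" using that by (auto simp: S_def split: if_splits)
      then have pj: "pt Q j = v" by (simp add: v_def vtx2_def)
      consider "j \<le> s_pos Q" | "j = s_pos Q + 1" | "s_pos Q + 1 < j" by linarith
      then show ?thesis
      proof cases
        case 1
        then show ?thesis using pj j by (intro disjI2 bexI[of _ "s_pos Q + 1 - j"]) (auto simp: pt_def)
      next
        case 2
        then show ?thesis using ej pt_0[of Q] by simp
      next
        case 3
        then show ?thesis using pj j by (intro disjI1 bexI[of _ "j - s_pos Q - 1"]) (auto simp: pt_def)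
      qed
    qed
    show "(\<forall>k\<in>{1..r_neg Q}. mu Q k \<noteq> v) \<and> (\<forall>d\<in>{1..s_pos Q}. - nu Q d \<noteq> v)" if "S = UNIV"
    proof -
      have ne: "\<not> expo_pt Q j > 0" using that by (auto simp: S_def split: if_splits)
      show ?thesis
      proof (intro conjI ballI)
        fix k assume k: "k \<in> {1..r_neg Q}"
        show "mu Q k \<noteq> v" using vee[OF ne muJ[OF k]] pt_mu[OF k] by simp
      next
        fix d assume d: "d \<in> {1..s_pos Q}"
        show "- nu Q d \<noteq> v" using vee[OF ne nuJ[OF d]] pt_nu[OF d] by simp
      qed
    qed
  qed (use Q dom dp in \<open>auto simp: S_def\<close>)
  show ?thesis using solves_ex[OF std] by (simp add: v_def)
qed

lemma side_solution_sum:
  assumes "finite I" and I: "\<And>i. i \<in> I \<Longrightarrow> side_solution Q \<sigma> (F i) (D i) (E i)"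
  shows "side_solution Q \<sigma> (\<lambda>y. \<Sum>i\<in>I. c i * F i y) (\<lambda>k y. \<Sum>i\<in>I. c i * D i k y) (\<lambda>d y. \<Sum>i\<in>I. c i * E i d y)"
  unfolding side_solution_def
proof (intro conjI ballI allI impI)
  show "continuous_on {y. 0 \<le> \<sigma> * y} (\<lambda>y. \<Sum>i\<in>I. c i * F i y)"
    using I by (intro continuous_intros) (auto simp: side_solution_def)
  show "continuous_on {y. 0 \<le> \<sigma> * y} (\<lambda>y. \<Sum>i\<in>I. c i * D i k y)" if "k \<in> {1..r_neg Q}" for k
    using I that by (intro continuous_intros) (auto simp: side_solution_def)
  show "continuous_on {y. 0 \<le> \<sigma> * y} (\<lambda>y. \<Sum>i\<in>I. c i * E i d y)" if "d \<in> {1..s_pos Q}" for d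
    using I that by (intro continuous_intros) (auto simp: side_solution_def)
  fix y assume y: "0 < \<sigma> * y"
  let ?r = "complex_of_real (lam Q / (kappa Q * y))"
  let ?p = "\<lambda>k. complex_of_real (p_neg Q * alpha Q k * mu Q k)" and ?q = "\<lambda>d. complex_of_real (q_pos Q * beta Q d * nu Q d)"
  have dF: "(F i has_vector_derivative ?r * (F i y + (\<Sum>k=1..r_neg Q. ?p k * D i k y) - (\<Sum>d=1..s_pos Q. ?q d * E i d y))) (at y)"
    if "i \<in> I" for i using I[OF that] y by (simp add: side_solution_def)
  show "((\<lambda>y. \<Sum>i\<in>I. c i * F i y) has_vector_derivative ?r * ((\<Sum>i\<in>I. c i * F i y)
      + (\<Sum>k=1..r_neg Q. ?p k * (\<Sum>i\<in>I. c i * D i k y)) - (\<Sum>d=1..s_pos Q. ?q d * (\<Sum>i\<in>I. c i * E i d y)))) (at y)"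
  proof (rule has_vector_derivative_eq_rhs[OF has_vector_derivative_sum])
    show "((\<lambda>y. c i * F i y) has_vector_derivative c i * (?r * (F i y + (\<Sum>k=1..r_neg Q. ?p k * D i k y) - (\<Sum>d=1..s_pos Q. ?q d * E i d y)))) (at y)"
      if "i \<in> I" for i using dF[OF that] by (intro has_vector_derivative_mult_right)
    have 1: "(\<Sum>k=1..r_neg Q. ?p k * (\<Sum>i\<in>I. c i * D i k y)) = (\<Sum>i\<in>I. c i * (\<Sum>k=1..r_neg Q. ?p k * D i k y))"
      unfolding sum_distrib_left by (subst sum.swap) (simp only: mult.left_commute)
    have 2: "(\<Sum>d=1..s_pos Q. ?q d * (\<Sum>i\<in>I. c i * E i d y)) = (\<Sum>i\<in>I. c i * (\<Sum>d=1..s_pos Q. ?q d * E i d y))"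
      unfolding sum_distrib_left by (subst sum.swap) (simp only: mult.left_commute)
    show "(\<Sum>i\<in>I. c i * (?r * (F i y + (\<Sum>k=1..r_neg Q. ?p k * D i k y) - (\<Sum>d=1..s_pos Q. ?q d * E i d y)))) =
      ?r * ((\<Sum>i\<in>I. c i * F i y) + (\<Sum>k=1..r_neg Q. ?p k * (\<Sum>i\<in>I. c i * D i k y)) - (\<Sum>d=1..s_pos Q. ?q d * (\<Sum>i\<in>I. c i * E i d y)))"
      unfolding 1 2 sum.distrib[symmetric] sum_subtractf[symmetric] sum_distrib_left[of ?r]
      by (intro sum.cong refl) (simp only: distrib_left right_diff_distrib mult.left_commute)
  qed
  show "((\<lambda>y. \<Sum>i\<in>I. c i * D i k y) has_vector_derivative - complex_of_real (mu Q k) * (\<Sum>i\<in>I. c i * D i k y) - (\<Sum>i\<in>I. c i * F i y)) (at y)"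
    if k: "k \<in> {1..r_neg Q}" for k
  proof (rule has_vector_derivative_eq_rhs[OF has_vector_derivative_sum])
    show "((\<lambda>y. c i * D i k y) has_vector_derivative c i * (- complex_of_real (mu Q k) * D i k y - F i y)) (at y)"
      if "i \<in> I" for i using I[OF that] y k by (intro has_vector_derivative_mult_right) (simp add: side_solution_def)
  qed (simp add: sum_distrib_left sum_subtractf right_diff_distrib sum_negf mult_ac)
  show "((\<lambda>y. \<Sum>i\<in>I. c i * E i d y) has_vector_derivative complex_of_real (nu Q d) * (\<Sum>i\<in>I. c i * E i d y) - (\<Sum>i\<in>I. c i * F i y)) (at y)"
    if d: "d \<in> {1..s_pos Q}" for d
  proof (rule has_vector_derivative_eq_rhs[OF has_vector_derivative_sum])
    show "((\<lambda>y. c i * E i d y) has_vector_derivative c i * (complex_of_real (nu Q d) * E i d y - F i y)) (at y)"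
      if "i \<in> I" for i using I[OF that] y d by (intro has_vector_derivative_mult_right) (simp add: side_solution_def)
  qed (simp add: sum_distrib_left sum_subtractf right_diff_distrib mult_ac)
qed

section \<open>The passage probability as a sum of contour integrals\<close>

lemma continuous_on_glue:
  fixes h f g :: "real \<Rightarrow> complex"
  assumes "closed S" "closed T" "continuous_on S f" "continuous_on T g"
    "\<And>x. x \<in> S \<Longrightarrow> h x = f x" "\<And>x. x \<in> T \<Longrightarrow> h x = g x"
  shows "continuous_on (S \<union> T) h"
proof (rule continuous_on_closed_Un[OF assms(1,2)])
  show "continuous_on S h" using assms(3,5) continuous_on_cong by metis
  show "continuous_on T h" using assms(4,6) continuous_on_cong by metis
qed

lemma measurable_piece:
  fixes h :: "real \<Rightarrow> complex"
  assumes "A \<in> sets borel" "continuous_on A h"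
  shows "(\<lambda>x. if x \<in> A then h x else 0) \<in> borel_measurable borel"
  by (rule borel_measurable_continuous_on_if[OF assms]) simp

text \<open>\<open>g\<close> and \<open>f\<close> differ at most at 0, so neither a starting point
  \<open>x > 0\<close> nor the limit at infinity sees the correction.\<close>

lemma (in eigen_data) passage_prob_eq:
  assumes ou: "ou_process Q M N V X x" and x: "l < x" "0 < x" and f0: "(f \<longlongrightarrow> 0) at_top"
  shows "complex_of_real (measure M {\<omega>\<in>space M. tau X l \<omega> < \<infinity>}) = f x"
proof -
  interpret M: prob_space M using ou by (simp add: ou_process_def)
  interpret o: ou M Q N V X x l by unfold_locales (rule ou, rule Q, rule kappa)
  interpret C: jump_chain "jump_law Q" "kappa Q" "lam Q" by (rule jump_chain_jump_law[OF Q kappa law])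
  have "eventually (\<lambda>y. f y = g y) at_top"
    using eventually_gt_at_top[of 0] by eventually_elim (simp add: g_def)
  then have g0: "(g \<longlongrightarrow> 0) at_top" using f0 by (rule Lim_transform_eventually[rotated])
  have "complex_of_real (measure C.S {w. \<exists>n. hit (kappa Q) l n x w}) = g x"
    by (rule C.hit_prob[OF g_meas g_bound g0 one_step x(1)])
  also have "g x = f x" using x by (simp add: g_def)
  finally show ?thesis unfolding o.passage_prob[OF x(1)] .
qed

text \<open>The weight \<open>w\<close> is left open because the exponentials are bounded by 1 to
  the right of 0, but by a constant depending on \<open>l\<close> and the vertex on
  \<open>[l, 0]\<close>.\<close>

lemma solves_sum_bound:
  assumes "finite I" and s: "\<And>i. i \<in> I \<Longrightarrow> solves Q \<sigma> (v i) (C i) (\<Psi> i) (F i) (D i) (E i) (B i)"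
    and y: "0 \<le> \<sigma> * y" and e: "\<And>i. i \<in> I \<Longrightarrow> exp (- y * v i) \<le> w i"
  shows "norm (\<Sum>i\<in>I. c i * F i y) \<le> (\<Sum>i\<in>I. norm (c i) * (B i * w i))"
    "d \<in> {1..s_pos Q} \<Longrightarrow> norm (\<Sum>i\<in>I. c i * E i d y) \<le> (\<Sum>i\<in>I. norm (c i) * (B i * w i))"
proof -
  have B: "0 \<le> B i" if "i \<in> I" for i using s[OF that] by (simp add: solves_def)
  show "norm (\<Sum>i\<in>I. c i * F i y) \<le> (\<Sum>i\<in>I. norm (c i) * (B i * w i))"
  proof (rule sum_norm_le)
    fix i assume i: "i \<in> I"
    have "norm (F i y) \<le> B i * exp (- y * v i)" using s[OF i] y by (simp add: solves_def)
    also have "\<dots> \<le> B i * w i" using e[OF i] B[OF i] by (rule mult_left_mono)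
    finally show "norm (c i * F i y) \<le> norm (c i) * (B i * w i)" by (simp add: norm_mult mult_left_mono)
  qed
  assume d: "d \<in> {1..s_pos Q}"
  show "norm (\<Sum>i\<in>I. c i * E i d y) \<le> (\<Sum>i\<in>I. norm (c i) * (B i * w i))"
  proof (rule sum_norm_le)
    fix i assume i: "i \<in> I"
    have "norm (E i d y) \<le> B i * exp (- y * v i)" using s[OF i] y d by (simp add: solves_def)
    also have "\<dots> \<le> B i * w i" using e[OF i] B[OF i] by (rule mult_left_mono)
    finally show "norm (c i * E i d y) \<le> norm (c i) * (B i * w i)" by (simp add: norm_mult mult_left_mono)
  qed
qed

lemma solves_sum_tendsto_0:
  assumes I: "finite I" and s: "\<And>i. i \<in> I \<Longrightarrow> solves Q 1 (v i) (C i) (\<Psi> i) (F i) (D i) (E i) (B i)"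
    and v: "\<And>i. i \<in> I \<Longrightarrow> 0 < v i"
  shows "((\<lambda>y. \<Sum>i\<in>I. c i * F i y) \<longlongrightarrow> 0) at_top"
proof (rule tendsto_null_sum)
  fix i assume i: "i \<in> I"
  have "(F i \<longlongrightarrow> 0) at_top"
  proof (rule Lim_null_comparison)
    show "eventually (\<lambda>y. norm (F i y) \<le> B i * exp (- y * v i)) at_top"
      using eventually_ge_at_top[of 0] by eventually_elim (use s[OF i] in \<open>simp add: solves_def\<close>)
    show "((\<lambda>y. B i * exp (- y * v i)) \<longlongrightarrow> 0) at_top" using v[OF i] by real_asymp
  qed
  then show "((\<lambda>y. c i * F i y) \<longlongrightarrow> 0) at_top" by (rule tendsto_mult_right_zero)
qed

lemma mu_inverse_le: "admissible Q \<Longrightarrow> k \<in> {1..r_neg Q} \<Longrightarrow> norm (- 1 / complex_of_real (mu Q k)) \<le> 1 / mu Q 1"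
proof -
  assume a: "admissible Q" "k \<in> {1..r_neg Q}"
  have "0 < mu Q 1" using a by (simp add: admissible_def)
  then show ?thesis using mu_pos[OF a] by (simp add: norm_divide field_simps)
qed

lemma side_solution_der:
  fixes f :: "real \<Rightarrow> complex" and D' E' :: "nat \<Rightarrow> real \<Rightarrow> complex"
  assumes "side_solution Q \<sigma> F D E" "0 < \<sigma> * y" "open A" "y \<in> A" "\<And>u. u \<in> A \<Longrightarrow> f u = F u" "0 < kappa Q"
    and D': "\<And>k u. k \<in> {1..r_neg Q} \<Longrightarrow> u \<in> A \<Longrightarrow> D' k u = D k u"
    and E': "\<And>d u. d \<in> {1..s_pos Q} \<Longrightarrow> u \<in> A \<Longrightarrow> E' d u = E d u"
  shows "k \<in> {1..r_neg Q} \<Longrightarrow> (D' k has_vector_derivative - complex_of_real (mu Q k) * D' k y - f y) (at y)"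
    and "d \<in> {1..s_pos Q} \<Longrightarrow> (E' d has_vector_derivative complex_of_real (nu Q d) * E' d y - f y) (at y)"
    and "\<exists>f'::complex. (f has_vector_derivative f') (at y) \<and>
        complex_of_real (kappa Q * y) * f' = complex_of_real (lam Q) * (f y + (\<Sum>k=1..r_neg Q. complex_of_real (p_neg Q * alpha Q k * mu Q k) * D' k y)
          - (\<Sum>d=1..s_pos Q. complex_of_real (q_pos Q * beta Q d * nu Q d) * E' d y))"
proof -
  show "(D' k has_vector_derivative - complex_of_real (mu Q k) * D' k y - f y) (at y)" if k: "k \<in> {1..r_neg Q}"
  proof (rule has_vector_derivative_transform_within_open[OF _ assms(3,4)])
    show "(D k has_vector_derivative - complex_of_real (mu Q k) * D' k y - f y) (at y)"
      using assms k by (simp add: side_solution_def)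
  qed (use D'[OF k] in simp)
  show "(E' d has_vector_derivative complex_of_real (nu Q d) * E' d y - f y) (at y)" if d: "d \<in> {1..s_pos Q}"
  proof (rule has_vector_derivative_transform_within_open[OF _ assms(3,4)])
    show "(E d has_vector_derivative complex_of_real (nu Q d) * E' d y - f y) (at y)"
      using assms d by (simp add: side_solution_def)
  qed (use E'[OF d] in simp)
  let ?R = "F y + (\<Sum>k=1..r_neg Q. complex_of_real (p_neg Q * alpha Q k * mu Q k) * D k y)
            - (\<Sum>d=1..s_pos Q. complex_of_real (q_pos Q * beta Q d * nu Q d) * E d y)"
  show "\<exists>f'::complex. (f has_vector_derivative f') (at y) \<and>
        complex_of_real (kappa Q * y) * f' = complex_of_real (lam Q) * (f y + (\<Sum>k=1..r_neg Q. complex_of_real (p_neg Q * alpha Q k * mu Q k) * D' k y)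
          - (\<Sum>d=1..s_pos Q. complex_of_real (q_pos Q * beta Q d * nu Q d) * E' d y))"
  proof (intro exI conjI)
    have "(F has_vector_derivative complex_of_real (lam Q / (kappa Q * y)) * ?R) (at y)"
      using assms by (simp add: side_solution_def)
    then show "(f has_vector_derivative complex_of_real (lam Q / (kappa Q * y)) * ?R) (at y)"
      by (rule has_vector_derivative_transform_within_open[OF _ assms(3,4)]) (use assms(5) in simp)
    have "y \<noteq> 0" using assms(2) by auto
    then have h1: "complex_of_real (kappa Q * y) * (complex_of_real (lam Q / (kappa Q * y)) * ?R) = complex_of_real (lam Q) * ?R"
      using assms(6) by simp
    have h2: "?R = f y + (\<Sum>k=1..r_neg Q. complex_of_real (p_neg Q * alpha Q k * mu Q k) * D' k y)
          - (\<Sum>d=1..s_pos Q. complex_of_real (q_pos Q * beta Q d * nu Q d) * E' d y)"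
      using assms(4,5) D' E' by simp
    show "complex_of_real (kappa Q * y) * (complex_of_real (lam Q / (kappa Q * y)) * ?R) = complex_of_real (lam Q) * (f y + (\<Sum>k=1..r_neg Q. complex_of_real (p_neg Q * alpha Q k * mu Q k) * D' k y)
          - (\<Sum>d=1..s_pos Q. complex_of_real (q_pos Q * beta Q d * nu Q d) * E' d y))"
      unfolding h2[symmetric] by (rule h1)
  qed
qed

lemma side_solution_right:
  assumes "side_solution Q 1 F D E"
  shows "continuous_on {0..} F" "k \<in> {1..r_neg Q} \<Longrightarrow> continuous_on {0..} (D k)"
    "d \<in> {1..s_pos Q} \<Longrightarrow> continuous_on {0..} (E d)"
proof -
  have "{y::real. 0 \<le> 1 * y} = {0..}" by auto
  then show "continuous_on {0..} F" "k \<in> {1..r_neg Q} \<Longrightarrow> continuous_on {0..} (D k)"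
    "d \<in> {1..s_pos Q} \<Longrightarrow> continuous_on {0..} (E d)"
    using assms unfolding side_solution_def by auto
qed

lemma side_solution_left:
  assumes "side_solution Q (- 1) F D E"
  shows "continuous_on {..0} F" "k \<in> {1..r_neg Q} \<Longrightarrow> continuous_on {..0} (D k)"
    "d \<in> {1..s_pos Q} \<Longrightarrow> continuous_on {..0} (E d)"
proof -
  have "{y::real. 0 \<le> - 1 * y} = {..0}" by auto
  then show "continuous_on {..0} F" "k \<in> {1..r_neg Q} \<Longrightarrow> continuous_on {..0} (D k)"
    "d \<in> {1..s_pos Q} \<Longrightarrow> continuous_on {..0} (E d)"
    using assms unfolding side_solution_def by auto
qed

text \<open>Where \<open>f = 1\<close> the equation for \<open>D k\<close> has the constant solution
  \<open>- 1 / mu k\<close>, the only one that stays bounded at minus infinity.\<close>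

lemma below_der:
  fixes f :: "real \<Rightarrow> complex" and D :: "nat \<Rightarrow> real \<Rightarrow> complex"
  assumes "admissible Q" "y < l" "\<And>y. y < l \<Longrightarrow> f y = (1 :: complex)" "\<And>y. y < l \<Longrightarrow> D k y = - 1 / complex_of_real (mu Q k)"
    "k \<in> {1..r_neg Q}"
  shows "(D k has_vector_derivative - mu Q k * D k y - f y) (at y)"
proof -
  have "complex_of_real (mu Q k) \<noteq> 0" using mu_pos[OF assms(1,5)] by simp
  then have "- mu Q k * D k y - f y = 0" using assms by simp
  moreover have "(D k has_vector_derivative 0) (at y)"
    by (rule has_vector_derivative_transform_within_open[of "\<lambda>_. - 1 / complex_of_real (mu Q k)" _ _ "{..<l}"])
      (use assms in auto)
  ultimately show ?thesis by simp
qed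

lemma eigen_data_pos:
  assumes Q: "admissible Q" "0 < kappa Q" and law: "prob_space (jump_law Q)" and l: "0 < l"
    and s: "\<And>i. i \<in> {1..r_neg Q} \<Longrightarrow> solves Q 1 (v i) (Gam Q m i) (\<Psi> i) (F i) (D i) (E i) (B i)"
    and v: "\<And>i. i \<in> {1..r_neg Q} \<Longrightarrow> 0 < v i"
    and f: "partial_eigenfunction_pos Q l m \<Psi> c f"
  shows "\<exists>D E B. eigen_data Q l f D E B" "l \<le> y \<Longrightarrow> f y = (\<Sum>i=1..r_neg Q. c i * F i y)"
proof -
  let ?I = "{1..r_neg Q}"
  define FF where "FF y = (\<Sum>i\<in>?I. c i * F i y)" for y
  define DD where "DD k y = (\<Sum>i\<in>?I. c i * D i k y)" for k y
  define EE where "EE d y = (\<Sum>i\<in>?I. c i * E i d y)" for d y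
  have ss: "side_solution Q 1 FF DD EE"
    unfolding FF_def[abs_def] DD_def[abs_def] EE_def[abs_def]
    by (rule side_solution_sum) (use s in \<open>auto simp: solves_def\<close>)
  have f_eq: "f y = (if y < l then 1 else FF y)" for y
  proof (cases "y < l")
    case False
    have "cint (Gam Q m i) (\<lambda>z. \<Psi> i z * exp (- complex_of_real y * z)) = F i y" if "i \<in> ?I" for i
      using s[OF that] False l by (simp add: solves_def)
    then show ?thesis using f False by (auto simp: partial_eigenfunction_pos_def FF_def intro!: sum.cong)
  qed (use f in \<open>simp add: partial_eigenfunction_pos_def\<close>)
  then show "l \<le> y \<Longrightarrow> f y = (\<Sum>i=1..r_neg Q. c i * F i y)" by (simp add: FF_def)
  \<comment> \<open>The linear system for \<open>c\<close>, divided by \<open>mu k\<close>: above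
    \<open>l\<close> the companion starts with the constant value that it has below
    \<open>l\<close>.\<close>
  have DDl: "DD k l = - 1 / complex_of_real (mu Q k)" if k: "k \<in> ?I" for k
  proof -
    have "(\<Sum>i=1..r_neg Q. c i * complex_of_real (mu Q k) *
           cint (Gam Q m i) (\<lambda>z. \<Psi> i z / (z - complex_of_real (mu Q k)) * exp (- complex_of_real l * z))) + 1 = 0"
      using f k by (simp add: partial_eigenfunction_pos_def)
    also have "(\<Sum>i=1..r_neg Q. c i * complex_of_real (mu Q k) *
           cint (Gam Q m i) (\<lambda>z. \<Psi> i z / (z - complex_of_real (mu Q k)) * exp (- complex_of_real l * z)))
        = (\<Sum>i\<in>?I. complex_of_real (mu Q k) * (c i * D i k l))"
    proof (rule sum.cong[OF refl])
      fix i assume "i \<in> ?I"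
      then have "cint (Gam Q m i) (\<lambda>z. \<Psi> i z / (z - complex_of_real (mu Q k)) * exp (- complex_of_real l * z)) = D i k l"
        using s[of i] k l unfolding solves_def by auto
      then show "c i * complex_of_real (mu Q k) * cint (Gam Q m i) (\<lambda>z. \<Psi> i z / (z - complex_of_real (mu Q k)) * exp (- complex_of_real l * z))
          = complex_of_real (mu Q k) * (c i * D i k l)" by simp
    qed
    also have "\<dots> = complex_of_real (mu Q k) * DD k l" by (simp add: DD_def sum_distrib_left)
    finally show ?thesis using mu_pos[OF Q(1) k] by (simp add: field_simps eq_neg_iff_add_eq_0)
  qed
  have c1: "continuous_on {0..} FF" "k \<in> ?I \<Longrightarrow> continuous_on {0..} (DD k)" "d \<in> {1..s_pos Q} \<Longrightarrow> continuous_on {0..} (EE d)" for k d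
    using side_solution_right[OF ss] by blast+
  define BB where "BB = (\<Sum>i\<in>?I. norm (c i) * (B i * 1))"
  have w: "exp (- y * v i) \<le> 1" if "0 \<le> y" "i \<in> ?I" for y i using that v[OF that(2)] by simp
  have Fb: "norm (FF y) \<le> BB" if "0 \<le> y" for y
    unfolding FF_def BB_def by (rule solves_sum_bound(1)[OF _ s]) (use that w in auto)
  have Eb: "norm (EE d y) \<le> BB" if "0 \<le> y" "d \<in> {1..s_pos Q}" for d y
    unfolding EE_def BB_def by (rule solves_sum_bound(2)[OF _ s]) (use that w in auto)
  have BB: "0 \<le> BB" using Fb[of 0] norm_ge_zero order_trans by blast
  define D' where "D' k y = (if y < l then - 1 / complex_of_real (mu Q k) else DD k y)" for k y
  define MM where "MM = 1 / mu Q 1"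
  let ?B = "1 + BB + MM"
  have m1: "0 \<le> MM" using Q by (simp add: admissible_def MM_def)
  have "eigen_data Q l f D' EE ?B"
  proof (rule eigen_data.intro)
    show "f \<in> borel_measurable borel"
    proof -
      have "(\<lambda>y. if y \<in> {l..} then FF y else 0) \<in> borel_measurable borel"
        by (intro measurable_piece continuous_on_subset[OF c1(1)]) (use l in auto)
      then have "(\<lambda>y. (if y \<in> {l..} then FF y else 0) + (if y < l then 1 else 0)) \<in> borel_measurable borel"
        by measurable
      moreover have "f = (\<lambda>y. (if y \<in> {l..} then FF y else 0) + (if y < l then 1 else 0))" using f_eq by auto
      ultimately show ?thesis by simp
    qed
    show "norm (f y) \<le> ?B" for y
      using f_eq[of y] Fb[of y] BB m1 l by (auto simp: add_increasing2 intro: order_trans)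
    show "continuous_on UNIV (D' k)" if k: "k \<in> ?I" for k
    proof -
      have "continuous_on ({..l} \<union> {l..}) (D' k)"
      proof (rule continuous_on_glue[of _ _ "\<lambda>_. - 1 / complex_of_real (mu Q k)" "DD k"])
        show "continuous_on {l..} (DD k)"
          by (rule continuous_on_subset[OF c1(2)[OF k]]) (use l in auto)
      qed (use DDl[OF k] in \<open>auto simp: D'_def\<close>)
      moreover have "{..l} \<union> {l..} = UNIV" by auto
      ultimately show ?thesis by simp
    qed
    show "norm (D' k y) \<le> ?B" if "k \<in> ?I" "y \<le> l" for k y
    proof -
      have "D' k y = - 1 / complex_of_real (mu Q k)" using that DDl by (auto simp: D'_def)
      then have "norm (D' k y) \<le> MM" unfolding MM_def using mu_inverse_le[OF Q(1) that(1)] by simp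
      then show ?thesis using BB by simp
    qed
    show "continuous_on {l..} (EE d)" if "d \<in> {1..s_pos Q}" for d
      by (rule continuous_on_subset[OF c1(3)[OF that]]) (use l in auto)
    show "norm (EE d y) \<le> ?B" if "d \<in> {1..s_pos Q}" "l \<le> y" for d y
      using Eb[OF _ that(1), of y] that l m1 by (simp add: add_increasing2 add_increasing)
    have der: "side_solution Q 1 FF DD EE" "0 < 1 * y" "open {l<..}" "y \<in> {l<..}" "\<And>u. u \<in> {l<..} \<Longrightarrow> f u = FF u" "0 < kappa Q"
      "\<And>k u. k \<in> ?I \<Longrightarrow> u \<in> {l<..} \<Longrightarrow> D' k u = DD k u"
      "\<And>d u. d \<in> {1..s_pos Q} \<Longrightarrow> u \<in> {l<..} \<Longrightarrow> EE d u = EE d u" if "l < y" for y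
      using ss that l f_eq Q by (auto simp: D'_def)
    show "(D' k has_vector_derivative - mu Q k * D' k y - f y) (at y)" if "k \<in> ?I" "y \<notin> {l, 0}" for k y
    proof (cases "l < y")
      case True
      show ?thesis using side_solution_der(1)[OF der[OF True] that(1)] by simp
    next
      case False
      then show ?thesis using that f_eq by (intro below_der[OF Q(1), of y l]) (auto simp: D'_def)
    qed
    show "(EE d has_vector_derivative nu Q d * EE d y - f y) (at y)" if "d \<in> {1..s_pos Q}" "l < y" "y \<noteq> 0" for d y
      using side_solution_der(2)[OF der[OF that(2)] that(1)] by simp
    show "\<exists>f'::complex. (f has_vector_derivative f') (at y) \<and>
        kappa Q * y * f' = lam Q * (f y + (\<Sum>k=1..r_neg Q. p_neg Q * alpha Q k * mu Q k * D' k y)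
          - (\<Sum>d=1..s_pos Q. q_pos Q * beta Q d * nu Q d * EE d y))" if "l < y" "y \<noteq> 0" for y
      using side_solution_der(3)[OF der[OF that(1)]] by simp
    show "f y = 1" if "y < l" for y using f_eq[of y] that by simp
    show "continuous_on {..<0} f" if "l < 0" using that l by simp
  qed (use Q law l in auto)
  then show "\<exists>D E B. eigen_data Q l f D E B" by blast
qed

text \<open>The three groups of linear equations match \<open>D\<close> at \<open>l\<close>,
  \<open>D\<close> at 0 and \<open>E\<close> at 0. They say nothing about \<open>f l\<close>; the
  value 1 there makes \<open>f\<close> continuous along the falling flow lines.\<close>

lemma eigen_data_neg:
  assumes Q: "admissible Q" "0 < kappa Q" and law: "prob_space (jump_law Q)" and l: "l < 0"
    and s: "\<And>i. i \<in> {1..r_neg Q} \<Longrightarrow> solves Q 1 (v i) (Gam Q m i) (\<Psi> i) (F i) (D i) (E i) (B i)"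
    and v: "\<And>i. i \<in> {1..r_neg Q} \<Longrightarrow> 0 < v i"
    and s2: "\<And>j. j \<in> {1..r_neg Q + s_pos Q + 1} \<Longrightarrow> solves Q (- 1) (v2 j) (Gam2 Q m2 j) (\<Psi>2 j) (F2 j) (D2 j) (E2 j) (B2 j)"
    and f: "partial_eigenfunction_neg Q l m \<Psi> m2 \<Psi>2 c b f" and fl: "f l = 1"
  shows "\<exists>D E B. eigen_data Q l f D E B" "0 < y \<Longrightarrow> f y = (\<Sum>i=1..r_neg Q. c i * F i y)"
proof -
  let ?I = "{1..r_neg Q}" and ?J = "{1..r_neg Q + s_pos Q + 1}"
  define FF where "FF y = (\<Sum>i\<in>?I. c i * F i y)" for y
  define DD where "DD k y = (\<Sum>i\<in>?I. c i * D i k y)" for k y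
  define EE where "EE d y = (\<Sum>i\<in>?I. c i * E i d y)" for d y
  define GG where "GG y = (\<Sum>j\<in>?J. b j * F2 j y)" for y
  define HH where "HH k y = (\<Sum>j\<in>?J. b j * D2 j k y)" for k y
  define KK where "KK d y = (\<Sum>j\<in>?J. b j * E2 j d y)" for d y
  have ss: "side_solution Q 1 FF DD EE"
    unfolding FF_def[abs_def] DD_def[abs_def] EE_def[abs_def]
    by (rule side_solution_sum) (use s in \<open>auto simp: solves_def\<close>)
  have ss2: "side_solution Q (- 1) GG HH KK"
    unfolding GG_def[abs_def] HH_def[abs_def] KK_def[abs_def]
    by (rule side_solution_sum) (use s2 in \<open>auto simp: solves_def\<close>)
  have f_eq: "f y = (if y < l then 1 else if y < 0 then GG y else if y = 0 then 0 else FF y)" for y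
  proof -
    have 1: "(\<Sum>i=1..r_neg Q. c i * (if y > 0 then cint (Gam Q m i) (\<lambda>z. \<Psi> i z * exp (- complex_of_real y * z)) else 0))
        = (if y > 0 then FF y else 0)"
      using s unfolding FF_def solves_def by (auto intro!: sum.cong)
    have 2: "(\<Sum>j=1..r_neg Q + s_pos Q + 1. b j *
            (if l \<le> y \<and> y < 0 then cint (Gam2 Q m2 j) (\<lambda>z. \<Psi>2 j z * exp (- complex_of_real y * z)) else 0))
        = (if l \<le> y \<and> y < 0 then GG y else 0)"
      using s2 unfolding GG_def solves_def by (auto intro!: sum.cong)
    have "f y = (if y > 0 then FF y else 0) + (if l \<le> y \<and> y < 0 then GG y else 0) + (if y < l then 1 else 0)"
      using f unfolding partial_eigenfunction_neg_def 1[symmetric] 2[symmetric] by blast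
    then show ?thesis using l by auto
  qed
  then show "0 < y \<Longrightarrow> f y = (\<Sum>i=1..r_neg Q. c i * F i y)" using l by (simp add: FF_def)
  have HHl: "HH k l = - 1 / complex_of_real (mu Q k)" if k: "k \<in> ?I" for k
  proof -
    have "(\<Sum>j=1..r_neg Q + s_pos Q + 1. b j *
           cint (Gam2 Q m2 j) (\<lambda>z. \<Psi>2 j z / (z - complex_of_real (mu Q k)) * exp (- complex_of_real l * z)))
        + 1 / complex_of_real (mu Q k) = 0"
      using f k by (simp add: partial_eigenfunction_neg_def)
    also have "(\<Sum>j=1..r_neg Q + s_pos Q + 1. b j *
           cint (Gam2 Q m2 j) (\<lambda>z. \<Psi>2 j z / (z - complex_of_real (mu Q k)) * exp (- complex_of_real l * z))) = HH k l"
      using s2 k l unfolding HH_def solves_def by (intro sum.cong) auto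
    finally show ?thesis by (simp add: eq_neg_iff_add_eq_0)
  qed
  have DH0: "DD k 0 = HH k 0" if k: "k \<in> ?I" for k
  proof -
    have "(\<Sum>i=1..r_neg Q. c i * cint (Gam Q m i) (\<lambda>z. \<Psi> i z / (z - complex_of_real (mu Q k))))
        + (\<Sum>j=1..r_neg Q + s_pos Q + 1. b j * cint (Gam2 Q m2 j) (\<lambda>z. \<Psi>2 j z / (complex_of_real (mu Q k) - z))) = 0"
      using f k by (simp add: partial_eigenfunction_neg_def)
    also have "(\<Sum>i=1..r_neg Q. c i * cint (Gam Q m i) (\<lambda>z. \<Psi> i z / (z - complex_of_real (mu Q k)))) = DD k 0"
      using s k unfolding DD_def solves_def by (intro sum.cong) auto
    also have "(\<Sum>j=1..r_neg Q + s_pos Q + 1. b j * cint (Gam2 Q m2 j) (\<lambda>z. \<Psi>2 j z / (complex_of_real (mu Q k) - z)))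
        = (\<Sum>j\<in>?J. - (b j * D2 j k 0))"
      using s2 k unfolding solves_def by (intro sum.cong) auto
    also have "\<dots> = - HH k 0" by (simp add: HH_def sum_negf)
    finally show ?thesis by simp
  qed
  have EK0: "EE d 0 = KK d 0" if d: "d \<in> {1..s_pos Q}" for d
  proof -
    have "(\<Sum>j=1..r_neg Q + s_pos Q + 1. b j * cint (Gam2 Q m2 j) (\<lambda>z. \<Psi>2 j z / (complex_of_real (nu Q d) + z)))
        - (\<Sum>i=1..r_neg Q. c i * cint (Gam Q m i) (\<lambda>z. \<Psi> i z / (complex_of_real (nu Q d) + z))) = 0"
      using f d by (simp add: partial_eigenfunction_neg_def)
    also have "(\<Sum>j=1..r_neg Q + s_pos Q + 1. b j * cint (Gam2 Q m2 j) (\<lambda>z. \<Psi>2 j z / (complex_of_real (nu Q d) + z))) = KK d 0"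
      using s2 d unfolding KK_def solves_def by (intro sum.cong) auto
    also have "(\<Sum>i=1..r_neg Q. c i * cint (Gam Q m i) (\<lambda>z. \<Psi> i z / (complex_of_real (nu Q d) + z))) = EE d 0"
      using s d unfolding EE_def solves_def by (intro sum.cong) auto
    finally show ?thesis by simp
  qed
  define BB where "BB = (\<Sum>i\<in>?I. norm (c i) * (B i * 1))"
  define CC where "CC = (\<Sum>j\<in>?J. norm (b j) * (B2 j * exp (\<bar>l\<bar> * \<bar>v2 j\<bar>)))"
  have w: "exp (- y * v i) \<le> 1" if "0 \<le> y" "i \<in> ?I" for y i using that v[OF that(2)] by simp
  \<comment> \<open>The left contours may have vertices of either sign, so on the bounded interval
    the exponents are estimated by absolute values.\<close>
  have w2: "exp (- y * v2 j) \<le> exp (\<bar>l\<bar> * \<bar>v2 j\<bar>)" if "l \<le> y" "y \<le> 0" for y j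
  proof -
    have "- y * v2 j \<le> \<bar>y\<bar> * \<bar>v2 j\<bar>" by (metis abs_ge_self abs_minus_cancel abs_mult)
    also have "\<dots> \<le> \<bar>l\<bar> * \<bar>v2 j\<bar>" using that by (intro mult_right_mono) auto
    finally show ?thesis by simp
  qed
  have Fb: "norm (FF y) \<le> BB" if "0 \<le> y" for y
    unfolding FF_def BB_def by (rule solves_sum_bound(1)[OF _ s]) (use that w in auto)
  have Eb: "norm (EE d y) \<le> BB" if "0 \<le> y" "d \<in> {1..s_pos Q}" for d y
    unfolding EE_def BB_def by (rule solves_sum_bound(2)[OF _ s]) (use that w in auto)
  have Gb: "norm (GG y) \<le> CC" if "l \<le> y" "y \<le> 0" for y
    unfolding GG_def CC_def by (rule solves_sum_bound(1)[OF _ s2 _ w2]) (use that in auto)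
  have Kb: "norm (KK d y) \<le> CC" if "l \<le> y" "y \<le> 0" "d \<in> {1..s_pos Q}" for d y
    unfolding KK_def CC_def by (rule solves_sum_bound(2)[OF _ s2 _ w2]) (use that in auto)
  have BB: "0 \<le> BB" using Fb[of 0] norm_ge_zero order_trans by blast
  have CC: "0 \<le> CC" using Gb[of 0] l norm_ge_zero order_trans by (meson less_imp_le order_refl)
  define D' where "D' k y = (if y < l then - 1 / complex_of_real (mu Q k) else if y < 0 then HH k y else DD k y)" for k y
  define E' where "E' d y = (if y < 0 then KK d y else EE d y)" for d y
  define MM where "MM = 1 / mu Q 1"
  let ?B = "1 + BB + CC + MM"
  have m1: "0 \<le> MM" using Q by (simp add: admissible_def MM_def)
  have c1: "continuous_on {0..} FF" "k \<in> ?I \<Longrightarrow> continuous_on {0..} (DD k)" "d \<in> {1..s_pos Q} \<Longrightarrow> continuous_on {0..} (EE d)" for k d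
    using side_solution_right[OF ss] by blast+
  have c2: "continuous_on {..0} GG" "k \<in> ?I \<Longrightarrow> continuous_on {..0} (HH k)" "d \<in> {1..s_pos Q} \<Longrightarrow> continuous_on {..0} (KK d)" for k d
    using side_solution_left[OF ss2] by blast+
  have "eigen_data Q l f D' E' ?B"
  proof (rule eigen_data.intro)
    show "f \<in> borel_measurable borel"
    proof -
      have "(\<lambda>y. if y \<in> {0<..} then FF y else 0) \<in> borel_measurable borel"
        by (intro measurable_piece continuous_on_subset[OF c1(1)]) auto
      moreover have "(\<lambda>y. if y \<in> {l..<0} then GG y else 0) \<in> borel_measurable borel"
        by (intro measurable_piece continuous_on_subset[OF c2(1)]) auto
      ultimately have "(\<lambda>y. (if y \<in> {0<..} then FF y else 0) + (if y \<in> {l..<0} then GG y else 0) + (if y < l then 1 else 0)) \<in> borel_measurable borel"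
        by measurable
      moreover have "f = (\<lambda>y. (if y \<in> {0<..} then FF y else 0) + (if y \<in> {l..<0} then GG y else 0) + (if y < l then 1 else 0))"
        using f_eq l by (auto simp: fun_eq_iff)
      ultimately show ?thesis by simp
    qed
    show "norm (f y) \<le> ?B" for y
    proof -
      show ?thesis using f_eq[of y] Fb[of y] Gb[of y] BB CC m1 by (auto split: if_splits)
    qed
    show "continuous_on UNIV (D' k)" if k: "k \<in> ?I" for k
    proof -
      have "continuous_on ({..l} \<union> {l..0}) (D' k)"
      proof (rule continuous_on_glue[of _ _ "\<lambda>_. - 1 / complex_of_real (mu Q k)" "HH k"])
        show "continuous_on {l..0} (HH k)" by (rule continuous_on_subset[OF c2(2)[OF k]]) auto
      qed (use HHl[OF k] DH0[OF k] l in \<open>auto simp: D'_def\<close>)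
      then have "continuous_on (({..l} \<union> {l..0}) \<union> {0..}) (D' k)"
        by (rule continuous_on_glue[of _ _ "D' k" "DD k", rotated 2]) (use l in \<open>auto simp: D'_def c1(2)[OF k]\<close>)
      moreover have "({..l} \<union> {l..0}) \<union> {0..} = UNIV" by auto
      ultimately show ?thesis by simp
    qed
    show "norm (D' k y) \<le> ?B" if "k \<in> ?I" "y \<le> l" for k y
    proof -
      have "D' k y = - 1 / complex_of_real (mu Q k)" using that HHl l by (auto simp: D'_def)
      then have "norm (D' k y) \<le> MM" unfolding MM_def using mu_inverse_le[OF Q(1) that(1)] by simp
      then show ?thesis using BB CC by simp
    qed
    show "continuous_on {l..} (E' d)" if d: "d \<in> {1..s_pos Q}" for d
    proof -
      have "continuous_on ({l..0} \<union> {0..}) (E' d)"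
      proof (rule continuous_on_glue[of _ _ "KK d" "EE d"])
        show "continuous_on {l..0} (KK d)" by (rule continuous_on_subset[OF c2(3)[OF d]]) auto
      qed (use EK0[OF d] c1(3)[OF d] in \<open>auto simp: E'_def\<close>)
      moreover have "{l..0} \<union> {0..} = {l..}" using l by auto
      ultimately show ?thesis by simp
    qed
    show "norm (E' d y) \<le> ?B" if "d \<in> {1..s_pos Q}" "l \<le> y" for d y
    proof -
      show ?thesis using Eb[of y d] Kb[of y d] that BB CC m1 by (auto simp: E'_def)
    qed
    have derp: "side_solution Q 1 FF DD EE" "0 < 1 * y" "open {0::real<..}" "y \<in> {0<..}" "\<And>u. u \<in> {0<..} \<Longrightarrow> f u = FF u" "0 < kappa Q"
      "\<And>k u. k \<in> ?I \<Longrightarrow> u \<in> {0<..} \<Longrightarrow> D' k u = DD k u"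
      "\<And>d u. d \<in> {1..s_pos Q} \<Longrightarrow> u \<in> {0<..} \<Longrightarrow> E' d u = EE d u" if "0 < y" for y :: real
      using ss that l f_eq Q by (auto simp: D'_def E'_def)
    have dern: "side_solution Q (- 1) GG HH KK" "0 < (- 1) * y" "open {l<..<0}" "y \<in> {l<..<0}" "\<And>u. u \<in> {l<..<0} \<Longrightarrow> f u = GG u" "0 < kappa Q"
      "\<And>k u. k \<in> ?I \<Longrightarrow> u \<in> {l<..<0} \<Longrightarrow> D' k u = HH k u"
      "\<And>d u. d \<in> {1..s_pos Q} \<Longrightarrow> u \<in> {l<..<0} \<Longrightarrow> E' d u = KK d u" if "l < y" "y < 0" for y
      using ss2 that l f_eq Q by (auto simp: D'_def E'_def)
    show "(D' k has_vector_derivative - mu Q k * D' k y - f y) (at y)" if k: "k \<in> ?I" and ne: "y \<notin> {l, 0}" for k y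
    proof -
      consider "0 < y" | "l < y" "y < 0" | "y < l" using ne l by fastforce
      then show ?thesis
      proof cases
        case 1
        show ?thesis using side_solution_der(1)[OF derp[OF 1] k] by simp
      next
        case 2
        show ?thesis using side_solution_der(1)[OF dern[OF 2] k] by simp
      next
        case 3
        then show ?thesis using k f_eq by (intro below_der[OF Q(1), of y l]) (auto simp: D'_def)
      qed
    qed
    show "(E' d has_vector_derivative nu Q d * E' d y - f y) (at y)" if d: "d \<in> {1..s_pos Q}" "l < y" "y \<noteq> 0" for d y
    proof (cases "0 < y")
      case True
      show ?thesis using side_solution_der(2)[OF derp[OF True] d(1)] by simp
    next
      case False
      then have "y < 0" using d by simp
      show ?thesis using side_solution_der(2)[OF dern[OF d(2) \<open>y < 0\<close>] d(1)] by simp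
    qed
    show "\<exists>f'::complex. (f has_vector_derivative f') (at y) \<and>
        kappa Q * y * f' = lam Q * (f y + (\<Sum>k=1..r_neg Q. p_neg Q * alpha Q k * mu Q k * D' k y)
          - (\<Sum>d=1..s_pos Q. q_pos Q * beta Q d * nu Q d * E' d y))" if y: "l < y" "y \<noteq> 0" for y
    proof (cases "0 < y")
      case True
      show ?thesis using side_solution_der(3)[OF derp[OF True]] by simp
    next
      case False
      then have "y < 0" using y by simp
      show ?thesis using side_solution_der(3)[OF dern[OF y(1) \<open>y < 0\<close>]] by simp
    qed
    show "continuous_on {..<0} f"
    proof -
      \<comment> \<open>Here the normalisation at \<open>l\<close> enters: the constant 1 below
        \<open>l\<close> continues into the left integrals without a gap.\<close>
      have "GG l = 1" using f_eq[of l] fl l by simp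
      then have "continuous_on ({..l} \<union> {l..0}) (\<lambda>y. if y < l then 1 else GG y)"
        by (intro continuous_on_glue[of _ _ "\<lambda>_. 1" GG] continuous_on_subset[OF c2(1)]) auto
      then have "continuous_on {..<0} (\<lambda>y. if y < l then 1 else GG y)"
        by (rule continuous_on_subset) auto
      then show ?thesis using f_eq by (subst continuous_on_cong[OF refl, of _ f "\<lambda>y. if y < l then 1 else GG y"]) auto
    qed
    show "f y = 1" if "y < l" for y using f_eq[of y] that by simp
  qed (use Q law l in auto)
  then show "\<exists>D E B. eigen_data Q l f D E B" by blast
qed

section \<open>Asymptotics of the first contour integral\<close>

lemma log_branch_constant:
  assumes "connected S" "continuous_on S L" "continuous_on S M" "\<And>z. z \<in> S \<Longrightarrow> exp (L z) = exp (M z)"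
  shows "\<exists>k::complex. \<forall>z\<in>S. L z = M z + k"
proof -
  have "(\<lambda>z. L z - M z) constant_on S"
  proof (rule continuous_discrete_range_constant[OF assms(1)])
    show "continuous_on S (\<lambda>z. L z - M z)" by (intro continuous_intros assms)
    fix x assume x: "x \<in> S"
    \<comment> \<open>Two logarithms of the same number differ by an integer multiple of
      \<open>2 * pi * i\<close>. The difference of \<open>L\<close> and \<open>M\<close> therefore
      takes values at mutual distance at least \<open>2 * pi\<close>, which forces it to be constant
      on a connected set.\<close>
    have "2 * pi \<le> norm ((L y - M y) - (L x - M x))" if y: "y \<in> S" and ne: "L y - M y \<noteq> L x - M x" for y
    proof -
      have "exp (L y - M y) = exp (L x - M x)" using assms(4)[OF x] assms(4)[OF y] by (simp add: exp_diff)
      then obtain n :: int where n: "L y - M y = L x - M x + complex_of_real (2 * of_int n * pi) * \<i>"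
        unfolding exp_eq by auto
      then have "n \<noteq> 0" using ne by auto
      then have "1 * (2 * pi) \<le> \<bar>real_of_int n\<bar> * (2 * pi)" by (intro mult_right_mono) auto
      then show ?thesis unfolding n by (simp add: norm_mult abs_mult)
    qed
    then show "\<exists>e>0. \<forall>y. y \<in> S \<and> L y - M y \<noteq> L x - M x \<longrightarrow> e \<le> norm (L y - M y - (L x - M x))"
      by (intro exI[of _ "2 * pi"]) auto
  qed
  then obtain k where "\<And>z. z \<in> S \<Longrightarrow> L z - M z = k" unfolding constant_on_def by blast
  then show ?thesis by (intro exI[of _ k]) (auto simp: algebra_simps)
qed

text \<open>The sign \<open>u\<close> turns the cut of the logarithm to the left or to the right of
  \<open>w\<close>. Connectedness of \<open>S\<close> makes one constant valid throughout.\<close>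

lemma power_branch_Ln:
  assumes h: "power_branch_on D w a h" and S: "connected S" "S \<subseteq> D"
    and u: "u = 1 \<or> u = - 1" and slit: "\<And>z. z \<in> S \<Longrightarrow> u * (z - complex_of_real w) \<notin> \<real>\<^sub>\<le>\<^sub>0"
  shows "\<exists>\<eta>. \<forall>z\<in>S. h z = \<eta> * exp (complex_of_real a * Ln (u * (z - complex_of_real w)))"
proof -
  obtain L where L: "L holomorphic_on D" "\<And>z. z \<in> D \<Longrightarrow> exp (L z) = z - complex_of_real w"
      "\<And>z. z \<in> D \<Longrightarrow> h z = exp (complex_of_real a * L z)"
    using h by (auto simp: power_branch_on_def)
  \<comment> \<open>A logarithm of \<open>u\<close>, which undoes the sign inside
    \<open>Ln\<close>.\<close>
  define q where "q = (if u = 1 then 0 else \<i> * complex_of_real pi)"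
  have uu: "u * u = 1" "exp q = u" using u by (auto simp: q_def)
  have "\<exists>k. \<forall>z\<in>S. L z = (Ln (u * (z - complex_of_real w)) + q) + k"
  proof (rule log_branch_constant[OF S(1)])
    show "continuous_on S L" using L(1) S(2) holomorphic_on_imp_continuous_on continuous_on_subset by blast
    show "continuous_on S (\<lambda>z. Ln (u * (z - complex_of_real w)) + q)"
      by (intro continuous_intros) (use slit in auto)
    show "exp (L z) = exp (Ln (u * (z - complex_of_real w)) + q)" if z: "z \<in> S" for z
    proof -
      have "u * (z - complex_of_real w) \<noteq> 0" using slit[OF z] by auto
      then have "exp (Ln (u * (z - complex_of_real w)) + q) = (u * u) * (z - complex_of_real w)"
        by (simp add: exp_add uu(2))
      then show ?thesis using L(2) z S(2) uu(1) by auto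
    qed
  qed
  then obtain k where k: "\<And>z. z \<in> S \<Longrightarrow> L z = Ln (u * (z - complex_of_real w)) + q + k" by blast
  have "h z = exp (complex_of_real a * (q + k)) * exp (complex_of_real a * Ln (u * (z - complex_of_real w)))" if z: "z \<in> S" for z
    using L(3)[of z] z S(2) by (auto simp: k algebra_simps simp flip: exp_add)
  then show ?thesis by blast
qed

definition vee :: "real \<Rightarrow> complex set" where "vee v = range (gam 1 v)"

lemma connected_vee: "connected (vee v)"
  unfolding vee_def by (intro connected_continuous_image gam_cont) simp

lemma vee_iff: "z \<in> vee v \<longleftrightarrow> Re z = v + \<bar>Im z\<bar>"
  by (auto simp: vee_def complex_eq_iff image_iff)

lemma vertex_in_vee: "complex_of_real v \<in> vee v"
  by (simp add: vee_iff)

text \<open>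
  A path in \<open>D\<close> from one vertex to the other may cross the positive axis, but not before
  it meets the rightmost contour.
\<close>
lemma connected_between_vees_aux:
  assumes D: "connected D" "open D" and sub: "vee c \<subseteq> D" "vee d \<subseteq> D" and dc: "d \<le> c" "c < 0"
  shows "\<exists>S. connected S \<and> S \<subseteq> D \<and> vee c \<subseteq> S \<and> vee d \<subseteq> S \<and> (\<forall>z\<in>S. - z \<notin> \<real>\<^sub>\<le>\<^sub>0)"
proof -
  have slit: "- z \<notin> \<real>\<^sub>\<le>\<^sub>0" if "Re z \<le> c + \<bar>Im z\<bar>" for z
    using that dc by (auto simp: complex_nonpos_Reals_iff)
  define R where "R = {z::complex. Re z < c + \<bar>Im z\<bar>}"
  have oR: "open R" unfolding R_def by (intro open_Collect_less continuous_intros)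
  have cR: "closure R \<subseteq> {z. Re z \<le> c + \<bar>Im z\<bar>}"
    by (rule closure_minimal) (auto simp: R_def intro!: closed_Collect_le continuous_intros)
  have ends: "complex_of_real d \<in> D" "complex_of_real c \<in> D" using sub vertex_in_vee by blast+
  show ?thesis
  proof (cases "d = c")
    case True
    then show ?thesis using sub connected_vee slit by (intro exI[of _ "vee c"]) (auto simp: vee_iff)
  next
    case False
    have "path_connected D" using D connected_open_path_connected by blast
    then obtain g where g: "path g" "path_image g \<subseteq> D" "pathstart g = complex_of_real d" "pathfinish g = complex_of_real c"
      using ends unfolding path_connected_def by blast
    have "pathstart g \<in> closure R" using g(3) False dc closure_subset[of R] by (auto simp: R_def)
    moreover have "pathfinish g \<notin> R" using g(4) by (simp add: R_def)
    ultimately obtain p where p: "path p" "pathstart p = pathstart g" "path_image p \<subseteq> path_image g"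
        "path_image p - {pathfinish p} \<subseteq> interior R" "pathfinish p \<in> frontier R"
      using exists_path_subpath_to_frontier[OF g(1)] by blast
    have fin: "pathfinish p \<in> vee c"
    proof -
      have "pathfinish p \<in> closure R" "pathfinish p \<notin> R" using p(5) oR by (auto simp: frontier_def interior_open)
      then show ?thesis using cR by (auto simp: vee_iff R_def)
    qed
    have Re: "Re z \<le> c + \<bar>Im z\<bar>" if "z \<in> path_image p \<union> vee c \<union> vee d" for z
      using that p(4) fin dc unfolding interior_open[OF oR] by (force simp: R_def vee_iff)
    have pc: "connected (path_image p \<union> vee c)"
      using fin pathfinish_in_path_image[of p]
      by (intro connected_Un connected_path_image p connected_vee) blast
    have "complex_of_real d \<in> path_image p"
      using pathstart_in_path_image[of p] p(2) g(3) by simp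
    then have "connected (path_image p \<union> vee c \<union> vee d)"
      using vertex_in_vee[of d] by (intro connected_Un[OF pc connected_vee]) blast
    then show ?thesis using p(3) g(2) sub Re slit by (intro exI[of _ "path_image p \<union> vee c \<union> vee d"]) blast
  qed
qed

lemma connected_between_vees:
  assumes "connected D" "open D" "vee c \<subseteq> D" "vee d \<subseteq> D" "c < 0" "d < 0"
  shows "\<exists>S. connected S \<and> S \<subseteq> D \<and> vee c \<subseteq> S \<and> vee d \<subseteq> S \<and> (\<forall>z\<in>S. - z \<notin> \<real>\<^sub>\<le>\<^sub>0)"
proof (cases "d \<le> c")
  case True
  show ?thesis by (rule connected_between_vees_aux[OF assms(1-4) True assms(5)])
next
  case False
  then show ?thesis using connected_between_vees_aux[OF assms(1,2,4,3)] assms by auto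
qed

text \<open>The point is the common factor on both contours: it ties the branch on the translated
  first contour to the branch under the integral of \<open>I\<close>.\<close>

lemma power_branch_vees:
  assumes h: "power_branch (vee c \<union> vee d) a h" and "c < 0" "d < 0"
  shows "\<exists>\<eta>. \<forall>z\<in>vee c \<union> vee d. h z = \<eta> * exp (complex_of_real a * Ln (- z))"
proof -
  obtain D where D: "open D" "simply_connected D" "vee c \<union> vee d \<subseteq> D" "power_branch_on D 0 a h"
    using h by (auto simp: power_branch_def)
  obtain S where S: "connected S" "S \<subseteq> D" "vee c \<subseteq> S" "vee d \<subseteq> S" "\<forall>z\<in>S. - z \<notin> \<real>\<^sub>\<le>\<^sub>0"
    using connected_between_vees[of D c d] D simply_connected_imp_connected[of D] assms by (metis le_sup_iff)
  have "\<exists>\<eta>. \<forall>z\<in>S. h z = \<eta> * exp (complex_of_real a * Ln (- 1 * (z - complex_of_real 0)))"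
    by (rule power_branch_Ln[OF D(4) S(1,2)]) (use S(5) in auto)
  then obtain \<eta> where "\<And>z. z \<in> S \<Longrightarrow> h z = \<eta> * exp (complex_of_real a * Ln (- z))" by auto
  then show ?thesis using S(3,4) by (intro exI[of _ \<eta>]) blast
qed

text \<open>
  The principal logarithms are cut along rays that start at the special points and point away from \<open>mu 1\<close>, so
  \<open>kbase\<close> continues a given branch from the first contour to the contours through \<open>mu 1 - a / x\<close>.
\<close>
definition kbase :: "params \<Rightarrow> complex \<Rightarrow> complex" where
  "kbase Q z = inverse z * (\<Prod>k=2..r_neg Q. exp (complex_of_real (expo_mu Q k) * Ln (complex_of_real (mu Q k) - z))) *
     (\<Prod>d=1..s_pos Q. exp (complex_of_real (expo_nu Q d) * Ln (z + complex_of_real (nu Q d))))"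

text \<open>Factor by factor each branch is a constant multiple of the principal one on
  \<open>S\<close>; the product of these constants is all that the choice of branch can
  change.\<close>

lemma kernel_branch_kbase:
  assumes "kernel_branch Q {2..r_neg Q} S \<Phi>" "connected S"
    and s1: "\<And>z k. z \<in> S \<Longrightarrow> k \<in> {2..r_neg Q} \<Longrightarrow> complex_of_real (mu Q k) - z \<notin> \<real>\<^sub>\<le>\<^sub>0"
    and s2: "\<And>z d. z \<in> S \<Longrightarrow> d \<in> {1..s_pos Q} \<Longrightarrow> z + complex_of_real (nu Q d) \<notin> \<real>\<^sub>\<le>\<^sub>0"
  shows "\<exists>\<omega>. \<forall>z\<in>S. \<Phi> z = \<omega> * kbase Q z"
proof -
  obtain D A B where D: "open D" "S \<subseteq> D"
    and A: "\<And>k. k \<in> {2..r_neg Q} \<Longrightarrow> power_branch_on D (mu Q k) (expo_mu Q k) (A k)"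
    and B: "\<And>d. d \<in> {1..s_pos Q} \<Longrightarrow> power_branch_on D (- nu Q d) (expo_nu Q d) (B d)"
    and Phi: "\<And>z. z \<in> D \<Longrightarrow> \<Phi> z = inverse z * (\<Prod>k\<in>{2..r_neg Q}. A k z) * (\<Prod>d=1..s_pos Q. B d z)"
    using assms(1) unfolding kernel_branch_def by blast
  have "\<exists>\<eta>. \<forall>z\<in>S. A k z = \<eta> * exp (complex_of_real (expo_mu Q k) * Ln (complex_of_real (mu Q k) - z))"
    if k: "k \<in> {2..r_neg Q}" for k
  proof -
    have "\<exists>\<eta>. \<forall>z\<in>S. A k z = \<eta> * exp (complex_of_real (expo_mu Q k) * Ln (- 1 * (z - complex_of_real (mu Q k))))"
      by (rule power_branch_Ln[OF A[OF k] assms(2) D(2)]) (use s1[OF _ k] in auto)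
    then show ?thesis by simp
  qed
  then obtain \<eta> where \<eta>: "\<And>k z. k \<in> {2..r_neg Q} \<Longrightarrow> z \<in> S \<Longrightarrow>
      A k z = \<eta> k * exp (complex_of_real (expo_mu Q k) * Ln (complex_of_real (mu Q k) - z))"
    by metis
  have "\<exists>\<eta>. \<forall>z\<in>S. B d z = \<eta> * exp (complex_of_real (expo_nu Q d) * Ln (z + complex_of_real (nu Q d)))"
    if d: "d \<in> {1..s_pos Q}" for d
  proof -
    have "\<exists>\<eta>. \<forall>z\<in>S. B d z = \<eta> * exp (complex_of_real (expo_nu Q d) * Ln (1 * (z - complex_of_real (- nu Q d))))"
      by (rule power_branch_Ln[OF B[OF d] assms(2) D(2)]) (use s2[OF _ d] in auto)
    then show ?thesis by simp
  qed
  then obtain \<theta> where \<theta>: "\<And>d z. d \<in> {1..s_pos Q} \<Longrightarrow> z \<in> S \<Longrightarrow>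
      B d z = \<theta> d * exp (complex_of_real (expo_nu Q d) * Ln (z + complex_of_real (nu Q d)))"
    by metis
  have "\<Phi> z = ((\<Prod>k=2..r_neg Q. \<eta> k) * (\<Prod>d=1..s_pos Q. \<theta> d)) * kbase Q z" if z: "z \<in> S" for z
  proof -
    have "\<Phi> z = inverse z * (\<Prod>k\<in>{2..r_neg Q}. A k z) * (\<Prod>d=1..s_pos Q. B d z)" using Phi z D by blast
    also have "(\<Prod>k\<in>{2..r_neg Q}. A k z) = (\<Prod>k=2..r_neg Q. \<eta> k) * (\<Prod>k=2..r_neg Q. exp (complex_of_real (expo_mu Q k) * Ln (complex_of_real (mu Q k) - z)))"
      using \<eta>[OF _ z] by (simp add: prod.distrib)
    also have "(\<Prod>d=1..s_pos Q. B d z) = (\<Prod>d=1..s_pos Q. \<theta> d) * (\<Prod>d=1..s_pos Q. exp (complex_of_real (expo_nu Q d) * Ln (z + complex_of_real (nu Q d))))"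
      using \<theta>[OF _ z] by (simp add: prod.distrib)
    finally show ?thesis by (simp add: kbase_def mult_ac)
  qed
  then show ?thesis by blast
qed

lemma norm_exp_Ln: "z \<noteq> 0 \<Longrightarrow> norm (exp (complex_of_real a * Ln z)) = norm z powr a"
  by (simp add: powr_def)

lemma norm_kbase:
  assumes "z \<noteq> 0" "\<And>k. k \<in> {2..r_neg Q} \<Longrightarrow> z \<noteq> complex_of_real (mu Q k)"
    "\<And>d. d \<in> {1..s_pos Q} \<Longrightarrow> z \<noteq> complex_of_real (- nu Q d)"
  shows "norm (kbase Q z) = ksize Q {2..r_neg Q} z"
proof -
  have "(\<Prod>k=2..r_neg Q. norm (exp (complex_of_real (expo_mu Q k) * Ln (complex_of_real (mu Q k) - z))))
      = (\<Prod>k=2..r_neg Q. norm (z - complex_of_real (mu Q k)) powr expo_mu Q k)"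
  proof (rule prod.cong[OF refl])
    fix k assume k: "k \<in> {2..r_neg Q}"
    show "norm (exp (complex_of_real (expo_mu Q k) * Ln (complex_of_real (mu Q k) - z))) = norm (z - complex_of_real (mu Q k)) powr expo_mu Q k"
      using norm_exp_Ln[of "complex_of_real (mu Q k) - z"] assms(2)[OF k] by (simp add: norm_minus_commute del: norm_exp_eq_Re)
  qed
  moreover have "(\<Prod>d=1..s_pos Q. norm (exp (complex_of_real (expo_nu Q d) * Ln (z + complex_of_real (nu Q d)))))
      = (\<Prod>d=1..s_pos Q. norm (z - complex_of_real (- nu Q d)) powr expo_nu Q d)"
  proof (rule prod.cong[OF refl])
    fix d assume d: "d \<in> {1..s_pos Q}"
    have "z + complex_of_real (nu Q d) \<noteq> 0" using assms(3)[OF d] by (simp add: eq_neg_iff_add_eq_0)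
    then show "norm (exp (complex_of_real (expo_nu Q d) * Ln (z + complex_of_real (nu Q d)))) = norm (z - complex_of_real (- nu Q d)) powr expo_nu Q d"
      using norm_exp_Ln[of "z + complex_of_real (nu Q d)"] by (simp del: norm_exp_eq_Re)
  qed
  ultimately show ?thesis
    using assms(1) unfolding kbase_def ksize_def norm_mult prod_norm[symmetric] by (simp add: norm_inverse powr_minus)
qed

lemma kbase_holomorphic:
  assumes "0 \<notin> S" "\<And>z k. z \<in> S \<Longrightarrow> k \<in> {2..r_neg Q} \<Longrightarrow> complex_of_real (mu Q k) - z \<notin> \<real>\<^sub>\<le>\<^sub>0"
    "\<And>z d. z \<in> S \<Longrightarrow> d \<in> {1..s_pos Q} \<Longrightarrow> z + complex_of_real (nu Q d) \<notin> \<real>\<^sub>\<le>\<^sub>0"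
  shows "kbase Q holomorphic_on S"
  unfolding kbase_def by (intro holomorphic_intros) (use assms in auto)

lemma kbase_measurable [measurable]:
  "kbase Q \<in> borel_measurable borel"
  unfolding kbase_def by measurable

section \<open>Bounds that are uniform in the vertex of the contour\<close>

lemma gam_powr_uniform:
  assumes "0 < \<delta>"
  shows "\<exists>C\<ge>0. \<forall>v t. \<delta> \<le> \<bar>v - w\<bar> \<and> \<bar>v - w\<bar> \<le> M \<longrightarrow>
    norm (gam 1 v t - complex_of_real w) powr e \<le> C * (1 + \<bar>t\<bar>) powr \<bar>e\<bar>"
proof -
  let ?c = "1 / (2 / \<delta> + 1)"
  have c: "0 < ?c" using assms by (simp add: add_pos_pos)
  have "norm (gam 1 v t - complex_of_real w) powr e \<le> max (?c powr e) ((\<bar>M\<bar> + 2) powr e) * (1 + \<bar>t\<bar>) powr \<bar>e\<bar>"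
    if v: "\<delta> \<le> \<bar>v - w\<bar>" "\<bar>v - w\<bar> \<le> M" for v t
  proof -
    let ?n = "norm (gam 1 v t - complex_of_real w)"
    have "1 + \<bar>t\<bar> \<le> (2 / \<bar>v - w\<bar> + 1) * ?n" using gam_lower[of 1 w v t] v assms by auto
    also have "\<dots> \<le> (2 / \<delta> + 1) * ?n" using v assms by (intro mult_right_mono add_right_mono divide_left_mono) auto
    finally have lo: "?c * (1 + \<bar>t\<bar>) \<le> ?n" using assms by (simp add: field_simps)
    have "?n \<le> (\<bar>v - w\<bar> + 2) * (1 + \<bar>t\<bar>)" by (rule gam_upper) simp
    also have "\<dots> \<le> (\<bar>M\<bar> + 2) * (1 + \<bar>t\<bar>)" using v by (intro mult_right_mono) auto
    finally have up: "?n \<le> (\<bar>M\<bar> + 2) * (1 + \<bar>t\<bar>)" .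
    have one: "1 \<le> (1 + \<bar>t\<bar>) powr \<bar>e\<bar>" by (intro ge_one_powr_ge_zero) auto
    show ?thesis
    proof (cases "0 \<le> e")
      case True
      then have "?n powr e \<le> ((\<bar>M\<bar> + 2) * (1 + \<bar>t\<bar>)) powr e" using up by (intro powr_mono2) auto
      also have "\<dots> = (\<bar>M\<bar> + 2) powr e * (1 + \<bar>t\<bar>) powr \<bar>e\<bar>" using True by (simp add: powr_mult)
      also have "\<dots> \<le> max (?c powr e) ((\<bar>M\<bar> + 2) powr e) * (1 + \<bar>t\<bar>) powr \<bar>e\<bar>" by (intro mult_right_mono) auto
      finally show ?thesis .
    next
      case False
      have "?c * 1 \<le> ?c * (1 + \<bar>t\<bar>)" using c by (intro mult_left_mono) auto
      then have "?c \<le> ?n" using lo by linarith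
      then have "?n powr e \<le> ?c powr e" using False c by (intro powr_mono2') auto
      also have "\<dots> \<le> max (?c powr e) ((\<bar>M\<bar> + 2) powr e) * 1" by simp
      also have "\<dots> \<le> max (?c powr e) ((\<bar>M\<bar> + 2) powr e) * (1 + \<bar>t\<bar>) powr \<bar>e\<bar>"
        using one by (intro mult_left_mono) (auto simp: max_def)
      finally show ?thesis .
    qed
  qed
  then show ?thesis by (intro exI[of _ "max (?c powr e) ((\<bar>M\<bar> + 2) powr e)"]) (auto simp: max_def)
qed

lemma ksize_gam_uniform:
  assumes "0 < \<delta>" "finite K"
  shows "\<exists>C\<ge>0. \<exists>N. \<forall>v t. (\<forall>w \<in> {0} \<union> mu Q ` K \<union> (\<lambda>d. - nu Q d) ` {1..s_pos Q}. \<delta> \<le> \<bar>v - w\<bar> \<and> \<bar>v - w\<bar> \<le> M) \<longrightarrow>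
    ksize Q K (gam 1 v t) \<le> C * (1 + \<bar>t\<bar>) powr N"
proof -
  define T where "T = {(v, t::real). \<forall>w \<in> {0} \<union> mu Q ` K \<union> (\<lambda>d. - nu Q d) ` {1..s_pos Q}. \<delta> \<le> \<bar>v - w\<bar> \<and> \<bar>v - w\<bar> \<le> M}"
  define b where "b p = 1 + \<bar>snd p\<bar>" for p :: "real \<times> real"
  have bpos: "0 < b p" for p by (simp add: b_def add_pos_nonneg)
  have one: "\<exists>C\<ge>0. \<forall>p\<in>T. norm (gam 1 (fst p) (snd p) - complex_of_real w) powr e \<le> C * b p powr \<bar>e\<bar>"
    if w: "w \<in> {0} \<union> mu Q ` K \<union> (\<lambda>d. - nu Q d) ` {1..s_pos Q}" for w e
  proof -
    obtain C where "0 \<le> C" "\<And>v t. \<delta> \<le> \<bar>v - w\<bar> \<and> \<bar>v - w\<bar> \<le> M \<Longrightarrow> norm (gam 1 v t - complex_of_real w) powr e \<le> C * (1 + \<bar>t\<bar>) powr \<bar>e\<bar>"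
      using gam_powr_uniform[OF assms(1), of w M e] by blast
    moreover have "\<delta> \<le> \<bar>fst p - w\<bar> \<and> \<bar>fst p - w\<bar> \<le> M" if "p \<in> T" for p
      using that w unfolding T_def by (auto split: prod.splits)
    ultimately show ?thesis unfolding b_def by blast
  qed
  have "\<exists>C\<ge>0. \<forall>p\<in>T. (\<Prod>k\<in>K. norm (gam 1 (fst p) (snd p) - complex_of_real (mu Q k)) powr expo_mu Q k) \<le> C * b p powr (\<Sum>k\<in>K. \<bar>expo_mu Q k\<bar>)"
    by (rule prod_powr_bound[OF assms(2)]) (simp_all add: one bpos)
  then obtain C1 where C1: "0 \<le> C1" "\<And>p. p \<in> T \<Longrightarrow> (\<Prod>k\<in>K. norm (gam 1 (fst p) (snd p) - complex_of_real (mu Q k)) powr expo_mu Q k) \<le> C1 * b p powr (\<Sum>k\<in>K. \<bar>expo_mu Q k\<bar>)"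
    by blast
  have "\<exists>C\<ge>0. \<forall>p\<in>T. (\<Prod>d=1..s_pos Q. norm (gam 1 (fst p) (snd p) - complex_of_real (- nu Q d)) powr expo_nu Q d) \<le> C * b p powr (\<Sum>d=1..s_pos Q. \<bar>expo_nu Q d\<bar>)"
  proof (rule prod_powr_bound)
    fix d assume "d \<in> {1..s_pos Q}"
    then show "\<exists>C\<ge>0. \<forall>p\<in>T. norm (gam 1 (fst p) (snd p) - complex_of_real (- nu Q d)) powr expo_nu Q d \<le> C * b p powr \<bar>expo_nu Q d\<bar>"
      by (intro one) blast
  qed (simp_all add: bpos)
  then obtain C2 where C2: "0 \<le> C2" "\<And>p. p \<in> T \<Longrightarrow> (\<Prod>d=1..s_pos Q. norm (gam 1 (fst p) (snd p) - complex_of_real (- nu Q d)) powr expo_nu Q d) \<le> C2 * b p powr (\<Sum>d=1..s_pos Q. \<bar>expo_nu Q d\<bar>)"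
    by blast
  obtain C0 where C0: "0 \<le> C0" "\<And>p. p \<in> T \<Longrightarrow> norm (gam 1 (fst p) (snd p) - complex_of_real 0) powr (- 1) \<le> C0 * b p powr 1"
    using one[of 0 "- 1"] by auto
  let ?N = "1 + (\<Sum>k\<in>K. \<bar>expo_mu Q k\<bar>) + (\<Sum>d=1..s_pos Q. \<bar>expo_nu Q d\<bar>)"
  have "ksize Q K (gam 1 (fst p) (snd p)) \<le> C0 * C1 * C2 * b p powr ?N" if p: "p \<in> T" for p
  proof -
    have "ksize Q K (gam 1 (fst p) (snd p)) \<le> (C0 * b p powr 1) * (C1 * b p powr (\<Sum>k\<in>K. \<bar>expo_mu Q k\<bar>)) * (C2 * b p powr (\<Sum>d=1..s_pos Q. \<bar>expo_nu Q d\<bar>))"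
      unfolding ksize_def using C0(2)[OF p] C1(2)[OF p] C2(2)[OF p] C0(1) C1(1) C2(1)
      by (intro mult_mono) (auto intro!: prod_nonneg mult_nonneg_nonneg)
    also have "\<dots> = C0 * C1 * C2 * b p powr ?N" by (simp only: powr_add mult_ac)
    finally show ?thesis .
  qed
  then have "\<forall>v t. (v, t) \<in> T \<longrightarrow> ksize Q K (gam 1 v t) \<le> C0 * C1 * C2 * (1 + \<bar>t\<bar>) powr ?N"
    by (auto simp: b_def)
  then show ?thesis
    using C0(1) C1(1) C2(1) by (intro exI[of _ "C0 * C1 * C2"] conjI exI[of _ ?N]) (auto simp: T_def)
qed

section \<open>Independence of the first contour integral of its vertex\<close>

lemma integrable_powr_exp_abs:
  fixes c N :: real
  assumes "0 < c"
  shows "integrable lborel (\<lambda>t. (1 + \<bar>t\<bar>) powr N * exp (- c * \<bar>t\<bar>))"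
proof -
  have "((\<lambda>t::real. (1 + t) powr N * exp (- (c / 2) * t)) \<longlongrightarrow> 0) at_top" using assms by real_asymp
  then have "eventually (\<lambda>t. (1 + t) powr N * exp (- (c / 2) * t) < 1) at_top"
    by (rule order_tendstoD) simp
  then obtain T where T: "\<And>t. T \<le> t \<Longrightarrow> (1 + t) powr N * exp (- (c / 2) * t) < 1" unfolding eventually_at_top_linorder by blast
  have "continuous_on {0..\<bar>T\<bar>} (\<lambda>t. (1 + t) powr N * exp (- (c / 2) * t))" by (intro continuous_intros) auto
  then have "bounded ((\<lambda>t. (1 + t) powr N * exp (- (c / 2) * t)) ` {0..\<bar>T\<bar>})"
    by (intro compact_imp_bounded compact_continuous_image) auto
  then obtain B where B: "\<And>t. t \<in> {0..\<bar>T\<bar>} \<Longrightarrow> norm ((1 + t) powr N * exp (- (c / 2) * t)) \<le> B"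
    unfolding bounded_iff by blast
  have bd: "(1 + t) powr N * exp (- (c / 2) * t) \<le> max 1 B" if "0 \<le> t" for t
  proof (cases "T \<le> t")
    case True
    then show ?thesis using T[OF True] by simp
  next
    case False
    then show ?thesis using B[of t] that by simp
  qed
  show ?thesis
  proof (rule Bochner_Integration.integrable_bound)
    show "integrable lborel (\<lambda>t. max 1 B * exp (- (c / 2) * \<bar>t\<bar>))"
      using integrable_exp_abs[of "c / 2"] assms by simp
    show "AE t in lborel. norm ((1 + \<bar>t\<bar>) powr N * exp (- c * \<bar>t\<bar>)) \<le> norm (max 1 B * exp (- (c / 2) * \<bar>t\<bar>))"
    proof (rule AE_I2)
      fix t :: real
      have "(1 + \<bar>t\<bar>) powr N * exp (- c * \<bar>t\<bar>) = ((1 + \<bar>t\<bar>) powr N * exp (- (c / 2) * \<bar>t\<bar>)) * exp (- (c / 2) * \<bar>t\<bar>)"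
        by (simp add: mult.assoc flip: exp_add)
      also have "\<dots> \<le> max 1 B * exp (- (c / 2) * \<bar>t\<bar>)" by (intro mult_right_mono bd) auto
      finally show "norm ((1 + \<bar>t\<bar>) powr N * exp (- c * \<bar>t\<bar>)) \<le> norm (max 1 B * exp (- (c / 2) * \<bar>t\<bar>))"
        by (simp add: abs_mult)
    qed
  qed measurable
qed

text \<open>The branch of the full kernel whose cut at \<open>mu 1\<close> runs to the right, away
  from the vertices. Its domain is the plane slit along the two parts of the real axis outside the
  interval from 0 to \<open>mu 1\<close>.\<close>

definition leading :: "params \<Rightarrow> complex \<Rightarrow> complex" where
  "leading Q z = exp (complex_of_real (expo_mu Q 1) * Ln (complex_of_real (mu Q 1) - z)) * kbase Q z"

definition leading_dom :: "params \<Rightarrow> complex set" where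
  "leading_dom Q = {z. z \<notin> \<real>\<^sub>\<le>\<^sub>0 \<and> complex_of_real (mu Q 1) - z \<notin> \<real>\<^sub>\<le>\<^sub>0}"

locale leading_kernel =
  fixes Q :: params
  assumes Q: "admissible Q"
begin

lemma mu1: "0 < mu Q 1" "1 \<in> {1..r_neg Q}"
  using Q by (auto simp: admissible_def)

lemma mu_gt: "k \<in> {2..r_neg Q} \<Longrightarrow> mu Q 1 < mu Q k"
  using mu_strict[OF Q, of 1 k] by auto

lemma slits:
  assumes "z \<in> leading_dom Q"
  shows "z \<noteq> 0" "k \<in> {1..r_neg Q} \<Longrightarrow> complex_of_real (mu Q k) - z \<notin> \<real>\<^sub>\<le>\<^sub>0"
    "d \<in> {1..s_pos Q} \<Longrightarrow> z + complex_of_real (nu Q d) \<notin> \<real>\<^sub>\<le>\<^sub>0"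
proof -
  show "z \<noteq> 0" using assms by (auto simp: leading_dom_def)
  show "complex_of_real (mu Q k) - z \<notin> \<real>\<^sub>\<le>\<^sub>0" if "k \<in> {1..r_neg Q}"
  proof -
    have "mu Q 1 \<le> mu Q k" using mu_pos[OF Q that] by auto
    then show ?thesis using assms by (auto simp: leading_dom_def complex_nonpos_Reals_iff)
  qed
  show "z + complex_of_real (nu Q d) \<notin> \<real>\<^sub>\<le>\<^sub>0" if "d \<in> {1..s_pos Q}"
    using assms nu_pos[OF Q that] by (auto simp: leading_dom_def complex_nonpos_Reals_iff)
qed

lemma leading_dom_open: "open (leading_dom Q)"
proof -
  have "open ((- \<real>\<^sub>\<le>\<^sub>0) \<inter> (\<lambda>z. complex_of_real (mu Q 1) - z) -` (- \<real>\<^sub>\<le>\<^sub>0))"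
    by (intro open_Int open_vimage continuous_intros) auto
  moreover have "leading_dom Q = (- \<real>\<^sub>\<le>\<^sub>0) \<inter> (\<lambda>z. complex_of_real (mu Q 1) - z) -` (- \<real>\<^sub>\<le>\<^sub>0)"
    by (auto simp: leading_dom_def)
  ultimately show ?thesis by simp
qed

text \<open>The star centre is \<open>mu 1 / 2\<close>: a segment from a nonreal point meets the
  real axis only at the centre, and one from a real point stays between 0 and \<open>mu 1\<close>.
  Star shape provides holomorphic primitives.\<close>

lemma leading_dom_starlike: "starlike (leading_dom Q)"
  unfolding starlike_def
proof (intro bexI[of _ "complex_of_real (mu Q 1 / 2)"] ballI)
  let ?c = "complex_of_real (mu Q 1 / 2)"
  show "?c \<in> leading_dom Q" using mu1 by (auto simp: leading_dom_def complex_nonpos_Reals_iff)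
  fix z assume z: "z \<in> leading_dom Q"
  show "closed_segment ?c z \<subseteq> leading_dom Q"
  proof
    fix w assume "w \<in> closed_segment ?c z"
    then obtain u where u: "0 \<le> u" "u \<le> 1" "w = (1 - u) *\<^sub>R ?c + u *\<^sub>R z" by (auto simp: closed_segment_def)
    have im: "Im w = u * Im z" and re: "Re w = (1 - u) * (mu Q 1 / 2) + u * Re z" by (simp_all add: u)
    show "w \<in> leading_dom Q"
    proof (cases "Im w = 0")
      case False
      then show ?thesis by (auto simp: leading_dom_def complex_nonpos_Reals_iff)
    next
      case True
      then consider "u = 0" | "Im z = 0" using im by auto
      then have "0 < Re w \<and> Re w < mu Q 1"
      proof cases
        case 1
        then show ?thesis using re mu1 by simp
      next
        case 2
        then have z2: "0 < Re z" "Re z < mu Q 1" using z by (auto simp: leading_dom_def complex_nonpos_Reals_iff)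
        have "Re w \<in> {0<..<mu Q 1}" unfolding re
          using convexD_alt[of "{0<..<mu Q 1}" "mu Q 1 / 2" "Re z" u] z2 mu1 u by auto
        then show ?thesis by simp
      qed
      then show ?thesis by (auto simp: leading_dom_def complex_nonpos_Reals_iff)
    qed
  qed
qed

lemma gam_dom: "0 < v \<Longrightarrow> v < mu Q 1 \<Longrightarrow> gam 1 v t \<in> leading_dom Q"
  by (auto simp: leading_dom_def complex_nonpos_Reals_iff)

lemma leading_holomorphic: "leading Q holomorphic_on leading_dom Q"
  unfolding leading_def
  by (intro holomorphic_intros kbase_holomorphic) (use slits mu1 in auto)

lemma norm_leading: "z \<in> leading_dom Q \<Longrightarrow> norm (leading Q z) = ksize Q {1..r_neg Q} z"
proof -
  assume z: "z \<in> leading_dom Q"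
  have k: "z \<noteq> complex_of_real (mu Q k)" if "k \<in> {1..r_neg Q}" for k using slits(2)[OF z that] by auto
  have d: "z \<noteq> complex_of_real (- nu Q d)" if "d \<in> {1..s_pos Q}" for d using slits(3)[OF z that] by auto
  have kb: "norm (kbase Q z) = ksize Q {2..r_neg Q} z"
    by (rule norm_kbase) (use slits(1)[OF z] k d in auto)
  have "{1..r_neg Q} = insert 1 {2..r_neg Q}" using mu1(2) by auto
  then show ?thesis
    unfolding leading_def norm_mult kb using norm_exp_Ln[of "complex_of_real (mu Q 1) - z" "expo_mu Q 1"] k[OF mu1(2)]
    by (simp add: ksize_def norm_minus_commute del: norm_exp_eq_Re)
qed

lemma leading_bound:
  assumes v: "0 < v1" "v2 < mu Q 1"
  shows "\<exists>C\<ge>0. \<exists>N. \<forall>v t. v1 \<le> v \<and> v \<le> v2 \<longrightarrow> norm (leading Q (gam 1 v t)) \<le> C * (1 + \<bar>t\<bar>) powr N"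
proof -
  \<comment> \<open>Lower bound for the distance of the vertices in \<open>[v1, v2]\<close> from the
    special points, which are all at most 0 or at least \<open>mu 1\<close>.\<close>
  define \<delta> where "\<delta> = min v1 (mu Q 1 - v2)"
  let ?W = "{0} \<union> mu Q ` {1..r_neg Q} \<union> (\<lambda>d. - nu Q d) ` {1..s_pos Q}"
  define M where "M = \<bar>v1\<bar> + \<bar>v2\<bar> + (\<Sum>w\<in>?W. \<bar>w\<bar>)"
  have \<delta>: "0 < \<delta>" using v by (simp add: \<delta>_def)
  obtain C N where C: "0 \<le> C" "\<And>v t. (\<forall>w \<in> ?W. \<delta> \<le> \<bar>v - w\<bar> \<and> \<bar>v - w\<bar> \<le> M) \<Longrightarrow> ksize Q {1..r_neg Q} (gam 1 v t) \<le> C * (1 + \<bar>t\<bar>) powr N"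
    using ksize_gam_uniform[OF \<delta> finite_atLeastAtMost, of Q 1 "r_neg Q" M] by blast
  have "norm (leading Q (gam 1 v t)) \<le> C * (1 + \<bar>t\<bar>) powr N" if vv: "v1 \<le> v" "v \<le> v2" for v t
  proof -
    have "\<delta> \<le> \<bar>v - w\<bar> \<and> \<bar>v - w\<bar> \<le> M" if w: "w \<in> ?W" for w
    proof
      have "\<bar>w\<bar> \<le> (\<Sum>w\<in>?W. \<bar>w\<bar>)" by (rule member_le_sum[OF w]) auto
      then show "\<bar>v - w\<bar> \<le> M" using vv by (simp add: M_def)
      consider "w \<le> 0" | k where "k \<in> {1..r_neg Q}" "w = mu Q k" using w nu_pos[OF Q] by force
      then show "\<delta> \<le> \<bar>v - w\<bar>"
      proof cases
        case 2
        then have "mu Q 1 \<le> w" using mu_pos[OF Q 2(1)] by auto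
        then show ?thesis using vv by (simp add: \<delta>_def)
      qed (use vv in \<open>simp add: \<delta>_def\<close>)
    qed
    then have "ksize Q {1..r_neg Q} (gam 1 v t) \<le> C * (1 + \<bar>t\<bar>) powr N" by (intro C) blast
    then show ?thesis using norm_leading[OF gam_dom[of v t]] v vv by simp
  qed
  then show ?thesis using C(1) by blast
qed

lemma leading_measurable [measurable]: "leading Q \<in> borel_measurable borel"
  unfolding leading_def by measurable

lemma norm_dgam_le: "norm (dgam 1 t) \<le> 2"
  using cmod_le[of "dgam 1 t"] by (simp add: dgam_def sgn_if split: if_splits)

lemma dgam_measurable [measurable]: "dgam 1 \<in> borel_measurable borel"
  unfolding dgam_def by measurable

definition lint :: "real \<Rightarrow> real \<Rightarrow> real \<Rightarrow> complex" where
  "lint x v t = leading Q (gam 1 v t) * exp (- complex_of_real x * gam 1 v t) * dgam 1 t"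

lemma lint_norm: "norm (lint x v t) \<le> 2 * (norm (leading Q (gam 1 v t)) * exp (- x * v - x * \<bar>t\<bar>))"
proof -
  have "norm (exp (- complex_of_real x * gam 1 v t)) = exp (- x * v - x * \<bar>t\<bar>)"
    by (simp add: algebra_simps)
  then have "norm (lint x v t) = (norm (leading Q (gam 1 v t)) * exp (- x * v - x * \<bar>t\<bar>)) * norm (dgam 1 t)"
    by (simp add: lint_def norm_mult)
  also have "\<dots> \<le> (norm (leading Q (gam 1 v t)) * exp (- x * v - x * \<bar>t\<bar>)) * 2"
    by (intro mult_left_mono norm_dgam_le) auto
  finally show ?thesis by simp
qed

lemma lint_integrable:
  assumes v: "0 < v" "v < mu Q 1" and x: "0 < x"
  shows "integrable lborel (lint x v)"
proof -
  obtain C N where C: "0 \<le> C" "\<And>t. norm (leading Q (gam 1 v t)) \<le> C * (1 + \<bar>t\<bar>) powr N"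
    using leading_bound[OF v] by auto
  show ?thesis
  proof (rule Bochner_Integration.integrable_bound)
    show "integrable lborel (\<lambda>t. 2 * C * ((1 + \<bar>t\<bar>) powr N * exp (- x * \<bar>t\<bar>)))"
      using integrable_powr_exp_abs[OF x] by simp
    show "lint x v \<in> borel_measurable lborel" unfolding lint_def[abs_def] by measurable
    show "AE t in lborel. norm (lint x v t) \<le> norm (2 * C * ((1 + \<bar>t\<bar>) powr N * exp (- x * \<bar>t\<bar>)))"
    proof (rule AE_I2)
      fix t
      have "norm (lint x v t) \<le> 2 * ((C * (1 + \<bar>t\<bar>) powr N) * exp (- x * \<bar>t\<bar>))"
        using v x by (intro order_trans[OF lint_norm] mult_left_mono mult_mono C(2)) (auto simp: C(1))
      then show "norm (lint x v t) \<le> norm (2 * C * ((1 + \<bar>t\<bar>) powr N * exp (- x * \<bar>t\<bar>)))"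
        using C(1) by (simp add: abs_mult mult.assoc)
    qed
  qed
qed

text \<open>Cauchy's theorem through a primitive \<open>H\<close>: at equal parameters its values on
  the two contours approach each other at both ends, so the integral of the difference
  vanishes.\<close>

lemma lint_vertex:
  assumes v: "0 < v1" "v1 \<le> v2" "v2 < mu Q 1" and x: "0 < x"
  shows "(\<integral>t. lint x v1 t \<partial>lborel) = (\<integral>t. lint x v2 t \<partial>lborel)"
proof -
  let ?g = "\<lambda>z. leading Q z * exp (- complex_of_real x * z)"
  have "?g holomorphic_on leading_dom Q" by (intro holomorphic_intros leading_holomorphic)
  then have "\<exists>H. \<forall>z\<in>leading_dom Q. (H has_field_derivative ?g z) (at z)"
    by (intro holomorphic_starlike_primitive[of _ _ "{}"] leading_dom_starlike leading_dom_open holomorphic_on_imp_continuous_on)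
      (auto intro: holomorphic_on_imp_differentiable_at leading_dom_open)
  then obtain H where H: "\<And>z. z \<in> leading_dom Q \<Longrightarrow> (H has_field_derivative ?g z) (at z)" by blast
  have dom: "gam 1 v t \<in> leading_dom Q" if "v1 \<le> v" "v \<le> v2" for v t using that v by (intro gam_dom) auto
  have Hd: "((\<lambda>t. H (gam 1 v t)) has_vector_derivative lint x v t) (at t)" if "t \<noteq> 0" "v1 \<le> v" "v \<le> v2" for v t
    using field_vector_diff_chain_at[OF gam_der[OF that(1)] H[OF dom[OF that(2,3)]]]
    by (simp add: lint_def o_def mult_ac)
  have Hc: "continuous_on UNIV (\<lambda>t. H (gam 1 v t))" if "v1 \<le> v" "v \<le> v2" for v
  proof -
    have "continuous_on (leading_dom Q) H" using H by (meson DERIV_isCont continuous_at_imp_continuous_on)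
    then show ?thesis by (rule continuous_on_compose2[OF _ gam_cont]) (use dom that in auto)
  qed
  obtain C N where C: "0 \<le> C" "\<And>v t. v1 \<le> v \<Longrightarrow> v \<le> v2 \<Longrightarrow> norm (leading Q (gam 1 v t)) \<le> C * (1 + \<bar>t\<bar>) powr N"
    using leading_bound[OF v(1,3)] by auto
  \<comment> \<open>Equal parameters mean equal imaginary parts, so a horizontal segment joins the
    two points; on it the integrand decays like \<open>exp (- x * |t|)\<close> up to a
    power.\<close>
  have far: "norm (H (gam 1 v1 t) - H (gam 1 v2 t)) \<le> C * (1 + \<bar>t\<bar>) powr N * exp (- x * \<bar>t\<bar>) * \<bar>v1 - v2\<bar>" for t
  proof -
    let ?S = "(\<lambda>v. gam 1 v t) ` {v1..v2}"
    have S: "?S = closed_segment (gam 1 v1 t) (gam 1 v2 t)"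
    proof -
      have "?S = (+) (gam 1 0 t) ` complex_of_real ` closed_segment v1 v2"
        using v by (auto simp: closed_segment_eq_real_ivl image_image gam_def algebra_simps)
      also have "\<dots> = closed_segment (gam 1 v1 t) (gam 1 v2 t)"
        unfolding closed_segment_of_real[symmetric] closed_segment_translation[symmetric] by (simp add: gam_def algebra_simps)
      finally show ?thesis .
    qed
    have "norm (H (gam 1 v1 t) - H (gam 1 v2 t)) \<le> (C * (1 + \<bar>t\<bar>) powr N * exp (- x * \<bar>t\<bar>)) * norm (gam 1 v1 t - gam 1 v2 t)"
    proof (rule field_differentiable_bound[of ?S H ?g])
      show "convex ?S" unfolding S by simp
      fix z assume "z \<in> ?S"
      then obtain u where u: "v1 \<le> u" "u \<le> v2" "z = gam 1 u t" by auto
      show "(H has_field_derivative ?g z) (at z within ?S)" using H dom u has_field_derivative_at_within by blast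
      have "norm (?g z) = norm (leading Q z) * exp (- x * u - x * \<bar>t\<bar>)" by (simp add: norm_mult u(3) algebra_simps)
      also have "\<dots> \<le> C * (1 + \<bar>t\<bar>) powr N * exp (- x * \<bar>t\<bar>)"
        unfolding u(3) using C u x v by (intro mult_mono) auto
      finally show "norm (?g z) \<le> C * (1 + \<bar>t\<bar>) powr N * exp (- x * \<bar>t\<bar>)" .
    qed (use v in auto)
    also have "gam 1 v1 t - gam 1 v2 t = complex_of_real (v1 - v2)" by (simp add: gam_def)
    finally show ?thesis by (simp only: norm_of_real)
  qed
  let ?b = "\<lambda>t. C * (1 + \<bar>t\<bar>) powr N * exp (- x * \<bar>t\<bar>) * \<bar>v1 - v2\<bar>"
  have "(LINT t|lborel. lint x v1 t - lint x v2 t) = 0"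
  proof (rule line_FTC)
    show "continuous_on UNIV (\<lambda>t. H (gam 1 v1 t) - H (gam 1 v2 t))" using Hc v by (intro continuous_intros) auto
    show "((\<lambda>t. H (gam 1 v1 t) - H (gam 1 v2 t)) has_vector_derivative lint x v1 t - lint x v2 t) (at t)" if "t \<noteq> 0" for t
      using Hd that v by (intro has_vector_derivative_diff) auto
    show "integrable lborel (\<lambda>t. lint x v1 t - lint x v2 t)"
      using lint_integrable v x by (intro Bochner_Integration.integrable_diff) auto
    have "(?b \<longlongrightarrow> 0) at_top"
    proof (rule Lim_transform_eventually)
      show "((\<lambda>t. C * (1 + t) powr N * exp (- x * t) * \<bar>v1 - v2\<bar>) \<longlongrightarrow> 0) at_top" using x by real_asymp
      show "eventually (\<lambda>t. C * (1 + t) powr N * exp (- x * t) * \<bar>v1 - v2\<bar> = ?b t) at_top"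
        using eventually_ge_at_top[of 0] by eventually_elim simp
    qed
    then show "((\<lambda>t. H (gam 1 v1 t) - H (gam 1 v2 t)) \<longlongrightarrow> 0) at_top"
      by (rule Lim_null_comparison[OF always_eventually, rotated]) (use far in blast)
    have "(?b \<longlongrightarrow> 0) at_bot"
    proof (rule Lim_transform_eventually)
      show "((\<lambda>t. C * (1 - t) powr N * exp (x * t) * \<bar>v1 - v2\<bar>) \<longlongrightarrow> 0) at_bot" using x by real_asymp
      show "eventually (\<lambda>t. C * (1 - t) powr N * exp (x * t) * \<bar>v1 - v2\<bar> = ?b t) at_bot"
        using eventually_le_at_bot[of 0] by eventually_elim simp
    qed
    then show "((\<lambda>t. H (gam 1 v1 t) - H (gam 1 v2 t)) \<longlongrightarrow> 0) at_bot"
      by (rule Lim_null_comparison[OF always_eventually, rotated]) (use far in blast)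
  qed
  then show ?thesis using lint_integrable v x by simp
qed

end

lemma cint_vee_right:
  assumes g: "\<And>t. t \<noteq> 0 \<Longrightarrow> g (gam 1 v t) * dgam 1 t = f t" and f: "integrable lborel f"
  shows "cint (vee_right v) g = (\<integral>t. f t \<partial>lborel)"
proof -
  have "snd (vee_right v) = UNIV" by (simp add: vee_right_def)
  then have "cint (vee_right v) g = integral UNIV f"
    unfolding cint_def
    by (simp only:) (rule integral_spike[of "{0}"], use std_vee_right[of v] g in \<open>auto simp: std_contour_def\<close>)
  then show ?thesis using integral_lborel[OF f] by simp
qed

section \<open>The rescaled integral and its limit\<close>

context leading_kernel
begin

text \<open>The integrand of \<open>I\<close> along the contour through \<open>- a\<close>, with the
  power taken in the branch that is cut along the positive axis.\<close>

definition core :: "real \<Rightarrow> real \<Rightarrow> complex" where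
  "core a t = exp (complex_of_real (expo_mu Q 1) * Ln (- gam 1 (- a) t)) * exp (- gam 1 (- a) t) * dgam 1 t"

lemma core_bound:
  assumes a: "0 < a"
  shows "\<exists>C\<ge>0. \<forall>t. norm (core a t) \<le> C * ((1 + \<bar>t\<bar>) powr expo_mu Q 1 * exp (- 1 * \<bar>t\<bar>))"
proof -
  obtain C where C: "0 \<le> C" "\<And>t. norm (gam 1 (- a) t - complex_of_real 0) powr expo_mu Q 1 \<le> C * (1 + \<bar>t\<bar>) powr expo_mu Q 1"
    using gam_powr_bound[of 1 "expo_mu Q 1" 0 "- a"] a by auto
  have "norm (core a t) \<le> (C * exp a * 2) * ((1 + \<bar>t\<bar>) powr expo_mu Q 1 * exp (- 1 * \<bar>t\<bar>))" for t
  proof -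
    have "gam 1 (- a) t \<noteq> 0" using a by (auto simp: complex_eq_iff)
    then have "norm (exp (complex_of_real (expo_mu Q 1) * Ln (- gam 1 (- a) t))) = norm (gam 1 (- a) t) powr expo_mu Q 1"
      using norm_exp_Ln[of "- gam 1 (- a) t"] by (simp del: norm_exp_eq_Re)
    moreover have "norm (exp (- gam 1 (- a) t)) = exp a * exp (- 1 * \<bar>t\<bar>)" by (simp flip: exp_add)
    ultimately have "norm (core a t) = norm (gam 1 (- a) t) powr expo_mu Q 1 * (exp a * exp (- 1 * \<bar>t\<bar>)) * norm (dgam 1 t)"
      by (simp only: core_def norm_mult)
    also have "\<dots> \<le> (C * (1 + \<bar>t\<bar>) powr expo_mu Q 1) * (exp a * exp (- 1 * \<bar>t\<bar>)) * 2"
      using C(1) C(2)[of t] by (intro mult_mono norm_dgam_le) auto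
    finally show ?thesis by (simp only: mult_ac)
  qed
  then show ?thesis using C(1) by (intro exI[of _ "C * exp a * 2"]) auto
qed

lemma core_measurable [measurable]: "core a \<in> borel_measurable borel"
  unfolding core_def by measurable

lemma core_integrable:
  assumes a: "0 < a"
  shows "integrable lborel (core a)"
proof -
  obtain C where C: "0 \<le> C" "\<And>t. norm (core a t) \<le> C * ((1 + \<bar>t\<bar>) powr expo_mu Q 1 * exp (- 1 * \<bar>t\<bar>))"
    using core_bound[OF a] by blast
  show ?thesis
  proof (rule Bochner_Integration.integrable_bound)
    show "integrable lborel (\<lambda>t. C * ((1 + \<bar>t\<bar>) powr expo_mu Q 1 * exp (- 1 * \<bar>t\<bar>)))"
      using integrable_powr_exp_abs[of 1] by simp
    show "AE t in lborel. norm (core a t) \<le> norm (C * ((1 + \<bar>t\<bar>) powr expo_mu Q 1 * exp (- 1 * \<bar>t\<bar>)))"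
      using C(2) by (intro AE_I2) (metis abs_ge_self order_trans real_norm_def)
  qed simp
qed

lemma kbase_isCont: "isCont (kbase Q) (complex_of_real (mu Q 1))"
proof -
  \<comment> \<open>\<open>b\<close> separates \<open>mu 1\<close> from the remaining points
    \<open>mu k\<close>, which leaves a vertical strip around \<open>mu 1\<close> free of their
    cuts.\<close>
  obtain b where b: "mu Q 1 < b" "\<And>k. k \<in> {2..r_neg Q} \<Longrightarrow> b \<le> mu Q k"
  proof (cases "{2..r_neg Q} = {}")
    case True
    then show ?thesis using that[of "mu Q 1 + 1"] by auto
  next
    case False
    then show ?thesis using that[of "Min (mu Q ` {2..r_neg Q})"] mu_gt by auto
  qed
  let ?S = "{z. 0 < Re z} \<inter> {z. Re z < b}"
  have "kbase Q holomorphic_on ?S"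
  proof (rule kbase_holomorphic)
    show "complex_of_real (mu Q k) - z \<notin> \<real>\<^sub>\<le>\<^sub>0" if "z \<in> ?S" "k \<in> {2..r_neg Q}" for z k
      using b(2)[OF that(2)] that(1) by (auto simp: complex_nonpos_Reals_iff)
    show "z + complex_of_real (nu Q d) \<notin> \<real>\<^sub>\<le>\<^sub>0" if "z \<in> ?S" "d \<in> {1..s_pos Q}" for z d
      using nu_pos[OF Q that(2)] that(1) by (auto simp: complex_nonpos_Reals_iff)
  qed auto
  then have "continuous_on ?S (kbase Q)" by (rule holomorphic_on_imp_continuous_on)
  moreover have "open ?S" by (intro open_Int open_halfspace_Re_gt open_halfspace_Re_lt)
  moreover have "complex_of_real (mu Q 1) \<in> ?S" using mu1 b by simp
  ultimately show ?thesis using continuous_on_eq_continuous_at by blast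
qed

text \<open>The factor at \<open>mu 1\<close> has been split off, so vertices up to and including
  \<open>mu 1\<close> are allowed. This supplies a dominating function while the vertex tends to
  \<open>mu 1\<close>.\<close>

lemma kbase_bound:
  "\<exists>C\<ge>0. \<exists>N\<ge>0. \<forall>v t. mu Q 1 / 2 \<le> v \<and> v \<le> mu Q 1 \<longrightarrow> norm (kbase Q (gam 1 v t)) \<le> C * (1 + \<bar>t\<bar>) powr N"
proof -
  define \<delta> where "\<delta> = Min (insert (mu Q 1 / 2) ((\<lambda>k. mu Q k - mu Q 1) ` {2..r_neg Q}))"
  let ?W = "{0} \<union> mu Q ` {2..r_neg Q} \<union> (\<lambda>d. - nu Q d) ` {1..s_pos Q}"
  define M where "M = mu Q 1 + (\<Sum>w\<in>?W. \<bar>w\<bar>)"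
  have \<delta>: "0 < \<delta>" using mu1 mu_gt by (auto simp: \<delta>_def)
  have \<delta>1: "\<delta> \<le> mu Q 1 / 2" "\<And>k. k \<in> {2..r_neg Q} \<Longrightarrow> \<delta> \<le> mu Q k - mu Q 1" unfolding \<delta>_def by (intro Min_le; force)+
  obtain C N where C: "0 \<le> C" "\<And>v t. (\<forall>w \<in> ?W. \<delta> \<le> \<bar>v - w\<bar> \<and> \<bar>v - w\<bar> \<le> M) \<Longrightarrow> ksize Q {2..r_neg Q} (gam 1 v t) \<le> C * (1 + \<bar>t\<bar>) powr N"
    using ksize_gam_uniform[OF \<delta> finite_atLeastAtMost, of Q 2 "r_neg Q" M] by blast
  have "norm (kbase Q (gam 1 v t)) \<le> C * (1 + \<bar>t\<bar>) powr \<bar>N\<bar>" if vv: "mu Q 1 / 2 \<le> v" "v \<le> mu Q 1" for v t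
  proof -
    have W: "\<delta> \<le> \<bar>v - w\<bar> \<and> \<bar>v - w\<bar> \<le> M" if w: "w \<in> ?W" for w
    proof
      have "\<bar>w\<bar> \<le> (\<Sum>w\<in>?W. \<bar>w\<bar>)" by (rule member_le_sum[OF w]) auto
      then show "\<bar>v - w\<bar> \<le> M" using vv mu1 unfolding M_def by linarith
      consider "w \<le> 0" | k where "k \<in> {2..r_neg Q}" "w = mu Q k" using w nu_pos[OF Q] by force
      then show "\<delta> \<le> \<bar>v - w\<bar>"
      proof cases
        case 2
        then show ?thesis using vv \<delta>1(2)[OF 2(1)] by simp
      qed (use vv \<delta>1(1) in simp)
    qed
    have ne: "gam 1 v t \<noteq> complex_of_real w" if "w \<in> ?W" for w
    proof
      assume e: "gam 1 v t = complex_of_real w"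
      then have "t = 0" by (metis Im_complex_of_real gam_simps(2))
      then have "v = w" using arg_cong[OF e, of Re] by simp
      then show False using W[OF that] \<delta> by simp
    qed
    have "norm (kbase Q (gam 1 v t)) = ksize Q {2..r_neg Q} (gam 1 v t)"
    proof (rule norm_kbase)
      show "gam 1 v t \<noteq> 0" using ne[of 0] by simp
      show "gam 1 v t \<noteq> complex_of_real (mu Q k)" if "k \<in> {2..r_neg Q}" for k using ne that by blast
      show "gam 1 v t \<noteq> complex_of_real (- nu Q d)" if "d \<in> {1..s_pos Q}" for d using ne that by blast
    qed
    also have "\<dots> \<le> C * (1 + \<bar>t\<bar>) powr N" using W by (intro C) blast
    also have "\<dots> \<le> C * (1 + \<bar>t\<bar>) powr \<bar>N\<bar>" using C(1) by (intro mult_left_mono powr_mono) auto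
    finally show ?thesis .
  qed
  then show ?thesis using C(1) by (intro exI[of _ C] conjI exI[of _ "\<bar>N\<bar>"]) auto
qed

text \<open>The contours are similar to each other, so the substitution carries the one with vertex
  \<open>mu 1 - a / x\<close> exactly to the one with vertex \<open>- a\<close>. Scaling by the
  positive number \<open>1 / x\<close> adds a real number to the principal logarithm and does not
  change the branch.\<close>

lemma lint_rescaled:
  assumes a: "0 < a" and x: "0 < x" "a < x * mu Q 1"
  shows "complex_of_real (exp (mu Q 1 * x) * x powr (1 + expo_mu Q 1)) * (\<integral>t. lint x (mu Q 1 - a / x) t \<partial>lborel)
    = (\<integral>t. kbase Q (complex_of_real (mu Q 1) + gam 1 (- a) t * complex_of_real (1 / x)) * core a t \<partial>lborel)"
proof -
  let ?v = "mu Q 1 - a / x" and ?e = "expo_mu Q 1"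
  have "(\<integral>t. lint x ?v t \<partial>lborel) = (1 / x) *\<^sub>R (\<integral>t. lint x ?v (1 / x * t) \<partial>lborel)"
    using lborel_integral_real_affine[of "1 / x" "lint x ?v" 0] x by simp
  then have "complex_of_real (exp (mu Q 1 * x) * x powr (1 + ?e)) * (\<integral>t. lint x ?v t \<partial>lborel)
      = (\<integral>t. complex_of_real (exp (mu Q 1 * x) * x powr (1 + ?e) * (1 / x)) * lint x ?v (1 / x * t) \<partial>lborel)"
    by (simp add: scaleR_conv_of_real mult_ac)
  also have "\<dots> = (\<integral>t. kbase Q (complex_of_real (mu Q 1) + gam 1 (- a) t * complex_of_real (1 / x)) * core a t \<partial>lborel)"
  proof (rule Bochner_Integration.integral_cong[OF refl])
    fix t
    let ?W = "gam 1 (- a) t"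
    have W0: "- ?W \<noteq> 0" using a by (auto simp: complex_eq_iff)
    have g: "gam 1 ?v (1 / x * t) = complex_of_real (mu Q 1) + ?W * complex_of_real (1 / x)"
      using x by (simp add: complex_eq_iff field_simps)
    have "complex_of_real (mu Q 1) - gam 1 ?v (1 / x * t) = complex_of_real (1 / x) * - ?W" unfolding g by simp
    moreover have "Ln (complex_of_real (1 / x) * - ?W) = complex_of_real (ln (1 / x)) + Ln (- ?W)"
      by (subst Ln_times_of_real) (use x W0 Ln_of_real[of "1 / x"] in simp_all)
    ultimately have "Ln (complex_of_real (mu Q 1) - gam 1 ?v (1 / x * t)) = complex_of_real (ln (1 / x)) + Ln (- ?W)"
      by (simp only:)
    moreover have "complex_of_real ?e * (complex_of_real (ln (1 / x)) + Ln (- ?W)) = complex_of_real (- ?e * ln x) + complex_of_real ?e * Ln (- ?W)"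
      using x by (simp add: ln_div algebra_simps)
    moreover have "x powr - ?e = exp (- ?e * ln x)" using x by (simp add: powr_def)
    ultimately have e1: "exp (complex_of_real ?e * Ln (complex_of_real (mu Q 1) - gam 1 ?v (1 / x * t)))
        = complex_of_real (x powr - ?e) * exp (complex_of_real ?e * Ln (- ?W))"
      by (simp only: exp_add exp_of_real)
    have e2: "exp (- complex_of_real x * gam 1 ?v (1 / x * t)) = complex_of_real (exp (- (mu Q 1 * x))) * exp (- ?W)"
    proof -
      have "- complex_of_real x * gam 1 ?v (1 / x * t) = complex_of_real (- (mu Q 1 * x)) + - ?W"
        unfolding g using x by (simp add: algebra_simps)
      then show ?thesis by (simp only: exp_add exp_of_real)
    qed
    have e3: "dgam 1 (1 / x * t) = dgam 1 t" using x by (simp add: dgam_def sgn_mult)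
    \<comment> \<open>The weight cancels the exponential at \<open>mu 1\<close>, the power of
      \<open>x\<close> from the singular factor and the factor \<open>1 / x\<close> from the change
      of variable.\<close>
    have "exp (mu Q 1 * x) * x powr (1 + ?e) * (1 / x) * (x powr - ?e * exp (- (mu Q 1 * x))) = 1"
      using x by (simp add: powr_add powr_minus exp_minus field_simps)
    then have e4: "complex_of_real (exp (mu Q 1 * x) * x powr (1 + ?e) * (1 / x)) * (complex_of_real (x powr - ?e) * complex_of_real (exp (- (mu Q 1 * x)))) = 1"
      unfolding of_real_mult[symmetric] by simp
    let ?c = "complex_of_real (exp (mu Q 1 * x) * x powr (1 + ?e) * (1 / x))" and ?p = "complex_of_real (x powr - ?e)"
      and ?q = "complex_of_real (exp (- (mu Q 1 * x)))" and ?K = "kbase Q (complex_of_real (mu Q 1) + ?W * complex_of_real (1 / x))"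
    have "?c * lint x ?v (1 / x * t)
        = (?c * (?p * ?q)) * (?K * core a t)"
      unfolding lint_def leading_def core_def e1 e2 e3 unfolding g by (simp only: mult_ac)
    then show "?c * lint x ?v (1 / x * t) = ?K * core a t" unfolding e4 by simp
  qed
  finally show ?thesis .
qed

lemma lint_limit:
  assumes a: "0 < a" and v: "0 < v" "v < mu Q 1"
  shows "((\<lambda>x. complex_of_real (exp (mu Q 1 * x) * x powr (1 + expo_mu Q 1)) * (\<integral>t. lint x v t \<partial>lborel))
    \<longlongrightarrow> kbase Q (complex_of_real (mu Q 1)) * (\<integral>t. core a t \<partial>lborel)) at_top"
proof (rule Lim_transform_eventually)
  obtain C N where C: "0 \<le> C" "0 \<le> N" "\<And>v t. mu Q 1 / 2 \<le> v \<Longrightarrow> v \<le> mu Q 1 \<Longrightarrow> norm (kbase Q (gam 1 v t)) \<le> C * (1 + \<bar>t\<bar>) powr N"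
    using kbase_bound by blast
  obtain B where B: "0 \<le> B" "\<And>t. norm (core a t) \<le> B * ((1 + \<bar>t\<bar>) powr expo_mu Q 1 * exp (- 1 * \<bar>t\<bar>))"
    using core_bound[OF a] by blast
  let ?s = "\<lambda>x t. kbase Q (complex_of_real (mu Q 1) + gam 1 (- a) t * complex_of_real (1 / x)) * core a t"
  have "((\<lambda>x. \<integral>t. ?s x t \<partial>lborel) \<longlongrightarrow> (\<integral>t. kbase Q (complex_of_real (mu Q 1)) * core a t \<partial>lborel)) at_top"
  proof (rule integral_dominated_convergence_at_top[where w="\<lambda>t. C * B * ((1 + \<bar>t\<bar>) powr (N + expo_mu Q 1) * exp (- 1 * \<bar>t\<bar>))"])
    show "integrable lborel (\<lambda>t. C * B * ((1 + \<bar>t\<bar>) powr (N + expo_mu Q 1) * exp (- 1 * \<bar>t\<bar>)))"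
      using integrable_powr_exp_abs[of 1] by simp
    show "AE t in lborel. ((\<lambda>x. ?s x t) \<longlongrightarrow> kbase Q (complex_of_real (mu Q 1)) * core a t) at_top"
    proof (intro AE_I2 tendsto_mult_right)
      fix t
      have "((\<lambda>x::real. 1 / x) \<longlongrightarrow> 0) at_top" by real_asymp
      then have "((\<lambda>x. complex_of_real (mu Q 1) + gam 1 (- a) t * complex_of_real (1 / x)) \<longlongrightarrow> complex_of_real (mu Q 1) + gam 1 (- a) t * complex_of_real 0) at_top"
        by (intro tendsto_intros)
      then show "((\<lambda>x. kbase Q (complex_of_real (mu Q 1) + gam 1 (- a) t * complex_of_real (1 / x))) \<longlongrightarrow> kbase Q (complex_of_real (mu Q 1))) at_top"
        by (intro isCont_tendsto_compose[OF kbase_isCont]) simp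
    qed
    show "\<forall>\<^sub>F x in at_top. AE t in lborel. norm (?s x t) \<le> C * B * ((1 + \<bar>t\<bar>) powr (N + expo_mu Q 1) * exp (- 1 * \<bar>t\<bar>))"
      using eventually_ge_at_top[of "max 1 (2 * a / mu Q 1)"]
    proof eventually_elim
      case (elim x)
      \<comment> \<open>The second bound puts the moving vertex into
        \<open>[mu 1 / 2, mu 1]\<close>, the range of \<open>kbase_bound\<close>;
        \<open>x >= 1\<close> gives \<open>|t / x| <= |t|\<close>, so the bound no longer depends on
        \<open>x\<close>.\<close>
      then have x: "1 \<le> x" "2 * a \<le> x * mu Q 1" using mu1 by (auto simp: field_simps)
      then have vx: "mu Q 1 / 2 \<le> mu Q 1 - a / x" "mu Q 1 - a / x \<le> mu Q 1" using a by (auto simp: field_simps)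
      show ?case
      proof (rule AE_I2)
        fix t
        have "complex_of_real (mu Q 1) + gam 1 (- a) t * complex_of_real (1 / x) = gam 1 (mu Q 1 - a / x) (t / x)"
          using x by (simp add: complex_eq_iff field_simps)
        then have "norm (kbase Q (complex_of_real (mu Q 1) + gam 1 (- a) t * complex_of_real (1 / x))) \<le> C * (1 + \<bar>t / x\<bar>) powr N"
          by (simp only: C(3)[OF vx])
        also have "\<dots> \<le> C * (1 + \<bar>t\<bar>) powr N"
        proof (intro mult_left_mono powr_mono2 C)
          have "\<bar>t\<bar> * 1 \<le> \<bar>t\<bar> * x" using x by (intro mult_left_mono) auto
          then show "1 + \<bar>t / x\<bar> \<le> 1 + \<bar>t\<bar>" using x by (simp add: field_simps)
        qed auto
        finally have "norm (?s x t) \<le> (C * (1 + \<bar>t\<bar>) powr N) * (B * ((1 + \<bar>t\<bar>) powr expo_mu Q 1 * exp (- 1 * \<bar>t\<bar>)))"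
          unfolding norm_mult using C(1) B by (intro mult_mono) auto
        then show "norm (?s x t) \<le> C * B * ((1 + \<bar>t\<bar>) powr (N + expo_mu Q 1) * exp (- 1 * \<bar>t\<bar>))"
          by (simp only: powr_add mult_ac)
      qed
    qed
  qed measurable
  then show "((\<lambda>x. \<integral>t. ?s x t \<partial>lborel) \<longlongrightarrow> kbase Q (complex_of_real (mu Q 1)) * (\<integral>t. core a t \<partial>lborel)) at_top"
    by simp
  show "\<forall>\<^sub>F x in at_top. (\<integral>t. ?s x t \<partial>lborel) = complex_of_real (exp (mu Q 1 * x) * x powr (1 + expo_mu Q 1)) * (\<integral>t. lint x v t \<partial>lborel)"
    using eventually_gt_at_top[of "max 1 (max (a / mu Q 1) (a / (mu Q 1 - v)))"]
  proof eventually_elim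
    case (elim x)
    \<comment> \<open>The third bound puts the moving vertex to the right of \<open>v\<close>, so
      that \<open>lint_vertex\<close> can shift the contour to it.\<close>
    then have x: "0 < x" "a < x * mu Q 1" "a < x * (mu Q 1 - v)" using mu1 v by (auto simp: field_simps)
    then have "v \<le> mu Q 1 - a / x" "mu Q 1 - a / x < mu Q 1" using a by (auto simp: field_simps)
    then have "(\<integral>t. lint x v t \<partial>lborel) = (\<integral>t. lint x (mu Q 1 - a / x) t \<partial>lborel)"
      using lint_vertex v x by simp
    then show ?case using lint_rescaled[OF a x(1,2)] by simp
  qed
qed

end

lemma contour_image_vee_right: "contour_image (vee_right v) = vee v"
  by (simp add: contour_image_def vee_right_eq vee_def)

text \<open>The branches \<open>h\<close> and \<open>\<Phi>\<close> contribute constants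
  \<open>\<eta>\<close> and \<open>\<omega>\<close> that are the same on the first contour and in
  \<open>I\<close>. For \<open>h\<close> the link is its common domain for both contours, for
  \<open>\<Phi>\<close> it is the segment from the vertex to \<open>mu 1\<close>.\<close>

lemma first_contour_asymptotics:
  assumes Q: "admissible Q" and kappa: "0 < kappa Q" and m: "vertices Q m" and a: "0 < a"
    and c: "consistent_branches Q m \<Psi>1 a \<Phi> h"
  shows "((\<lambda>x. complex_of_real (exp (mu Q 1 * x) * x powr (1 + expo_mu Q 1)) *
      cint (Gam Q m 1) (\<lambda>z. \<Psi>1 z * exp (- complex_of_real x * z))) \<longlongrightarrow> I_const Q a \<Phi> h) at_top"
proof -
  interpret leading_kernel Q by unfold_locales (rule Q)
  let ?M = "complex_of_real (mu Q 1)" and ?e = "complex_of_real (expo_mu Q 1)"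
  have "0 < p_neg Q" "0 < lam Q" "0 < alpha Q 1" using Q by (auto simp: admissible_def)
  then have "expo_mu Q 1 < 0" using kappa by (simp add: expo_mu_def)
  then have G: "Gam Q m 1 = vee_right (m 1)" and m1: "0 < m 1" "m 1 < mu Q 1"
    using bspec[OF m[unfolded vertices_def] mu1(2)] by (simp_all add: Gam_def)
  let ?seg = "closed_segment (complex_of_real (m 1)) ?M"
  have pm: "kernel_branch Q {2..r_neg Q} (vee (m 1) \<union> ?seg) \<Phi>"
    and pb: "power_branch (vee (- a) \<union> (\<lambda>z. z - ?M) ` vee (m 1)) (expo_mu Q 1) h"
    and cons: "\<And>z. z \<in> vee (m 1) \<Longrightarrow> h (z - ?M) * \<Phi> z = \<Psi>1 z"
    using c unfolding consistent_branches_def G contour_image_vee_right by blast+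
  have tr: "(\<lambda>z. z - ?M) ` vee (m 1) = vee (m 1 - mu Q 1)"
  proof -
    have "z \<in> (\<lambda>z. z - ?M) ` vee (m 1)" if "z \<in> vee (m 1 - mu Q 1)" for z
      using that by (intro image_eqI[of _ _ "z + ?M"]) (auto simp: vee_iff)
    then show ?thesis by (auto simp: vee_iff)
  qed
  obtain \<eta> where \<eta>: "\<And>z. z \<in> vee (- a) \<union> vee (m 1 - mu Q 1) \<Longrightarrow> h z = \<eta> * exp (?e * Ln (- z))"
    using power_branch_vees[OF pb[unfolded tr]] a m1 by auto
  have S: "0 < Re z" "Im z = 0 \<Longrightarrow> Re z \<le> mu Q 1" if "z \<in> vee (m 1) \<union> ?seg" for z
    using that m1 unfolding closed_segment_of_real by (auto simp: vee_iff closed_segment_eq_real_ivl)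
  have "\<exists>\<omega>. \<forall>z \<in> vee (m 1) \<union> ?seg. \<Phi> z = \<omega> * kbase Q z"
  proof (rule kernel_branch_kbase[OF pm])
    show "connected (vee (m 1) \<union> ?seg)"
      using vertex_in_vee[of "m 1"] by (intro connected_Un connected_vee connected_segment) auto
    show "complex_of_real (mu Q k) - z \<notin> \<real>\<^sub>\<le>\<^sub>0" if "z \<in> vee (m 1) \<union> ?seg" "k \<in> {2..r_neg Q}" for z k
      using S(2)[OF that(1)] mu_gt[OF that(2)] by (auto simp: complex_nonpos_Reals_iff)
    show "z + complex_of_real (nu Q d) \<notin> \<real>\<^sub>\<le>\<^sub>0" if "z \<in> vee (m 1) \<union> ?seg" "d \<in> {1..s_pos Q}" for z d
      using S(1)[OF that(1)] nu_pos[OF Q that(2)] by (auto simp: complex_nonpos_Reals_iff)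
  qed
  then obtain \<omega> where \<omega>: "\<And>z. z \<in> vee (m 1) \<union> ?seg \<Longrightarrow> \<Phi> z = \<omega> * kbase Q z" by blast
  have gv: "gam 1 v t \<in> vee v" for v t by (simp add: vee_iff)
  have F: "cint (Gam Q m 1) (\<lambda>z. \<Psi>1 z * exp (- complex_of_real x * z)) = \<eta> * \<omega> * (\<integral>t. lint x (m 1) t \<partial>lborel)"
    if x: "0 < x" for x
  proof -
    have "cint (vee_right (m 1)) (\<lambda>z. \<Psi>1 z * exp (- complex_of_real x * z)) = (\<integral>t. \<eta> * \<omega> * lint x (m 1) t \<partial>lborel)"
    proof (rule cint_vee_right)
      fix t
      let ?z = "gam 1 (m 1) t"
      have "h (?z - ?M) = \<eta> * exp (?e * Ln (?M - ?z))" using \<eta>[of "?z - ?M"] gv tr by auto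
      then have "\<Psi>1 ?z = \<eta> * \<omega> * leading Q ?z"
        using cons[OF gv, of t] \<omega>[of ?z] gv by (simp add: leading_def mult_ac)
      then show "\<Psi>1 ?z * exp (- complex_of_real x * ?z) * dgam 1 t = \<eta> * \<omega> * lint x (m 1) t"
        by (simp add: lint_def mult_ac)
    qed (use lint_integrable[OF m1 x] in simp)
    then show ?thesis unfolding G by simp
  qed
  have I: "I_const Q a \<Phi> h = \<eta> * \<omega> * (kbase Q ?M * (\<integral>t. core a t \<partial>lborel))"
  proof -
    have "cint (vee_right (- a)) (\<lambda>z. h z * exp (- z)) = (\<integral>t. \<eta> * core a t \<partial>lborel)"
    proof (rule cint_vee_right)
      show "h (gam 1 (- a) t) * exp (- gam 1 (- a) t) * dgam 1 t = \<eta> * core a t" for t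
        using \<eta>[of "gam 1 (- a) t"] gv by (simp add: core_def mult_ac)
    qed (use core_integrable[OF a] in simp)
    then show ?thesis using \<omega>[of ?M] by (simp add: I_const_def mult_ac)
  qed
  have "((\<lambda>x. \<eta> * \<omega> * (complex_of_real (exp (mu Q 1 * x) * x powr (1 + expo_mu Q 1)) * (\<integral>t. lint x (m 1) t \<partial>lborel))) \<longlongrightarrow> I_const Q a \<Phi> h) at_top"
    unfolding I by (intro tendsto_mult_left lint_limit a m1)
  then show ?thesis
  proof (rule Lim_transform_eventually)
    show "\<forall>\<^sub>F x in at_top. \<eta> * \<omega> * (complex_of_real (exp (mu Q 1 * x) * x powr (1 + expo_mu Q 1)) * (\<integral>t. lint x (m 1) t \<partial>lborel))
        = complex_of_real (exp (mu Q 1 * x) * x powr (1 + expo_mu Q 1)) * cint (Gam Q m 1) (\<lambda>z. \<Psi>1 z * exp (- complex_of_real x * z))"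
      using eventually_gt_at_top[of 0] by eventually_elim (simp only: F, simp only: mult_ac)
  qed
qed

section \<open>Limit of the weighted passage probability\<close>

lemma passage_asymptotics:
  fixes f :: "real \<Rightarrow> complex"
  assumes Q: "admissible Q" "0 < kappa Q" and m: "vertices Q m" and a: "0 < a"
    and cb: "consistent_branches Q m (\<Psi> 1) a \<Phi> h"
    and s: "\<And>i. i \<in> {1..r_neg Q} \<Longrightarrow> solves Q 1 (vtx Q m i) (Gam Q m i) (\<Psi> i) (F i) (D i) (E i) (B i)"
    and e: "eigen_data Q l f D' E' B'"
    and f: "\<And>y. 0 < y \<Longrightarrow> l < y \<Longrightarrow> f y = (\<Sum>i=1..r_neg Q. c i * F i y)"
    and ou: "\<And>x. x > 0 \<Longrightarrow> x > l \<Longrightarrow> ou_process Q (P x) N V X x"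
  shows "\<exists>K::real. ((\<lambda>x. measure (P x) {\<omega> \<in> space (P x). tau X l \<omega> < \<infinity>}
           / (exp (- mu Q 1 * x) * x powr (p_neg Q * alpha Q 1 * lam Q / kappa Q - 1))) \<longlongrightarrow> K) at_top \<and>
     complex_of_real K = c 1 * I_const Q a \<Phi> h"
proof -
  let ?I = "{1..r_neg Q}"
  let ?e = "1 + expo_mu Q 1"
  define p where "p x = measure (P x) {\<omega> \<in> space (P x). tau X l \<omega> < \<infinity>}" for x
  define w where "w x = exp (mu Q 1 * x) * x powr ?e" for x
  have one: "1 \<in> ?I" using Q by (auto simp: admissible_def)
  have f0: "(f \<longlongrightarrow> 0) at_top"
  proof (rule Lim_transform_eventually)
    show "((\<lambda>y. \<Sum>i\<in>?I. c i * F i y) \<longlongrightarrow> 0) at_top"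
      by (rule solves_sum_tendsto_0[OF _ s]) (use vtx_pos[OF Q(1) m] in auto)
    show "\<forall>\<^sub>F y in at_top. (\<Sum>i\<in>?I. c i * F i y) = f y"
      using eventually_gt_at_top[of "max 0 l"] by eventually_elim (simp add: f)
  qed
  have p_eq: "complex_of_real (p x) = (\<Sum>i\<in>?I. c i * F i x)" if "0 < x" "l < x" for x
    unfolding p_def using eigen_data.passage_prob_eq[OF e ou[OF that] that(2,1) f0] f[OF that] by simp
  have summand: "((\<lambda>x. complex_of_real (w x) * F i x) \<longlongrightarrow> (if i = 1 then I_const Q a \<Phi> h else 0)) at_top" if i: "i \<in> ?I" for i
  proof (cases "i = 1")
    case True
    have "((\<lambda>x. complex_of_real (w x) * cint (Gam Q m 1) (\<lambda>z. \<Psi> 1 z * exp (- complex_of_real x * z))) \<longlongrightarrow> I_const Q a \<Phi> h) at_top"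
      unfolding w_def by (rule first_contour_asymptotics[OF Q m a cb])
    moreover have "\<forall>\<^sub>F x in at_top. complex_of_real (w x) * cint (Gam Q m 1) (\<lambda>z. \<Psi> 1 z * exp (- complex_of_real x * z)) = complex_of_real (w x) * F 1 x"
      using eventually_ge_at_top[of 0] by eventually_elim (use s[OF one] in \<open>simp add: solves_def\<close>)
    ultimately show ?thesis unfolding True by (auto intro: Lim_transform_eventually)
  next
    case False
    \<comment> \<open>The surplus of the vertex over \<open>mu 1\<close> leaves an exponential decay
      that beats the power of \<open>x\<close>.\<close>
    then have v: "mu Q 1 < vtx Q m i" using vtx_gt[OF Q(1) m, of i] i by auto
    have "((\<lambda>x. complex_of_real (w x) * F i x) \<longlongrightarrow> 0) at_top"
    proof (rule Lim_null_comparison)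
      show "\<forall>\<^sub>F x in at_top. norm (complex_of_real (w x) * F i x) \<le> B i * (x powr ?e * exp (- (vtx Q m i - mu Q 1) * x))"
        using eventually_gt_at_top[of 0]
      proof eventually_elim
        case (elim x)
        have "norm (F i x) \<le> B i * exp (- x * vtx Q m i)" using s[OF i] elim by (simp add: solves_def)
        then have "norm (complex_of_real (w x) * F i x) \<le> w x * (B i * exp (- x * vtx Q m i))"
          by (simp add: norm_mult w_def mult_left_mono)
        also have "\<dots> = B i * (x powr ?e * (exp (mu Q 1 * x) * exp (- x * vtx Q m i)))" by (simp add: w_def mult_ac)
        also have "exp (mu Q 1 * x) * exp (- x * vtx Q m i) = exp (- (vtx Q m i - mu Q 1) * x)"
          by (simp add: algebra_simps flip: exp_add)
        finally show ?case .
      qed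
      show "((\<lambda>x. B i * (x powr ?e * exp (- (vtx Q m i - mu Q 1) * x))) \<longlongrightarrow> 0) at_top"
      proof -
        define \<rho> where "\<rho> = vtx Q m i - mu Q 1"
        have "0 < \<rho>" using v by (simp add: \<rho>_def)
        then show ?thesis unfolding \<rho>_def[symmetric] by real_asymp
      qed
    qed
    then show ?thesis using False by simp
  qed
  have "((\<lambda>x. \<Sum>i\<in>?I. c i * (complex_of_real (w x) * F i x)) \<longlongrightarrow> (\<Sum>i\<in>?I. c i * (if i = 1 then I_const Q a \<Phi> h else 0))) at_top"
    using summand by (intro tendsto_sum tendsto_mult_left)
  also have "(\<Sum>i\<in>?I. c i * (if i = 1 then I_const Q a \<Phi> h else 0)) = c 1 * I_const Q a \<Phi> h"
    using one by (simp add: if_distrib cong: if_cong)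
  finally have lim: "((\<lambda>x. complex_of_real (w x * p x)) \<longlongrightarrow> c 1 * I_const Q a \<Phi> h) at_top"
  proof (rule Lim_transform_eventually)
    show "\<forall>\<^sub>F x in at_top. (\<Sum>i\<in>?I. c i * (complex_of_real (w x) * F i x)) = complex_of_real (w x * p x)"
      using eventually_gt_at_top[of "max 0 l"]
      by eventually_elim (simp add: p_eq sum_distrib_left mult_ac)
  qed
  let ?K = "Re (c 1 * I_const Q a \<Phi> h)"
  \<comment> \<open>The weighted probability is real, so the complex limit has imaginary part 0 and
    defines a real \<open>K\<close>.\<close>
  have "((\<lambda>x. Im (complex_of_real (w x * p x))) \<longlongrightarrow> Im (c 1 * I_const Q a \<Phi> h)) at_top"
    by (rule tendsto_Im[OF lim])
  then have "((\<lambda>x::real. 0) \<longlongrightarrow> Im (c 1 * I_const Q a \<Phi> h)) at_top" by (simp only: Im_complex_of_real)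
  from tendsto_unique[OF trivial_limit_at_top_linorder this tendsto_const]
  have "Im (c 1 * I_const Q a \<Phi> h) = 0" .
  then have K: "complex_of_real ?K = c 1 * I_const Q a \<Phi> h" by (simp add: complex_eq_iff)
  have "((\<lambda>x. Re (complex_of_real (w x * p x))) \<longlongrightarrow> ?K) at_top" by (rule tendsto_Re[OF lim])
  then have lim_p: "((\<lambda>x. w x * p x) \<longlongrightarrow> ?K) at_top" by simp
  have "((\<lambda>x. p x / (exp (- mu Q 1 * x) * x powr (p_neg Q * alpha Q 1 * lam Q / kappa Q - 1))) \<longlongrightarrow> ?K) at_top"
  proof (rule Lim_transform_eventually[OF lim_p])
    have e_eq: "?e = - (p_neg Q * alpha Q 1 * lam Q / kappa Q - 1)" by (simp add: expo_mu_def mult_ac)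
    have "exp (u * x) * x powr (- b) * r = r / (exp (- u * x) * x powr b)" for u x b r :: real
      by (simp add: exp_minus powr_minus field_simps)
    then show "\<forall>\<^sub>F x in at_top. w x * p x = p x / (exp (- mu Q 1 * x) * x powr (p_neg Q * alpha Q 1 * lam Q / kappa Q - 1))"
      unfolding w_def e_eq by (intro always_eventually allI)
  qed
  then show ?thesis using K unfolding p_def by blast
qed

text \<open>Homogeneous equations survive any linear combination; the equations with the term
  \<open>1 / mu k\<close> and the part of \<open>f\<close> below \<open>l\<close> survive only if
  the weights sum to 1.\<close>

lemma partial_eigenfunction_neg_affine:
  assumes "partial_eigenfunction_neg Q l m \<Psi> m2 \<Psi>2 c1 b1 f1" "partial_eigenfunction_neg Q l m \<Psi> m2 \<Psi>2 c2 b2 f2"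
    and w: "w1 + w2 = 1"
  shows "partial_eigenfunction_neg Q l m \<Psi> m2 \<Psi>2 (\<lambda>i. w1 * c1 i + w2 * c2 i) (\<lambda>j. w1 * b1 j + w2 * b2 j)
    (\<lambda>y. w1 * f1 y + w2 * f2 y)"
proof -
  have lin: "(\<Sum>i\<in>I. (w1 * u i + w2 * v i) * g i) = w1 * (\<Sum>i\<in>I. u i * g i) + w2 * (\<Sum>i\<in>I. v i * g i)"
    for u v g :: "nat \<Rightarrow> complex" and I
    by (simp add: sum_distrib_left sum.distrib distrib_right mult.assoc)
  have aff: "w1 * A + w2 * B + t = w1 * (A + t) + w2 * (B + t)" for A B t
  proof -
    have "w1 * (A + t) + w2 * (B + t) = w1 * A + w2 * B + (w1 + w2) * t" by (simp add: algebra_simps)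
    then show ?thesis by (simp add: w)
  qed
  have z: "w1 * A1 + w2 * A2 + (w1 * B1 + w2 * B2) = 0" if "A1 + B1 = 0" "A2 + B2 = 0" for A1 A2 B1 B2
    using that by (simp add: eq_neg_iff_add_eq_0[symmetric])
  have z': "w1 * A1 + w2 * A2 - (w1 * B1 + w2 * B2) = 0" if "A1 - B1 = 0" "A2 - B2 = 0" for A1 A2 B1 B2
    using that by simp
  have aff2: "w1 * (A1 + B1 + t) + w2 * (A2 + B2 + t) = (w1 * A1 + w2 * A2) + (w1 * B1 + w2 * B2) + t" for A1 A2 B1 B2 t
    unfolding aff[of "A1 + B1" "A2 + B2" t, symmetric] by (simp add: distrib_left)
  show ?thesis
    unfolding partial_eigenfunction_neg_def
  proof (intro conjI allI ballI)
    fix y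
    show "w1 * f1 y + w2 * f2 y = (\<Sum>i=1..r_neg Q. (w1 * c1 i + w2 * c2 i) *
            (if y > 0 then cint (Gam Q m i) (\<lambda>z. \<Psi> i z * exp (- complex_of_real y * z)) else 0))
          + (\<Sum>j=1..r_neg Q + s_pos Q + 1. (w1 * b1 j + w2 * b2 j) *
            (if l \<le> y \<and> y < 0 then cint (Gam2 Q m2 j) (\<lambda>z. \<Psi>2 j z * exp (- complex_of_real y * z)) else 0))
          + (if y < l then 1 else 0)"
      unfolding lin aff2[symmetric] using assms(1,2) unfolding partial_eigenfunction_neg_def by presburger
  next
    fix k assume k: "k \<in> {1..r_neg Q}"
    have "w1 * (A + t) + w2 * (B + t) = 0" if "A + t = 0" "B + t = 0" for A B t using that by simp
    then show "(\<Sum>j=1..r_neg Q + s_pos Q + 1. (w1 * b1 j + w2 * b2 j) *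
           cint (Gam2 Q m2 j) (\<lambda>z. \<Psi>2 j z / (z - complex_of_real (mu Q k)) * exp (- complex_of_real l * z)))
        + 1 / complex_of_real (mu Q k) = 0"
      unfolding lin aff using assms(1,2) k unfolding partial_eigenfunction_neg_def by simp
    show "(\<Sum>i=1..r_neg Q. (w1 * c1 i + w2 * c2 i) * cint (Gam Q m i) (\<lambda>z. \<Psi> i z / (z - complex_of_real (mu Q k))))
        + (\<Sum>j=1..r_neg Q + s_pos Q + 1. (w1 * b1 j + w2 * b2 j) *
             cint (Gam2 Q m2 j) (\<lambda>z. \<Psi>2 j z / (complex_of_real (mu Q k) - z))) = 0"
      unfolding lin by (rule z) (use assms(1,2) k in \<open>auto simp only: partial_eigenfunction_neg_def\<close>)
  next
    fix d assume d: "d \<in> {1..s_pos Q}"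
    show "(\<Sum>j=1..r_neg Q + s_pos Q + 1. (w1 * b1 j + w2 * b2 j) *
             cint (Gam2 Q m2 j) (\<lambda>z. \<Psi>2 j z / (complex_of_real (nu Q d) + z)))
        - (\<Sum>i=1..r_neg Q. (w1 * c1 i + w2 * c2 i) *
             cint (Gam Q m i) (\<lambda>z. \<Psi> i z / (complex_of_real (nu Q d) + z))) = 0"
      unfolding lin by (rule z') (use assms(1,2) d in \<open>auto simp only: partial_eigenfunction_neg_def\<close>)
  qed
qed

theorem theorem3p1:
  fixes Q :: params and l :: real
    and P :: "real \<Rightarrow> 'a measure"
    and N :: "real \<Rightarrow> 'a \<Rightarrow> nat" and V :: "nat \<Rightarrow> 'a \<Rightarrow> real" and X :: "real \<Rightarrow> 'a \<Rightarrow> real"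
    and m m2 :: "nat \<Rightarrow> real" and \<Psi> \<Psi>2 :: "nat \<Rightarrow> complex \<Rightarrow> complex"
    and a :: real and \<Phi> h :: "complex \<Rightarrow> complex"
    and c c1 b1 c2 b2 :: "nat \<Rightarrow> complex" and f f1 f2 :: "real \<Rightarrow> complex"
  assumes "admissible Q" and "kappa Q > 0" and "l \<noteq> 0"
    and "\<And>x. x > 0 \<Longrightarrow> x > l \<Longrightarrow> ou_process Q (P x) N V X x"
    and "vertices Q m"
    and "\<And>i. i \<in> {1..r_neg Q} \<Longrightarrow>
           psi_branch Q (contour_image (Gam Q m i) - {complex_of_real (mu Q i)}) (\<Psi> i)"
    and "a > 0" and "consistent_branches Q m (\<Psi> 1) a \<Phi> h"
    and "l > 0 \<Longrightarrow> partial_eigenfunction_pos Q l m \<Psi> c f"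
    and "l < 0 \<Longrightarrow> vertices2 Q m2"
    and "\<And>j. l < 0 \<Longrightarrow> j \<in> {1..r_neg Q + s_pos Q + 1} \<Longrightarrow>
           psi_branch Q (contour_image (Gam2 Q m2 j) - {complex_of_real (pt Q j)}) (\<Psi>2 j)"
    and "l < 0 \<Longrightarrow> partial_eigenfunction_neg Q l m \<Psi> m2 \<Psi>2 c1 b1 f1"
    and "l < 0 \<Longrightarrow> partial_eigenfunction_neg Q l m \<Psi> m2 \<Psi>2 c2 b2 f2"
    and "l < 0 \<Longrightarrow> f1 l \<noteq> f2 l"
  shows "\<exists>K::real.
     ((\<lambda>x. measure (P x) {\<omega> \<in> space (P x). tau X l \<omega> < \<infinity>}
           / (exp (- mu Q 1 * x) * x powr (p_neg Q * alpha Q 1 * lam Q / kappa Q - 1))) \<longlongrightarrow> K) at_top \<and>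
     (l < 0 \<longrightarrow> complex_of_real K = I_const Q a \<Phi> h *
        (c1 1 * ((1 - f2 l) / (f1 l - f2 l)) + c2 1 * ((f1 l - 1) / (f1 l - f2 l)))) \<and>
     (l > 0 \<longrightarrow> complex_of_real K = c 1 * I_const Q a \<Phi> h)"
proof -
  \<comment> \<open>Total mass 1 of the jump law is deduced from the existence of jumps with that
    law, so one instance of the process is fixed, started at a point above both 0 and
    \<open>l\<close>.\<close>
  note Q = assms(1,2) and m = assms(5) and ou = assms(4)
  have ou0: "ou_process Q (P (\<bar>l\<bar> + 1)) N V X (\<bar>l\<bar> + 1)" using assms(3) by (intro ou) auto
  interpret M: prob_space "P (\<bar>l\<bar> + 1)" using ou0 by (simp add: ou_process_def)
  interpret o: ou "P (\<bar>l\<bar> + 1)" Q N V X "\<bar>l\<bar> + 1" l by unfold_locales (rule ou0, rule Q, rule Q)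
  have law: "prob_space (jump_law Q)" by (rule o.prob_space_jump_law)
  have "\<forall>i\<in>{1..r_neg Q}. \<exists>F D E B. solves Q 1 (vtx Q m i) (Gam Q m i) (\<Psi> i) F D E B"
    using Gam_solves[OF Q m _ assms(6)] by blast
  then obtain F D E B where s: "\<And>i. i \<in> {1..r_neg Q} \<Longrightarrow> solves Q 1 (vtx Q m i) (Gam Q m i) (\<Psi> i) (F i) (D i) (E i) (B i)"
    by metis
  note v = vtx_pos[OF assms(1) m]
  have asymp: "\<exists>K::real. ((\<lambda>x. measure (P x) {\<omega> \<in> space (P x). tau X l \<omega> < \<infinity>}
           / (exp (- mu Q 1 * x) * x powr (p_neg Q * alpha Q 1 * lam Q / kappa Q - 1))) \<longlongrightarrow> K) at_top \<and>
     complex_of_real K = C 1 * I_const Q a \<Phi> h"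
    if "eigen_data Q l g D' E' B'" "\<And>y. 0 < y \<Longrightarrow> l < y \<Longrightarrow> g y = (\<Sum>i=1..r_neg Q. C i * F i y)" for g C D' E' B'
    by (rule passage_asymptotics[where \<Psi>=\<Psi>, OF Q m assms(7,8) _ that(1)]) (fact s that(2) ou)+
  show ?thesis
  proof (cases "0 < l")
    case True
    note e = eigen_data_pos[OF Q law True s v assms(9)[OF True]]
    obtain D' E' B' where D': "eigen_data Q l f D' E' B'" using e(1) by blast
    have "f y = (\<Sum>i=1..r_neg Q. c i * F i y)" if "l < y" for y using e(2)[of y] that by simp
    then show ?thesis using asymp[OF D', of c] True by simp
  next
    case False
    then have l: "l < 0" using assms(3) by simp
    have "\<forall>j\<in>{1..r_neg Q + s_pos Q + 1}. \<exists>F D E B. solves Q (- 1) (vtx2 Q m2 j) (Gam2 Q m2 j) (\<Psi>2 j) F D E B"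
      using Gam2_solves[OF Q assms(10)[OF l] _ assms(11)[OF l]] by blast
    then obtain F2 D2 E2 B2 where s2: "\<And>j. j \<in> {1..r_neg Q + s_pos Q + 1} \<Longrightarrow>
        solves Q (- 1) (vtx2 Q m2 j) (Gam2 Q m2 j) (\<Psi>2 j) (F2 j) (D2 j) (E2 j) (B2 j)"
      by metis
    \<comment> \<open>The weights solve \<open>w1 + w2 = 1\<close> and
      \<open>w1 * f1 l + w2 * f2 l = 1\<close>.\<close>
    define w1 where "w1 = (1 - f2 l) / (f1 l - f2 l)"
    define w2 where "w2 = (f1 l - 1) / (f1 l - f2 l)"
    define g where "g y = w1 * f1 y + w2 * f2 y" for y
    have ne: "f1 l - f2 l \<noteq> 0" using assms(14)[OF l] by simp
    have w: "w1 + w2 = 1" using ne by (simp add: w1_def w2_def flip: add_divide_distrib)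
    have gl: "g l = 1"
    proof -
      have "g l = ((1 - f2 l) * f1 l + (f1 l - 1) * f2 l) / (f1 l - f2 l)"
        by (simp add: g_def w1_def w2_def add_divide_distrib)
      also have "(1 - f2 l) * f1 l + (f1 l - 1) * f2 l = f1 l - f2 l" by (simp add: algebra_simps)
      finally show ?thesis using ne by simp
    qed
    have "partial_eigenfunction_neg Q l m \<Psi> m2 \<Psi>2 (\<lambda>i. w1 * c1 i + w2 * c2 i) (\<lambda>j. w1 * b1 j + w2 * b2 j) g"
      unfolding g_def[abs_def] by (rule partial_eigenfunction_neg_affine[OF assms(12,13)[OF l] w])
    note e = eigen_data_neg[OF Q law l s v s2 this gl]
    obtain D' E' B' where D': "eigen_data Q l g D' E' B'" using e(1) by blast
    obtain K :: real where
      "((\<lambda>x. measure (P x) {\<omega> \<in> space (P x). tau X l \<omega> < \<infinity>}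
           / (exp (- mu Q 1 * x) * x powr (p_neg Q * alpha Q 1 * lam Q / kappa Q - 1))) \<longlongrightarrow> K) at_top"
      "complex_of_real K = (w1 * c1 1 + w2 * c2 1) * I_const Q a \<Phi> h"
      using asymp[OF D', of "\<lambda>i. w1 * c1 i + w2 * c2 i"] e(2) by blast
    then show ?thesis using l unfolding w1_def w2_def
      by (intro exI[of _ K]) (simp add: mult_ac)
  qed
qed

end
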